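(* Let $\mathbf{n}=(n_1,\dots,n_d)$ be a size vector and $N=\prod_{i=1}^d n_i$. The rank of a $d$-dimensional necklace in the set $\mathcal{N}_q^{\mathbf{n}}$ can be computed in $O(N^5)$ time.
   Context: Let $\Sigma=\{1<2<\dots<q\}$. A word of size $\mathbf{n}=(n_1,\dots,n_d)$ is an array $w=(w_p)$ of symbols of $\Sigma$ indexed by positions $p$ with $1\le p_i\le n_i$; coordinates are read modulo $n_i$. For $g\in Z_{\mathbf{n}}=Z_{n_1}\times\dots\times Z_{n_d}$ (representatives $0\le g_i\le n_i-1$), the translation $\langle w\rangle_g$ is the word with $(\langle w\rangle_g)_p=w_{p+g}$. A necklace of size $\mathbf{n}$ is an orbit of words under translation; $\mathcal{N}_q^{\mathbf{n}}$ is the set of necklaces of size $\mathbf{n}$. Standing convention: $n_1\le\dots\le n_d$. Ordering. Translations are ordered by $\mathrm{index}(g)=\sum_{i=1}^d g_i\prod_{j=1}^{i-1}n_j$. The $i$-th slice $w_i$ ($1\le i\le n_d$) of a $d$-dimensional word $w$ is the $(d-1)$-dimensional word of size $(n_1,\dots,n_{d-1})$ obtained by fixing the last coordinate to $i$. Words of the same size are ordered recursively on $d$. A $0$-dimensional word is a symbol, ordered as in $\Sigma$. In each dimension, the canonical representation $\langle u\rangle$ of a word $u$ (or of its necklace) is the smallest word in its translation orbit, and $G(u,\langle u\rangle)$ is the smallest translation $g$ with $\langle u\rangle_g=\langle u\rangle$ (the translate of $u$ by $g$ equals the canonical representation). For $d$-dimensional words $w\neq u$ of the same size, let $i$ be the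 smallest index with $w_i\ne u_i$; then $w<u$ if either $\langle w_i\rangle<\langle u_i\rangle$, or $\langle w_i\rangle=\langle u_i\rangle$ and $\mathrm{index}(G(w_i,\langle w_i\rangle))<\mathrm{index}(G(u_i,\langle u_i\rangle))$. Necklaces are ordered by their canonical representations. The rank of a necklace in $\mathcal{N}_q^{\mathbf{n}}$ is the number of necklaces of $\mathcal{N}_q^{\mathbf{n}}$ strictly smaller than it. The input necklace is given by its canonical representation. *)

theory Defs
  imports Complex_Main "HOL-Library.FuncSet"
begin

section \<open>Multidimensional words and their translations\<close>

text \<open>
  A size vector \<open>[n\<^sub>1, \<dots>, n\<^sub>d]\<close> is a list. Positions are counted from 0 instead of 1, so that positions
  and the representatives of the translation group are the same set and addition of coordinates
  is plain addition modulo \<open>n\<^sub>i\<close>.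
\<close>

definition size_vector :: "nat list \<Rightarrow> bool" where
  "size_vector n \<longleftrightarrow> n \<noteq> [] \<and> (\<forall>m\<in>set n. 1 \<le> m) \<and> sorted n"

definition positions :: "nat list \<Rightarrow> nat list set" where
  "positions n = {p. length p = length n \<and> (\<forall>i<length n. p ! i < n ! i)}"

type_synonym word = "nat list \<Rightarrow> nat"

definition words :: "nat \<Rightarrow> nat list \<Rightarrow> word set" where
  "words q n = positions n \<rightarrow>\<^sub>E {1..q}"

definition translate :: "nat list \<Rightarrow> nat list \<Rightarrow> word \<Rightarrow> word" where
  "translate n g w =
     (\<lambda>p\<in>positions n. w (map (\<lambda>i. (p ! i + g ! i) mod n ! i) [0..<length n]))"

definition orbit :: "nat list \<Rightarrow> word \<Rightarrow> word set" where
  "orbit n w = (\<lambda>g. translate n g w) ` positions n"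

definition necklaces :: "nat \<Rightarrow> nat list \<Rightarrow> word set set" where
  "necklaces q n = orbit n ` words q n"

section \<open>The ordering\<close>

definition index :: "nat list \<Rightarrow> nat list \<Rightarrow> nat" where
  "index n g = (\<Sum>i<length n. g ! i * (\<Prod>j<i. n ! j))"

text \<open>The slice at \<open>i\<close> of a word of size \<open>n @ [m]\<close>; it has size \<open>n\<close>.\<close>

definition slice :: "nat list \<Rightarrow> word \<Rightarrow> nat \<Rightarrow> word" where
  "slice n w i = (\<lambda>p\<in>positions n. w (p @ [i]))"

definition least_word :: "(word \<Rightarrow> word \<Rightarrow> bool) \<Rightarrow> word set \<Rightarrow> word" where
  "least_word lt C = (THE v. v \<in> C \<and> (\<forall>u\<in>C. u \<noteq> v \<longrightarrow> lt v u))"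

text \<open>The translation \<open>G(w, v)\<close>.\<close>

definition least_translation :: "nat list \<Rightarrow> word \<Rightarrow> word \<Rightarrow> nat list" where
  "least_translation n w v = arg_min (index n) (\<lambda>g. g \<in> positions n \<and> translate n g w = v)"

function word_less :: "nat list \<Rightarrow> word \<Rightarrow> word \<Rightarrow> bool" where
  "word_less [] = (\<lambda>w u. w [] < u [])"
| "word_less (n @ [m]) = (\<lambda>w u. \<exists>i<m.
     slice n w i \<noteq> slice n u i \<and> (\<forall>j<i. slice n w j = slice n u j) \<and>
     (let x = slice n w i; y = slice n u i;
          x' = least_word (word_less n) (orbit n x); y' = least_word (word_less n) (orbit n y)
      in word_less n x' y' \<or>
         x' = y' \<and> index n (least_translation n x x') < index n (least_translation n y y')))"
  subgoal for P x by (cases x rule: rev_cases) auto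
  by auto
termination
  by (relation "measure length") auto

definition representative :: "nat list \<Rightarrow> word set \<Rightarrow> word" where
  "representative n C = least_word (word_less n) C"

definition necklace_rank :: "nat \<Rightarrow> nat list \<Rightarrow> word set \<Rightarrow> nat" where
  "necklace_rank q n C =
     card {D \<in> necklaces q n. word_less n (representative n D) (representative n C)}"

section \<open>Random access machine programs under the uniform cost measure\<close>

text \<open>
  Structured programs over natural-number variables and arrays. Every arithmetic operation, memory
  access and test costs one time unit. Unrestricted multiplication at unit cost would make huge
  integers a source of free parallelism; therefore execution is relative to a bound \<open>B\<close> and is
  stuck as soon as some computed value exceeds \<open>B\<close>.
\<close>

datatype binop = Plus | Minus | Times | Divide | Modulo | Less | Equal

datatype exp = Lit nat | Var nat | Cell nat exp | Bin binop exp exp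

datatype com =
    Skip
  | Assign nat exp
  | Update nat exp exp
  | Seq com com
  | If exp com com
  | While exp com

datatype store = Store (scalar: "nat \<Rightarrow> nat") (arr: "nat \<Rightarrow> nat \<Rightarrow> nat")

text \<open>Subtraction is truncated at 0.\<close>

fun apply_op :: "binop \<Rightarrow> nat \<Rightarrow> nat \<Rightarrow> nat" where
  "apply_op Plus a b = a + b"
| "apply_op Minus a b = a - b"
| "apply_op Times a b = a * b"
| "apply_op Divide a b = a div b"
| "apply_op Modulo a b = a mod b"
| "apply_op Less a b = (if a < b then 1 else 0)"
| "apply_op Equal a b = (if a = b then 1 else 0)"

fun eval_exp :: "store \<Rightarrow> exp \<Rightarrow> nat" where
  "eval_exp s (Lit k) = k"
| "eval_exp s (Var x) = scalar s x"
| "eval_exp s (Cell a e) = arr s a (eval_exp s e)"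
| "eval_exp s (Bin f e e') = apply_op f (eval_exp s e) (eval_exp s e')"

fun cost :: "exp \<Rightarrow> nat" where
  "cost (Lit k) = 1"
| "cost (Var x) = 1"
| "cost (Cell a e) = cost e + 1"
| "cost (Bin f e e') = cost e + cost e' + 1"

text \<open>All values occurring in the evaluation of an expression are at most \<open>B\<close>.\<close>

fun fits :: "nat \<Rightarrow> store \<Rightarrow> exp \<Rightarrow> bool" where
  "fits B s (Lit k) \<longleftrightarrow> k \<le> B"
| "fits B s (Var x) \<longleftrightarrow> scalar s x \<le> B"
| "fits B s (Cell a e) \<longleftrightarrow> fits B s e \<and> arr s a (eval_exp s e) \<le> B"
| "fits B s (Bin f e e') \<longleftrightarrow>
     fits B s e \<and> fits B s e' \<and> apply_op f (eval_exp s e) (eval_exp s e') \<le> B"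

text \<open>\<open>exec B c s t s'\<close>: started in \<open>s\<close>, the program \<open>c\<close> halts in \<open>s'\<close> after \<open>t\<close> time units.\<close>

inductive exec :: "nat \<Rightarrow> com \<Rightarrow> store \<Rightarrow> nat \<Rightarrow> store \<Rightarrow> bool" for B where
  exec_Skip: "exec B Skip s 1 s"
| exec_Assign: "fits B s e \<Longrightarrow>
    exec B (Assign x e) s (cost e + 1) (Store ((scalar s)(x := eval_exp s e)) (arr s))"
| exec_Update: "fits B s i \<Longrightarrow> fits B s e \<Longrightarrow>
    exec B (Update a i e) s (cost i + cost e + 1)
      (Store (scalar s) ((arr s)(a := (arr s a)(eval_exp s i := eval_exp s e))))"
| exec_Seq: "exec B c1 s t s' \<Longrightarrow> exec B c2 s' t' s'' \<Longrightarrow> exec B (Seq c1 c2) s (t + t') s''"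
| exec_If_true: "fits B s e \<Longrightarrow> eval_exp s e \<noteq> 0 \<Longrightarrow> exec B c1 s t s' \<Longrightarrow>
    exec B (If e c1 c2) s (cost e + 1 + t) s'"
| exec_If_false: "fits B s e \<Longrightarrow> eval_exp s e = 0 \<Longrightarrow> exec B c2 s t s' \<Longrightarrow>
    exec B (If e c1 c2) s (cost e + 1 + t) s'"
| exec_While_false: "fits B s e \<Longrightarrow> eval_exp s e = 0 \<Longrightarrow> exec B (While e c) s (cost e + 1) s"
| exec_While_true: "fits B s e \<Longrightarrow> eval_exp s e \<noteq> 0 \<Longrightarrow> exec B c s t s' \<Longrightarrow>
    exec B (While e c) s' t' s'' \<Longrightarrow> exec B (While e c) s (cost e + 1 + t + t') s''"

text \<open>
  Input convention: variable 0 holds the dimension and variable 1 the alphabet size; array 0 holds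
  the size vector and array 1 the symbols of the word, the symbol at position \<open>p\<close> being stored in
  cell \<open>index n p\<close>. Everything else is 0.
\<close>

definition input_store :: "nat \<Rightarrow> nat list \<Rightarrow> word \<Rightarrow> store" where
  "input_store q n w = Store
     ((\<lambda>_. 0)(0 := length n, 1 := q))
     ((\<lambda>_ _. 0)
       (0 := \<lambda>i. if i < length n then n ! i else 0,
        1 := \<lambda>k. if k < prod_list n then w (inv_into (positions n) (index n) k) else 0))"

text \<open>
  Values of \<open>O(N log (d + q + N))\<close> bits: enough for the input and for numbers of the
  magnitude of the number \<open>q\<^sup>N\<close> of words.
\<close>

definition word_bound :: "nat \<Rightarrow> nat \<Rightarrow> nat list \<Rightarrow> nat" where
  "word_bound k q n = (length n + q + prod_list n) ^ (k * prod_list n)"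

end

theory Submission imports Defs
begin

text \<open>
  Why the theorem holds. Let \<open>w\<close> be the canonical representation of the given necklace and \<open>N\<close> the
  number of positions. A necklace is smaller than \<open>w\<close> iff the least translate of any of its words is
  smaller than \<open>w\<close>, so by Burnside's lemma \<open>N\<close> times the rank is the sum, over all translations \<open>g\<close>,
  of the number \<open>F(g, w)\<close> of words fixed by \<open>g\<close> whose least translate is smaller than \<open>w\<close>
  (\<open>rank_burnside\<close>). The program computes these \<open>N\<close> numbers.

  Words as strings. A word of size \<open>n @ [m]\<close> is a string of \<open>m\<close> slices of size \<open>n\<close>. The order is encoded
  in integers: \<open>wkey\<close> numbers the words of a size in increasing order, and the key of a
  slice is the key of its canonical representation times the number of translations plus the least
  translation that leads there (\<open>wkey_props\<close>). The keys of slices are the letters of an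
  alphabet. The translations of size \<open>n\<close> act on it, two letters are in the same orbit iff they have
  the same quotient by the order of the group, and letters of different orbits are ordered by these
  quotients (\<open>orbit_alphabet_letters\<close>). A translation of the whole word applies one group element to
  every letter and rotates the string (\<open>code_trn\<close>).

  An automaton. Let the string \<open>w\<close> be least among its translates. The strings none of whose translates
  is below \<open>w\<close> are recognised as in string matching: the states are the translates of proper
  prefixes of \<open>w\<close>, of which there are at most as many as positions, the state after reading \<open>u\<close> is the
  longest suffix of \<open>u\<close> that is a state, and a letter is rejected if it completes an occurrence of
  something below \<open>w\<close>. A string fixed by the translation with group part \<open>h\<close> and rotation \<open>r\<close>
  is determined by its first \<open>l = gcd r m\<close> letters: it continues as a sequence in which
  moving by \<open>l\<close> places applies a fixed group element. Such a sequence avoids everything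
  below \<open>w\<close> iff there is a state from which its first \<open>l\<close> letters lead to the correspondingly translated
  state, and this state is unique (\<open>closes_good\<close>, \<open>good_closes\<close>, \<open>closes_unique\<close>). Hence the strings in
  question are counted by walks of length \<open>l\<close> (\<open>card_not_below\<close>), which a dynamic program counts.

  The recursion. The alphabet has exponentially many letters, but only letters in the orbit of some
  letter of \<open>w\<close> can prolong a match. All other letters lead to the empty state or are rejected,
  depending only on how their orbit compares with that of the expected letter
  (\<open>step_count_names\<close>). How many of them are fixed by a group element \<open>s\<close> follows from the number of
  fixed words of size \<open>n\<close> and the number \<open>F(s, w\<^sub>j)\<close> for the slice \<open>w\<^sub>j\<close> (\<open>card_Fixed_class\<close>). So the
  counts for size \<open>n @ [m]\<close> come from those for size \<open>n\<close>, and the program runs through the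
  prefixes of the size vector, treating all blocks of the word of the current size.

  The time. Let \<open>R\<close> be the number of positions of the current prefix. For one block and one
  translation, \<open>R ^ 4\<close> operations suffice, which makes \<open>N * R ^ 4\<close> for a level (\<open>level_hoare\<close>). Entries
  equal to 1 stand at the front of the sorted size vector and are skipped, since the dimension may
  exceed \<open>N\<close>. After them \<open>R\<close> at least doubles from level to level, so the sum is \<open>O(N ^ 5)\<close>
  (\<open>sum_levels\<close>). All stored values are at most \<open>(d + q + N) ^ (4 * N)\<close> (\<open>key_le\<close>).

  The program is built from assignments of expressions with bounded sums and searches. These
  are compiled once and for all (\<open>compile_correct\<close>), and a Hoare logic with time bounds
  (\<open>hoare\<close> in the locale \<open>machine\<close>) reasons about the rest.
\<close>

section \<open>Matching against a least rotation up to a group action\<close>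

definition lex_less :: "nat list \<Rightarrow> nat list \<Rightarrow> bool" where
  "lex_less u v \<longleftrightarrow> (\<exists>j<length v. j < length u \<and> take j u = take j v \<and> u ! j < v ! j)"

text \<open>
  The group is written as addition \<open>ad\<close> on \<open>{..<p}\<close> and letters are numbers. The quotient of a letter
  by \<open>p\<close> names its orbit, so that the usual order of numbers compares orbits first.
\<close>

locale orbit_alphabet =
  fixes L :: "nat set" and p :: nat and ad :: "nat \<Rightarrow> nat \<Rightarrow> nat" and act :: "nat \<Rightarrow> nat \<Rightarrow> nat"
  assumes finite_L: "finite L"
    and p_pos: "0 < p"
    and ad_less: "\<lbrakk>a < p; b < p\<rbrakk> \<Longrightarrow> ad a b < p"
    and ad_comm: "\<lbrakk>a < p; b < p\<rbrakk> \<Longrightarrow> ad a b = ad b a"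
    and ad_inverse: "a < p \<Longrightarrow> \<exists>b<p. ad a b = 0"
    and act_in: "\<lbrakk>h < p; x \<in> L\<rbrakk> \<Longrightarrow> act h x \<in> L"
    and act_0: "x \<in> L \<Longrightarrow> act 0 x = x"
    and act_ad: "\<lbrakk>a < p; b < p; x \<in> L\<rbrakk> \<Longrightarrow> act (ad a b) x = act a (act b x)"
    and class_act: "\<lbrakk>h < p; x \<in> L\<rbrakk> \<Longrightarrow> act h x div p = x div p"
    and class_orbit: "\<lbrakk>x \<in> L; y \<in> L; x div p = y div p\<rbrakk> \<Longrightarrow> \<exists>h<p. act h x = y"
begin

definition al :: "nat \<Rightarrow> nat list \<Rightarrow> nat list" where
  "al h u = map (act h) u"

lemma length_al [simp]: "length (al h u) = length u"
  by (simp add: al_def)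

lemma al_Nil [simp]: "al h [] = []"
  by (simp add: al_def)

lemma al_append: "al h (u @ v) = al h u @ al h v"
  by (simp add: al_def)

lemma al_in: "h < p \<Longrightarrow> set u \<subseteq> L \<Longrightarrow> set (al h u) \<subseteq> L"
  by (auto simp: al_def act_in)

lemma al_0: "set u \<subseteq> L \<Longrightarrow> al 0 u = u"
  by (auto simp: al_def act_0 intro!: map_idI)

lemma al_ad: "a < p \<Longrightarrow> b < p \<Longrightarrow> set u \<subseteq> L \<Longrightarrow> al (ad a b) u = al a (al b u)"
  by (auto simp: al_def act_ad)

lemma take_al: "take j (al h u) = al h (take j u)"
  by (simp add: al_def take_map)

lemma drop_al: "drop j (al h u) = al h (drop j u)"
  by (simp add: al_def drop_map)

lemma inverse_act:
  assumes "h < p"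
  obtains h' where "h' < p" "\<And>x. x \<in> L \<Longrightarrow> act h' (act h x) = x" "\<And>x. x \<in> L \<Longrightarrow> act h (act h' x) = x"
proof -
  obtain h' where h': "h' < p" "ad h h' = 0" using ad_inverse[OF assms] by auto
  then have "ad h' h = 0" using ad_comm assms by auto
  with h' assms that show ?thesis by (metis act_0 act_ad)
qed

lemma inverse_al:
  assumes "h < p"
  obtains h' where "h' < p" "\<And>u. set u \<subseteq> L \<Longrightarrow> al h' (al h u) = u" "\<And>u. set u \<subseteq> L \<Longrightarrow> al h (al h' u) = u"
proof -
  obtain h' where "h' < p" "\<And>x. x \<in> L \<Longrightarrow> act h' (act h x) = x" "\<And>x. x \<in> L \<Longrightarrow> act h (act h' x) = x"
    using inverse_act[OF assms] by metis
  then show ?thesis by (intro that[of h']) (auto simp: al_def subset_iff intro!: map_idI)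
qed

lemma act_inj: "h < p \<Longrightarrow> x \<in> L \<Longrightarrow> y \<in> L \<Longrightarrow> act h x = act h y \<Longrightarrow> x = y"
  by (metis inverse_act)

lemma al_inj: "h < p \<Longrightarrow> set u \<subseteq> L \<Longrightarrow> set v \<subseteq> L \<Longrightarrow> al h u = al h v \<Longrightarrow> u = v"
  by (metis inverse_al)

end

text \<open>The string \<open>w\<close> represents its class under rotations and the action of the group on all letters.\<close>

locale least_translate = orbit_alphabet +
  fixes w :: "nat list" and m :: nat
  assumes length_w: "length w = m" and m_pos: "0 < m" and w_in: "set w \<subseteq> L"
    and least: "\<lbrakk>r < m; k < p\<rbrakk> \<Longrightarrow> \<not> lex_less (al k (rotate r w)) w"
begin

text \<open>
  The states record how much of \<open>w\<close>, up to the action of the group, has just been read. Proper prefixes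
  suffice: longer matches are never needed to detect something below \<open>w\<close>.
\<close>

definition States :: "nat list set" where
  "States = {al h (take j w) | h j. h < p \<and> j < m}"

definition st :: "nat list \<Rightarrow> nat list" where
  "st u = drop (LEAST i. drop i u \<in> States) u"

text \<open>
  After \<open>u\<close>, the letter \<open>x\<close> is rejected if a suffix of \<open>u @ [x]\<close> has a translate that agrees with a
  prefix of \<open>w\<close> except for a smaller last letter.
\<close>

definition rej :: "nat list \<Rightarrow> nat \<Rightarrow> bool" where
  "rej u x \<longleftrightarrow> (\<exists>j<m. \<exists>k<p. j \<le> length u \<and> al k (drop (length u - j) u) = take j w \<and> act k x < w ! j)"

lemma set_take_w: "set (take j w) \<subseteq> L"
  using w_in set_take_subset by fast

lemma w_nth_in: "i < m \<Longrightarrow> w ! i \<in> L"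
  using w_in length_w by auto

lemma Nil_States: "[] \<in> States"
  unfolding States_def using m_pos p_pos by (intro CollectI exI[of _ 0]) auto

lemma length_States: "u \<in> States \<Longrightarrow> length u < m"
  unfolding States_def using length_w by auto

lemma States_in: "u \<in> States \<Longrightarrow> set u \<subseteq> L"
  unfolding States_def using al_in set_take_w by auto

lemma finite_States: "finite States"
proof -
  have "States \<subseteq> (\<lambda>(h, j). al h (take j w)) ` ({..<p} \<times> {..<m})"
    unfolding States_def by auto
  then show ?thesis by (rule finite_subset) auto
qed

text \<open>
  States are closed under prefixes and under the group. The former makes \<open>st\<close> computable letter by
  letter, the latter makes the automaton equivariant.
\<close>

lemma States_prefix: "u @ v \<in> States \<Longrightarrow> u \<in> States"
proof -
  assume "u @ v \<in> States"
  then obtain h j where hj: "h < p" "j < m" "u @ v = al h (take j w)" unfolding States_def by auto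
  then have "u = take (length u) (al h (take j w))" by (metis append_eq_conv_conj)
  then have "u = al h (take (min (length u) j) w)" by (simp add: take_al min.commute)
  then show ?thesis unfolding States_def using hj by (intro CollectI exI[of _ h] exI[of _ "min (length u) j"]) auto
qed

lemma States_al: "h < p \<Longrightarrow> u \<in> States \<Longrightarrow> al h u \<in> States"
  unfolding States_def using al_ad set_take_w ad_less by (smt (verit) mem_Collect_eq)

lemma States_al_iff: "h < p \<Longrightarrow> set u \<subseteq> L \<Longrightarrow> al h u \<in> States \<longleftrightarrow> u \<in> States"
  by (metis States_al inverse_al)

lemma st_ex: "drop (length u) u \<in> States"
  using Nil_States by simp

lemma st_States: "st u \<in> States"
  unfolding st_def using LeastI[of "\<lambda>i. drop i u \<in> States", OF st_ex] .

lemma st_state: "u \<in> States \<Longrightarrow> st u = u"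
  unfolding st_def using Least_eq_0[of "\<lambda>i. drop i u \<in> States"] by simp

lemma st_in: "set u \<subseteq> L \<Longrightarrow> set (st u) \<subseteq> L"
  using st_States States_in by blast

lemma st_drop:
  assumes "k \<le> length u" "\<And>i. i < k \<Longrightarrow> drop i u \<notin> States"
  shows "st u = st (drop k u)"
proof -
  have "(LEAST i. drop i u \<in> States) = (LEAST i. drop i (drop k u) \<in> States) + k" (is "?l = ?r + k")
  proof (rule Least_equality)
    show "drop (?r + k) u \<in> States"
      using LeastI[of "\<lambda>i. drop i (drop k u) \<in> States", OF st_ex] by simp
    fix y assume y: "drop y u \<in> States"
    then have "k \<le> y" using assms(2) not_le by blast
    then have "drop (y - k) (drop k u) \<in> States" using y by simp
    then have "?r \<le> y - k" by (rule Least_le)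
    then show "?r + k \<le> y" using \<open>k \<le> y\<close> by simp
  qed
  then show ?thesis unfolding st_def by simp
qed

lemma st_suffix:
  obtains v where "u = v @ st u" "\<And>i. i < length v \<Longrightarrow> drop i u \<notin> States" 
proof -
  let ?i = "LEAST i. drop i u \<in> States"
  have le: "?i \<le> length u" by (rule Least_le) (rule st_ex)
  show ?thesis
  proof (rule that[of "take ?i u"])
    show "u = take ?i u @ st u" unfolding st_def by simp
    show "drop i u \<notin> States" if "i < length (take ?i u)" for i
      using that le not_less_Least by auto
  qed
qed

text \<open>A suffix of \<open>u @ y\<close> that is a state restricts to a suffix of \<open>u\<close> that is a state, hence starts within \<open>st u\<close>.\<close>

lemma st_append: "st (u @ y) = st (st u @ y)"
proof -
  obtain v where v: "u = v @ st u" "\<And>i. i < length v \<Longrightarrow> drop i u \<notin> States" using st_suffix[of u] by metis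
  have "st (u @ y) = st (drop (length v) (u @ y))"
  proof (rule st_drop)
    show "length v \<le> length (u @ y)" by (subst v(1)) simp
    fix i assume i: "i < length v"
    then have "i \<le> length u" by (subst v(1)) simp
    then have "drop i (u @ y) = drop i u @ y" by simp
    then show "drop i (u @ y) \<notin> States" using v(2)[OF i] States_prefix by metis
  qed
  also have "drop (length v) (u @ y) = st u @ y" by (subst v(1)) simp
  finally show ?thesis .
qed

text \<open>States have fewer than \<open>m\<close> letters, so the automaton forgets everything older than that.\<close>

lemma st_long: "m \<le> length u \<Longrightarrow> st (a @ u) = st u"
proof -
  assume "m \<le> length u"
  have "st (a @ u) = st (drop (length a) (a @ u))"
  proof (rule st_drop)
    fix i assume "i < length a"
    then have "m \<le> length (drop i (a @ u))" using \<open>m \<le> length u\<close> by simp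
    then show "drop i (a @ u) \<notin> States" using length_States by fastforce
  qed simp
  then show ?thesis by simp
qed

lemma st_al: "h < p \<Longrightarrow> set u \<subseteq> L \<Longrightarrow> st (al h u) = al h (st u)"
proof -
  assume h: "h < p" "set u \<subseteq> L"
  have "drop i (al h u) \<in> States \<longleftrightarrow> drop i u \<in> States" for i
    using States_al_iff[OF h(1), of "drop i u"] h(2) set_drop_subset by (fastforce simp: drop_al)
  then show ?thesis unfolding st_def by (simp add: drop_al)
qed

text \<open>The suffix that witnesses rejection is itself a state, hence a suffix of the longest one.\<close>

lemma rej_st:
  assumes "set u \<subseteq> L"
  shows "rej u x \<longleftrightarrow> rej (st u) x"
proof -
  obtain v where v: "u = v @ st u" "\<And>i. i < length v \<Longrightarrow> drop i u \<notin> States" using st_suffix[of u] by metis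
  have *: "j \<le> length u \<and> al k (drop (length u - j) u) = take j w \<longleftrightarrow>
        j \<le> length (st u) \<and> al k (drop (length (st u) - j) (st u)) = take j w" if jk: "j < m" "k < p" for j k
  proof -
    have "j \<le> length (st u)" if "j \<le> length u" "al k (drop (length u - j) u) = take j w"
    proof (rule ccontr)
      assume "\<not> j \<le> length (st u)"
      moreover have "length u = length v + length (st u)" by (subst v(1)) simp
      ultimately have "length u - j < length v" using that(1) by linarith
      then have "drop (length u - j) u \<notin> States" by (rule v(2))
      moreover have "al k (drop (length u - j) u) \<in> States"
        unfolding that(2) States_def using jk p_pos set_take_w al_0 by (intro CollectI exI[of _ 0] exI[of _ j]) auto
      ultimately show False using States_al_iff[OF jk(2)] assms set_drop_subset by (metis order_trans)
    qed
    moreover have "drop (length u - j) u = drop (length (st u) - j) (st u)" if "j \<le> length (st u)"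
    proof -
      have "length u - j = length v + (length (st u) - j)"
        using that arg_cong[OF v(1), of length] by simp
      then show ?thesis by (subst (2) v(1)) simp
    qed
    moreover have "length (st u) \<le> length u" by (subst (2) v(1)) simp
    ultimately show ?thesis by auto
  qed
  then show ?thesis unfolding rej_def by blast
qed

lemma rej_al_imp:
  assumes "h < p" "set u \<subseteq> L" "x \<in> L" "rej u x"
  shows "rej (al h u) (act h x)"
proof -
  obtain h' where h': "h' < p" "\<And>x. x \<in> L \<Longrightarrow> act h' (act h x) = x"
      "\<And>u. set u \<subseteq> L \<Longrightarrow> al h' (al h u) = u"
  proof -
    obtain h' where "h' < p" "\<And>x. x \<in> L \<Longrightarrow> act h' (act h x) = x" using inverse_act[OF assms(1)] by metis
    then show ?thesis by (intro that[of h']) (auto simp: al_def subset_iff intro!: map_idI)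
  qed
  obtain j k where jk: "j < m" "k < p" "j \<le> length u" "al k (drop (length u - j) u) = take j w" "act k x < w ! j"
    using assms(4) unfolding rej_def by auto
  have dL: "set (drop (length u - j) u) \<subseteq> L" using assms(2) set_drop_subset by fast
  have "al (ad k h') (drop (length (al h u) - j) (al h u)) = take j w"
    using jk h' dL al_ad[OF jk(2) h'(1) al_in[OF assms(1) dL]] by (simp add: drop_al)
  moreover have "act (ad k h') (act h x) < w ! j"
    using act_ad[OF jk(2) h'(1) act_in[OF assms(1,3)]] h'(2)[OF assms(3)] jk(5) by simp
  moreover have "j \<le> length (al h u)" using jk by simp
  ultimately show ?thesis unfolding rej_def using jk(1) ad_less[OF jk(2) h'(1)] by blast
qed

lemma rej_al:
  assumes "h < p" "set u \<subseteq> L" "x \<in> L"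
  shows "rej (al h u) (act h x) \<longleftrightarrow> rej u x"
proof
  obtain h' where h': "h' < p" "\<And>x. x \<in> L \<Longrightarrow> act h' (act h x) = x" using inverse_act[OF assms(1)] by metis
  then have "al h' (al h u) = u" using assms(2) by (auto simp: al_def subset_iff intro!: map_idI)
  then show "rej (al h u) (act h x) \<Longrightarrow> rej u x"
    using rej_al_imp[OF h'(1) al_in[OF assms(1,2)] act_in[OF assms(1,3)]] h'(2)[OF assms(3)] by simp
qed (rule rej_al_imp[OF assms])

text \<open>The string \<open>xs\<close> is read after \<open>a\<close> without rejection.\<close>

definition admissible :: "nat list \<Rightarrow> nat list \<Rightarrow> bool" where
  "admissible a xs \<longleftrightarrow> (\<forall>i<length xs. \<not> rej (a @ take i xs) (xs ! i))"

lemma admissible_Nil [simp]: "admissible a []"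
  by (simp add: admissible_def)

lemma admissible_snoc: "admissible a (xs @ [x]) \<longleftrightarrow> admissible a xs \<and> \<not> rej (a @ xs) x"
  unfolding admissible_def by (auto simp: nth_append less_Suc_eq)

lemma admissible_append: "admissible a (xs @ ys) \<longleftrightarrow> admissible a xs \<and> admissible (a @ xs) ys"
proof (induction ys rule: rev_induct)
  case (snoc y ys)
  then show ?case using admissible_snoc[of a "xs @ ys" y] admissible_snoc[of "a @ xs" ys y] by auto
qed simp

lemma admissible_st:
  assumes "set a \<subseteq> L" "set xs \<subseteq> L"
  shows "admissible a xs \<longleftrightarrow> admissible (st a) xs"
  using assms(2)
proof (induction xs rule: rev_induct)
  case (snoc x xs)
  have "rej (a @ xs) x \<longleftrightarrow> rej (st a @ xs) x"
    using rej_st[of "a @ xs" x] rej_st[of "st a @ xs" x] st_append[of a xs] assms(1) st_in[OF assms(1)] snoc.prems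
    by simp
  then show ?case using snoc admissible_snoc by simp
qed simp

lemma admissible_al:
  assumes "h < p" "set a \<subseteq> L" "set xs \<subseteq> L"
  shows "admissible (al h a) (al h xs) \<longleftrightarrow> admissible a xs"
  using assms(3)
proof (induction xs rule: rev_induct)
  case (snoc x xs)
  have "al h (xs @ [x]) = al h xs @ [act h x]" by (simp add: al_def)
  moreover have "rej (al h a @ al h xs) (act h x) \<longleftrightarrow> rej (a @ xs) x"
    using rej_al[OF assms(1), of "a @ xs" x] assms(2) snoc.prems by (simp add: al_append)
  ultimately show ?case using snoc admissible_snoc by simp
qed simp

lemma upt_split: "i \<le> j \<Longrightarrow> j \<le> k \<Longrightarrow> [i..<k] = [i..<j] @ [j..<k]"
  by (metis le_add_diff_inverse upt_add_eq_append)

section \<open>Counting walks of the automaton\<close>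

definition step_count :: "nat set \<Rightarrow> nat list \<Rightarrow> nat list \<Rightarrow> nat" where
  "step_count X c b = card {x\<in>X. \<not> rej c x \<and> st (c @ [x]) = b}"

definition walk_set :: "nat set \<Rightarrow> nat \<Rightarrow> nat list \<Rightarrow> nat list \<Rightarrow> nat list set" where
  "walk_set X i a b = {xs. set xs \<subseteq> X \<and> length xs = i \<and> admissible a xs \<and> st (a @ xs) = b}"

definition walk_count :: "nat set \<Rightarrow> nat \<Rightarrow> nat list \<Rightarrow> nat list \<Rightarrow> nat" where
  "walk_count X i a b = card (walk_set X i a b)"

lemma finite_walk_set: "finite X \<Longrightarrow> finite (walk_set X i a b)"
  unfolding walk_set_def by (rule finite_subset[OF _ finite_lists_length_eq[of X i]]) auto

lemma walk_count_le: "finite X \<Longrightarrow> walk_count X i a b \<le> card X ^ i"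
  unfolding walk_count_def
  by (subst card_lists_length_eq[symmetric], assumption)
    (rule card_mono, auto simp: walk_set_def finite_lists_length_eq)

lemma walk_count_0: "a \<in> States \<Longrightarrow> walk_count X 0 a b = (if a = b then 1 else 0)"
proof -
  assume "a \<in> States"
  then have "walk_set X 0 a b = (if a = b then {[]} else {})"
    unfolding walk_set_def using st_state by auto
  then show ?thesis unfolding walk_count_def by simp
qed

text \<open>The state before the last letter splits the walks; this is the matrix product that the program iterates.\<close>

lemma walk_count_Suc:
  assumes "X \<subseteq> L" "a \<in> States"
  shows "walk_count X (Suc i) a b = (\<Sum>c\<in>States. walk_count X i a c * step_count X c b)"
proof -
  have finX: "finite X" using assms(1) finite_L finite_subset by blast
  let ?f = "\<lambda>c. (\<lambda>(xs, x). xs @ [x]) ` (walk_set X i a c \<times> {x\<in>X. \<not> rej c x \<and> st (c @ [x]) = b})"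
  have "walk_set X (Suc i) a b = (\<Union>c\<in>States. ?f c)"
  proof (intro equalityI subsetI)
    fix ys assume ys: "ys \<in> walk_set X (Suc i) a b"
    then obtain xs x where xs: "ys = xs @ [x]" unfolding walk_set_def by (cases ys rule: rev_cases) auto
    have sub: "set (a @ xs) \<subseteq> L" using ys xs assms States_in unfolding walk_set_def by auto
    have "xs \<in> walk_set X i a (st (a @ xs))" "x \<in> X" "\<not> rej (st (a @ xs)) x" "st (st (a @ xs) @ [x]) = b"
      using ys xs admissible_snoc[of a xs x] rej_st[OF sub] st_append[of "a @ xs" "[x]"] unfolding walk_set_def by auto
    then show "ys \<in> (\<Union>c\<in>States. ?f c)" using xs st_States by (intro UN_I[of "st (a @ xs)"]) auto
  next
    fix ys assume "ys \<in> (\<Union>c\<in>States. ?f c)"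
    then obtain xs x c where xs: "ys = xs @ [x]" "xs \<in> walk_set X i a c" "x \<in> X" "\<not> rej c x" "st (c @ [x]) = b"
      by auto
    have c: "c = st (a @ xs)" using xs(2) unfolding walk_set_def by auto
    have sub: "set (a @ xs) \<subseteq> L" using xs assms States_in unfolding walk_set_def by auto
    show "ys \<in> walk_set X (Suc i) a b"
      using xs admissible_snoc[of a xs x] rej_st[OF sub] st_append[of "a @ xs" "[x]"] c unfolding walk_set_def by auto
  qed
  moreover have "card (\<Union>c\<in>States. ?f c) = (\<Sum>c\<in>States. card (?f c))"
  proof (rule card_UN_disjoint)
    show "\<forall>c\<in>States. finite (?f c)" using finite_walk_set finX by auto
    show "\<forall>c\<in>States. \<forall>c'\<in>States. c \<noteq> c' \<longrightarrow> ?f c \<inter> ?f c' = {}" unfolding walk_set_def by auto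
  qed (rule finite_States)
  moreover have "card (?f c) = walk_count X i a c * step_count X c b" for c
    unfolding walk_count_def step_count_def by (subst card_image) (auto simp: inj_on_def card_cartesian_product)
  ultimately show ?thesis unfolding walk_count_def by simp
qed

section \<open>Twisted periodic sequences as closed walks\<close>

text \<open>Nowhere in the infinite sequence \<open>E\<close> does a translate of something below \<open>w\<close> occur.\<close>

definition good :: "(nat \<Rightarrow> nat) \<Rightarrow> bool" where
  "good E \<longleftrightarrow> (\<forall>i k j. k < p \<longrightarrow> j < m \<longrightarrow> (\<forall>j'<j. act k (E (i + j')) = w ! j') \<longrightarrow> \<not> act k (E (i + j)) < w ! j)"

lemma good_if_admissible:
  assumes "\<And>n. admissible a (map E [0..<n])"
  shows "good E"
  unfolding good_def
proof (intro allI impI notI)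
  fix i k j assume H: "k < p" "j < m" "\<forall>j'<j. act k (E (i + j')) = w ! j'" "act k (E (i + j)) < w ! j"
  let ?u = "a @ map E [0..<i + j]"
  have d: "drop (length ?u - j) ?u = map E [i..<i + j]" by (simp add: drop_map)
  have "al k (map E [i..<i + j]) = take j w"
    using H length_w by (auto simp: al_def list_eq_iff_nth_eq)
  then have "rej ?u (E (i + j))" unfolding rej_def using H d by (intro exI[of _ j] exI[of _ k] conjI) simp_all
  moreover have "take (i + j) (map E [0..<Suc (i + j)]) = map E [0..<i + j]" by (simp add: take_map)
  moreover have "map E [0..<Suc (i + j)] ! (i + j) = E (i + j)" by (simp del: upt_Suc)
  ultimately show False using assms[of "Suc (i + j)"] unfolding admissible_def by (metis diff_zero length_map length_upt lessI)
qed

lemma not_rej_if_good: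
  assumes "good E" "i \<le> n"
  shows "\<not> rej (map E [i..<n]) (E n)"
proof
  let ?u = "map E [i..<n]"
  assume "rej ?u (E n)"
  then obtain j k where jk: "j < m" "k < p" "j \<le> n - i" "al k (drop (n - i - j) ?u) = take j w" "act k (E n) < w ! j"
    unfolding rej_def by auto
  have d: "drop (n - i - j) ?u = map E [n - j..<n]" using jk(3) assms(2) by (simp add: drop_map)
  have "act k (E (n - j + j')) = w ! j'" if "j' < j" for j'
  proof -
    have "(al k (map E [n - j..<n])) ! j' = (take j w) ! j'" using jk(4) d by simp
    then show ?thesis using that jk(3) by (simp add: al_def)
  qed
  moreover have "n - j + j = n" using jk(3) by simp
  ultimately show False using assms(1) jk unfolding good_def by metis
qed

lemma admissible_if_good:
  assumes "good E" "i \<le> n"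
  shows "admissible (map E [i..<n]) (map E [n..<n + k])"
proof (induction k)
  case (Suc k)
  have "map E [i..<n] @ map E [n..<n + k] = map E [i..<n + k]"
    using assms(2) upt_split[of i n "n + k"] by simp
  moreover have "map E [n..<n + Suc k] = map E [n..<n + k] @ [E (n + k)]" by simp
  ultimately show ?case using Suc admissible_snoc not_rej_if_good[OF assms(1), of i "n + k"] assms(2) by simp
qed simp

end

text \<open>Moving by \<open>l\<close> places in \<open>E\<close> applies \<open>t'\<close>, the inverse of \<open>t\<close>.\<close>

locale twisted = least_translate +
  fixes E :: "nat \<Rightarrow> nat" and l t t' :: nat
  assumes E_in: "E i \<in> L" and l_pos: "0 < l" and t: "t < p" "t' < p"
    and tt': "\<And>x. x \<in> L \<Longrightarrow> act t (act t' x) = x"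
    and E_shift: "E (i + l) = act t' (E i)"
begin

lemma t't: "x \<in> L \<Longrightarrow> act t' (act t x) = x"
  by (metis act_in act_inj tt' t)

lemma al_t't: "set u \<subseteq> L \<Longrightarrow> al t' (al t u) = u"
  using t't by (auto simp: al_def subset_iff intro!: map_idI)

lemma al_tt': "set u \<subseteq> L \<Longrightarrow> al t (al t' u) = u"
  using tt' by (auto simp: al_def subset_iff intro!: map_idI)

abbreviation "apow c \<equiv> al t' ^^ c"

lemma apow_in: "set u \<subseteq> L \<Longrightarrow> set (apow c u) \<subseteq> L"
  by (induction c) (auto dest: al_in[OF t(2)])

lemma st_apow: "set u \<subseteq> L \<Longrightarrow> st (apow c u) = apow c (st u)"
  by (induction c) (auto simp: st_al[OF t(2)] apow_in)

lemma admissible_apow: "set a \<subseteq> L \<Longrightarrow> set u \<subseteq> L \<Longrightarrow> admissible (apow c a) (apow c u) \<longleftrightarrow> admissible a u"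
  by (induction c) (auto simp: admissible_al[OF t(2)] apow_in)

lemma apow_append: "apow c (u @ v) = apow c u @ apow c v"
  by (induction c) (auto simp: al_append)

lemma apow_inj: "set u \<subseteq> L \<Longrightarrow> set v \<subseteq> L \<Longrightarrow> apow c u = apow c v \<Longrightarrow> u = v"
proof (induction c)
  case (Suc c)
  then show ?case using al_inj[OF t(2) apow_in apow_in] by auto
qed simp

lemma apow_surj: "set u \<subseteq> L \<Longrightarrow> \<exists>v. set v \<subseteq> L \<and> apow c v = u"
proof (induction c arbitrary: u)
  case (Suc c)
  have "al t' (al t u) = u" by (rule al_t't[OF Suc.prems])
  moreover obtain v where "set v \<subseteq> L" "apow c v = al t u" using Suc.IH[OF al_in[OF t(1) Suc.prems]] by auto
  ultimately show ?case by (intro exI[of _ v]) auto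
qed auto

lemma apow_States: "set u \<subseteq> L \<Longrightarrow> apow c u \<in> States \<longleftrightarrow> u \<in> States"
  by (induction c) (auto simp: States_al_iff[OF t(2)] apow_in)

lemma map_E_in: "set (map E xs) \<subseteq> L"
  using E_in by auto

lemma map_E_shift: "map E [i + l..<j + l] = al t' (map E [i..<j])"
proof -
  have "[i + l..<j + l] = map (\<lambda>k. k + l) [i..<j]" by (induction j) auto
  then have "map E [i + l..<j + l] = map (\<lambda>k. E (k + l)) [i..<j]" by (simp add: o_def)
  then show ?thesis by (simp add: E_shift al_def)
qed

lemma map_E_block: "map E [c * l..<c * l + l] = apow c (map E [0..<l])"
proof (induction c)
  case (Suc c)
  have "map E [Suc c * l..<Suc c * l + l] = map E [c * l + l..<(c * l + l) + l]" by (simp add: add.commute)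
  also have "\<dots> = al t' (map E [c * l..<c * l + l])" by (rule map_E_shift)
  finally show ?case using Suc by simp
qed simp

lemma map_E_Suc: "map E [0..<Suc c * l] = map E [0..<c * l] @ apow c (map E [0..<l])"
proof -
  have "[0..<Suc c * l] = [0..<c * l] @ [c * l..<c * l + l]"
    using upt_split[of 0 "c * l" "Suc c * l"] by (simp add: add.commute)
  then show ?thesis using map_E_block by simp
qed

lemma map_E_Suc': "map E [0..<Suc c * l] = map E [0..<l] @ al t' (map E [0..<c * l])"
proof -
  have "[0..<Suc c * l] = [0..<l] @ [0 + l..<c * l + l]"
    using upt_split[of 0 l "Suc c * l"] by (simp add: add.commute)
  then show ?thesis using map_E_shift[of 0 "c * l"] by simp
qed

text \<open>Reading one period from \<open>a\<close> leads to the translate of \<open>a\<close> by \<open>t'\<close>, where the next period, translated by \<open>t'\<close>, can be read in the same way.\<close>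

abbreviation "closes a \<equiv> admissible a (map E [0..<l]) \<and> al t (st (a @ map E [0..<l])) = a"

lemma closes_iter:
  assumes "a \<in> States" "closes a"
  shows "admissible a (map E [0..<c * l]) \<and> st (a @ map E [0..<c * l]) = apow c a"
proof (induction c)
  case 0
  then show ?case using assms st_state by simp
next
  case (Suc c)
  let ?u = "map E [0..<c * l]" and ?x = "map E [0..<l]"
  have aL: "set a \<subseteq> L" using assms States_in by auto
  have "st (a @ ?x) = al t' (al t (st (a @ ?x)))"
    using al_t't[OF st_in[of "a @ ?x"]] aL by (simp add: E_in image_subset_iff)
  then have ax: "st (a @ ?x) = al t' a" using assms(2) by simp
  have "admissible (apow c a) (apow c ?x)" using assms(2) admissible_apow[OF aL map_E_in] by blast
  then have "admissible (a @ ?u) (apow c ?x)"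
    using admissible_st[of "a @ ?u" "apow c ?x"] Suc aL apow_in[OF map_E_in] by (simp add: E_in image_subset_iff)
  then have "admissible a (map E [0..<Suc c * l])" unfolding map_E_Suc admissible_append using Suc by simp
  moreover have "st (a @ map E [0..<Suc c * l]) = st (st (a @ ?u) @ apow c ?x)"
    unfolding map_E_Suc by (metis append_assoc st_append)
  moreover have "\<dots> = apow (Suc c) a"
    using Suc ax st_apow[of "a @ ?x" c] aL by (simp add: apow_append funpow_swap1 E_in image_subset_iff)
  ultimately show ?case by simp
qed

text \<open>By equivariance a closing walk can be continued forever.\<close>

lemma closes_good:
  assumes "a \<in> States" "closes a"
  shows "good E"
proof (rule good_if_admissible[of a])
  fix n
  have "n \<le> n * l" using l_pos by simp
  then have "map E [0..<n * l] = map E [0..<n] @ map E [n..<n * l]"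
    using upt_split[of 0 n "n * l"] by simp
  then show "admissible a (map E [0..<n])" using closes_iter[OF assms, of n] admissible_append by simp
qed

text \<open>
  After \<open>m\<close> periods the state no longer depends on the one started from, and it is the translate of
  the initial one by a fixed group element.
\<close>

lemma closes_unique:
  assumes "a \<in> States" "closes a" "b \<in> States" "closes b"
  shows "a = b"
proof -
  have "m \<le> length (map E [0..<m * l])" using l_pos by simp
  then have "st (a @ map E [0..<m * l]) = st (b @ map E [0..<m * l])" using st_long by metis
  then have "apow m a = apow m b" using closes_iter[OF assms(1,2), of m] closes_iter[OF assms(3,4), of m] by simp
  then show ?thesis using apow_inj States_in assms by auto
qed

text \<open>
  The state after \<open>m\<close> periods, translated back \<open>m\<close> times, closes: by \<open>st_long\<close> the states after \<open>m\<close> and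
  after \<open>m + 1\<close> periods differ by the twist only.
\<close>

lemma good_closes:
  assumes "good E"
  shows "\<exists>a\<in>States. closes a"
proof -
  let ?u = "map E [0..<m * l]" and ?x = "map E [0..<l]"
  have uL: "set ?u \<subseteq> L" by (rule map_E_in)
  obtain a where a: "set a \<subseteq> L" "apow m a = st ?u" using apow_surj[OF st_in[OF uL]] by auto
  have aS: "a \<in> States" using apow_States[OF a(1), of m] a(2) st_States by simp
  have "admissible ?u (map E [m * l..<m * l + l])" using admissible_if_good[OF assms, of 0 "m * l" l] by simp
  then have "admissible (apow m a) (apow m ?x)"
    unfolding map_E_block using admissible_st uL a apow_in[OF map_E_in] by simp
  then have ok: "admissible a ?x" using admissible_apow[OF a(1) map_E_in] by blast
  have "apow m (st (a @ ?x)) = st (st ?u @ apow m ?x)"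
    using st_apow[of "a @ ?x" m] a apow_append[of m a ?x] by (simp add: E_in image_subset_iff)
  also have "\<dots> = st (map E [0..<Suc m * l])" unfolding map_E_Suc using st_append by metis
  also have "\<dots> = st (al t' ?u)" unfolding map_E_Suc' by (rule st_long) (use l_pos in simp)
  also have "\<dots> = al t' (st ?u)" by (rule st_al[OF t(2) uL])
  also have "\<dots> = apow m (al t' a)" unfolding a(2)[symmetric] by (rule funpow_swap1)
  finally have "st (a @ ?x) = al t' a"
    using apow_inj[OF st_in[of "a @ ?x"] al_in[OF t(2) a(1)]] a(1) by (simp add: E_in image_subset_iff)
  moreover have "al t (al t' a) = a" by (rule al_tt'[OF a(1)])
  ultimately show ?thesis using ok aS by auto
qed

end

section \<open>Names for states and letters\<close>

text \<open>
  Sums over the set of states become sums over numbers in which all but the first name of a state are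
  masked out. This is how a program without sets enumerates them.
\<close>

lemma sum_over_image:
  fixes n :: nat
  shows "(\<Sum>y\<in>f ` {..<n}. h y) = (\<Sum>a<n. of_bool (\<forall>a'<a. f a' \<noteq> f a) * (h (f a) :: nat))"
proof (induction n)
  case (Suc n)
  show ?case
  proof (cases "f n \<in> f ` {..<n}")
    case True
    then have "\<not> (\<forall>a'<n. f a' \<noteq> f n)" by auto
    then show ?thesis using Suc True by (simp add: lessThan_Suc insert_absorb)
  next
    case False
    then have "\<forall>a'<n. f a' \<noteq> f n" by (metis image_eqI lessThan_iff)
    then show ?thesis using Suc False by (simp add: lessThan_Suc)
  qed
qed simp

lemma card_image_filter:
  fixes n :: nat
  shows "card {y\<in>f ` {..<n}. P y} = (\<Sum>a<n. of_bool (\<forall>a'<a. f a' \<noteq> f a) * of_bool (P (f a)))"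
proof -
  have "card {y\<in>f ` {..<n}. P y} = (\<Sum>y\<in>f ` {..<n}. of_bool (P y))"
    by (simp add: Int_def)
  then show ?thesis using sum_over_image[of "\<lambda>y. of_bool (P y)" f n] by simp
qed

context least_translate
begin

text \<open>
  A number \<open>a < p * m\<close> encodes the group element \<open>a mod p\<close> and the place \<open>a div p\<close> in \<open>w\<close>. It names a
  state, the translated prefix of that length, and also a letter, the translated letter at that place.
\<close>

definition state :: "nat \<Rightarrow> nat list" where
  "state a = al (a mod p) (take (a div p) w)"

definition letter :: "nat \<Rightarrow> nat" where
  "letter x = act (x mod p) (w ! (x div p))"

text \<open>Several numbers may name the same state or letter; the first one is chosen.\<close>

definition canon :: "nat \<Rightarrow> bool" where
  "canon a \<longleftrightarrow> (\<forall>a'<a. state a' \<noteq> state a)"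

definition newname :: "nat \<Rightarrow> bool" where
  "newname x \<longleftrightarrow> (\<forall>x'<x. letter x' \<noteq> letter x)"

definition succ_name :: "nat \<Rightarrow> nat \<Rightarrow> nat" where
  "succ_name a x = (LEAST b. state b = st (state a @ [letter x]))"

text \<open>The letters in the orbit of some letter of \<open>w\<close>; see \<open>named_if_class\<close>.\<close>

definition Named :: "nat set" where
  "Named = letter ` {..<p * m}"

definition Fixed :: "nat \<Rightarrow> nat set" where
  "Fixed s = {x\<in>L. act s x = x}"

lemma div_less_m: "a < p * m \<Longrightarrow> a div p < m"
  by (simp add: less_mult_imp_div_less mult.commute)

lemma mod_less_p: "a mod p < p"
  using p_pos by simp

lemma pair_less: "h < p \<Longrightarrow> j < m \<Longrightarrow> j * p + h < p * m"
proof -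
  assume "h < p" "j < m"
  then have "j * p + h < (j + 1) * p" by simp
  also have "\<dots> \<le> m * p" using \<open>j < m\<close> by (intro mult_right_mono) auto
  finally show ?thesis by (simp add: mult.commute)
qed

lemma length_state: "a < p * m \<Longrightarrow> length (state a) = a div p"
  using div_less_m[of a] by (simp add: state_def length_w)

lemma States_state: "States = state ` {..<p * m}"
proof (intro equalityI subsetI)
  fix u assume "u \<in> States"
  then obtain h j where hj: "h < p" "j < m" "u = al h (take j w)" unfolding States_def by auto
  then have "u = state (j * p + h)" unfolding state_def by simp
  then show "u \<in> state ` {..<p * m}" using pair_less[OF hj(1,2)] by auto
next
  fix u assume "u \<in> state ` {..<p * m}"
  then show "u \<in> States" unfolding States_def state_def using div_less_m mod_less_p by blast
qed

lemma sum_States: "(\<Sum>a\<in>States. f a) = (\<Sum>a<p * m. of_bool (canon a) * (f (state a) :: nat))"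
  unfolding States_state sum_over_image canon_def ..

lemma canon_eq: "canon a \<Longrightarrow> canon b \<Longrightarrow> state a = state b \<Longrightarrow> a = b"
  unfolding canon_def by (metis nat_neq_iff)

lemma state_0: "state 0 = []"
  by (simp add: state_def)

lemma letter_in: "x < p * m \<Longrightarrow> letter x \<in> L"
  unfolding letter_def using act_in mod_less_p w_nth_in div_less_m by auto

lemma Named_in: "Named \<subseteq> L"
  unfolding Named_def using letter_in by auto

lemma finite_Fixed: "finite (Fixed s)"
  unfolding Fixed_def using finite_L by simp

lemma Fixed_in: "Fixed s \<subseteq> L"
  unfolding Fixed_def by auto

lemma succ_name:
  assumes "a < p * m" "x < p * m"
  shows "state (succ_name a x) = st (state a @ [letter x])" "canon (succ_name a x)" "succ_name a x < p * m"
proof -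
  obtain b where b: "b < p * m" "state b = st (state a @ [letter x])"
    using st_States[of "state a @ [letter x]"] States_state by auto
  show 1: "state (succ_name a x) = st (state a @ [letter x])" unfolding succ_name_def by (rule LeastI) (rule b(2))
  show "canon (succ_name a x)"
    unfolding canon_def 1 unfolding succ_name_def using not_less_Least by blast
  have "succ_name a x \<le> b" unfolding succ_name_def by (rule Least_le) (rule b(2))
  then show "succ_name a x < p * m" using b(1) by simp
qed

text \<open>
  In the state \<open>state a\<close> the orbit of the expected letter is that of \<open>w ! (a div p)\<close>. A letter of a smaller
  orbit is smaller than the expected one under every translation.
\<close>

lemma rej_small:
  assumes "a < p * m" "x \<in> L" "x div p < w ! (a div p) div p"
  shows "rej (state a) x"
proof -
  let ?j = "a div p"
  obtain k where k: "k < p" "\<And>u. set u \<subseteq> L \<Longrightarrow> al k (al (a mod p) u) = u"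
    using inverse_al[OF mod_less_p] by metis
  have "al k (state a) = take ?j w" unfolding state_def by (rule k(2)) (rule set_take_w)
  moreover have "act k x < w ! ?j"
    using class_act[OF k(1) assms(2)] assms(3) by (metis div_le_mono not_le)
  ultimately show ?thesis
    unfolding rej_def using k(1) div_less_m[OF assms(1)] length_state[OF assms(1)]
    by (intro exI[of _ ?j] exI[of _ k] conjI) auto
qed

text \<open>
  If a translate of a suffix of \<open>take j w\<close> is the prefix \<open>take j' w\<close>, then its continuation by \<open>w ! j\<close> cannot
  fall below \<open>w\<close>, because the corresponding rotation of \<open>w\<close> does not.
\<close>

lemma border_next_le:
  assumes "j < m" "j' \<le> j" "k < p" "al k (drop (j - j') (take j w)) = take j' w"
  shows "w ! j' \<le> act k (w ! j)"
proof (cases "j' = j")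
  case True
  have "\<not> lex_less (al k (rotate 0 w)) w" by (rule least[OF m_pos assms(3)])
  moreover have "take j (al k w) = take j w" using assms(4) True by (simp add: take_al)
  ultimately show ?thesis
    unfolding lex_less_def using True assms(1) length_w by (auto simp: al_def not_less)
next
  case False
  let ?r = "j - j'"
  have r: "?r < m" using assms(1) by simp
  have nth: "rotate ?r w ! i = w ! (?r + i)" if "i \<le> j'" for i
    using that assms(1,2) length_w by (simp add: nth_rotate)
  have "take j' (al k (rotate ?r w)) = take j' w"
  proof (rule nth_equalityI)
    show "length (take j' (al k (rotate ?r w))) = length (take j' w)" by simp
    fix i assume "i < length (take j' (al k (rotate ?r w)))"
    then have i: "i < j'" by simp
    have "take j' (al k (rotate ?r w)) ! i = act k (w ! (?r + i))"
      using i nth assms(1,2) length_w by (simp add: al_def)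
    also have "\<dots> = al k (drop ?r (take j w)) ! i"
      using i assms(1,2) length_w by (simp add: al_def)
    finally show "take j' (al k (rotate ?r w)) ! i = take j' w ! i" using assms(4) by simp
  qed
  moreover have "al k (rotate ?r w) ! j' = act k (w ! j)"
    using nth[of j'] assms(1,2) length_w by (simp add: al_def)
  ultimately show ?thesis
    using least[OF r assms(3)] assms(1,2) length_w unfolding lex_less_def
    by (metis le_less_trans length_al length_rotate not_less)
qed

lemma named_if_class:
  assumes "x \<in> L" "j < m" "x div p = w ! j div p"
  shows "x \<in> Named"
proof -
  obtain h where h: "h < p" "act h (w ! j) = x"
    using class_orbit[OF w_nth_in[OF assms(2)] assms(1)] assms(3) by auto
  then have "x = letter (j * p + h)" by (simp add: letter_def)
  then show ?thesis unfolding Named_def using pair_less[OF h(1) assms(2)] by auto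
qed

text \<open>
  Shorter matches than the current state expect letters of orbits no larger, by \<open>border_next_le\<close>. So
  an unnamed letter whose orbit is large enough for the longest match is strictly larger in orbit
  than every expected letter.
\<close>

lemma unnamed_not_rej:
  assumes "a < p * m" "x \<in> L" "x \<notin> Named" "w ! (a div p) div p \<le> x div p"
  shows "\<not> rej (state a) x"
proof
  let ?j = "a div p" and ?h = "a mod p"
  assume "rej (state a) x"
  then obtain j' k where jk: "j' < m" "k < p" "j' \<le> ?j" "al k (drop (?j - j') (state a)) = take j' w" "act k x < w ! j'"
    unfolding rej_def using length_state[OF assms(1)] by auto
  have jm: "?j < m" by (rule div_less_m[OF assms(1)])
  have sub: "set (drop (?j - j') (take ?j w)) \<subseteq> L" using set_take_w set_drop_subset by fast
  have "al (ad k ?h) (drop (?j - j') (take ?j w)) = take j' w"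
    using jk(4) al_ad[OF jk(2) mod_less_p sub] by (simp add: state_def drop_al)
  then have "w ! j' \<le> act (ad k ?h) (w ! ?j)"
    by (rule border_next_le[OF jm jk(3) ad_less[OF jk(2) mod_less_p]])
  then have "w ! j' div p \<le> w ! ?j div p"
    using class_act[OF ad_less[OF jk(2) mod_less_p] w_nth_in[OF jm]] div_le_mono by metis
  moreover have "x div p \<le> w ! j' div p"
    using jk(5) class_act[OF jk(2) assms(2)] by (metis div_le_mono less_imp_le)
  ultimately have "x div p = w ! j' div p" using assms(4) by simp
  then show False using named_if_class[OF assms(2) jk(1)] assms(3) by simp
qed

lemma States_last_named:
  assumes "u @ [x] \<in> States"
  shows "x \<in> Named"
proof -
  obtain h j where hj: "h < p" "j < m" "u @ [x] = al h (take j w)" using assms unfolding States_def by auto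
  have "length (u @ [x]) = length (al h (take j w))" by (rule arg_cong[OF hj(3)])
  then have j: "j = Suc (length u)" using length_w hj(2) by simp
  then have "x = act h (w ! length u)"
    using arg_cong[OF hj(3), of "\<lambda>v. v ! length u"] hj(2) length_w by (simp add: al_def)
  then have "x = letter (length u * p + h)" using hj(1) by (simp add: letter_def)
  moreover have "length u * p + h < p * m" by (rule pair_less) (use hj j in auto)
  ultimately show ?thesis unfolding Named_def by auto
qed

lemma st_unnamed: "x \<notin> Named \<Longrightarrow> st (u @ [x]) = []"
proof (rule ccontr)
  assume x: "x \<notin> Named" "st (u @ [x]) \<noteq> []"
  obtain v where "u @ [x] = v @ st (u @ [x])" using st_suffix[of "u @ [x]"] by metis
  then have "st (u @ [x]) = butlast (st (u @ [x])) @ [x]"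
    using x(2) by (metis append_butlast_last_id last_appendR last_snoc)
  then show False using States_last_named st_States x(1) by metis
qed

text \<open>
  The letters outside the orbits of \<open>w\<close> are counted without being enumerated: they reset the automaton
  unless their orbit is below the expected one, and what remains after removing those and
  the named ones is their number.
\<close>

lemma step_count_names:
  assumes "a < p * m"
  shows "step_count (Fixed s) (state a) b =
    (if b = [] then card (Fixed s) - card {x\<in>Fixed s. x div p < w ! (a div p) div p}
        - card {x\<in>Named. act s x = x \<and> w ! (a div p) div p \<le> x div p} else 0)
    + card {x\<in>Named. act s x = x \<and> \<not> rej (state a) x \<and> st (state a @ [x]) = b}"
proof -
  let ?c = "w ! (a div p) div p"
  let ?S = "{x\<in>Fixed s. x div p < ?c}"
  let ?N = "{x\<in>Named. act s x = x \<and> ?c \<le> x div p}"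
  let ?U = "{x\<in>Fixed s. ?c \<le> x div p \<and> x \<notin> Named}"
  have fin: "finite ?S" "finite ?N" "finite ?U" using finite_Fixed finite_subset[OF Named_in finite_L] by auto
  have N: "?N \<subseteq> Fixed s" using Named_in by (auto simp: Fixed_def)
  have "Fixed s = ?S \<union> ?N \<union> ?U" using N by (auto simp: Fixed_def)
  then have "card (Fixed s) = card (?S \<union> ?N \<union> ?U)" by simp
  also have "\<dots> = card ?S + card ?N + card ?U"
  proof -
    have "?S \<inter> ?N = {}" "(?S \<union> ?N) \<inter> ?U = {}" by auto
    then show ?thesis using fin card_Un_disjoint[of ?S ?N] card_Un_disjoint[of "?S \<union> ?N" ?U] by simp
  qed
  finally have U: "card ?U = card (Fixed s) - card ?S - card ?N" by simp
  let ?V = "{x\<in>Named. act s x = x \<and> \<not> rej (state a) x \<and> st (state a @ [x]) = b}"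
  let ?A = "{x\<in>Fixed s. \<not> rej (state a) x \<and> st (state a @ [x]) = b}"
  have f1: "?c \<le> x div p" if "x \<in> Fixed s" "\<not> rej (state a) x" for x
    using rej_small[OF assms, of x] that by (auto simp: Fixed_def not_less[symmetric])
  have f2: "\<not> rej (state a) x" if "x \<in> Fixed s" "x \<notin> Named" "?c \<le> x div p" for x
    using unnamed_not_rej[OF assms, of x] that by (auto simp: Fixed_def)
  have f3: "x \<in> Fixed s" if "x \<in> Named" "act s x = x" for x
    using Named_in that by (auto simp: Fixed_def)
  have f4: "act s x = x" if "x \<in> Fixed s" for x
    using that by (simp add: Fixed_def)
  have "card ?A = (if b = [] then card ?U else 0) + card ?V"
  proof (cases "b = []")
    case True
    have "?A = ?U \<union> ?V" unfolding True using f1 f2 f3 f4 st_unnamed by blast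
    moreover have "?U \<inter> ?V = {}" by blast
    moreover have "finite ?V" using finite_subset[OF Named_in finite_L] by simp
    ultimately show ?thesis using True fin(3) card_Un_disjoint[of ?U ?V] by simp
  next
    case False
    have "?A = ?V"
    proof (rule Collect_cong)
      fix x
      show "(x \<in> Fixed s \<and> \<not> rej (state a) x \<and> st (state a @ [x]) = b) =
        (x \<in> Named \<and> act s x = x \<and> \<not> rej (state a) x \<and> st (state a @ [x]) = b)"
        using f3[of x] f4[of x] st_unnamed[of x "state a"] False by metis
    qed
    then show ?thesis using False by simp
  qed
  then show ?thesis unfolding step_count_def using U by simp
qed

lemma card_Named: "card {x\<in>Named. P x} = (\<Sum>x<p * m. of_bool (newname x) * of_bool (P (letter x)))"
  unfolding Named_def card_image_filter newname_def ..

text \<open>The transition counts in terms of names, masked so that only first names count as targets.\<close>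

lemma step_count_table:
  assumes "a < p * m" "a' < p * m"
  shows "of_bool (canon a') * step_count (Fixed s) (state a) (state a') =
    of_bool (a' = 0) * (card (Fixed s) - card {x\<in>Fixed s. x div p < w ! (a div p) div p}
        - (\<Sum>x<p * m. of_bool (newname x \<and> act s (letter x) = letter x \<and> w ! (a div p) div p \<le> letter x div p)))
    + (\<Sum>x<p * m. of_bool (newname x \<and> act s (letter x) = letter x \<and> \<not> rej (state a) (letter x) \<and> succ_name a x = a'))"
proof -
  have s: "st (state a @ [letter x]) = state a' \<longleftrightarrow> succ_name a x = a'" if "canon a'" "x < p * m" for x
    using succ_name[OF assms(1) that(2)] canon_eq that(1) by metis
  have 0: "a' = 0 \<longleftrightarrow> state a' = []" if "canon a'"
    using that state_0 canon_eq[of a' 0] canon_def by auto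
  have c0: "canon 0" by (simp add: canon_def)
  show ?thesis
  proof (cases "canon a'")
    case True
    have "(\<Sum>x<p * m. of_bool (newname x) * of_bool (act s (letter x) = letter x \<and> \<not> rej (state a) (letter x) \<and> st (state a @ [letter x]) = state a'))
      = (\<Sum>x<p * m. of_bool (newname x \<and> act s (letter x) = letter x \<and> \<not> rej (state a) (letter x) \<and> succ_name a x = a') :: nat)"
      using s[OF True] by (intro sum.cong) auto
    then show ?thesis unfolding step_count_names[OF assms(1)] card_Named using True 0[OF True]
      by (simp only: of_bool_conj[symmetric] of_bool_eq mult_1 if_True split: if_splits) auto
  next
    case False
    then have "a' \<noteq> 0" using c0 by metis
    moreover have "succ_name a x \<noteq> a'" if "x < p * m" for x using succ_name(2)[OF assms(1) that] False by auto
    ultimately show ?thesis using False by simp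
  qed
qed

text \<open>
  The next three characterisations mention only values \<open>act h (w ! i)\<close>, which are tabulated. The index
  ranges over all of \<open>{..<m}\<close> with a guard because the loops of the program have bounds that
  are stored in variables.
\<close>

lemma state_eq_iff:
  assumes "a < p * m" "a' < p * m"
  shows "state a' = state a \<longleftrightarrow> a' div p = a div p \<and> (\<forall>i<m. i < a div p \<longrightarrow> act (a' mod p) (w ! i) = act (a mod p) (w ! i))"
proof (cases "a' div p = a div p")
  case True
  then have "state a' = state a \<longleftrightarrow> (\<forall>i<a div p. state a' ! i = state a ! i)"
    using length_state[OF assms(1)] length_state[OF assms(2)] by (simp add: list_eq_iff_nth_eq)
  also have "\<dots> \<longleftrightarrow> (\<forall>i<a div p. act (a' mod p) (w ! i) = act (a mod p) (w ! i))"
    using True div_less_m[OF assms(1)] length_w by (simp add: state_def al_def)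
  finally show ?thesis using True div_less_m[OF assms(1)] by (meson less_trans)
next
  case False
  then show ?thesis using length_state[OF assms(1)] length_state[OF assms(2)] by metis
qed

lemma al_state_eq_iff:
  assumes "a < p * m" "a' < p * m" "t < p"
  shows "al t (state a') = state a \<longleftrightarrow> a' div p = a div p \<and>
    (\<forall>i<m. i < a div p \<longrightarrow> act (ad t (a' mod p)) (w ! i) = act (a mod p) (w ! i))"
proof (cases "a' div p = a div p")
  case True
  then have "al t (state a') = state a \<longleftrightarrow> (\<forall>i<a div p. al t (state a') ! i = state a ! i)"
    using length_state[OF assms(1)] length_state[OF assms(2)] by (simp add: list_eq_iff_nth_eq)
  also have "\<dots> \<longleftrightarrow> (\<forall>i<a div p. act (ad t (a' mod p)) (w ! i) = act (a mod p) (w ! i))"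
    using True div_less_m[OF assms(1)] length_w act_ad[OF assms(3) mod_less_p w_nth_in]
    by (simp add: state_def al_def)
  finally show ?thesis using True div_less_m[OF assms(1)] by (meson less_trans)
next
  case False
  then show ?thesis using length_state[OF assms(1)] length_state[OF assms(2)] by (metis length_al)
qed

lemma rej_state_iff:
  assumes "a < p * m" "x < p * m"
  shows "rej (state a) (letter x) \<longleftrightarrow> (\<exists>y<p * m. y div p \<le> a div p \<and>
    (\<forall>i<m. i < y div p \<longrightarrow> act (ad (y mod p) (a mod p)) (w ! (a div p - y div p + i)) = w ! i) \<and>
    act (ad (y mod p) (x mod p)) (w ! (x div p)) < w ! (y div p))" (is "?l \<longleftrightarrow> (\<exists>y<p * m. ?P (y div p) (y mod p))")
proof -
  have "?l \<longleftrightarrow> (\<exists>j<m. \<exists>k<p. ?P j k)"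
  proof -
    have "(j \<le> length (state a) \<and> al k (drop (length (state a) - j) (state a)) = take j w \<and> act k (letter x) < w ! j) = ?P j k"
      if jk: "j < m" "k < p" for j k
    proof -
      have 1: "act k (letter x) = act (ad k (x mod p)) (w ! (x div p))"
        unfolding letter_def by (rule act_ad[symmetric, OF jk(2) mod_less_p w_nth_in[OF div_less_m[OF assms(2)]]])
      have 2: "al k (drop (a div p - j) (state a)) = take j w \<longleftrightarrow>
         (\<forall>i<m. i < j \<longrightarrow> act (ad k (a mod p)) (w ! (a div p - j + i)) = w ! i)" if "j \<le> a div p"
      proof -
        have "act k (act (a mod p) (w ! (a div p - j + i))) = act (ad k (a mod p)) (w ! (a div p - j + i))" if "i < j" for i
          using that \<open>j \<le> a div p\<close> div_less_m[OF assms(1)] by (intro act_ad[symmetric, OF jk(2) mod_less_p w_nth_in]) simp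
        then show ?thesis using that jk div_less_m[OF assms(1)] length_w
          by (auto simp: list_eq_iff_nth_eq state_def al_def)
      qed
      show ?thesis using 1 2 length_state[OF assms(1)] by auto
    qed
    then show ?thesis unfolding rej_def by blast
  qed
  also have "\<dots> \<longleftrightarrow> (\<exists>y<p * m. ?P (y div p) (y mod p))"
  proof
    assume "\<exists>j<m. \<exists>k<p. ?P j k"
    then obtain j k where jk: "j < m" "k < p" "?P j k" by blast
    then show "\<exists>y<p * m. ?P (y div p) (y mod p)"
      using pair_less[OF jk(2,1)] by (intro exI[of _ "j * p + k"]) (simp del: Nat.diff_add_assoc2 Nat.add_diff_assoc2)
  next
    assume "\<exists>y<p * m. ?P (y div p) (y mod p)"
    then obtain y where y: "y < p * m" "?P (y div p) (y mod p)" by blast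
    show "\<exists>j<m. \<exists>k<p. ?P j k"
      by (rule exI[of _ "y div p"], rule conjI[OF div_less_m[OF y(1)]], rule exI[of _ "y mod p"],
          rule conjI[OF mod_less_p], rule y(2))
  qed
  finally show ?thesis .
qed

section \<open>Strings fixed by a translation\<close>

definition fixed_words :: "nat \<Rightarrow> nat \<Rightarrow> nat list set" where
  "fixed_words h r = {v. set v \<subseteq> L \<and> length v = m \<and> al h (rotate r v) = v}"

definition below :: "nat list \<Rightarrow> bool" where
  "below v \<longleftrightarrow> (\<exists>i<m. \<exists>k<p. lex_less (al k (rotate i v)) w)"

text \<open>An occurrence of something below \<open>w\<close> in the periodic continuation of \<open>v\<close> can be shifted to begin within the first period.\<close>

lemma good_iff_not_below:
  assumes "length v = m" "\<And>i. E i = v ! (i mod m)"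
  shows "good E \<longleftrightarrow> \<not> below v"
proof -
  have nth: "al k (rotate i v) ! j = act k (E (i + j))" if "j < m" for i j k
    using that assms by (simp add: al_def nth_rotate add.commute)
  have "lex_less (al k (rotate i v)) w \<longleftrightarrow> (\<exists>j<m. (\<forall>j'<j. act k (E (i + j')) = w ! j') \<and> act k (E (i + j)) < w ! j)" for i k
  proof -
    have "(j < length (al k (rotate i v)) \<and> take j (al k (rotate i v)) = take j w \<and> al k (rotate i v) ! j < w ! j) =
      ((\<forall>j'<j. act k (E (i + j')) = w ! j') \<and> act k (E (i + j)) < w ! j)" if j: "j < m" for j
    proof -
    have "take j (al k (rotate i v)) = take j w \<longleftrightarrow> (\<forall>j'<j. act k (E (i + j')) = w ! j')"
      using j assms(1) length_w nth by (auto simp: list_eq_iff_nth_eq)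
    then show ?thesis
      using j assms(1) nth by simp
    qed
    then show ?thesis unfolding lex_less_def length_w by blast
  qed
  then have *: "below v \<longleftrightarrow> (\<exists>i<m. \<exists>k<p. \<exists>j<m. (\<forall>j'<j. act k (E (i + j')) = w ! j') \<and> act k (E (i + j)) < w ! j)"
    unfolding below_def by simp
  have E: "E (i mod m + j) = E (i + j)" for i j unfolding assms(2) by (simp add: mod_add_left_eq)
  show ?thesis
  proof
    assume "good E" then show "\<not> below v" unfolding * good_def by blast
  next
    assume nb: "\<not> below v"
    show "good E" unfolding good_def
    proof (intro allI impI notI)
      fix i k j assume "k < p" "j < m" "\<forall>j'<j. act k (E (i + j')) = w ! j'" "act k (E (i + j)) < w ! j"
      then have "i mod m < m \<and> (\<exists>k<p. \<exists>j<m. (\<forall>j'<j. act k (E (i mod m + j')) = w ! j') \<and> act k (E (i mod m + j)) < w ! j)"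
        unfolding E using m_pos by auto
      then show False using nb unfolding * by blast
    qed
  qed
qed

end

section \<open>Counting the fixed strings that are not below\<close>

lemma sum_filter_of_bool:
  fixes f :: "'b \<Rightarrow> nat"
  assumes "finite A"
  shows "(\<Sum>b\<in>{b\<in>A. P b}. f b) = (\<Sum>b\<in>A. of_bool (P b) * f b)"
  using assms by (subst sum.inter_filter) (auto simp: of_bool_def if_distrib[of "\<lambda>x. x * _"] cong: if_cong)

lemma funpow_cong_mod:
  assumes "(f ^^ n) x = x" "a mod n = b mod n"
  shows "(f ^^ a) x = (f ^^ b) x"
  by (metis assms funpow_mod_eq)

text \<open>
  For the translation \<open>(h, r)\<close>, the number \<open>l\<close> plays the role of the gcd of \<open>r\<close> and \<open>m\<close>, and \<open>u\<close> that of its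
  coefficient of \<open>r\<close> in Bezout's identity. A fixed string is fixed by \<open>u\<close>-fold application, which moves by
  \<open>l\<close> places and acts as \<open>t\<close>, and by \<open>(m div l)\<close>-fold application, which moves by a multiple of \<open>m\<close> and
  acts as \<open>s\<close>; so its letters are fixed by \<open>s\<close>.
\<close>

locale twisted_count = least_translate +
  fixes h r l u s t :: nat
  assumes h: "h < p" and l: "0 < l" "l dvd m" "l dvd r" and u: "(u * r) mod m = l mod m"
    and s: "s < p" "\<And>x. x \<in> L \<Longrightarrow> act s x = (act h ^^ (m div l)) x"
    and t: "t < p" "\<And>x. x \<in> L \<Longrightarrow> act t x = (act h ^^ u) x"
begin

lemma pow_in: "k < p \<Longrightarrow> x \<in> L \<Longrightarrow> (act k ^^ c) x \<in> L"
  by (induction c) (auto intro: act_in)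

lemma Fixed_pow: "x \<in> Fixed s \<Longrightarrow> (act h ^^ (m div l)) x = x"
  using s unfolding Fixed_def by auto

lemma unit: "(u * (r div l)) mod (m div l) = 1 mod (m div l)"
proof -
  obtain m' where m': "m = l * m'" using l(2) by (rule dvdE)
  obtain r' where r': "r = l * r'" using l(3) by (rule dvdE)
  note mr = m' r'
  then have "(l * (u * r')) mod (l * m') = (l * 1) mod (l * m')" using u by (simp add: mult.left_commute)
  then have "l * ((u * r') mod m') = l * (1 mod m')" by (metis mult_mod_right)
  then show ?thesis using mr l(1) by simp
qed

lemma pow_act_comm: "a < p \<Longrightarrow> b < p \<Longrightarrow> x \<in> L \<Longrightarrow> act a (act b x) = act b (act a x)"
  by (metis act_ad ad_comm)

lemma act_Fixed: "a < p \<Longrightarrow> x \<in> Fixed s \<Longrightarrow> act a x \<in> Fixed s"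
  unfolding Fixed_def using act_in pow_act_comm s(1) by auto

lemma pow_Fixed: "a < p \<Longrightarrow> x \<in> Fixed s \<Longrightarrow> (act a ^^ c) x \<in> Fixed s"
  by (induction c) (auto intro: act_Fixed)

lemma pow_t: "x \<in> L \<Longrightarrow> (act t ^^ c) x = (act h ^^ (u * c)) x"
proof (induction c)
  case (Suc c)
  have "act t ((act h ^^ (u * c)) x) = (act h ^^ u) ((act h ^^ (u * c)) x)"
    by (rule t(2)) (rule pow_in[OF h Suc.prems])
  then show ?case using Suc by (simp add: funpow_add)
qed simp

lemma pow_t_r: "x \<in> Fixed s \<Longrightarrow> (act t ^^ (r div l)) x = act h x"
proof -
  assume x: "x \<in> Fixed s"
  have "(act h ^^ (u * (r div l))) x = (act h ^^ 1) x"
    by (rule funpow_cong_mod[OF Fixed_pow[OF x]]) (rule unit)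
  then show ?thesis using pow_t[OF subsetD[OF Fixed_in x]] by simp
qed

lemma pow_t_m: "x \<in> Fixed s \<Longrightarrow> (act t ^^ (m div l)) x = x"
proof -
  assume x: "x \<in> Fixed s"
  have "(act h ^^ (u * (m div l))) x = (act h ^^ 0) x"
    by (rule funpow_cong_mod[OF Fixed_pow[OF x]]) simp
  then show ?thesis using pow_t[OF subsetD[OF Fixed_in x]] by simp
qed

definition t' :: nat where
  "t' = (SOME t'. t' < p \<and> (\<forall>x\<in>L. act t' (act t x) = x) \<and> (\<forall>x\<in>L. act t (act t' x) = x))"

lemma t': "t' < p" "\<And>x. x \<in> L \<Longrightarrow> act t' (act t x) = x" "\<And>x. x \<in> L \<Longrightarrow> act t (act t' x) = x"
proof -
  have "\<exists>t'. t' < p \<and> (\<forall>x\<in>L. act t' (act t x) = x) \<and> (\<forall>x\<in>L. act t (act t' x) = x)"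
    using inverse_act[OF t(1)] by metis
  from someI_ex[OF this] show "t' < p" "\<And>x. x \<in> L \<Longrightarrow> act t' (act t x) = x" "\<And>x. x \<in> L \<Longrightarrow> act t (act t' x) = x"
    unfolding t'_def[symmetric] by auto
qed

lemma pow_t't: "x \<in> L \<Longrightarrow> (act t ^^ c) ((act t' ^^ c) x) = x"
proof (induction c)
  case (Suc c)
  then show ?case using t'(3) pow_in[OF t'(1)] by (subst funpow_Suc_right) simp
qed simp

text \<open>The sequence that begins with \<open>xs\<close> and is multiplied by the inverse of \<open>t\<close> every \<open>l\<close> places.\<close>

definition ext :: "nat list \<Rightarrow> nat \<Rightarrow> nat" where
  "ext xs i = (act t' ^^ (i div l)) (xs ! (i mod l))"

definition base_words :: "nat list set" where
  "base_words = {xs. set xs \<subseteq> Fixed s \<and> length xs = l}"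

lemma ext_Fixed: "xs \<in> base_words \<Longrightarrow> ext xs i \<in> Fixed s"
  unfolding ext_def base_words_def using l(1) by (intro pow_Fixed[OF t'(1)]) auto

lemma ext_shift: "ext xs (i + c * l) = (act t' ^^ c) (ext xs i)"
  unfolding ext_def using l(1) by (simp add: funpow_add add.commute)

lemma ext_small: "i < l \<Longrightarrow> ext xs i = xs ! i"
  by (simp add: ext_def)

text \<open>After \<open>m div l\<close> twists the total twist is a power of \<open>s\<close>, which acts trivially on the letters in use.\<close>

lemma ext_period: "xs \<in> base_words \<Longrightarrow> ext xs (i + m) = ext xs i"
proof -
  assume xs: "xs \<in> base_words"
  let ?c = "m div l"
  have "ext xs (i + m) = (act t' ^^ ?c) (ext xs i)" using ext_shift[of xs i ?c] l(2) by simp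
  moreover have "(act t ^^ ?c) ((act t' ^^ ?c) (ext xs i)) = ext xs i"
    using pow_t't ext_Fixed[OF xs] Fixed_in by blast
  moreover have "(act t' ^^ ?c) (ext xs i) \<in> Fixed s" by (rule pow_Fixed[OF t'(1) ext_Fixed[OF xs]])
  ultimately show ?thesis using pow_t_m by metis
qed

lemma ext_mod: "xs \<in> base_words \<Longrightarrow> ext xs (i mod m) = ext xs i"
proof -
  assume xs: "xs \<in> base_words"
  have "ext xs (i + c * m) = ext xs i" for i c
    by (induction c) (auto simp: ext_period[OF xs] add.assoc[symmetric] add.commute[of m])
  then show ?thesis by (metis mod_mult_div_eq mult.commute)
qed

lemma ext_word:
  assumes "xs \<in> base_words"
  shows "map (ext xs) [0..<m] \<in> fixed_words h r"
proof -
  let ?v = "map (ext xs) [0..<m]"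
  have "al h (rotate r ?v) ! i = ?v ! i" if i: "i < m" for i
  proof -
    let ?c = "r div l" and ?y = "ext xs i"
    have yF: "?y \<in> Fixed s" by (rule ext_Fixed[OF assms])
    have "al h (rotate r ?v) ! i = act h (ext xs (i + r))"
      using i m_pos ext_mod[OF assms] by (simp add: al_def nth_rotate add.commute)
    also have "ext xs (i + r) = (act t' ^^ ?c) ?y" using ext_shift[of xs i ?c] l(3) by simp
    also have "act h ((act t' ^^ ?c) ?y) = (act t ^^ ?c) ((act t' ^^ ?c) ?y)"
      by (rule pow_t_r[symmetric]) (rule pow_Fixed[OF t'(1) yF])
    also have "\<dots> = ?y" using pow_t't yF Fixed_in by blast
    finally show ?thesis using i by simp
  qed
  then have "al h (rotate r ?v) = ?v" by (intro nth_equalityI) auto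
  moreover have "set ?v \<subseteq> L" using ext_Fixed[OF assms] Fixed_in by auto
  ultimately show ?thesis unfolding fixed_words_def by auto
qed

lemma l_le: "l \<le> m"
  using l m_pos by (auto dest: dvd_imp_le)

lemma word_ext:
  assumes "v \<in> fixed_words h r"
  shows "take l v \<in> base_words" "map (ext (take l v)) [0..<m] = v"
proof -
  have v: "set v \<subseteq> L" "length v = m" "al h (rotate r v) = v" using assms unfolding fixed_words_def by auto
  define V where "V i = v ! (i mod m)" for i
  have VL: "V i \<in> L" for i using v m_pos unfolding V_def by (meson mod_less_divisor nth_mem subsetD)
  have V1: "act h (V (i + r)) = V i" for i
  proof -
    have "v ! (i mod m) = al h (rotate r v) ! (i mod m)" using v(3) by simp
    also have "\<dots> = act h (v ! ((r + i mod m) mod m))" using v(2) m_pos by (simp add: al_def nth_rotate)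
    finally show ?thesis unfolding V_def by (simp add: mod_add_right_eq add.commute)
  qed
  have Vc: "(act h ^^ c) (V (i + c * r)) = V i" for c i
  proof (induction c arbitrary: i)
    case (Suc c)
    have "(act h ^^ Suc c) (V (i + Suc c * r)) = act h ((act h ^^ c) (V ((i + r) + c * r)))"
      by (simp add: add.assoc)
    then show ?case using Suc V1 by simp
  qed simp
  have Vm: "V (i + c * m) = V i" for i c unfolding V_def by simp
  have VF: "V i \<in> Fixed s" for i
  proof -
    (* (m div l)-fold application of the translation moves by a multiple of m *)
    have "(m div l) * r = (r div l) * m" using l(2,3) by (auto elim!: dvdE)
    then have "(act h ^^ (m div l)) (V i) = V i" using Vc[of "m div l" i] Vm by simp
    then show ?thesis unfolding Fixed_def using s(2)[OF VL] VL by simp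
  qed
  have Vl: "V (i + l) = act t' (V i)" for i
  proof -
    (* u-fold application of the translation moves by l places *)
    have "V (i + u * r) = V (i + l)" unfolding V_def using u by (metis mod_add_right_eq)
    then have "act t (V (i + l)) = V i" using Vc[of u i] t(2)[OF VL] by simp
    then show ?thesis using t'(2)[OF VL] by metis
  qed
  have Vlc: "V (i + c * l) = (act t' ^^ c) (V i)" for i c
  proof (induction c)
    case (Suc c)
    have "V (i + Suc c * l) = V ((i + c * l) + l)" by (simp add: add.assoc add.commute[of l])
    then show ?case using Vl Suc by simp
  qed simp
  have small: "take l v ! i = V i" if "i < l" for i using that l_le v(2) by (simp add: V_def)
  show base: "take l v \<in> base_words"
    unfolding base_words_def using VF small l_le v(2) by (auto simp: in_set_conv_nth)
  have ext: "ext (take l v) i = V i" for i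
    unfolding ext_def using small[of "i mod l"] Vlc[of "i mod l" "i div l"] l(1) by simp
  show "map (ext (take l v)) [0..<m] = v"
    by (rule nth_equalityI) (auto simp: ext V_def v(2))
qed

lemma take_ext:
  assumes "xs \<in> base_words"
  shows "take l (map (ext xs) [0..<m]) = xs"
proof -
  have "length xs = l" using assms by (simp add: base_words_def)
  then show ?thesis using l_le by (intro nth_equalityI) (simp_all add: ext_small)
qed

text \<open>The fixed strings are freely parametrised by \<open>l\<close> letters fixed by \<open>s\<close>.\<close>

lemma bij_ext: "bij_betw (\<lambda>xs. map (ext xs) [0..<m]) base_words (fixed_words h r)"
  by (rule bij_betw_byWitness[where f' = "take l"]) (auto simp: take_ext word_ext intro: ext_word)

lemma card_base_words: "card base_words = card (Fixed s) ^ l"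
  unfolding base_words_def using card_lists_length_eq[OF finite_Fixed] .

lemma card_fixed_words: "card (fixed_words h r) = card (Fixed s) ^ l"
  using bij_betw_same_card[OF bij_ext] card_base_words by simp

lemma good_ext:
  assumes "xs \<in> base_words"
  shows "good (ext xs) \<longleftrightarrow> (\<exists>a\<in>States. admissible a xs \<and> al t (st (a @ xs)) = a)"
    and "\<lbrakk>a \<in> States; admissible a xs; al t (st (a @ xs)) = a; b \<in> States; admissible b xs; al t (st (b @ xs)) = b\<rbrakk> \<Longrightarrow> a = b"
proof -
  interpret twisted L p ad act w m "ext xs" l t t'
  proof
    show "ext xs i \<in> L" for i using ext_Fixed[OF assms] Fixed_in by blast
    show "ext xs (i + l) = act t' (ext xs i)" for i using ext_shift[of xs i 1] by simp
  qed (use l t t' in auto)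
  have xs: "map (ext xs) [0..<l] = xs"
  proof -
    have "length xs = l" using assms by (simp add: base_words_def)
    then show ?thesis by (intro nth_equalityI) (simp_all add: ext_small)
  qed
  show "good (ext xs) \<longleftrightarrow> (\<exists>a\<in>States. admissible a xs \<and> al t (st (a @ xs)) = a)"
    using good_closes closes_good unfolding xs by blast
  show "a = b" if "a \<in> States" "admissible a xs" "al t (st (a @ xs)) = a" "b \<in> States" "admissible b xs" "al t (st (b @ xs)) = b"
    using closes_unique[of a b] that unfolding xs by simp
qed

text \<open>
  By uniqueness of the closing state, the strings are partitioned by that state, and those that belong
  to \<open>a\<close> are the walks from \<open>a\<close> to a state that \<open>t\<close> maps back to \<open>a\<close>.
\<close>

theorem card_not_below:
  "card {v\<in>fixed_words h r. \<not> below v} =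
    (\<Sum>a\<in>States. \<Sum>b\<in>States. of_bool (al t b = a) * walk_count (Fixed s) l a b)"
proof -
  let ?G = "{xs\<in>base_words. good (ext xs)}"
  let ?C = "\<lambda>a. {xs\<in>base_words. admissible a xs \<and> al t (st (a @ xs)) = a}"
  have fin: "finite base_words"
    unfolding base_words_def using finite_lists_length_eq[OF finite_Fixed] .
  have below: "good (ext xs) \<longleftrightarrow> \<not> below (map (ext xs) [0..<m])" if "xs \<in> base_words" for xs
    by (rule good_iff_not_below) (use ext_mod[OF that] m_pos in auto)
  have "bij_betw (\<lambda>xs. map (ext xs) [0..<m]) ?G {v\<in>fixed_words h r. \<not> below v}"
  proof (rule bij_betw_imageI)
    show "inj_on (\<lambda>xs. map (ext xs) [0..<m]) ?G"
      using bij_betw_imp_inj_on[OF bij_ext] by (rule inj_on_subset) blast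
    show "(\<lambda>xs. map (ext xs) [0..<m]) ` ?G = {v\<in>fixed_words h r. \<not> below v}"
      unfolding bij_betw_imp_surj_on[OF bij_ext, symmetric] using below by blast
  qed
  then have "card {v\<in>fixed_words h r. \<not> below v} = card ?G" by (rule bij_betw_same_card[symmetric])
  also have "?G = {xs\<in>base_words. \<exists>a\<in>States. admissible a xs \<and> al t (st (a @ xs)) = a}"
    by (rule Collect_cong, rule conj_cong[OF refl], erule good_ext(1))
  also have "\<dots> = (\<Union>a\<in>States. ?C a)" by (simp only: UN_simps Collect_bex_eq[symmetric] set_eq_iff UN_iff mem_Collect_eq) blast
  also have "card \<dots> = (\<Sum>a\<in>States. card (?C a))"
  proof (rule card_UN_disjoint)
    show "\<forall>a\<in>States. \<forall>b\<in>States. a \<noteq> b \<longrightarrow> ?C a \<inter> ?C b = {}"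
    proof (intro ballI impI equals0I)
      fix a b xs assume ab: "a \<in> States" "b \<in> States" "a \<noteq> b" and X: "xs \<in> ?C a \<inter> ?C b"
      note C = X[THEN IntD1, unfolded mem_Collect_eq] X[THEN IntD2, unfolded mem_Collect_eq]
      have "a = b"
        by (rule good_ext(2)[of xs]) (rule C[THEN conjunct1] C[THEN conjunct2, THEN conjunct1]
            C[THEN conjunct2, THEN conjunct2] ab)+
      then show False using ab(3) by simp
    qed
    show "\<forall>a\<in>States. finite (?C a)" using fin by simp
  qed (rule finite_States)
  also have "\<dots> = (\<Sum>a\<in>States. \<Sum>b\<in>States. of_bool (al t b = a) * walk_count (Fixed s) l a b)"
  proof (rule sum.cong[OF refl])
    fix a assume a: "a \<in> States"
    have "xs \<in> ?C a \<longleftrightarrow> (\<exists>b. (b \<in> States \<and> al t b = a) \<and> xs \<in> walk_set (Fixed s) l a b)" for xs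
    proof
      assume "xs \<in> ?C a"
      then have "st (a @ xs) \<in> States \<and> al t (st (a @ xs)) = a" "xs \<in> walk_set (Fixed s) l a (st (a @ xs))"
        using st_States unfolding walk_set_def base_words_def mem_Collect_eq by (iprover, iprover)
      then show "\<exists>b. (b \<in> States \<and> al t b = a) \<and> xs \<in> walk_set (Fixed s) l a b" by iprover
    next
      assume "\<exists>b. (b \<in> States \<and> al t b = a) \<and> xs \<in> walk_set (Fixed s) l a b"
      then obtain b where b: "al t b = a" "xs \<in> walk_set (Fixed s) l a b" by iprover
      then have "st (a @ xs) = b" unfolding walk_set_def mem_Collect_eq by iprover
      then have "al t (st (a @ xs)) = a" using b(1) by (rule ssubst)
      then show "xs \<in> ?C a" using b(2) unfolding walk_set_def base_words_def mem_Collect_eq by iprover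
    qed
    then have C: "?C a = (\<Union>b\<in>{b\<in>States. al t b = a}. walk_set (Fixed s) l a b)"
      unfolding set_eq_iff UN_iff Bex_def mem_Collect_eq by iprover
    have "card (?C a) = (\<Sum>b\<in>{b\<in>States. al t b = a}. walk_count (Fixed s) l a b)"
      unfolding walk_count_def C
    proof (rule card_UN_disjoint)
      show "\<forall>b\<in>{b\<in>States. al t b = a}. finite (walk_set (Fixed s) l a b)"
        using finite_walk_set[OF finite_Fixed] by blast
      show "finite {b\<in>States. al t b = a}" using finite_States by simp
      show "\<forall>b\<in>{b\<in>States. al t b = a}. \<forall>b'\<in>{b\<in>States. al t b = a}. b \<noteq> b' \<longrightarrow>
          walk_set (Fixed s) l a b \<inter> walk_set (Fixed s) l a b' = {}"
        unfolding walk_set_def by blast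
    qed
    also have "\<dots> = (\<Sum>b\<in>States. of_bool (al t b = a) * walk_count (Fixed s) l a b)"
      by (rule sum_filter_of_bool[OF finite_States])
    finally show "card (?C a) = (\<Sum>b\<in>States. of_bool (al t b = a) * walk_count (Fixed s) l a b)" .
  qed
  finally show ?thesis .
qed

lemma finite_fixed_words: "finite (fixed_words h r)"
  by (rule finite_subset[OF _ finite_lists_length_eq[OF finite_L, of m]]) (auto simp: fixed_words_def)

corollary card_below:
  "card {v\<in>fixed_words h r. below v} = card (Fixed s) ^ l -
    (\<Sum>a<p * m. of_bool (canon a) * (\<Sum>b<p * m. of_bool (al t (state b) = state a) *
       (of_bool (canon b) * walk_count (Fixed s) l (state a) (state b))))"
proof -
  have "{v\<in>fixed_words h r. below v} = fixed_words h r - {v\<in>fixed_words h r. \<not> below v}" by auto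
  then have "card {v\<in>fixed_words h r. below v} = card (fixed_words h r) - card {v\<in>fixed_words h r. \<not> below v}"
    using finite_fixed_words by (simp add: card_Diff_subset)
  then show ?thesis
    unfolding card_not_below card_fixed_words sum_States by (simp add: mult.left_commute)
qed

end

section \<open>Positions, translations and slices\<close>

definition proper :: "nat list \<Rightarrow> bool" where
  "proper n \<longleftrightarrow> (\<forall>m\<in>set n. 1 \<le> m)"

lemma proper_snoc [simp]: "proper (n @ [m]) \<longleftrightarrow> proper n \<and> 1 \<le> m"
  by (auto simp: proper_def)

lemma proper_pos: "proper n \<Longrightarrow> 0 < prod_list n"
  by (induction n) (auto simp: proper_def)

lemma positions_Nil [simp]: "positions [] = {[]}"
  by (auto simp: positions_def)

lemma positions_snoc: "positions (n @ [m]) = (\<lambda>(p, i). p @ [i]) ` (positions n \<times> {..<m})"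
proof (intro equalityI subsetI)
  fix p assume p: "p \<in> positions (n @ [m])"
  then have len: "length p = Suc (length n)" by (simp add: positions_def)
  then obtain p' i where pi: "p = p' @ [i]" by (metis length_Suc_conv_rev)
  have bound: "\<forall>j<Suc (length n). (p' @ [i]) ! j < (n @ [m]) ! j" using p pi by (simp add: positions_def)
  have "p' ! j < n ! j" if "j < length n" for j
    using spec[OF bound, of j] that len pi by (simp add: nth_append)
  moreover have "i < m" using spec[OF bound, of "length n"] len pi by (simp add: nth_append)
  ultimately show "p \<in> (\<lambda>(p, i). p @ [i]) ` (positions n \<times> {..<m})"
    using len pi by (auto simp: positions_def image_iff)
qed (auto simp: positions_def nth_append less_Suc_eq)

lemma snoc_in_positions [simp]: "p @ [i] \<in> positions (n @ [m]) \<longleftrightarrow> p \<in> positions n \<and> i < m"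
  by (auto simp: positions_snoc)

lemma length_positions: "p \<in> positions n \<Longrightarrow> length p = length n"
  by (simp add: positions_def)

lemma prod_nth: "(\<Prod>j<length n. n ! j) = prod_list (n :: nat list)"
proof (induction n rule: rev_induct)
  case (snoc m n)
  have "(\<Prod>j<length n. (n @ [m]) ! j) = (\<Prod>j<length n. n ! j)"
    by (intro prod.cong) (auto simp: nth_append)
  then show ?case using snoc by simp
qed simp

lemma index_Nil [simp]: "index [] p = 0"
  by (simp add: index_def)

text \<open>
  The last coordinate is the most significant one, so a translation of size \<open>n @ [m]\<close> with group part \<open>h\<close> and
  rotation \<open>r\<close> has the number \<open>h + prod_list n * r\<close>.
\<close>

lemma index_snoc:
  assumes "length p = length n"
  shows "index (n @ [m]) (p @ [i]) = index n p + prod_list n * i"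
proof -
  have "(\<Prod>j<k. (n @ [m]) ! j) = (\<Prod>j<k. n ! j)" if "k \<le> length n" for k
    using that by (intro prod.cong) (auto simp: nth_append)
  then show ?thesis using assms by (simp add: index_def nth_append prod_nth mult.commute)
qed

lemma bij_index: "bij_betw (index n) (positions n) {..<prod_list n}"
proof (induction n rule: rev_induct)
  case Nil
  then show ?case by (auto simp: bij_betw_def)
next
  case (snoc m n)
  let ?N = "prod_list n"
  have lt: "index n p < ?N" if "p \<in> positions n" for p
    using bij_betw_apply[OF snoc that] by simp
  have dv: "(index n p + ?N * y) div ?N = y" if "p \<in> positions n" for p y
    using lt[OF that] by (cases "?N = 0") auto
  show ?case
  proof (rule bij_betw_byWitness[where f' = "\<lambda>k. inv_into (positions n) (index n) (k mod ?N) @ [k div ?N]"])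
    show "\<forall>a\<in>positions (n @ [m]).
      inv_into (positions n) (index n) (index (n @ [m]) a mod ?N) @ [index (n @ [m]) a div ?N] = a"
      using lt dv bij_betw_inv_into_left[OF snoc]
      by (auto simp: positions_snoc index_snoc length_positions)
    show "\<forall>k\<in>{..<prod_list (n @ [m])}.
      index (n @ [m]) (inv_into (positions n) (index n) (k mod ?N) @ [k div ?N]) = k"
    proof
      fix k assume "k \<in> {..<prod_list (n @ [m])}"
      then have "0 < ?N" by (cases "?N = 0") auto
      then have k: "k mod ?N \<in> {..<?N}" by simp
      have "inv_into (positions n) (index n) (k mod ?N) \<in> positions n"
        using bij_betw_inv_into[OF snoc] k by (rule bij_betw_apply)
      then show "index (n @ [m]) (inv_into (positions n) (index n) (k mod ?N) @ [k div ?N]) = k"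
        using bij_betw_inv_into_right[OF snoc k] by (simp add: index_snoc length_positions)
    qed
    show "index (n @ [m]) ` positions (n @ [m]) \<subseteq> {..<prod_list (n @ [m])}"
    proof
      fix k assume "k \<in> index (n @ [m]) ` positions (n @ [m])"
      then obtain p i where pi: "p \<in> positions n" "i < m" "k = index n p + ?N * i"
        by (auto simp: positions_snoc index_snoc length_positions)
      then have "k < ?N * Suc i" using lt by simp
      also have "\<dots> \<le> ?N * m" using pi(2) by (intro mult_le_mono2) simp
      finally show "k \<in> {..<prod_list (n @ [m])}" by simp
    qed
    show "(\<lambda>k. inv_into (positions n) (index n) (k mod ?N) @ [k div ?N]) ` {..<prod_list (n @ [m])}
      \<subseteq> positions (n @ [m])"
    proof
      fix p assume "p \<in> (\<lambda>k. inv_into (positions n) (index n) (k mod ?N) @ [k div ?N]) ` {..<prod_list (n @ [m])}"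
      then obtain k where k: "k < ?N * m" "p = inv_into (positions n) (index n) (k mod ?N) @ [k div ?N]" by auto
      then have "0 < ?N" by (cases "?N = 0") auto
      then have "k mod ?N \<in> {..<?N}" by simp
      then have "inv_into (positions n) (index n) (k mod ?N) \<in> positions n"
        using bij_betw_apply[OF bij_betw_inv_into[OF snoc]] by blast
      then show "p \<in> positions (n @ [m])"
        using k by (simp add: less_mult_imp_div_less mult.commute)
    qed
  qed
qed

text \<open>From here on translations are numbered by their index, which is also how the program stores them.\<close>

definition vec :: "nat list \<Rightarrow> nat \<Rightarrow> nat list" where
  "vec n k = inv_into (positions n) (index n) k"

lemma vec_in: "k < prod_list n \<Longrightarrow> vec n k \<in> positions n"
  unfolding vec_def using bij_betw_apply[OF bij_betw_inv_into[OF bij_index]] by simp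

lemma index_vec: "k < prod_list n \<Longrightarrow> index n (vec n k) = k"
  unfolding vec_def using bij_betw_inv_into_right[OF bij_index] by simp

lemma vec_index: "p \<in> positions n \<Longrightarrow> vec n (index n p) = p"
  unfolding vec_def using bij_betw_inv_into_left[OF bij_index] by simp

lemma index_less: "p \<in> positions n \<Longrightarrow> index n p < prod_list n"
  using bij_betw_apply[OF bij_index] by simp

lemma vec_snoc: "h < prod_list n \<Longrightarrow> r < m \<Longrightarrow> vec (n @ [m]) (h + prod_list n * r) = vec n h @ [r]"
  using vec_index[of "vec n h @ [r]" "n @ [m]"] by (simp add: vec_in index_snoc length_positions index_vec)

lemma positions_eq_vec: "positions n = vec n ` {..<prod_list n}"
  unfolding vec_def using bij_betw_imp_surj_on[OF bij_betw_inv_into[OF bij_index]] by simp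

definition vadd :: "nat list \<Rightarrow> nat list \<Rightarrow> nat list \<Rightarrow> nat list" where
  "vadd n g g' = map (\<lambda>i. (g ! i + g' ! i) mod n ! i) [0..<length n]"

lemma vadd_in: "proper n \<Longrightarrow> vadd n g g' \<in> positions n"
  by (auto simp: vadd_def positions_def proper_def Suc_le_eq)

lemma vadd_comm: "vadd n g g' = vadd n g' g"
  by (simp add: vadd_def add.commute)

lemma vadd_assoc: "vadd n (vadd n a b) c = vadd n a (vadd n b c)"
  by (simp add: vadd_def mod_add_left_eq mod_add_right_eq add.assoc)

lemma vadd_0: "p \<in> positions n \<Longrightarrow> vadd n p (replicate (length n) 0) = p"
  by (auto simp: vadd_def positions_def intro: nth_equalityI)

lemma vadd_inverse:
  assumes "p \<in> positions n"
  obtains p' where "p' \<in> positions n" "vadd n p p' = replicate (length n) 0"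
proof
  let ?p' = "map (\<lambda>i. (n ! i - p ! i) mod n ! i) [0..<length n]"
  have p: "p ! i < n ! i" if "i < length n" for i using assms that by (simp add: positions_def)
  then show "?p' \<in> positions n" by (fastforce simp: positions_def)
  show "vadd n p ?p' = replicate (length n) 0"
    by (rule nth_equalityI) (use p in \<open>auto simp: vadd_def mod_add_right_eq less_imp_le\<close>)
qed

lemma vadd_snoc: "length p = length n \<Longrightarrow> length p' = length n \<Longrightarrow>
  vadd (n @ [m]) (p @ [i]) (p' @ [i']) = vadd n p p' @ [(i + i') mod m]"
  by (auto simp: vadd_def nth_append)

lemma index_replicate_0: "index n (replicate (length n) 0) = 0"
  by (simp add: index_def)

lemma replicate_0_in: "proper n \<Longrightarrow> replicate (length n) 0 \<in> positions n"
  by (auto simp: positions_def proper_def Suc_le_eq)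

lemma vec_0: "proper n \<Longrightarrow> vec n 0 = replicate (length n) 0"
  using vec_index[OF replicate_0_in] index_replicate_0 by metis

definition gadd :: "nat list \<Rightarrow> nat \<Rightarrow> nat \<Rightarrow> nat" where
  "gadd n a b = index n (vadd n (vec n a) (vec n b))"

definition trn :: "nat list \<Rightarrow> nat \<Rightarrow> word \<Rightarrow> word" where
  "trn n h w = translate n (vec n h) w"

lemma translate_vadd: "translate n g w = (\<lambda>p\<in>positions n. w (vadd n p g))"
  by (simp add: translate_def vadd_def)

lemma vec_gadd: "proper n \<Longrightarrow> vec n (gadd n a b) = vadd n (vec n a) (vec n b)"
  unfolding gadd_def by (rule vec_index) (rule vadd_in)

lemma gadd_less: "proper n \<Longrightarrow> gadd n a b < prod_list n"
  unfolding gadd_def by (rule index_less) (rule vadd_in)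

lemma gadd_comm: "gadd n a b = gadd n b a"
  unfolding gadd_def using vadd_comm by metis

lemma gadd_0: "proper n \<Longrightarrow> a < prod_list n \<Longrightarrow> gadd n a 0 = a"
  by (simp add: gadd_def vec_0 vadd_0 vec_in index_vec)

lemma gadd_inverse:
  assumes "proper n" "a < prod_list n"
  obtains b where "b < prod_list n" "gadd n a b = 0"
proof -
  obtain p' where "p' \<in> positions n" "vadd n (vec n a) p' = replicate (length n) 0"
    using vadd_inverse[OF vec_in[OF assms(2)]] .
  then show ?thesis
    using that[of "index n p'"] by (simp add: gadd_def vec_index index_less index_replicate_0)
qed

lemma gadd_snoc:
  assumes "proper n" "h < prod_list n" "h' < prod_list n" "r < m" "r' < m"
  shows "gadd (n @ [m]) (h + prod_list n * r) (h' + prod_list n * r') =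
    gadd n h h' + prod_list n * ((r + r') mod m)"
  using assms by (simp add: gadd_def vec_snoc vadd_snoc length_positions vec_in index_snoc vadd_in)

lemma words_extensional: "w \<in> words q n \<Longrightarrow> w \<in> extensional (positions n)"
  by (auto simp: words_def PiE_def)

lemma trn_in: "proper n \<Longrightarrow> w \<in> words q n \<Longrightarrow> trn n h w \<in> words q n"
  unfolding trn_def translate_vadd words_def by (auto simp: vadd_in PiE_def Pi_def)

lemma trn_gadd: "proper n \<Longrightarrow> trn n (gadd n a b) w = trn n a (trn n b w)"
  unfolding trn_def translate_vadd by (auto simp: vec_gadd vadd_in vadd_assoc fun_eq_iff)

lemma trn_0: "proper n \<Longrightarrow> w \<in> words q n \<Longrightarrow> trn n 0 w = w"
  unfolding trn_def translate_vadd
  by (auto simp: vec_0 vadd_0 fun_eq_iff words_def PiE_def extensional_def)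

lemma slice_in: "w \<in> words q (n @ [m]) \<Longrightarrow> i < m \<Longrightarrow> slice n w i \<in> words q n"
  unfolding words_def slice_def by (auto simp: PiE_def Pi_def)

text \<open>A translation permutes the slices cyclically and acts on each of them by the same translation of one dimension less.\<close>

lemma slice_trn:
  assumes "proper n" "h < prod_list n" "r < m" "i < m"
  shows "slice n (trn (n @ [m]) (h + prod_list n * r) w) i = trn n h (slice n w ((i + r) mod m))"
  using assms unfolding trn_def translate_vadd slice_def
  by (auto simp: fun_eq_iff vec_snoc vadd_snoc length_positions vec_in vadd_in)

lemma slices_eq:
  assumes "w \<in> words q (n @ [m])" "u \<in> words q (n @ [m])" "\<And>i. i < m \<Longrightarrow> slice n w i = slice n u i"
  shows "w = u"
proof (rule extensionalityI[OF words_extensional[OF assms(1)] words_extensional[OF assms(2)]])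
  fix p assume "p \<in> positions (n @ [m])"
  then obtain p' i where "p = p' @ [i]" "p' \<in> positions n" "i < m" by (auto simp: positions_snoc)
  then show "w p = u p" using assms(3)[of i] by (auto simp: slice_def dest!: fun_cong[of _ _ p'])
qed

lemma glue_slices:
  assumes "\<And>i. i < m \<Longrightarrow> x i \<in> words q n"
  obtains w where "w \<in> words q (n @ [m])" "\<And>i. i < m \<Longrightarrow> slice n w i = x i"
proof
  let ?w = "\<lambda>p\<in>positions (n @ [m]). x (last p) (butlast p)"
  show "?w \<in> words q (n @ [m])"
    unfolding words_def
  proof (intro PiE_I)
    fix p assume p: "p \<in> positions (n @ [m])"
    then obtain p' i where pi: "p = p' @ [i]" "p' \<in> positions n" "i < m" by (auto simp: positions_snoc)
    have "x i p' \<in> {1..q}" using assms[OF pi(3)] pi(2) unfolding words_def by (rule PiE_mem)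
    then show "?w p \<in> {1..q}" using p pi by simp
  qed simp
  show "slice n ?w i = x i" if "i < m" for i
    using words_extensional[OF assms[OF that]] that
    by (auto simp: slice_def fun_eq_iff extensional_def)
qed

lemma orbit_trn: "orbit n w = (\<lambda>h. trn n h w) ` {..<prod_list n}"
  unfolding orbit_def trn_def positions_eq_vec by (simp add: image_image)

lemma finite_positions: "finite (positions n)"
  unfolding positions_eq_vec by simp

lemma finite_words: "finite (words q n)"
  unfolding words_def using finite_positions by (intro finite_PiE) auto

lemma card_words: "card (words q n) = q ^ prod_list n"
proof -
  have "card (positions n) = prod_list n" using bij_betw_same_card[OF bij_index] by simp
  then show ?thesis unfolding words_def by (simp add: card_PiE finite_positions)
qed

section \<open>Words as numbers\<close>

lemma horner_Suc:
  "(\<Sum>i<Suc m. f i * b ^ (Suc m - 1 - i)) = b * (\<Sum>i<m. f i * b ^ (m - 1 - i)) + (f m :: nat)"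
proof -
  have "f i * b ^ (m - i) = b * (f i * b ^ (m - 1 - i))" if "i < m" for i
  proof -
    have "m - i = Suc (m - 1 - i)" using that by simp
    then show ?thesis by simp
  qed
  then have "(\<Sum>i<m. f i * b ^ (m - i)) = b * (\<Sum>i<m. f i * b ^ (m - 1 - i))"
    unfolding sum_distrib_left by (intro sum.cong) auto
  then show ?thesis by simp
qed

lemma horner_bound:
  fixes f :: "nat \<Rightarrow> nat"
  assumes "\<And>i. i < m \<Longrightarrow> f i < b"
  shows "(\<Sum>i<m. f i * b ^ (m - 1 - i)) < b ^ m"
  using assms
proof (induction m)
  case (Suc m)
  let ?s = "\<Sum>i<m. f i * b ^ (m - 1 - i)"
  have "?s + 1 \<le> b ^ m" using Suc by (simp add: Suc_le_eq)
  then have "b * (?s + 1) \<le> b * b ^ m" by (rule mult_le_mono2)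
  then show ?case unfolding horner_Suc using Suc.prems[of m] by simp
qed simp

lemma digit_less:
  assumes "x < b" "y < b"
  shows "b * u + x < b * v + y \<longleftrightarrow> u < v \<or> u = v \<and> x < (y :: nat)"
proof -
  have "b * u + x < b * v + y" if "u < v" "x < b" for u v x y
  proof -
    have "b * (u + 1) \<le> b * v" using that by (intro mult_le_mono2) simp
    then show ?thesis using that by simp
  qed
  then show ?thesis using assms by (metis add_less_cancel_left less_asym nat_neq_iff)
qed

lemma digit_eq:
  assumes "x < b" "y < b"
  shows "b * u + x = b * v + y \<longleftrightarrow> u = v \<and> x = (y :: nat)"
proof
  assume eq: "b * u + x = b * v + y"
  have "(b * u + x) div b = u" "(b * v + y) div b = v" using assms by simp_all
  then show "u = v \<and> x = y" using eq by simp
qed simp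

text \<open>Numbers with the same number of digits, the first being the most significant, compare like their digit strings.\<close>

lemma horner_less:
  fixes f g :: "nat \<Rightarrow> nat"
  assumes "\<And>i. i < m \<Longrightarrow> f i < b" "\<And>i. i < m \<Longrightarrow> g i < b"
  shows "((\<Sum>i<m. f i * b ^ (m - 1 - i)) < (\<Sum>i<m. g i * b ^ (m - 1 - i)) \<longleftrightarrow>
      (\<exists>i<m. f i < g i \<and> (\<forall>j<i. f j = g j))) \<and>
    ((\<Sum>i<m. f i * b ^ (m - 1 - i)) = (\<Sum>i<m. g i * b ^ (m - 1 - i)) \<longleftrightarrow> (\<forall>i<m. f i = g i))"
  using assms
proof (induction m)
  case (Suc m)
  let ?u = "\<Sum>i<m. f i * b ^ (m - 1 - i)" and ?v = "\<Sum>i<m. g i * b ^ (m - 1 - i)"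
  have IH: "?u < ?v \<longleftrightarrow> (\<exists>i<m. f i < g i \<and> (\<forall>j<i. f j = g j))" "?u = ?v \<longleftrightarrow> (\<forall>i<m. f i = g i)"
    using Suc by simp_all
  have fg: "f m < b" "g m < b" using Suc.prems by simp_all
  note digit_eq[OF fg, of ?u ?v]
  moreover have "(\<exists>i<Suc m. f i < g i \<and> (\<forall>j<i. f j = g j)) \<longleftrightarrow>
      (\<exists>i<m. f i < g i \<and> (\<forall>j<i. f j = g j)) \<or> (\<forall>j<m. f j = g j) \<and> f m < g m"
    unfolding Ex_less_Suc by blast
  moreover have "(\<forall>i<Suc m. f i = g i) \<longleftrightarrow> (\<forall>i<m. f i = g i) \<and> f m = g m"
    unfolding All_less_Suc by blast
  ultimately show ?case unfolding horner_Suc digit_less[OF fg, of ?u ?v] IH by blast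
qed simp

text \<open>
  For a numbering \<open>f\<close> of the words of size \<open>n\<close>: the number of the canonical representation,
  the least translation leading there, and the pair of both as one number.
\<close>

definition least_key :: "(word \<Rightarrow> nat) \<Rightarrow> nat list \<Rightarrow> word \<Rightarrow> nat" where
  "least_key f n x = Min ((\<lambda>h. f (trn n h x)) ` {..<prod_list n})"

definition least_shift :: "(word \<Rightarrow> nat) \<Rightarrow> nat list \<Rightarrow> word \<Rightarrow> nat" where
  "least_shift f n x = (LEAST h. h < prod_list n \<and> f (trn n h x) = least_key f n x)"

definition slice_key :: "(word \<Rightarrow> nat) \<Rightarrow> nat list \<Rightarrow> word \<Rightarrow> nat" where
  "slice_key f n x = least_key f n x * prod_list n + least_shift f n x"

text \<open>A strict bound on the keys of the words of a size; the keys of slices are digits in base \<open>key_bound q n * prod_list n\<close>.\<close>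

function key_bound :: "nat \<Rightarrow> nat list \<Rightarrow> nat" where
  "key_bound q [] = q + 1"
| "key_bound q (n @ [m]) = (key_bound q n * prod_list n) ^ m"
  subgoal for P x by (cases x, cases "snd x" rule: rev_cases) auto
  by auto
termination
  by (relation "measure (length \<circ> snd)") auto

function wkey :: "nat \<Rightarrow> nat list \<Rightarrow> word \<Rightarrow> nat" where
  "wkey q [] = (\<lambda>w. w [])"
| "wkey q (n @ [m]) = (\<lambda>w. \<Sum>i<m. slice_key (wkey q n) n (slice n w i) * (key_bound q n * prod_list n) ^ (m - 1 - i))"
  subgoal for P x by (cases x, cases "snd x" rule: rev_cases) auto
  by auto
termination
  by (relation "measure (length \<circ> snd)") auto

abbreviation "mkey q n \<equiv> least_key (wkey q n) n"
abbreviation "skey q n \<equiv> slice_key (wkey q n) n"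

text \<open>Whatever injective numbering of the words of size \<open>n\<close> is used, the keys of slices have the following properties.\<close>

context
  fixes f :: "word \<Rightarrow> nat" and n :: "nat list" and q b :: nat
  assumes pn: "proper n"
    and inj: "inj_on f (words q n)"
    and less_b: "\<And>x. x \<in> words q n \<Longrightarrow> f x < b"
begin

lemma N_pos: "0 < prod_list n"
  using proper_pos[OF pn] .

lemma trn_inverse:
  assumes "h < prod_list n"
  obtains h' where "h' < prod_list n" "\<And>x. x \<in> words q n \<Longrightarrow> trn n h' (trn n h x) = x"
    "\<And>x. x \<in> words q n \<Longrightarrow> trn n h (trn n h' x) = x"
proof -
  obtain h' where h': "h' < prod_list n" "gadd n h h' = 0" using gadd_inverse[OF pn assms] .
  show ?thesis
    by (rule that[OF h'(1)]) (metis h'(2) gadd_comm pn trn_0 trn_gadd)+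
qed

lemma least_key_le: "h < prod_list n \<Longrightarrow> least_key f n x \<le> f (trn n h x)"
  unfolding least_key_def by (intro Min_le) auto

lemma least_key_attained: "\<exists>h<prod_list n. f (trn n h x) = least_key f n x"
proof -
  have "least_key f n x \<in> (\<lambda>h. f (trn n h x)) ` {..<prod_list n}"
    unfolding least_key_def using N_pos by (intro Min_in) auto
  then show ?thesis by auto
qed

lemma least_shift: "least_shift f n x < prod_list n" "f (trn n (least_shift f n x) x) = least_key f n x"
  using LeastI_ex[of "\<lambda>h. h < prod_list n \<and> f (trn n h x) = least_key f n x"] least_key_attained[of x]
  unfolding least_shift_def by auto

lemma least_key_trn: "x \<in> words q n \<Longrightarrow> h < prod_list n \<Longrightarrow> least_key f n (trn n h x) = least_key f n x"
proof -
  have le: "least_key f n x \<le> least_key f n (trn n h x)" if "h < prod_list n" for h x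
  proof -
    obtain h' where "h' < prod_list n" "f (trn n h' (trn n h x)) = least_key f n (trn n h x)"
      using least_key_attained[of "trn n h x"] by auto
    then show ?thesis using least_key_le[OF gadd_less[OF pn, of h' h], of x] trn_gadd[OF pn, of h' h x] by simp
  qed
  assume x: "x \<in> words q n" "h < prod_list n"
  obtain h' where "h' < prod_list n" "trn n h' (trn n h x) = x" using trn_inverse[OF x(2)] x(1) by metis
  then show ?thesis using le[OF x(2), of x] le[of h' "trn n h x"] by simp
qed

lemma slice_key_div: "slice_key f n x div prod_list n = least_key f n x"
  unfolding slice_key_def using least_shift(1)[of x] N_pos by simp

lemma slice_key_mod: "slice_key f n x mod prod_list n = least_shift f n x"
  unfolding slice_key_def using least_shift(1)[of x] by simp

lemma slice_key_less: "slice_key f n x < slice_key f n y \<longleftrightarrow>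
    least_key f n x < least_key f n y \<or> least_key f n x = least_key f n y \<and> least_shift f n x < least_shift f n y"
  unfolding slice_key_def mult.commute[of _ "prod_list n"] by (rule digit_less[OF least_shift(1) least_shift(1)])

text \<open>A word is recovered from its canonical representation by undoing the translation.\<close>

lemma slice_key_inj: "inj_on (slice_key f n) (words q n)"
proof (rule inj_onI)
  fix x y assume xy: "x \<in> words q n" "y \<in> words q n" "slice_key f n x = slice_key f n y"
  have k: "least_key f n x = least_key f n y" using slice_key_div[of x] slice_key_div[of y] xy(3) by simp
  have s: "least_shift f n x = least_shift f n y" using slice_key_mod[of x] slice_key_mod[of y] xy(3) by simp
  have "f (trn n (least_shift f n x) x) = f (trn n (least_shift f n x) y)"
    using least_shift(2)[of x] least_shift(2)[of y] k s by simp
  then have "trn n (least_shift f n x) x = trn n (least_shift f n x) y"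
    using inj trn_in[OF pn] xy by (auto dest: inj_onD)
  then show "x = y" using trn_inverse[OF least_shift(1)[of x]] xy by metis
qed

lemma least_key_less: "x \<in> words q n \<Longrightarrow> least_key f n x < b"
  using least_key_attained[of x] less_b trn_in[OF pn] by metis

lemma slice_key_bound: "x \<in> words q n \<Longrightarrow> slice_key f n x < b * prod_list n"
proof -
  assume "x \<in> words q n"
  then have "(least_key f n x + 1) * prod_list n \<le> b * prod_list n"
    using least_key_less by (intro mult_le_mono1) (simp add: Suc_le_eq)
  then show ?thesis unfolding slice_key_def using least_shift(1)[of x] by simp
qed

text \<open>Equal least keys mean equal canonical representations, hence the same orbit.\<close>

lemma least_key_orbit:
  assumes "x \<in> words q n" "y \<in> words q n" "least_key f n x = least_key f n y"
  obtains h where "h < prod_list n" "trn n h x = y"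
proof -
  obtain h where h: "h < prod_list n" "f (trn n h x) = least_key f n x" using least_key_attained by auto
  obtain k where k: "k < prod_list n" "f (trn n k y) = least_key f n y" using least_key_attained by auto
  have "trn n h x = trn n k y"
    by (rule inj_onD[OF inj _ trn_in[OF pn assms(1)] trn_in[OF pn assms(2)]]) (use h k assms(3) in simp)
  moreover obtain k' where k': "k' < prod_list n" "trn n k' (trn n k y) = y"
    using trn_inverse[OF k(1)] assms(2) by metis
  ultimately have "trn n (gadd n k' h) x = y" using trn_gadd[OF pn] by simp
  then show ?thesis by (rule that[OF gadd_less[OF pn]])
qed

lemma least_word_eq:
  assumes "x \<in> words q n" "\<And>u v. u \<in> words q n \<Longrightarrow> v \<in> words q n \<Longrightarrow> lt u v \<longleftrightarrow> f u < f v"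
  shows "least_word lt (orbit n x) \<in> orbit n x" "f (least_word lt (orbit n x)) = least_key f n x"
proof -
  let ?v = "trn n (least_shift f n x) x"
  have v: "?v \<in> orbit n x" unfolding orbit_trn using least_shift(1) by blast
  have sub: "orbit n x \<subseteq> words q n" unfolding orbit_trn using trn_in[OF pn assms(1)] by auto
  have min: "f ?v \<le> f u" if "u \<in> orbit n x" for u
    using that least_key_le least_shift(2) unfolding orbit_trn by auto
  have "least_word lt (orbit n x) = ?v"
    unfolding least_word_def
  proof (rule the_equality)
    show "?v \<in> orbit n x \<and> (\<forall>u\<in>orbit n x. u \<noteq> ?v \<longrightarrow> lt ?v u)"
    proof (intro conjI ballI impI v)
      fix u assume u: "u \<in> orbit n x" "u \<noteq> ?v"
      then have "f u \<noteq> f ?v" using inj sub v by (metis inj_onD subsetD)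
      then show "lt ?v u" using min[OF u(1)] assms(2) sub v u(1) by (metis le_neq_implies_less subsetD)
    qed
    fix v' assume v': "v' \<in> orbit n x \<and> (\<forall>u\<in>orbit n x. u \<noteq> v' \<longrightarrow> lt v' u)"
    then show "v' = ?v" using min assms(2) sub v by (metis not_le subsetD)
  qed
  then show "least_word lt (orbit n x) \<in> orbit n x" "f (least_word lt (orbit n x)) = least_key f n x"
    using v least_shift(2) by simp_all
qed

lemma index_least_translation:
  assumes "x \<in> words q n" "v \<in> words q n" "f v = least_key f n x"
  shows "index n (least_translation n x v) = least_shift f n x"
proof -
  have v: "trn n h x = v \<longleftrightarrow> f (trn n h x) = least_key f n x" for h
    using assms(3) inj_onD[OF inj _ trn_in[OF pn assms(1)] assms(2), of h] by auto
  define g where "g = vec n (least_shift f n x)"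
  have g: "g \<in> positions n" "index n g = least_shift f n x"
    unfolding g_def using vec_in index_vec least_shift(1) by auto
  have tg: "translate n g x = v" unfolding g_def trn_def[symmetric] v by (rule least_shift(2))
  have "is_arg_min (index n) (\<lambda>g. g \<in> positions n \<and> translate n g x = v) g"
    unfolding is_arg_min_linorder
  proof (intro conjI allI impI g(1) tg)
    fix y assume y: "y \<in> positions n \<and> translate n y x = v"
    then have "trn n (index n y) x = v" by (simp add: trn_def vec_index)
    then show "index n g \<le> index n y"
      unfolding g(2) least_shift_def using y v index_less by (intro Least_le) auto
  qed
  moreover have "is_arg_min (index n) (\<lambda>g. g \<in> positions n \<and> translate n g x = v) (least_translation n x v)"
    unfolding least_translation_def arg_min_def using calculation by (rule someI)
  ultimately show ?thesis using g(2) unfolding is_arg_min_linorder by (metis order_antisym)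
qed

end

text \<open>
  The three parts have to be proved together by induction on the dimension: the order of words of
  size \<open>n @ [m]\<close> refers to canonical representations of slices, which are determined only once the order of
  size \<open>n\<close> is known to be that of an injective numbering.
\<close>

lemma wkey_props:
  assumes "proper n"
  shows "inj_on (wkey q n) (words q n) \<and> (\<forall>x\<in>words q n. wkey q n x < key_bound q n) \<and>
    (\<forall>x\<in>words q n. \<forall>y\<in>words q n. word_less n x y \<longleftrightarrow> wkey q n x < wkey q n y)"
  using assms
proof (induction n rule: rev_induct)
  case Nil
  have "x = y" if "x \<in> words q []" "y \<in> words q []" "x [] = y []" for x y
    by (rule extensionalityI[OF words_extensional[OF that(1)] words_extensional[OF that(2)]]) (use that in auto)
  then show ?case by (auto simp: inj_on_def words_def PiE_def)
next
  case (snoc m n)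
  have pn: "proper n" using snoc.prems by simp
  have inj: "inj_on (wkey q n) (words q n)" and bnd: "\<And>x. x \<in> words q n \<Longrightarrow> wkey q n x < key_bound q n"
    and less: "\<And>x y. x \<in> words q n \<Longrightarrow> y \<in> words q n \<Longrightarrow> word_less n x y \<longleftrightarrow> wkey q n x < wkey q n y"
    using snoc.IH[OF pn] by auto
  note ctx = pn inj bnd
  let ?B = "key_bound q n * prod_list n"
  have sk: "skey q n (slice n w i) < ?B" if "w \<in> words q (n @ [m])" "i < m" for w i
    using slice_key_bound[OF ctx slice_in[OF that]] .
  have sk_eq: "skey q n (slice n w i) = skey q n (slice n u i) \<longleftrightarrow> slice n w i = slice n u i"
    if "w \<in> words q (n @ [m])" "u \<in> words q (n @ [m])" "i < m" for w u i
    using slice_key_inj[OF ctx] slice_in that by (metis inj_onD)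
  have 1: "wkey q (n @ [m]) w < key_bound q (n @ [m])" if "w \<in> words q (n @ [m])" for w
    using horner_bound[of m "\<lambda>i. skey q n (slice n w i)" ?B] sk[OF that] by simp
  have 2: "w = u" if wu: "w \<in> words q (n @ [m])" "u \<in> words q (n @ [m])" "wkey q (n @ [m]) w = wkey q (n @ [m]) u" for w u
  proof (rule slices_eq[OF wu(1,2)])
    fix i assume "i < m"
    then show "slice n w i = slice n u i"
      using horner_less[of m "\<lambda>i. skey q n (slice n w i)" ?B "\<lambda>i. skey q n (slice n u i)"] sk wu sk_eq by auto
  qed
  have 3: "word_less (n @ [m]) w u \<longleftrightarrow> wkey q (n @ [m]) w < wkey q (n @ [m]) u"
    if wu: "w \<in> words q (n @ [m])" "u \<in> words q (n @ [m])" for w u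
  proof -
    have step: "(let x = slice n w i; y = slice n u i;
          x' = least_word (word_less n) (orbit n x); y' = least_word (word_less n) (orbit n y)
      in word_less n x' y' \<or>
         x' = y' \<and> index n (least_translation n x x') < index n (least_translation n y y')) \<longleftrightarrow>
       skey q n (slice n w i) < skey q n (slice n u i)" if i: "i < m" for i
    proof -
      define x where "x = slice n w i"
      define y where "y = slice n u i"
      define x' where "x' = least_word (word_less n) (orbit n x)"
      define y' where "y' = least_word (word_less n) (orbit n y)"
      have x: "x \<in> words q n" and y: "y \<in> words q n" unfolding x_def y_def using slice_in wu i by auto
      have x': "x' \<in> words q n" "wkey q n x' = mkey q n x"
        unfolding x'_def using least_word_eq[OF ctx x less] trn_in[OF pn x] by (auto simp: orbit_trn)
      have y': "y' \<in> words q n" "wkey q n y' = mkey q n y"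
        unfolding y'_def using least_word_eq[OF ctx y less] trn_in[OF pn y] by (auto simp: orbit_trn)
      have "x' = y' \<longleftrightarrow> mkey q n x = mkey q n y" using x' y' inj by (metis inj_onD)
      moreover have "index n (least_translation n x x') = least_shift (wkey q n) n x"
        by (rule index_least_translation[OF ctx x x'])
      moreover have "index n (least_translation n y y') = least_shift (wkey q n) n y"
        by (rule index_least_translation[OF ctx y y'])
      moreover have "word_less n x' y' \<longleftrightarrow> mkey q n x < mkey q n y"
        using less[OF x'(1) y'(1)] x'(2) y'(2) by simp
      moreover note slice_key_less[OF ctx, of x y]
      ultimately show ?thesis
        unfolding Let_def x_def[symmetric] y_def[symmetric] unfolding x'_def[symmetric] y'_def[symmetric]
        by (simp only:)
    qed
    have "word_less (n @ [m]) w u \<longleftrightarrow> (\<exists>i<m. slice n w i \<noteq> slice n u i \<and> (\<forall>j<i. slice n w j = slice n u j) \<and>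
        skey q n (slice n w i) < skey q n (slice n u i))"
      unfolding word_less.simps using step by blast
    also have "\<dots> \<longleftrightarrow> (\<exists>i<m. skey q n (slice n w i) < skey q n (slice n u i) \<and>
        (\<forall>j<i. skey q n (slice n w j) = skey q n (slice n u j)))"
      using sk_eq[OF wu] by (metis less_irrefl less_trans)
    also have "\<dots> \<longleftrightarrow> wkey q (n @ [m]) w < wkey q (n @ [m]) u"
      using horner_less[of m "\<lambda>i. skey q n (slice n w i)" ?B "\<lambda>i. skey q n (slice n u i)"] sk wu by simp
    finally show ?thesis .
  qed
  show ?case using 1 2 3 by (auto intro: inj_onI)
qed

lemma wkey_inj: "proper n \<Longrightarrow> inj_on (wkey q n) (words q n)"
  using wkey_props by blast

lemma wkey_bound: "proper n \<Longrightarrow> x \<in> words q n \<Longrightarrow> wkey q n x < key_bound q n"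
  using wkey_props by blast

lemma word_less_iff:
  "proper n \<Longrightarrow> x \<in> words q n \<Longrightarrow> y \<in> words q n \<Longrightarrow> word_less n x y \<longleftrightarrow> wkey q n x < wkey q n y"
  using wkey_props by blast

text \<open>
  The two families of counts that the program passes from level to level. The second one depends only on
  the orbit of \<open>y\<close>, so \<open>y\<close> need not be a canonical representation.
\<close>

definition num_fixed :: "nat \<Rightarrow> nat list \<Rightarrow> nat \<Rightarrow> nat" where
  "num_fixed q n s = card {x\<in>words q n. trn n s x = x}"

definition num_below :: "nat \<Rightarrow> nat list \<Rightarrow> nat \<Rightarrow> word \<Rightarrow> nat" where
  "num_below q n s y = card {x\<in>words q n. trn n s x = x \<and> mkey q n x < mkey q n y}"

lemma num_fixed_le: "num_fixed q n s \<le> q ^ prod_list n"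
  unfolding num_fixed_def card_words[symmetric] by (rule card_mono[OF finite_words]) auto

lemma num_below_le: "num_below q n s y \<le> q ^ prod_list n"
  unfolding num_below_def card_words[symmetric] by (rule card_mono[OF finite_words]) auto

section \<open>Burnside's lemma for the rank\<close>

lemma trn_inv:
  assumes "proper n" "h < prod_list n"
  obtains h' where "h' < prod_list n" "gadd n h h' = 0" "gadd n h' h = 0"
  using gadd_inverse[OF assms] gadd_comm by metis

lemma orbit_refl: "proper n \<Longrightarrow> x \<in> words q n \<Longrightarrow> x \<in> orbit n x"
  unfolding orbit_trn using trn_0 proper_pos by (metis imageI lessThan_iff)

lemma orbit_sub: "proper n \<Longrightarrow> x \<in> words q n \<Longrightarrow> orbit n x \<subseteq> words q n"
  unfolding orbit_trn using trn_in by auto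

lemma orbit_eq:
  assumes "proper n" "x \<in> words q n" "y \<in> orbit n x"
  shows "orbit n y = orbit n x"
proof -
  have sub: "orbit n y \<subseteq> orbit n x" if yx: "y \<in> orbit n x" for x y
  proof
    fix z assume "z \<in> orbit n y"
    then obtain a b where "z = trn n a (trn n b x)" using yx unfolding orbit_trn by auto
    then have "z = trn n (gadd n a b) x" using trn_gadd[OF assms(1)] by simp
    then show "z \<in> orbit n x" unfolding orbit_trn using gadd_less[OF assms(1)] by blast
  qed
  obtain h where h: "h < prod_list n" "y = trn n h x" using assms(3) unfolding orbit_trn by auto
  obtain h' where h': "h' < prod_list n" "gadd n h' h = 0" using trn_inv[OF assms(1) h(1)] by metis
  have "trn n h' y = x" unfolding h(2) trn_gadd[OF assms(1), symmetric] h'(2) by (rule trn_0[OF assms(1,2)])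
  then have "x \<in> orbit n y" unfolding orbit_trn using h'(1) by blast
  then show ?thesis using sub assms(3) by blast
qed

text \<open>
  The stabiliser of \<open>v\<close> is in bijection with the translations that map \<open>x\<close> to \<open>v\<close>, by adding one of them, and the sets of the
  latter partition the group.
\<close>

lemma orbit_stabilizer:
  assumes "proper n" "x \<in> words q n"
  shows "(\<Sum>v\<in>orbit n x. card {g. g < prod_list n \<and> trn n g v = v}) = prod_list n"
proof -
  let ?N = "prod_list n"
  let ?F = "\<lambda>v. {g. g < ?N \<and> trn n g x = v}"
  have fib: "card {g. g < ?N \<and> trn n g v = v} = card (?F v)" if vx: "v \<in> orbit n x" for v
  proof -
    obtain h where h: "h < ?N" "v = trn n h x" using vx unfolding orbit_trn by auto
    obtain h' where h': "h' < ?N" "gadd n h h' = 0" "gadd n h' h = 0" using trn_inv[OF assms(1) h(1)] by metis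
    have h'v: "trn n h' v = x"
      unfolding h(2) trn_gadd[OF assms(1), symmetric] h'(3) by (rule trn_0[OF assms])
    have assoc: "gadd n (gadd n x y) z = gadd n x (gadd n y z)" for x y z
      unfolding gadd_def using assms(1) by (simp add: vec_index vadd_in vadd_assoc)
    have "bij_betw (gadd n h) {g. g < ?N \<and> trn n g v = v} (?F v)"
    proof (rule bij_betw_byWitness[where f' = "gadd n h'"])
      have 0: "gadd n 0 x = x" if "x < ?N" for x using gadd_0[OF assms(1) that] gadd_comm by metis
      show "\<forall>a\<in>{g. g < ?N \<and> trn n g v = v}. gadd n h' (gadd n h a) = a"
        using 0 by (simp add: assoc[symmetric] h'(3))
      show "\<forall>a\<in>?F v. gadd n h (gadd n h' a) = a"
        using 0 by (simp add: assoc[symmetric] h'(2))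
      show "gadd n h ` {g. g < ?N \<and> trn n g v = v} \<subseteq> ?F v"
      proof
        fix y assume "y \<in> gadd n h ` {g. g < ?N \<and> trn n g v = v}"
        then obtain g where g: "g < ?N" "trn n g v = v" "y = gadd n h g" by auto
        have "trn n y x = trn n g (trn n h x)"
          unfolding g(3) using trn_gadd[OF assms(1)] gadd_comm by metis
        then show "y \<in> ?F v" using g h gadd_less[OF assms(1)] by simp
      qed
      show "gadd n h' ` ?F v \<subseteq> {g. g < ?N \<and> trn n g v = v}"
      proof
        fix y assume "y \<in> gadd n h' ` ?F v"
        then obtain g where g: "g < ?N" "trn n g x = v" "y = gadd n h' g" by auto
        have "trn n y v = trn n g (trn n h' v)"
          unfolding g(3) using trn_gadd[OF assms(1)] gadd_comm by metis
        then show "y \<in> {g. g < ?N \<and> trn n g v = v}" using g h'v gadd_less[OF assms(1)] by simp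
      qed
    qed
    then show ?thesis by (rule bij_betw_same_card)
  qed
  have fin: "finite (orbit n x)" unfolding orbit_trn by simp
  have "(\<Sum>v\<in>orbit n x. card {g. g < ?N \<and> trn n g v = v}) = (\<Sum>v\<in>orbit n x. card (?F v))"
    using fib by (rule sum.cong[OF refl])
  also have "\<dots> = card (\<Union>v\<in>orbit n x. ?F v)"
    by (rule card_UN_disjoint[symmetric, OF fin]) auto
  also have "(\<Union>v\<in>orbit n x. ?F v) = {..<?N}" unfolding orbit_trn by auto
  finally show ?thesis by simp
qed

lemma representative:
  assumes "proper n" "C \<in> necklaces q n"
  shows "representative n C \<in> C" "representative n C \<in> words q n" "\<And>x. x \<in> C \<Longrightarrow> x \<in> words q n \<and> C = orbit n x"
    "\<And>x. x \<in> C \<Longrightarrow> mkey q n x = wkey q n (representative n C)"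
proof -
  obtain x0 where x0: "x0 \<in> words q n" "C = orbit n x0" using assms(2) unfolding necklaces_def by auto
  note ctx = assms(1) wkey_inj[OF assms(1)] wkey_bound[OF assms(1)]
  have lw: "representative n C \<in> orbit n x0" "wkey q n (representative n C) = mkey q n x0"
    unfolding representative_def x0(2)
    using least_word_eq[OF ctx x0(1) word_less_iff[OF assms(1)]] by simp_all
  show *: "x \<in> words q n \<and> C = orbit n x" if "x \<in> C" for x
    using that x0 orbit_sub[OF assms(1) x0(1)] orbit_eq[OF assms(1) x0(1)] by auto
  show "representative n C \<in> C" using lw(1) x0(2) by simp
  then show "representative n C \<in> words q n" using * by blast
  show "mkey q n x = wkey q n (representative n C)" if xC: "x \<in> C" for x
  proof -
    obtain h where "h < prod_list n" "x = trn n h x0" using xC x0(2) unfolding orbit_trn by auto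
    then show ?thesis using least_key_trn[OF ctx x0(1)] lw(2) by simp
  qed
qed

text \<open>Each necklace below the given one contributes the order of the group to the sum, by \<open>orbit_stabilizer\<close>.\<close>

theorem rank_burnside:
  assumes "proper n" "C \<in> necklaces q n"
  shows "necklace_rank q n C * prod_list n = (\<Sum>g<prod_list n. num_below q n g (representative n C))"
proof -
  let ?N = "prod_list n" and ?w = "representative n C"
  let ?D = "{D \<in> necklaces q n. word_less n (representative n D) ?w}"
  let ?X = "{x\<in>words q n. mkey q n x < mkey q n ?w}"
  note rep = representative[OF assms(1)]
  have w: "mkey q n ?w = wkey q n ?w" "?w \<in> words q n" using rep[OF assms(2)] by auto
  have D_iff: "word_less n (representative n D) ?w \<longleftrightarrow> mkey q n x < mkey q n ?w" if "D \<in> necklaces q n" "x \<in> D" for D x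
    using rep(2,4)[OF that(1)] that(2) w word_less_iff[OF assms(1)] by simp
  have finD: "finite (necklaces q n)" unfolding necklaces_def using finite_words by blast
  have disj: "D \<inter> D' = {}" if "D \<in> necklaces q n" "D' \<in> necklaces q n" "D \<noteq> D'" for D D'
    using rep(3)[OF that(1)] rep(3)[OF that(2)] that(3) by blast
  have X: "?X = \<Union> ?D"
  proof (intro equalityI subsetI)
    fix x assume x: "x \<in> ?X"
    then have "orbit n x \<in> necklaces q n" "x \<in> orbit n x"
      unfolding necklaces_def using orbit_refl[OF assms(1)] by auto
    then show "x \<in> \<Union> ?D" using D_iff x by blast
  next
    fix x assume "x \<in> \<Union> ?D"
    then obtain D where "D \<in> ?D" "x \<in> D" by blast
    then show "x \<in> ?X" using D_iff rep(3) by blast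
  qed
  have "(\<Sum>g<?N. num_below q n g ?w) = (\<Sum>g<?N. \<Sum>x\<in>?X. of_bool (trn n g x = x))"
  proof (rule sum.cong[OF refl])
    fix g
    have "{x\<in>words q n. trn n g x = x \<and> mkey q n x < mkey q n ?w} = {x\<in>?X. trn n g x = x}" by auto
    then show "num_below q n g ?w = (\<Sum>x\<in>?X. of_bool (trn n g x = x))"
      unfolding num_below_def using finite_words[of q n] by (simp add: Int_def)
  qed
  also have "\<dots> = (\<Sum>x\<in>?X. \<Sum>g<?N. of_bool (trn n g x = x))" by (rule sum.swap)
  also have "\<dots> = (\<Sum>x\<in>?X. card {g. g < ?N \<and> trn n g x = x})"
    by (intro sum.cong refl) (simp add: Int_def lessThan_def)
  also have "\<dots> = (\<Sum>D\<in>?D. \<Sum>x\<in>D. card {g. g < ?N \<and> trn n g x = x})"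
  proof -
    have "(\<Sum>x\<in>\<Union> ?D. card {g. g < ?N \<and> trn n g x = x}) =
        (sum \<circ> sum) (\<lambda>x. card {g. g < ?N \<and> trn n g x = x}) ?D"
    proof (rule sum.Union_disjoint[where C = "?D"])
      show "\<forall>D\<in>?D. finite D"
      proof
        fix D assume "D \<in> ?D"
        then have "D \<in> necklaces q n" by (simp only: mem_Collect_eq)
        then show "finite D" unfolding necklaces_def orbit_trn by auto
      qed
      show "\<forall>D\<in>?D. \<forall>D'\<in>?D. D \<noteq> D' \<longrightarrow> D \<inter> D' = {}"
      proof (intro ballI impI)
        fix D D' assume "D \<in> ?D" "D' \<in> ?D" "D \<noteq> D'"
        then show "D \<inter> D' = {}" using disj[of D D'] by (simp only: mem_Collect_eq simp_thms)
      qed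
    qed
    then show ?thesis unfolding X comp_def .
  qed
  also have "\<dots> = (\<Sum>D\<in>?D. ?N)"
  proof (rule sum.cong[OF refl])
    fix D assume "D \<in> ?D"
    then obtain x where "x \<in> words q n" "D = orbit n x" unfolding necklaces_def by auto
    then show "(\<Sum>x\<in>D. card {g. g < ?N \<and> trn n g x = x}) = ?N" using orbit_stabilizer[OF assms(1)] by simp
  qed
  finally show ?thesis unfolding necklace_rank_def by simp
qed

section \<open>Slices as letters\<close>

definition letters :: "nat \<Rightarrow> nat list \<Rightarrow> nat set" where
  "letters q n = skey q n ` words q n"

definition lact :: "nat \<Rightarrow> nat list \<Rightarrow> nat \<Rightarrow> nat \<Rightarrow> nat" where
  "lact q n h y = skey q n (trn n h (inv_into (words q n) (skey q n) y))"

definition code :: "nat \<Rightarrow> nat list \<Rightarrow> nat \<Rightarrow> word \<Rightarrow> nat list" where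
  "code q n m w = map (\<lambda>i. skey q n (slice n w i)) [0..<m]"

lemma skey_inj: "proper n \<Longrightarrow> inj_on (skey q n) (words q n)"
  using slice_key_inj[OF _ wkey_inj wkey_bound] by blast

lemma skey_eq_iff: "proper n \<Longrightarrow> x \<in> words q n \<Longrightarrow> y \<in> words q n \<Longrightarrow> skey q n x = skey q n y \<longleftrightarrow> x = y"
  using skey_inj by (metis inj_onD)

lemma skey_div: "proper n \<Longrightarrow> skey q n x div prod_list n = mkey q n x"
  using slice_key_div[OF _ wkey_inj wkey_bound] by blast

lemma skey_bound: "proper n \<Longrightarrow> x \<in> words q n \<Longrightarrow> skey q n x < key_bound q n * prod_list n"
  using slice_key_bound[OF _ wkey_inj wkey_bound] by blast

lemma mkey_trn: "proper n \<Longrightarrow> x \<in> words q n \<Longrightarrow> h < prod_list n \<Longrightarrow> mkey q n (trn n h x) = mkey q n x"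
  using least_key_trn[OF _ wkey_inj wkey_bound] by blast

lemma lact_skey: "proper n \<Longrightarrow> x \<in> words q n \<Longrightarrow> lact q n h (skey q n x) = skey q n (trn n h x)"
  unfolding lact_def by (simp add: inv_into_f_f[OF skey_inj])

lemma orbit_alphabet_letters:
  assumes "proper n"
  shows "orbit_alphabet (letters q n) (prod_list n) (gadd n) (lact q n)"
proof
  note ctx = assms wkey_inj[OF assms] wkey_bound[OF assms]
  show "finite (letters q n)" unfolding letters_def using finite_words by simp
  show "0 < prod_list n" by (rule proper_pos[OF assms])
  show "gadd n a b < prod_list n" for a b by (rule gadd_less[OF assms])
  show "gadd n a b = gadd n b a" for a b by (rule gadd_comm)
  show "\<exists>b<prod_list n. gadd n a b = 0" if "a < prod_list n" for a
    using gadd_inverse[OF assms that] by metis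
  fix x h assume x: "x \<in> letters q n" 
  then obtain u where u: "u \<in> words q n" "x = skey q n u" unfolding letters_def by auto
  show "lact q n h x \<in> letters q n"
    unfolding u(2) lact_skey[OF assms u(1)] letters_def using trn_in[OF assms u(1)] by simp
  show "lact q n 0 x = x"
    unfolding u(2) lact_skey[OF assms u(1)] trn_0[OF assms u(1)] ..
  show "lact q n (gadd n a b) x = lact q n a (lact q n b x)" for a b
    unfolding u(2) lact_skey[OF assms u(1)] lact_skey[OF assms trn_in[OF assms u(1)]] trn_gadd[OF assms] ..
  show "lact q n h x div prod_list n = x div prod_list n" if "h < prod_list n"
    unfolding u(2) lact_skey[OF assms u(1)] skey_div[OF assms] by (rule mkey_trn[OF assms u(1) that])
  fix y assume y: "y \<in> letters q n" "x div prod_list n = y div prod_list n"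
  then obtain v where v: "v \<in> words q n" "y = skey q n v" unfolding letters_def by auto
  have "mkey q n u = mkey q n v" using y(2) unfolding u(2) v(2) skey_div[OF assms] .
  then obtain k where "k < prod_list n" "trn n k u = v" using least_key_orbit[OF ctx u(1) v(1)] by metis
  then show "\<exists>k<prod_list n. lact q n k x = y" unfolding u(2) v(2) lact_skey[OF assms u(1)] by blast
qed

lemma length_code [simp]: "length (code q n m w) = m"
  by (simp add: code_def)

lemma code_nth: "i < m \<Longrightarrow> code q n m w ! i = skey q n (slice n w i)"
  by (simp add: code_def)

lemma code_letters: "w \<in> words q (n @ [m]) \<Longrightarrow> set (code q n m w) \<subseteq> letters q n"
  unfolding code_def letters_def using slice_in by auto

lemma code_inj:
  assumes "proper n"
  shows "inj_on (code q n m) (words q (n @ [m]))"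
proof (rule inj_onI)
  fix w u assume wu: "w \<in> words q (n @ [m])" "u \<in> words q (n @ [m])" "code q n m w = code q n m u"
  show "w = u"
  proof (rule slices_eq[OF wu(1,2)])
    fix i assume "i < m"
    then show "slice n w i = slice n u i"
      using code_nth[of i m q n] wu skey_eq_iff[OF assms slice_in slice_in] by metis
  qed
qed

lemma code_surj:
  assumes "proper n" "set v \<subseteq> letters q n" "length v = m"
  obtains w where "w \<in> words q (n @ [m])" "code q n m w = v"
proof -
  define x where "x i = inv_into (words q n) (skey q n) (v ! i)" for i
  have x: "x i \<in> words q n" "skey q n (x i) = v ! i" if "i < m" for i
  proof -
    have "v ! i \<in> skey q n ` words q n" using assms(2,3) that unfolding letters_def by auto
    then show "x i \<in> words q n" "skey q n (x i) = v ! i"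
      unfolding x_def by (rule inv_into_into, rule f_inv_into_f)
  qed
  obtain w where w: "w \<in> words q (n @ [m])" "\<And>i. i < m \<Longrightarrow> slice n w i = x i"
    using glue_slices[of m x q n] x(1) by metis
  have "code q n m w = v" by (rule nth_equalityI) (use w(2) x(2) assms(3) in \<open>auto simp: code_nth\<close>)
  then show ?thesis using that w(1) by blast
qed

text \<open>Both sides compare the keys of the slices from the first one on.\<close>

lemma code_less:
  assumes "proper n" "v \<in> words q (n @ [m])" "w \<in> words q (n @ [m])"
  shows "lex_less (code q n m v) (code q n m w) \<longleftrightarrow> wkey q (n @ [m]) v < wkey q (n @ [m]) w"
proof -
  let ?B = "key_bound q n * prod_list n"
  have "take j (code q n m v) = take j (code q n m w) \<longleftrightarrow> (\<forall>j'<j. skey q n (slice n v j') = skey q n (slice n w j'))"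
    if "j < m" for j
    using that by (auto simp: list_eq_iff_nth_eq code_nth)
  then have "lex_less (code q n m v) (code q n m w) \<longleftrightarrow>
    (\<exists>j<m. skey q n (slice n v j) < skey q n (slice n w j) \<and> (\<forall>j'<j. skey q n (slice n v j') = skey q n (slice n w j')))"
    unfolding lex_less_def by (auto simp: code_nth)
  also have "\<dots> \<longleftrightarrow> wkey q (n @ [m]) v < wkey q (n @ [m]) w"
    using horner_less[of m "\<lambda>i. skey q n (slice n v i)" ?B "\<lambda>i. skey q n (slice n w i)"]
      skey_bound[OF assms(1) slice_in[OF assms(2)]] skey_bound[OF assms(1) slice_in[OF assms(3)]]
    by simp
  finally show ?thesis .
qed

text \<open>A word \<open>y\<close> that is its own canonical representation, seen as a string of slices, is least among its translates.\<close>

locale block_step =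
  fixes q :: nat and n :: "nat list" and m :: nat and y :: word
  assumes proper: "proper n" and m1: "1 \<le> m" and y: "y \<in> words q (n @ [m])"
    and y_least: "wkey q (n @ [m]) y = mkey q (n @ [m]) y"
begin

sublocale orbit_alphabet "letters q n" "prod_list n" "gadd n" "lact q n"
  by (rule orbit_alphabet_letters[OF proper])

lemma proper': "proper (n @ [m])"
  using proper m1 by simp

lemma code_trn:
  assumes "w \<in> words q (n @ [m])" "h < prod_list n" "r < m"
  shows "code q n m (trn (n @ [m]) (h + prod_list n * r) w) = al h (rotate r (code q n m w))"
proof (rule nth_equalityI)
  fix i assume "i < length (code q n m (trn (n @ [m]) (h + prod_list n * r) w))"
  then have i: "i < m" by simp
  have "(r + i) mod m < m" using m1 by simp
  then show "code q n m (trn (n @ [m]) (h + prod_list n * r) w) ! i = al h (rotate r (code q n m w)) ! i"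
    using i lact_skey[OF proper slice_in[OF assms(1)]] slice_trn[OF proper assms(2,3) i]
    by (simp add: code_nth al_def nth_rotate add.commute)
qed simp

lemma shift_less: "h < prod_list n \<Longrightarrow> r < m \<Longrightarrow> h + prod_list n * r < prod_list (n @ [m])"
proof -
  assume "h < prod_list n" "r < m"
  then have "h + prod_list n * r < prod_list n * (r + 1)" by simp
  also have "\<dots> \<le> prod_list n * m" using \<open>r < m\<close> by (intro mult_le_mono2) simp
  finally show ?thesis by simp
qed

sublocale least_translate "letters q n" "prod_list n" "gadd n" "lact q n" "code q n m y" m
proof
  show "length (code q n m y) = m" by simp
  show "0 < m" using m1 by simp
  show "set (code q n m y) \<subseteq> letters q n" by (rule code_letters[OF y])
  fix r k assume rk: "r < m" "k < prod_list n"
  let ?v = "trn (n @ [m]) (k + prod_list n * r) y"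
  have v: "?v \<in> words q (n @ [m])" by (rule trn_in[OF proper' y])
  have "mkey q (n @ [m]) y \<le> wkey q (n @ [m]) ?v"
    by (rule least_key_le[OF proper' wkey_inj[OF proper'] wkey_bound[OF proper'] shift_less[OF rk(2,1)]])
  then show "\<not> lex_less (al k (rotate r (code q n m y))) (code q n m y)"
    unfolding code_trn[OF y rk(2,1), symmetric] code_less[OF proper v y] y_least by simp
qed

lemma below_code:
  assumes "v \<in> words q (n @ [m])"
  shows "below (code q n m v) \<longleftrightarrow> mkey q (n @ [m]) v < mkey q (n @ [m]) y"
proof
  note ctx = proper' wkey_inj[OF proper'] wkey_bound[OF proper']
  assume "below (code q n m v)"
  then obtain i k where ik: "i < m" "k < prod_list n" "lex_less (al k (rotate i (code q n m v))) (code q n m y)"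
    unfolding below_def by auto
  have "wkey q (n @ [m]) (trn (n @ [m]) (k + prod_list n * i) v) < wkey q (n @ [m]) y"
    using ik(3) unfolding code_trn[OF assms ik(2,1), symmetric] code_less[OF proper trn_in[OF proper' assms] y] .
  moreover have "mkey q (n @ [m]) v \<le> wkey q (n @ [m]) (trn (n @ [m]) (k + prod_list n * i) v)"
    by (rule least_key_le[OF ctx shift_less[OF ik(2,1)]])
  ultimately show "mkey q (n @ [m]) v < mkey q (n @ [m]) y" using y_least by simp
next
  note ctx = proper' wkey_inj[OF proper'] wkey_bound[OF proper']
  assume *: "mkey q (n @ [m]) v < mkey q (n @ [m]) y"
  obtain g where g: "g < prod_list (n @ [m])" "wkey q (n @ [m]) (trn (n @ [m]) g v) = mkey q (n @ [m]) v"
    using least_key_attained[OF ctx, where x = v] by auto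
  define k where "k = g mod prod_list n"
  define i where "i = g div prod_list n"
  have ik: "k < prod_list n" "i < m" "g = k + prod_list n * i"
    using g(1) p_pos unfolding k_def i_def by (auto simp: less_mult_imp_div_less mult.commute)
  have "lex_less (al k (rotate i (code q n m v))) (code q n m y)"
    using * g(2) unfolding y_least[symmetric] ik(3)
    unfolding code_trn[OF assms ik(1,2), symmetric] code_less[OF proper trn_in[OF proper' assms] y] by simp
  then show "below (code q n m v)" unfolding below_def using ik by blast
qed

lemma fixed_code:
  assumes "h < prod_list n" "r < m" "v \<in> words q (n @ [m])"
  shows "code q n m v \<in> fixed_words h r \<longleftrightarrow> trn (n @ [m]) (h + prod_list n * r) v = v"
proof -
  have "code q n m v \<in> fixed_words h r \<longleftrightarrow>
      code q n m (trn (n @ [m]) (h + prod_list n * r) v) = code q n m v"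
    unfolding fixed_words_def code_trn[OF assms(3,1,2)] using code_letters[OF assms(3)] by simp
  also have "\<dots> \<longleftrightarrow> trn (n @ [m]) (h + prod_list n * r) v = v"
    by (rule inj_on_eq_iff[OF code_inj[OF proper] trn_in[OF proper' assms(3)] assms(3)])
  finally show ?thesis .
qed

text \<open>Together with \<open>below_code\<close>, this reduces the counts for words of size \<open>n @ [m]\<close> to counts of strings.\<close>

lemma card_code:
  assumes "h < prod_list n" "r < m"
  shows "card {v\<in>words q (n @ [m]). trn (n @ [m]) (h + prod_list n * r) v = v \<and> Q (code q n m v)} =
    card {v\<in>fixed_words h r. Q v}"
proof -
  let ?A = "{v\<in>words q (n @ [m]). trn (n @ [m]) (h + prod_list n * r) v = v \<and> Q (code q n m v)}"
  have "{v\<in>fixed_words h r. Q v} = code q n m ` ?A"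
  proof (intro equalityI subsetI)
    fix v assume v: "v \<in> {v\<in>fixed_words h r. Q v}"
    then obtain w where w: "w \<in> words q (n @ [m])" "code q n m w = v"
      using code_surj[OF proper, of v q m] unfolding fixed_words_def by auto
    have "w \<in> ?A" using fixed_code[OF assms w(1)] v w by (simp only: mem_Collect_eq simp_thms)
    then show "v \<in> code q n m ` ?A" unfolding w(2)[symmetric] by (rule imageI)
  next
    fix v assume "v \<in> code q n m ` ?A"
    then obtain w where w: "w \<in> ?A" "v = code q n m w" by (rule imageE)
    then show "v \<in> {v\<in>fixed_words h r. Q v}"
      using fixed_code[OF assms, of w] by (simp only: mem_Collect_eq simp_thms)
  qed
  moreover have "inj_on (code q n m) ?A" by (rule inj_on_subset[OF code_inj[OF proper]]) (rule Collect_restrict)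
  ultimately show ?thesis by (simp only: card_image)
qed

lemma num_below_code: "h < prod_list n \<Longrightarrow> r < m \<Longrightarrow>
    num_below q (n @ [m]) (h + prod_list n * r) y = card {v\<in>fixed_words h r. below v}"
  unfolding num_below_def card_code[symmetric]
  by (intro arg_cong[of _ _ card] Collect_cong conj_cong refl) (simp only: below_code)

lemma num_fixed_code: "h < prod_list n \<Longrightarrow> r < m \<Longrightarrow>
    num_fixed q (n @ [m]) (h + prod_list n * r) = card (fixed_words h r)"
  unfolding num_fixed_def using card_code[of h r "\<lambda>_. True"] by (simp only: simp_thms Collect_mem_eq)

lemma skey_Fixed: "x \<in> words q n \<Longrightarrow> skey q n x \<in> Fixed s \<longleftrightarrow> trn n s x = x"
proof -
  assume x: "x \<in> words q n"
  have "skey q n x \<in> Fixed s \<longleftrightarrow> skey q n (trn n s x) = skey q n x"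
    unfolding Fixed_def mem_Collect_eq lact_skey[OF proper x]
    using imageI[OF x, of "skey q n"] unfolding letters_def by iprover
  also have "\<dots> \<longleftrightarrow> trn n s x = x" by (rule skey_eq_iff[OF proper trn_in[OF proper x] x])
  finally show ?thesis .
qed

lemma card_Fixed_if: "card {x\<in>Fixed s. Q x} = card {x\<in>words q n. trn n s x = x \<and> Q (skey q n x)}"
proof -
  let ?A = "{x\<in>words q n. trn n s x = x \<and> Q (skey q n x)}"
  have "{x\<in>Fixed s. Q x} = skey q n ` ?A"
  proof (intro equalityI subsetI)
    fix z assume z: "z \<in> {x\<in>Fixed s. Q x}"
    then have "z \<in> letters q n" by (simp only: Fixed_def mem_Collect_eq)
    then obtain x where x: "x \<in> words q n" "z = skey q n x" unfolding letters_def by (rule imageE)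
    then have "x \<in> ?A" using z skey_Fixed[OF x(1)] by (simp only: mem_Collect_eq simp_thms)
    then show "z \<in> skey q n ` ?A" unfolding x(2) by (rule imageI)
  next
    fix z assume "z \<in> skey q n ` ?A"
    then obtain x where x: "x \<in> ?A" "z = skey q n x" by (rule imageE)
    then show "z \<in> {x\<in>Fixed s. Q x}" using skey_Fixed[of x s] by (simp only: mem_Collect_eq simp_thms)
  qed
  moreover have "inj_on (skey q n) ?A" by (rule inj_on_subset[OF skey_inj[OF proper]]) (rule Collect_restrict)
  ultimately show ?thesis by (simp only: card_image)
qed

lemma card_Fixed: "card (Fixed s) = num_fixed q n s"
  using card_Fixed_if[of s "\<lambda>_. True"] by (simp only: num_fixed_def simp_thms Collect_mem_eq)

text \<open>
  This closes the recursion: fixed letters of an orbit below that of \<open>w ! j\<close> are the words of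
  size \<open>n\<close> counted by \<open>num_below\<close> for the \<open>j\<close>-th slice.
\<close>

lemma card_Fixed_class: "j < m \<Longrightarrow>
  card {x\<in>Fixed s. x div prod_list n < code q n m y ! j div prod_list n} = num_below q n s (slice n y j)"
  unfolding card_Fixed_if num_below_def by (simp add: code_nth skey_div[OF proper])

end

section \<open>Expressions with bounded sums and searches\<close>

text \<open>
  \<open>XAgg g x y e\<close> evaluates \<open>e\<close> with \<open>x\<close> ranging below the value of the variable \<open>y\<close>, and either adds up the
  results or finds the first \<open>x\<close> with a nonzero result. The bound is a variable, not an
  expression, so that the running time is governed by the values of few variables.
\<close>

datatype agg = Total | First

datatype xexp = XL nat | XV nat | XC nat xexp | XB binop xexp xexp | XAgg agg nat nat xexp

text \<open>
  The search is a fold as well: the accumulator counts the leading zeros and stops growing once it lags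
  behind the index. If there is no nonzero result, it ends up as the bound.
\<close>

fun agg_step :: "agg \<Rightarrow> nat \<Rightarrow> nat \<Rightarrow> nat \<Rightarrow> nat" where
  "agg_step Total i v acc = acc + v"
| "agg_step First i v acc = acc + (if acc = i then 1 else 0) * (if v = 0 then 1 else 0)"

fun agg_fold :: "agg \<Rightarrow> nat \<Rightarrow> (nat \<Rightarrow> nat) \<Rightarrow> nat" where
  "agg_fold g 0 f = 0"
| "agg_fold g (Suc i) f = agg_step g i (f i) (agg_fold g i f)"

lemma agg_fold_Total [simp]: "agg_fold Total n f = (\<Sum>i<n. f i)"
  by (induction n) auto

lemma agg_fold_First [simp]: "agg_fold First n f = (LEAST i. n \<le> i \<or> f i \<noteq> 0)"
proof (induction n)
  case 0
  show ?case by (simp add: Least_eq_0)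
next
  case (Suc n)
  let ?P = "\<lambda>n i. n \<le> i \<or> f i \<noteq> 0"
  have ex: "?P n n" by simp
  have P: "?P n (Least (?P n))" by (rule LeastI[of "?P n", OF ex])
  have le: "Least (?P n) \<le> n" by (rule Least_le[of "?P n", OF ex])
  have below: "\<not> ?P n i" if "i < Least (?P n)" for i using not_less_Least[OF that] .
  show ?case
  proof (cases "Least (?P n) = n \<and> f n = 0")
    case True
    have "Least (?P (Suc n)) = Suc n"
    proof (rule Least_equality)
      fix i assume i: "?P (Suc n) i"
      show "Suc n \<le> i"
      proof (rule ccontr)
        assume "\<not> Suc n \<le> i"
        then have "f i \<noteq> 0" "i \<le> n" using i by auto
        then show False using True below[of i] by (cases "i = n") auto
      qed
    qed simp
    then show ?thesis using Suc True by simp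
  next
    case False
    have "Least (?P (Suc n)) = Least (?P n)"
    proof (rule Least_equality)
      show "?P (Suc n) (Least (?P n))" using P le False by auto
      fix i assume "?P (Suc n) i"
      then have "?P n i" by auto
      then show "Least (?P n) \<le> i" by (rule Least_le)
    qed
    then show ?thesis using Suc False by auto
  qed
qed

fun xev :: "(nat \<Rightarrow> nat) \<Rightarrow> (nat \<Rightarrow> nat \<Rightarrow> nat) \<Rightarrow> xexp \<Rightarrow> nat" where
  "xev V A (XL c) = c"
| "xev V A (XV x) = V x"
| "xev V A (XC a e) = A a (xev V A e)"
| "xev V A (XB f e1 e2) = apply_op f (xev V A e1) (xev V A e2)"
| "xev V A (XAgg g x y e) = agg_fold g (V y) (\<lambda>i. xev (V(x := i)) A e)"

text \<open>
  Variables below 20 belong to the program, those from 20 to 99 are bound variables, numbered by nesting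
  depth, and those from 100 on are temporaries of compiled code.
\<close>

fun wfx :: "nat \<Rightarrow> xexp \<Rightarrow> bool" where
  "wfx n (XL c) = True"
| "wfx n (XV x) = (x < n)"
| "wfx n (XC a e) = wfx n e"
| "wfx n (XB f e1 e2) = (wfx n e1 \<and> wfx n e2)"
| "wfx n (XAgg g x y e) = (x = n \<and> n < 100 \<and> y < 20 \<and> wfx (n + 1) e)"

fun bnds :: "xexp \<Rightarrow> nat set" where
  "bnds (XL c) = {}"
| "bnds (XV x) = {}"
| "bnds (XC a e) = bnds e"
| "bnds (XB f e1 e2) = bnds e1 \<union> bnds e2"
| "bnds (XAgg g x y e) = insert y (bnds e)"

text \<open>
  If variables and cells are at most \<open>S\<close>, an expression and all its parts are at most \<open>S ^ vdeg e\<close>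
  (\<open>xev_le\<close>). If all loop bounds are at most \<open>P\<close>, its evaluation takes time
  \<open>tcoef e * P ^ tdeg e\<close> (\<open>compile_correct\<close>).
\<close>

fun vdeg :: "xexp \<Rightarrow> nat" where
  "vdeg (XL c) = c + 1"
| "vdeg (XV x) = 1"
| "vdeg (XC a e) = vdeg e + 1"
| "vdeg (XB f e1 e2) = vdeg e1 + vdeg e2"
| "vdeg (XAgg g x y e) = vdeg e + 2"

fun tdeg :: "xexp \<Rightarrow> nat" where
  "tdeg (XL c) = 0"
| "tdeg (XV x) = 0"
| "tdeg (XC a e) = tdeg e"
| "tdeg (XB f e1 e2) = max (tdeg e1) (tdeg e2)"
| "tdeg (XAgg g x y e) = tdeg e + 1"

fun tcoef :: "xexp \<Rightarrow> nat" where
  "tcoef (XL c) = 2"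
| "tcoef (XV x) = 2"
| "tcoef (XC a e) = tcoef e + 3"
| "tcoef (XB f e1 e2) = tcoef e1 + tcoef e2 + 4"
| "tcoef (XAgg g x y e) = tcoef e + 26"

text \<open>One step of the fold, with the accumulator in \<open>k\<close> and the value of the body in \<open>k + 1\<close>.\<close>

fun agg_exp :: "agg \<Rightarrow> nat \<Rightarrow> nat \<Rightarrow> exp" where
  "agg_exp Total k x = Bin Plus (Var k) (Var (k + 1))"
| "agg_exp First k x = Bin Plus (Var k) (Bin Times (Bin Equal (Var k) (Var x)) (Bin Equal (Var (k + 1)) (Lit 0)))"

text \<open>The value is left in the temporary \<open>k\<close>; temporaries from \<open>k\<close> on are overwritten.\<close>

fun compile :: "nat \<Rightarrow> xexp \<Rightarrow> com" where
  "compile k (XL c) = Assign k (Lit c)"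
| "compile k (XV x) = Assign k (Var x)"
| "compile k (XC a e) = Seq (compile k e) (Assign k (Cell a (Var k)))"
| "compile k (XB f e1 e2) =
     Seq (compile k e1) (Seq (compile (k + 1) e2) (Assign k (Bin f (Var k) (Var (k + 1)))))"
| "compile k (XAgg g x y e) =
     Seq (Assign k (Lit 0)) (Seq (Assign x (Lit 0))
       (While (Bin Less (Var x) (Var y))
         (Seq (compile (k + 1) e) (Seq (Assign k (agg_exp g k x)) (Assign x (Bin Plus (Var x) (Lit 1)))))))"

lemma vdeg_pos: "1 \<le> vdeg e"
  by (induction e) auto

lemma xev_cong: "wfx n e \<Longrightarrow> 20 \<le> n \<Longrightarrow> (\<And>x. x < n \<Longrightarrow> V x = V' x) \<Longrightarrow> xev V A e = xev V' A e"
proof (induction e arbitrary: n V V')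
  case (XAgg g x y e)
  have "xev (V(x := i)) A e = xev (V'(x := i)) A e" for i
    by (rule XAgg.IH[of "n + 1"]) (use XAgg.prems in \<open>auto simp: less_Suc_eq\<close>)
  moreover have "V y = V' y" using XAgg.prems by auto
  ultimately show ?case by simp
next
  case (XB f e1 e2)
  then have "xev V A e1 = xev V' A e1" "xev V A e2 = xev V' A e2" by (metis wfx.simps(4))+
  then show ?case by simp
next
  case (XC a e)
  then have "xev V A e = xev V' A e" by (metis wfx.simps(3))
  then show ?case by simp
qed auto

lemma power_sum_le: "a \<le> (S::nat) ^ m \<Longrightarrow> b \<le> S ^ k \<Longrightarrow> 2 \<le> S \<Longrightarrow> 1 \<le> m \<Longrightarrow> 1 \<le> k \<Longrightarrow> a + b \<le> S ^ (m + k)"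
proof -
  assume *: "a \<le> S ^ m" "b \<le> S ^ k" "2 \<le> S" "1 \<le> m" "1 \<le> k"
  have 2: "2 \<le> S ^ j" if "1 \<le> j" for j
    using *(3) that by (metis le_trans power_increasing power_one_right one_le_numeral)
  obtain u v where "S ^ m = 2 + u" "S ^ k = 2 + v" using 2[OF *(4)] 2[OF *(5)] by (auto simp: le_iff_add)
  then have "S ^ m + S ^ k \<le> S ^ m * S ^ k" by (simp add: algebra_simps)
  then show ?thesis using *(1,2) by (simp add: power_add)
qed

lemma apply_op_le:
  assumes "a \<le> (S::nat) ^ m" "b \<le> S ^ k" "2 \<le> S" "1 \<le> m" "1 \<le> k"
  shows "apply_op f a b \<le> S ^ (m + k)"
proof -
  have "a + b \<le> S ^ (m + k)" by (rule power_sum_le[OF assms])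
  moreover have "a * b \<le> S ^ (m + k)" unfolding power_add using assms(1,2) by (rule mult_le_mono)
  moreover have "1 \<le> S ^ (m + k)" using assms(3) by simp
  ultimately show ?thesis
    by (cases f) (auto intro: le_trans[OF div_le_dividend] le_trans[OF mod_less_eq_dividend])
qed

lemma agg_fold_le:
  assumes "\<And>i. i < n \<Longrightarrow> f i \<le> (M::nat)" "1 \<le> M"
  shows "agg_fold g n f \<le> n * M"
  using assms(1)
proof (induction n)
  case (Suc n)
  have "agg_step g n (f n) (agg_fold g n f) \<le> agg_fold g n f + M"
    using Suc.prems[of n] assms(2) by (cases g) auto
  moreover have "agg_fold g n f \<le> n * M" using Suc by simp
  ultimately show ?case by simp
qed simp

lemma xev_le:
  assumes "2 \<le> S" "\<And>a k. A a k \<le> S"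
  shows "wfx n e \<Longrightarrow> 20 \<le> n \<Longrightarrow> (\<And>x. x < n \<Longrightarrow> V x \<le> S) \<Longrightarrow> xev V A e \<le> S ^ vdeg e"
proof (induction e arbitrary: n V)
  case (XL c)
  have "c < 2 ^ c" by simp
  also have "(2::nat) ^ c \<le> S ^ c" using assms(1) by (rule power_mono) simp
  also have "S ^ c \<le> S ^ (c + 1)" using assms(1) by (intro power_increasing) auto
  finally show ?case by simp
next
  case (XC a e)
  have "S \<le> S ^ (vdeg e + 1)" using assms(1) by simp
  then show ?case using le_trans[OF assms(2)] by simp
next
  case (XB f e1 e2)
  then have "xev V A e1 \<le> S ^ vdeg e1" "xev V A e2 \<le> S ^ vdeg e2" by (metis wfx.simps(4))+
  then show ?case using apply_op_le[OF _ _ assms(1) vdeg_pos vdeg_pos] by simp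
next
  case (XAgg g x y e)
  have Vy: "V y \<le> S" using XAgg.prems by auto
  have "xev (V(x := i)) A e \<le> S ^ vdeg e" if "i < V y" for i
  proof (rule XAgg.IH[of "n + 1"])
    have "i \<le> S" using that Vy by simp
    then show "(V(x := i)) z \<le> S" if "z < n + 1" for z using that XAgg.prems by (auto simp: less_Suc_eq)
  qed (use XAgg.prems in auto)
  then have "agg_fold g (V y) (\<lambda>i. xev (V(x := i)) A e) \<le> V y * S ^ vdeg e"
    using assms(1) by (intro agg_fold_le) auto
  also have "\<dots> \<le> S * S ^ vdeg e" using Vy by simp
  also have "\<dots> \<le> S ^ (vdeg e + 2)" using assms(1) by simp
  finally show ?case by simp
qed auto

text \<open>
  The constant 4 per round is the cost of evaluating and testing \<open>Var x < Var y\<close>; the last, failing test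
  accounts for the final 4.
\<close>

lemma count_loop:
  assumes step: "\<And>i s. i < n \<Longrightarrow> J i s \<Longrightarrow> \<exists>t s'. exec B c s t s' \<and> t \<le> T \<and> J (Suc i) s'"
    and xy: "\<And>i s. i \<le> n \<Longrightarrow> J i s \<Longrightarrow> scalar s x = i \<and> scalar s y = n" and B: "n \<le> B" "1 \<le> B"
  shows "i \<le> n \<Longrightarrow> J i s \<Longrightarrow>
    \<exists>t s'. exec B (While (Bin Less (Var x) (Var y)) c) s t s' \<and> t \<le> (n - i) * (T + 4) + 4 \<and> J n s'"
proof (induction "n - i" arbitrary: i s)
  case 0
  then have "i = n" by simp
  have "exec B (While (Bin Less (Var x) (Var y)) c) s (cost (Bin Less (Var x) (Var y)) + 1) s"
    by (rule exec_While_false) (use xy[of n s] 0 \<open>i = n\<close> B in auto)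
  then show ?case using 0 \<open>i = n\<close> by (intro exI[of _ 4] exI[of _ s]) (simp add: eval_nat_numeral)
next
  case (Suc k)
  then have i: "i < n" and k: "k = n - Suc i" by simp_all
  obtain t1 s1 where s1: "exec B c s t1 s1" "t1 \<le> T" "J (Suc i) s1" using step[OF i Suc.prems(2)] by auto
  obtain t2 s2 where s2: "exec B (While (Bin Less (Var x) (Var y)) c) s1 t2 s2" "t2 \<le> (n - Suc i) * (T + 4) + 4" "J n s2"
    using Suc.hyps(1)[of "Suc i" s1] k i s1(3) by auto
  have "exec B (While (Bin Less (Var x) (Var y)) c) s (cost (Bin Less (Var x) (Var y)) + 1 + t1 + t2) s2"
    by (rule exec_While_true[OF _ _ s1(1) s2(1)]) (use xy[of i s] Suc.prems i B in auto)
  moreover have "n - i = Suc (n - Suc i)" using i by simp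
  then have "cost (Bin Less (Var x) (Var y)) + 1 + t1 + t2 \<le> (n - i) * (T + 4) + 4" using s1(2) s2(2) by simp
  ultimately show ?case using s2(3) by blast
qed

lemma scale_mono: "1 \<le> (P::nat) \<Longrightarrow> d \<le> d' \<Longrightarrow> c \<le> c' \<Longrightarrow> c * P ^ d \<le> c' * P ^ d'"
  by (intro mult_le_mono power_increasing) auto

text \<open>
  Arrays are never written, and of the variables only temporaries from \<open>k\<close> on and bound variables
  change, so subexpressions do not disturb each other. Bound variables do not exceed the loop bounds,
  hence not \<open>S\<close>, whereas temporaries may grow up to \<open>S ^ vdeg e\<close>.
\<close>

lemma compile_correct:
  assumes S: "2 \<le> S" and P: "1 \<le> P"
  shows "wfx n e \<Longrightarrow> 20 \<le> n \<Longrightarrow> n \<le> 100 \<Longrightarrow> 100 \<le> k \<Longrightarrow> S ^ vdeg e \<le> B \<Longrightarrow> (\<And>x. x < 100 \<Longrightarrow> scalar s x \<le> S) \<Longrightarrow>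
    (\<And>a j. arr s a j \<le> S) \<Longrightarrow> (\<And>y. y \<in> bnds e \<Longrightarrow> scalar s y \<le> P) \<Longrightarrow>
    \<exists>t s'. exec B (compile k e) s t s' \<and> t \<le> tcoef e * P ^ tdeg e \<and> scalar s' k = xev (scalar s) (arr s) e \<and>
      arr s' = arr s \<and> (\<forall>x. x < n \<or> 100 \<le> x \<and> x < k \<longrightarrow> scalar s' x = scalar s x) \<and> (\<forall>x<100. scalar s' x \<le> S)"
proof (induction e arbitrary: n k s)
  case (XL c)
  have "c \<le> B"
    using xev_le[OF S XL.prems(7), of n "XL c" "scalar s"] XL.prems by simp
  then have "exec B (compile k (XL c)) s 2 (Store ((scalar s)(k := c)) (arr s))"
    using exec_Assign[of B s "Lit c" k] by (simp add: eval_nat_numeral)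
  then show ?case using XL.prems by (intro exI[of _ 2] exI) (auto)
next
  case (XV x)
  have "scalar s x \<le> B"
    using XV.prems(5) XV.prems(6)[of x] XV.prems(1,3) by simp
  then have "exec B (compile k (XV x)) s 2 (Store ((scalar s)(k := scalar s x)) (arr s))"
    using exec_Assign[of B s "Var x" k] by (simp add: eval_nat_numeral)
  then show ?case using XV.prems by (intro exI[of _ 2] exI) (auto)
next
  case (XC a e)
  have B: "xev (scalar s) (arr s) e \<le> S ^ vdeg e"
    using xev_le[OF S XC.prems(7), of n e "scalar s"] XC.prems by simp
  have e_B: "S ^ vdeg e \<le> B" "S \<le> B"
  proof -
    have "S ^ vdeg e \<le> S ^ (vdeg e + 1)" "S ^ 1 \<le> S ^ (vdeg e + 1)"
      by (rule power_increasing; use S in simp)+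
    then show "S ^ vdeg e \<le> B" "S \<le> B"
      using le_trans[OF _ XC.prems(5)[unfolded vdeg.simps]] unfolding power_one_right by blast+
  qed
  obtain t s' where s': "exec B (compile k e) s t s'" "t \<le> tcoef e * P ^ tdeg e" "scalar s' k = xev (scalar s) (arr s) e"
      "arr s' = arr s" "\<forall>x. x < n \<or> 100 \<le> x \<and> x < k \<longrightarrow> scalar s' x = scalar s x" "\<forall>x<100. scalar s' x \<le> S"
    using XC.IH[of n k s] XC.prems e_B by auto
  have ex: "exec B (compile k (XC a e)) s (t + 3) (Store ((scalar s')(k := arr s' a (scalar s' k))) (arr s'))"
    using exec_Seq[OF s'(1) exec_Assign[of B s' "Cell a (Var k)" k]] B e_B s'(3,4) XC.prems(7)
    by (simp add: le_trans[OF _ e_B(1)] le_trans[OF _ e_B(2)] eval_nat_numeral)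
  have tm: "t + 3 \<le> tcoef (XC a e) * P ^ tdeg (XC a e)"
  proof -
    have "3 \<le> 3 * P ^ tdeg e" using P by simp
    then show ?thesis using s'(2) by (simp add: algebra_simps)
  qed
  show ?case
  proof (intro exI conjI)
    show "exec B (compile k (XC a e)) s (t + 3) (Store ((scalar s')(k := arr s' a (scalar s' k))) (arr s'))" by (rule ex)
    show "t + 3 \<le> tcoef (XC a e) * P ^ tdeg (XC a e)" by (rule tm)
  qed (use s' XC.prems(2,3,4) in simp_all)
next
  case (XB f e1 e2)
  have e_B: "S ^ vdeg e1 \<le> B" "S ^ vdeg e2 \<le> B"
  proof -
    have "S ^ vdeg e1 \<le> S ^ (vdeg e1 + vdeg e2)" "S ^ vdeg e2 \<le> S ^ (vdeg e1 + vdeg e2)" 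
      using S by (auto intro!: power_increasing)
    then show "S ^ vdeg e1 \<le> B" "S ^ vdeg e2 \<le> B" using XB.prems(5) by simp_all
  qed
  have v: "xev (scalar s) (arr s) e1 \<le> B" "xev (scalar s) (arr s) e2 \<le> B" "xev (scalar s) (arr s) (XB f e1 e2) \<le> B"
    using xev_le[OF S XB.prems(7), of n e1 "scalar s"] xev_le[OF S XB.prems(7), of n e2 "scalar s"]
      xev_le[OF S XB.prems(7), of n "XB f e1 e2" "scalar s"] XB.prems e_B
    by (simp_all add: order.trans[OF _ e_B(1)] order.trans[OF _ e_B(2)] order.trans[OF _ XB.prems(5)])
  obtain t1 s1 where s1: "exec B (compile k e1) s t1 s1" "t1 \<le> tcoef e1 * P ^ tdeg e1" "scalar s1 k = xev (scalar s) (arr s) e1"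
      "arr s1 = arr s" "\<forall>x. x < n \<or> 100 \<le> x \<and> x < k \<longrightarrow> scalar s1 x = scalar s x" "\<forall>x<100. scalar s1 x \<le> S"
    using XB.IH(1)[of n k s] XB.prems e_B by auto
  have bnd: "y < 20" if "wfx n e" "y \<in> bnds e" for y n e
    using that by (induction e arbitrary: n) auto
  have sb: "scalar s1 y \<le> P" if "y \<in> bnds e2" for y
  proof -
    have "y < n" using bnd[of n e2 y] XB.prems(1,2) that by simp
    then show ?thesis using s1(5) XB.prems(8)[of y] that by simp
  qed
  obtain t2 s2 where s2: "exec B (compile (k + 1) e2) s1 t2 s2" "t2 \<le> tcoef e2 * P ^ tdeg e2"
      "scalar s2 (k + 1) = xev (scalar s1) (arr s1) e2"
      "arr s2 = arr s1" "\<forall>x. x < n \<or> 100 \<le> x \<and> x < k + 1 \<longrightarrow> scalar s2 x = scalar s1 x" "\<forall>x<100. scalar s2 x \<le> S"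
    using XB.IH(2)[of n "k + 1" s1] XB.prems e_B s1(4,6) sb by auto
  have e2: "xev (scalar s1) (arr s1) e2 = xev (scalar s) (arr s) e2"
    unfolding s1(4) by (rule xev_cong[of n]) (use XB.prems s1(5) in auto)
  have sk: "scalar s2 k = xev (scalar s) (arr s) e1" using s2(5) s1(3) XB.prems(4) by simp
  let ?s = "Store ((scalar s2)(k := xev (scalar s) (arr s) (XB f e1 e2))) (arr s2)"
  have "exec B (Assign k (Bin f (Var k) (Var (k + 1)))) s2 4 ?s"
    using exec_Assign[of B s2 "Bin f (Var k) (Var (k + 1))" k] v sk s2(3) e2 by (simp add: eval_nat_numeral)
  then have ex: "exec B (compile k (XB f e1 e2)) s (t1 + (t2 + 4)) ?s"
    using exec_Seq[OF s1(1) exec_Seq[OF s2(1)]] by simp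
  have tm: "t1 + (t2 + 4) \<le> tcoef (XB f e1 e2) * P ^ tdeg (XB f e1 e2)"
  proof -
    let ?d = "max (tdeg e1) (tdeg e2)"
    have "tcoef e1 * P ^ tdeg e1 \<le> tcoef e1 * P ^ ?d" "tcoef e2 * P ^ tdeg e2 \<le> tcoef e2 * P ^ ?d"
      "4 * P ^ 0 \<le> 4 * P ^ ?d" by (rule scale_mono[OF P]; simp)+
    then show ?thesis using s1(2) s2(2)
      unfolding tcoef.simps tdeg.simps distrib_right power_0 mult_1_right by linarith
  qed
  show ?case
  proof (intro exI conjI)
    show "exec B (compile k (XB f e1 e2)) s (t1 + (t2 + 4)) ?s" by (rule ex)
    show "t1 + (t2 + 4) \<le> tcoef (XB f e1 e2) * P ^ tdeg (XB f e1 e2)" by (rule tm)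
  qed (use s1 s2 XB.prems(2,3,4) in simp_all)
next
  case (XAgg g x y e)
  let ?N = "scalar s y"
  let ?f = "\<lambda>i. xev ((scalar s)(x := i)) (arr s) e"
  have x: "x = n" "n < 100" "y < 20" "wfx (n + 1) e" using XAgg.prems by auto
  have yP: "?N \<le> P" and yS: "?N \<le> S" using XAgg.prems x by auto
  have vB: "S ^ (vdeg e + 2) \<le> B" using XAgg.prems(5) by simp
  have SB: "S ^ vdeg e \<le> B" "S * S ^ vdeg e + 1 \<le> B" "S ^ vdeg e \<ge> S" 
  proof -
    have 1: "S * S ^ vdeg e + 1 \<le> S ^ (vdeg e + 2)"
    proof -
      have "1 \<le> S * S ^ vdeg e" using S by simp
      then have "S * S ^ vdeg e + 1 \<le> 2 * (S * S ^ vdeg e)" by simp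
      also have "\<dots> \<le> S * (S * S ^ vdeg e)" using S by (intro mult_le_mono1)
      finally show ?thesis by (simp add: power_add power2_eq_square algebra_simps)
    qed
    then show "S * S ^ vdeg e + 1 \<le> B" using vB by simp
    moreover have "1 * S ^ vdeg e \<le> S * S ^ vdeg e" using S by (intro mult_le_mono1) simp
    ultimately show "S ^ vdeg e \<le> B" by linarith
    have "S ^ 1 \<le> S ^ vdeg e" using S vdeg_pos by (intro power_increasing) auto
    then show "S ^ vdeg e \<ge> S" by simp
  qed
  have f_le: "?f i \<le> S ^ vdeg e" if "i < ?N" for i
  proof -
    have iS: "i \<le> S" using that yS by simp
    show ?thesis
    proof (rule xev_le[OF S XAgg.prems(7) x(4)])
      show "((scalar s)(x := i)) z \<le> S" if "z < n + 1" for z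
        using that iS x(1,2) XAgg.prems(6)[of z] by auto
    qed (use XAgg.prems(2) in simp)
  qed
  have fold_le: "agg_fold g i ?f \<le> S * S ^ vdeg e" if "i \<le> ?N" for i
  proof -
    have "agg_fold g i ?f \<le> i * S ^ vdeg e" using f_le that SB(3) S by (intro agg_fold_le) auto
    also have "\<dots> \<le> S * S ^ vdeg e" using that yS by (intro mult_le_mono1) simp
    finally show ?thesis .
  qed
  define J where "J i u \<longleftrightarrow> scalar u x = i \<and> scalar u k = agg_fold g i ?f \<and> arr u = arr s \<and>
      (\<forall>z. z < n \<or> 100 \<le> z \<and> z < k \<longrightarrow> scalar u z = scalar s z) \<and> (\<forall>z<100. scalar u z \<le> S)" for i u
  let ?c = "Seq (compile (k + 1) e) (Seq (Assign k (agg_exp g k x)) (Assign x (Bin Plus (Var x) (Lit 1))))"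
  let ?T = "tcoef e * P ^ tdeg e + 14"
  have step: "\<exists>t u'. exec B ?c u t u' \<and> t \<le> ?T \<and> J (Suc i) u'" if i: "i < ?N" and u: "J i u" for i u
  proof -
    note Ju = u[unfolded J_def]
    obtain t u1 where u1: "exec B (compile (k + 1) e) u t u1" "t \<le> tcoef e * P ^ tdeg e"
        "scalar u1 (k + 1) = xev (scalar u) (arr u) e"
        "arr u1 = arr u" "\<forall>z. z < n + 1 \<or> 100 \<le> z \<and> z < k + 1 \<longrightarrow> scalar u1 z = scalar u z" "\<forall>z<100. scalar u1 z \<le> S"
    proof -
      have bnd: "y < 20" if "wfx n e" "y \<in> bnds e" for y n e
        using that by (induction e arbitrary: n) auto
      have "scalar u z \<le> P" if "z \<in> bnds e" for z
      proof -
        have "z < n" using bnd[OF x(4) that] XAgg.prems(2) by simp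
        then show ?thesis using Ju XAgg.prems(8)[of z] that by simp
      qed
      then show ?thesis using XAgg.IH[of "n + 1" "k + 1" u] x Ju XAgg.prems SB(1) that by auto
    qed
    have v: "xev (scalar u) (arr u) e = ?f i"
    proof -
      have "xev (scalar u) (arr u) e = xev ((scalar s)(x := i)) (arr u) e"
        by (rule xev_cong[OF x(4)]) (use XAgg.prems Ju x in \<open>auto simp: less_Suc_eq\<close>)
      then show ?thesis using Ju by simp
    qed
    have sc: "scalar u1 (k + 1) = ?f i" "scalar u1 k = agg_fold g i ?f" "scalar u1 x = i"
      using u1(3,5) v Ju x XAgg.prems(4) by auto
    have iB: "i + 1 \<le> B" using i yS SB by simp
    have ge1: "1 \<le> S ^ vdeg e" using S by simp
    let ?u2 = "Store ((scalar u1)(k := agg_fold g (Suc i) ?f)) (arr u1)"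
    have fits: "fits B u1 (agg_exp g k x)" "eval_exp u1 (agg_exp g k x) = agg_fold g (Suc i) ?f"
        "cost (agg_exp g k x) \<le> 9"
      using sc f_le[OF i] fold_le[of i] fold_le[of "Suc i"] i iB SB by (cases g; auto)+
    have e2: "exec B (Assign k (agg_exp g k x)) u1 (cost (agg_exp g k x) + 1) ?u2"
      using exec_Assign[OF fits(1), of k] fits(2) by simp
    let ?u3 = "Store ((scalar ?u2)(x := i + 1)) (arr ?u2)"
    have xk: "x \<noteq> k" using x XAgg.prems(4) by simp
    have e3: "exec B (Assign x (Bin Plus (Var x) (Lit 1))) ?u2 4 ?u3"
      using exec_Assign[of B ?u2 "Bin Plus (Var x) (Lit 1)" x] sc xk iB by (simp add: eval_nat_numeral)
    have "exec B ?c u (t + (cost (agg_exp g k x) + 1 + 4)) ?u3"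
      by (rule exec_Seq[OF u1(1) exec_Seq[OF e2 e3]])
    moreover have "J (Suc i) ?u3"
      unfolding J_def using u1(4,5,6) Ju x XAgg.prems(4) i yS xk by auto
    ultimately show ?thesis using u1(2) fits(3)
      by (intro exI[of _ "t + (cost (agg_exp g k x) + 1 + 4)"] exI[of _ ?u3]) auto
  qed
  have xy: "scalar u x = i \<and> scalar u y = ?N" if "J i u" for i u
    using that x XAgg.prems(2) unfolding J_def by auto
  let ?s0 = "Store ((scalar s)(k := 0)) (arr s)"
  let ?s1 = "Store ((scalar ?s0)(x := 0)) (arr ?s0)"
  have J0: "J 0 ?s1" unfolding J_def using x XAgg.prems(4,6) by auto
  have NB: "?N \<le> B" "1 \<le> B" using yS SB by auto
  obtain t u where u: "exec B (While (Bin Less (Var x) (Var y)) ?c) ?s1 t u" "t \<le> (?N - 0) * (?T + 4) + 4" "J ?N u"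
    using count_loop[of ?N J B ?c ?T x y 0 ?s1, OF step xy NB _ J0] by auto
  have a0: "exec B (Assign k (Lit 0)) s 2 ?s0" using exec_Assign[of B s "Lit 0" k] by (simp add: eval_nat_numeral)
  have a1: "exec B (Assign x (Lit 0)) ?s0 2 ?s1" using exec_Assign[of B ?s0 "Lit 0" x] by (simp add: eval_nat_numeral)
  have ex: "exec B (compile k (XAgg g x y e)) s (2 + (2 + t)) u"
    unfolding compile.simps by (rule exec_Seq[OF a0 exec_Seq[OF a1 u(1)]])
  have "2 + (2 + t) \<le> tcoef (XAgg g x y e) * P ^ tdeg (XAgg g x y e)"
  proof -
    have "t \<le> P * (?T + 4) + 4" using u(2) yP by (meson add_le_mono1 diff_le_self le_trans mult_le_mono1)
    then have t: "t \<le> tcoef e * P ^ (tdeg e + 1) + 18 * P + 4" by (simp add: algebra_simps)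
    have "8 * P ^ 0 \<le> 8 * P ^ (tdeg e + 1)" "18 * P ^ 1 \<le> 18 * P ^ (tdeg e + 1)"
      by (rule scale_mono[OF P]; simp)+
    then show ?thesis
      using t unfolding tcoef.simps tdeg.simps distrib_right power_0 mult_1_right power_one_right by linarith
  qed
  then show ?case using ex u(3) unfolding J_def by (intro exI[of _ "2 + (2 + t)"] exI[of _ u]) auto
qed

section \<open>A Hoare logic with time bounds\<close>

text \<open>Assertions speak about the variables of the program and the arrays only.\<close>

definition vis :: "store \<Rightarrow> nat \<Rightarrow> nat" where
  "vis s = (\<lambda>x. if x < 20 then scalar s x else 0)"

definition small :: "nat \<Rightarrow> (nat \<Rightarrow> nat) \<Rightarrow> (nat \<Rightarrow> nat \<Rightarrow> nat) \<Rightarrow> bool" where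
  "small S V A \<longleftrightarrow> (\<forall>x. V x \<le> S) \<and> (\<forall>a k. A a k \<le> S)"

definition ok :: "nat \<Rightarrow> store \<Rightarrow> bool" where
  "ok S s \<longleftrightarrow> (\<forall>x<100. scalar s x \<le> S) \<and> (\<forall>a k. arr s a k \<le> S)"

lemma ok_small: "ok S s \<Longrightarrow> small S (vis s) (arr s)"
  by (auto simp: ok_def small_def vis_def)

type_synonym assertion = "(nat \<Rightarrow> nat) \<Rightarrow> (nat \<Rightarrow> nat \<Rightarrow> nat) \<Rightarrow> bool"

definition HSet :: "nat \<Rightarrow> xexp \<Rightarrow> com" where
  "HSet x e = Seq (compile 100 e) (Assign x (Var 100))"

definition HUpd :: "nat \<Rightarrow> xexp \<Rightarrow> xexp \<Rightarrow> com" where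
  "HUpd a i e = Seq (compile 100 i) (Seq (compile 101 e) (Update a (Var 100) (Var 101)))"

definition HFor :: "nat \<Rightarrow> nat \<Rightarrow> com \<Rightarrow> com" where
  "HFor x y c = Seq (Assign x (Lit 0))
     (While (Bin Less (Var x) (Var y)) (Seq c (Assign x (Bin Plus (Var x) (Lit 1)))))"

text \<open>Writes to the cells from the value of \<open>b\<close> on; variable 12 is the running offset.\<close>

definition HFill :: "nat \<Rightarrow> nat \<Rightarrow> xexp \<Rightarrow> xexp \<Rightarrow> com" where
  "HFill a y b e = HFor 12 y (HUpd a (XB Plus b (XV 12)) e)"

definition fill :: "nat \<Rightarrow> nat \<Rightarrow> (nat \<Rightarrow> nat) \<Rightarrow> (nat \<Rightarrow> nat) \<Rightarrow> nat \<Rightarrow> nat" where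
  "fill b n f g = (\<lambda>k. if b \<le> k \<and> k < b + n then f (k - b) else g k)"

text \<open>
  Values at rest are at most \<open>S\<close>. Intermediate results of expressions of degree at most \<open>D\<close> may exceed
  \<open>S\<close> and still fit into the machine.
\<close>

locale machine =
  fixes B S D :: nat
  assumes S2: "2 \<le> S" and SB: "S ^ D \<le> B" and D_pos: "1 \<le> D"
begin

lemma S_le_B: "S \<le> B"
proof -
  have "S ^ 1 \<le> S ^ D" using S2 D_pos by (intro power_increasing) auto
  then show ?thesis using SB by simp
qed

text \<open>The bound \<open>S\<close> on all stored values is part of every triple.\<close>

definition hoare :: "assertion \<Rightarrow> com \<Rightarrow> nat \<Rightarrow> assertion \<Rightarrow> bool" where
  "hoare Pr c T Q \<longleftrightarrow> (\<forall>s. ok S s \<and> Pr (vis s) (arr s) \<longrightarrow>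
     (\<exists>t s'. exec B c s t s' \<and> t \<le> T \<and> ok S s' \<and> Q (vis s') (arr s')))"

lemma hoare_conseq:
  assumes "hoare Pr c T Q" "\<And>V A. small S V A \<Longrightarrow> Pr' V A \<Longrightarrow> Pr V A" "T \<le> T'" "\<And>V A. small S V A \<Longrightarrow> Q V A \<Longrightarrow> Q' V A"
  shows "hoare Pr' c T' Q'"
  unfolding hoare_def
proof (intro allI impI, elim conjE)
  fix s assume s: "ok S s" "Pr' (vis s) (arr s)"
  then obtain t s' where "exec B c s t s'" "t \<le> T" "ok S s'" "Q (vis s') (arr s')"
    using assms(1,2) ok_small unfolding hoare_def by meson
  then show "\<exists>t s'. exec B c s t s' \<and> t \<le> T' \<and> ok S s' \<and> Q' (vis s') (arr s')"
    using assms(3,4) ok_small by (meson le_trans)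
qed

lemma hoare_Seq:
  assumes "hoare Pr c1 T1 Q" "hoare Q c2 T2 R"
  shows "hoare Pr (Seq c1 c2) (T1 + T2) R"
  unfolding hoare_def
proof (intro allI impI, elim conjE)
  fix s assume s: "ok S s" "Pr (vis s) (arr s)"
  obtain t s' where s': "exec B c1 s t s'" "t \<le> T1" "ok S s'" "Q (vis s') (arr s')"
    using assms(1) s unfolding hoare_def by blast
  obtain t2 s2 where s2: "exec B c2 s' t2 s2" "t2 \<le> T2" "ok S s2" "R (vis s2) (arr s2)"
    using assms(2) s' unfolding hoare_def by blast
  show "\<exists>t s'. exec B (Seq c1 c2) s t s' \<and> t \<le> T1 + T2 \<and> ok S s' \<and> R (vis s') (arr s')"
    using exec_Seq[OF s'(1) s2(1)] s' s2 by (meson add_le_mono)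
qed

lemma compile_ok:
  assumes "wfx 20 e" "vdeg e \<le> D" "100 \<le> k" "1 \<le> P" "ok S s" "\<And>y. y \<in> bnds e \<Longrightarrow> vis s y \<le> P"
  shows "\<exists>t s'. exec B (compile k e) s t s' \<and> t \<le> tcoef e * P ^ tdeg e \<and> scalar s' k = xev (vis s) (arr s) e \<and>
      arr s' = arr s \<and> vis s' = vis s \<and> (\<forall>x. 100 \<le> x \<and> x < k \<longrightarrow> scalar s' x = scalar s x) \<and> ok S s'"
proof -
  have vB: "S ^ vdeg e \<le> B"
    by (rule le_trans[OF power_increasing[OF assms(2)] SB]) (use S2 in simp)
  have bnd: "y < 20" if "wfx n e" "y \<in> bnds e" for y n e
    using that by (induction e arbitrary: n) auto
  have b: "scalar s y \<le> P" if "y \<in> bnds e" for y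
    using assms(6)[OF that] bnd[OF assms(1) that] by (simp add: vis_def)
  obtain t s' where s': "exec B (compile k e) s t s'" "t \<le> tcoef e * P ^ tdeg e" "scalar s' k = xev (scalar s) (arr s) e"
      "arr s' = arr s" "\<forall>x. x < 20 \<or> 100 \<le> x \<and> x < k \<longrightarrow> scalar s' x = scalar s x" "\<forall>x<100. scalar s' x \<le> S"
    using compile_correct[OF S2 assms(4,1) _ _ assms(3) vB, of s] assms(5) b unfolding ok_def by auto
  have "xev (scalar s) (arr s) e = xev (vis s) (arr s) e"
    by (rule xev_cong[OF assms(1)]) (auto simp: vis_def)
  moreover have "vis s' = vis s" using s'(5) by (auto simp: vis_def)
  moreover have "ok S s'" using s'(4,6) assms(5) by (simp add: ok_def)
  ultimately show ?thesis using s' by auto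
qed

lemma hoare_Set:
  assumes "wfx 20 e" "vdeg e \<le> D" "x < 20" "1 \<le> P"
    and "\<And>V A. small S V A \<Longrightarrow> Pr V A \<Longrightarrow> (\<forall>y\<in>bnds e. V y \<le> P) \<and> xev V A e \<le> S \<and> Q (V(x := xev V A e)) A"
  shows "hoare Pr (HSet x e) ((tcoef e + 2) * P ^ tdeg e) Q"
  unfolding hoare_def
proof (intro allI impI, elim conjE)
  fix s assume s: "ok S s" "Pr (vis s) (arr s)"
  note a = assms(5)[OF ok_small[OF s(1)] s(2)]
  obtain t s' where s': "exec B (compile 100 e) s t s'" "t \<le> tcoef e * P ^ tdeg e" "scalar s' 100 = xev (vis s) (arr s) e"
      "arr s' = arr s" "vis s' = vis s" "ok S s'"
    using compile_ok[OF assms(1,2) _ assms(4) s(1)] a by blast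
  let ?s = "Store ((scalar s')(x := xev (vis s) (arr s) e)) (arr s')"
  have "exec B (Assign x (Var 100)) s' 2 ?s"
    using exec_Assign[of B s' "Var 100" x] s'(3) a S_le_B by (simp add: eval_nat_numeral)
  then have "exec B (HSet x e) s (t + 2) ?s" unfolding HSet_def by (rule exec_Seq[OF s'(1)])
  moreover have "t + 2 \<le> (tcoef e + 2) * P ^ tdeg e"
  proof -
    have "2 \<le> 2 * P ^ tdeg e" using assms(4) by simp
    then show ?thesis using s'(2) by (simp add: algebra_simps)
  qed
  moreover have "ok S ?s" using s'(6) a by (simp add: ok_def)
  moreover have "vis ?s = (vis s)(x := xev (vis s) (arr s) e)" 
  proof
    fix z
    show "vis ?s z = ((vis s)(x := xev (vis s) (arr s) e)) z"
      using fun_cong[OF s'(5), of z] assms(3) by (simp add: vis_def split: if_splits)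
  qed
  ultimately show "\<exists>t s'. exec B (HSet x e) s t s' \<and> t \<le> (tcoef e + 2) * P ^ tdeg e \<and> ok S s' \<and> Q (vis s') (arr s')"
    using a s'(4) by (intro exI[of _ "t + 2"] exI[of _ ?s]) simp
qed

lemma hoare_Upd:
  assumes "wfx 20 e" "vdeg e \<le> D" "wfx 20 i" "vdeg i \<le> D" "1 \<le> P"
    and "\<And>V A. small S V A \<Longrightarrow> Pr V A \<Longrightarrow> (\<forall>y\<in>bnds e \<union> bnds i. V y \<le> P) \<and> xev V A e \<le> S \<and>
      Q V (A(a := (A a)(xev V A i := xev V A e)))"
  shows "hoare Pr (HUpd a i e) ((tcoef e + tcoef i + 3) * P ^ max (tdeg e) (tdeg i)) Q"
  unfolding hoare_def
proof (intro allI impI, elim conjE)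
  fix s assume s: "ok S s" "Pr (vis s) (arr s)"
  note a = assms(6)[OF ok_small[OF s(1)] s(2)]
  obtain t1 s1 where s1: "exec B (compile 100 i) s t1 s1" "t1 \<le> tcoef i * P ^ tdeg i" "scalar s1 100 = xev (vis s) (arr s) i"
      "arr s1 = arr s" "vis s1 = vis s" "ok S s1"
    using compile_ok[OF assms(3,4) _ assms(5) s(1)] a by blast
  obtain t2 s2 where s2: "exec B (compile 101 e) s1 t2 s2" "t2 \<le> tcoef e * P ^ tdeg e" "scalar s2 101 = xev (vis s1) (arr s1) e"
      "arr s2 = arr s1" "vis s2 = vis s1" "\<forall>x. 100 \<le> x \<and> x < 101 \<longrightarrow> scalar s2 x = scalar s1 x" "ok S s2"
    using compile_ok[OF assms(1,2) _ assms(5) s1(6), of 101] a s1(5) by auto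
  have iB: "xev (vis s) (arr s) i \<le> B"
  proof -
    have "xev (vis s) (arr s) i \<le> S ^ vdeg i"
      by (rule xev_le[OF S2 _ assms(3)]) (use ok_small[OF s(1)] in \<open>auto simp: small_def\<close>)
    also have "\<dots> \<le> S ^ D" using assms(4) S2 by (intro power_increasing) auto
    finally show ?thesis using SB by simp
  qed
  have v: "scalar s2 100 = xev (vis s) (arr s) i" "scalar s2 101 = xev (vis s) (arr s) e"
    using s1 s2 by auto
  let ?s = "Store (scalar s2) ((arr s2)(a := (arr s2 a)(xev (vis s) (arr s) i := xev (vis s) (arr s) e)))"
  have "exec B (Update a (Var 100) (Var 101)) s2 3 ?s"
    using exec_Update[of B s2 "Var 100" "Var 101" a] v a iB S_le_B by (simp add: eval_nat_numeral)
  then have "exec B (HUpd a i e) s (t1 + (t2 + 3)) ?s"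
    unfolding HUpd_def by (rule exec_Seq[OF s1(1) exec_Seq[OF s2(1)]])
  moreover have "t1 + (t2 + 3) \<le> (tcoef e + tcoef i + 3) * P ^ max (tdeg e) (tdeg i)"
  proof -
    let ?d = "max (tdeg e) (tdeg i)"
    have "tcoef e * P ^ tdeg e \<le> tcoef e * P ^ ?d" "tcoef i * P ^ tdeg i \<le> tcoef i * P ^ ?d"
      "3 * P ^ 0 \<le> 3 * P ^ ?d" by (rule scale_mono[OF assms(5)]; simp)+
    then show ?thesis using s1(2) s2(2) unfolding distrib_right power_0 mult_1_right by linarith
  qed
  moreover have "ok S ?s" using s2(7) a by (simp add: ok_def)
  moreover have "vis ?s = vis s2" by (rule ext) (simp add: vis_def)
  then have "vis ?s = vis s" using s1(5) s2(5) by simp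
  ultimately show "\<exists>t s'. exec B (HUpd a i e) s t s' \<and> t \<le> (tcoef e + tcoef i + 3) * P ^ max (tdeg e) (tdeg i) \<and>
      ok S s' \<and> Q (vis s') (arr s')"
    using a s1(4) s2(4) by (intro exI[of _ "t1 + (t2 + 3)"] exI[of _ ?s]) simp
qed

lemma hoare_For:
  assumes xy: "x < 20" "y < 20" "x \<noteq> y"
    and pre: "\<And>V A. small S V A \<Longrightarrow> Pr V A \<Longrightarrow> V y = n \<and> I 0 (V(x := 0)) A"
    and body: "\<And>i. i < n \<Longrightarrow> hoare (\<lambda>V A. I i V A \<and> V x = i \<and> V y = n) c T
      (\<lambda>V A. V x = i \<and> V y = n \<and> I (Suc i) (V(x := Suc i)) A)"
    and post: "\<And>V A. small S V A \<Longrightarrow> I n V A \<Longrightarrow> V x = n \<Longrightarrow> V y = n \<Longrightarrow> Q V A"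
  shows "hoare Pr (HFor x y c) (n * (T + 8) + 6) Q"
  unfolding hoare_def
proof (intro allI impI, elim conjE)
  fix s assume s: "ok S s" "Pr (vis s) (arr s)"
  note a = pre[OF ok_small[OF s(1)] s(2)]
  let ?s0 = "Store ((scalar s)(x := 0)) (arr s)"
  let ?c = "Seq c (Assign x (Bin Plus (Var x) (Lit 1)))"
  define J where "J i u \<longleftrightarrow> ok S u \<and> vis u x = i \<and> vis u y = n \<and> I i (vis u) (arr u)" for i u
  have nS: "n \<le> S" using s(1) a xy by (auto simp: ok_def vis_def)
  have upd: "vis (Store ((scalar u)(x := v)) A) = (vis u)(x := v)" for u v A
    using xy(1) by (auto simp: vis_def fun_eq_iff)
  have "J 0 ?s0" using s(1) a xy(1,3) unfolding J_def upd by (auto simp: ok_def)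
  moreover have "\<exists>t u'. exec B ?c u t u' \<and> t \<le> T + 4 \<and> J (Suc i) u'" if i: "i < n" and u: "J i u" for i u
  proof -
    obtain t u1 where u1: "exec B c u t u1" "t \<le> T" "ok S u1" "vis u1 x = i" "vis u1 y = n" "I (Suc i) ((vis u1)(x := Suc i)) (arr u1)"
      using body[OF i] u unfolding hoare_def J_def by blast
    let ?u = "Store ((scalar u1)(x := Suc i)) (arr u1)"
    have "exec B (Assign x (Bin Plus (Var x) (Lit 1))) u1 4 ?u"
      using exec_Assign[of B u1 "Bin Plus (Var x) (Lit 1)" x] u1(4) i nS S_le_B xy(1) 
      by (simp add: vis_def eval_nat_numeral)
    then have "exec B ?c u (t + 4) ?u" by (rule exec_Seq[OF u1(1)])
    moreover have "J (Suc i) ?u" using u1 i nS xy(3) unfolding J_def upd by (auto simp: ok_def)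
    ultimately show ?thesis using u1(2) by (intro exI[of _ "t + 4"] exI[of _ ?u]) simp
  qed
  moreover have "scalar u x = i \<and> scalar u y = n" if "i \<le> n" "J i u" for i u
    using that(2) xy unfolding J_def vis_def by auto
  ultimately obtain t u where u: "exec B (While (Bin Less (Var x) (Var y)) ?c) ?s0 t u" "t \<le> (n - 0) * (T + 4 + 4) + 4" "J n u"
    using count_loop[of n J B ?c "T + 4" x y 0 ?s0] nS S_le_B S2 by auto
  have "exec B (Assign x (Lit 0)) s 2 ?s0"
    using exec_Assign[of B s "Lit 0" x] by (simp add: eval_nat_numeral)
  then have "exec B (HFor x y c) s (2 + t) u" unfolding HFor_def by (rule exec_Seq[OF _ u(1)])
  moreover have "ok S u" "Q (vis u) (arr u)" using u(3) post ok_small unfolding J_def by auto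
  ultimately show "\<exists>t s'. exec B (HFor x y c) s t s' \<and> t \<le> n * (T + 8) + 6 \<and> ok S s' \<and> Q (vis s') (arr s')"
    using u(2) by (intro exI[of _ "2 + t"] exI[of _ u]) (auto simp: add.commute)
qed

text \<open>
  The entries are computed with the earlier part of the table already in place, so that a table may be defined
  by recursion. The number of entries is bounded by a monomial in \<open>P\<close> in order to obtain one for the time.
\<close>

lemma hoare_Fill:
  assumes wf: "wfx 20 e" "vdeg e \<le> D" "wfx 20 b" "vdeg b + 1 \<le> D" "y < 20" "y \<noteq> 12" "1 \<le> P" "12 \<notin> bnds e" "12 \<notin> bnds b"
    and n: "n \<le> c * P ^ r" "1 \<le> c"
    and pre: "\<And>V A z. small S V A \<Longrightarrow> Pr V A \<Longrightarrow> z < n \<Longrightarrow>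
      xev (V(12 := z)) (A(a := fill w z f (A a))) b = w \<and>
      xev (V(12 := z)) (A(a := fill w z f (A a))) e = f z \<and> f z \<le> S \<and> (\<forall>y\<in>bnds e \<union> bnds b. V y \<le> P)"
    and y: "\<And>V A. small S V A \<Longrightarrow> Pr V A \<Longrightarrow> V y = n"
    and post: "\<And>V A. small S V A \<Longrightarrow> Pr V A \<Longrightarrow> Q (V(12 := n)) (A(a := fill w n f (A a)))"
  shows "hoare Pr (HFill a y b e) (c * (tcoef e + tcoef b + 24) * P ^ (max (tdeg e) (tdeg b) + r)) Q"
proof -
  let ?d = "max (tdeg e) (tdeg b)"
  let ?T = "(tcoef e + (tcoef b + 6) + 3) * P ^ ?d"
  define I where "I i V A \<longleftrightarrow> (\<exists>V0 A0. small S V0 A0 \<and> Pr V0 A0 \<and> V = V0(12 := i) \<and> A = A0(a := fill w i f (A0 a)))" for i V A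
  have f0: "fill w 0 f g = g" for g by (auto simp: fill_def)
  have fS: "(fill w i f g)(w + i := f i) = fill w (Suc i) f g" for i g
    by (auto simp: fill_def fun_eq_iff)
  have "hoare Pr (HFill a y b e) (n * (?T + 8) + 6) Q"
    unfolding HFill_def
  proof (rule hoare_For[where I = I])
    fix V A assume VA: "small S V A" "Pr V A"
    have "A = A(a := fill w 0 f (A a))" by (simp add: f0)
    then show "V y = n \<and> I 0 (V(12 := 0)) A" unfolding I_def using y VA by blast
  next
    fix i assume i: "i < n"
    let ?Q = "\<lambda>V A. V 12 = i \<and> V y = n \<and> I (Suc i) (V(12 := Suc i)) A"
    have "hoare (\<lambda>V A. I i V A \<and> V 12 = i \<and> V y = n) (HUpd a (XB Plus b (XV 12)) e)
      ((tcoef e + tcoef (XB Plus b (XV 12)) + 3) * P ^ max (tdeg e) (tdeg (XB Plus b (XV 12)))) ?Q"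
    proof (rule hoare_Upd)
      show "wfx 20 e" "vdeg e \<le> D" "1 \<le> P" "wfx 20 (XB Plus b (XV 12))" "vdeg (XB Plus b (XV 12)) \<le> D"
        using wf by simp_all
      fix V A assume VA: "small S V A" "I i V A \<and> V 12 = i \<and> V y = n"
      then obtain V0 A0 where 0: "small S V0 A0" "Pr V0 A0" "V = V0(12 := i)" "A = A0(a := fill w i f (A0 a))"
        unfolding I_def by blast
      note p = pre[OF 0(1,2) i, folded 0(3,4)]
      have eq: "A(a := (A a)(w + i := f i)) = A0(a := fill w (Suc i) f (A0 a))"
        unfolding 0(4) fun_upd_same fS fun_upd_upd ..
      have V: "V(12 := Suc i) = V0(12 := Suc i)" using 0(3) by simp
      have "I (Suc i) (V(12 := Suc i)) (A(a := (A a)(w + i := f i)))"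
        unfolding I_def eq V using 0(1,2) by blast
      moreover have "\<forall>z\<in>bnds e \<union> bnds b. V z \<le> P" using p wf(8,9) unfolding 0(3) by (metis Un_iff fun_upd_other)
      moreover have "xev V A (XB Plus b (XV 12)) = w + i" using p VA(2) by simp
      ultimately show "(\<forall>z\<in>bnds e \<union> bnds (XB Plus b (XV 12)). V z \<le> P) \<and> xev V A e \<le> S \<and>
          ?Q V (A(a := (A a)(xev V A (XB Plus b (XV 12)) := xev V A e)))"
        using p VA(2) by simp
    qed
    then show "hoare (\<lambda>V A. I i V A \<and> V 12 = i \<and> V y = n) (HUpd a (XB Plus b (XV 12)) e) ?T ?Q"
      by (rule hoare_conseq) auto
  next
    fix V A assume "I n V A"
    then show "Q V A" unfolding I_def using post by blast
  qed (use wf in auto)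
  moreover have "n * (?T + 8) + 6 \<le> c * (tcoef e + tcoef b + 24) * P ^ (?d + r)"
  proof -
    have "8 \<le> 8 * P ^ ?d" using wf(7) by simp
    then have "?T + 8 \<le> (tcoef e + tcoef b + 17) * P ^ ?d" by (simp add: algebra_simps)
    then have "n * (?T + 8) \<le> (c * P ^ r) * ((tcoef e + tcoef b + 17) * P ^ ?d)" using n(1) by (rule mult_le_mono[rotated])
    also have "\<dots> = c * (tcoef e + tcoef b + 17) * P ^ (?d + r)" by (simp add: power_add algebra_simps)
    finally have "n * (?T + 8) \<le> c * (tcoef e + tcoef b + 17) * P ^ (?d + r)" .
    moreover have "6 * 1 \<le> c * 7 * P ^ (?d + r)" using n(2) wf(7) by (intro mult_le_mono) auto
    ultimately have "n * (?T + 8) + 6 \<le> (c * (tcoef e + tcoef b + 17) + c * 7) * P ^ (?d + r)"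
      unfolding distrib_right by linarith
    then show ?thesis by (simp add: algebra_simps)
  qed
  ultimately show ?thesis using hoare_conseq[where Pr = Pr and Pr' = Pr and Q = Q and Q' = Q] by blast
qed

lemma hoare_While:
  assumes x: "x < 20"
    and body: "\<And>i. i < n \<Longrightarrow> hoare (I i) c (T i) (I (Suc i))"
    and guard: "\<And>i V A. i \<le> n \<Longrightarrow> I i V A \<Longrightarrow> V x \<noteq> 0 \<longleftrightarrow> i < n"
  shows "hoare (I 0) (While (Var x) c) ((\<Sum>i<n. T i + 2) + 2) (I n)"
proof -
  have "\<exists>t s'. exec B (While (Var x) c) s t s' \<and> t \<le> (\<Sum>i\<in>{i..<n}. T i + 2) + 2 \<and> ok S s' \<and> I n (vis s') (arr s')"
    if "i \<le> n" "ok S s" "I i (vis s) (arr s)" for i s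
    using that
  proof (induction "n - i" arbitrary: i s)
    case 0
    then have "i = n" by simp
    have "scalar s x = 0" using guard[of i "vis s" "arr s"] 0 \<open>i = n\<close> x by (simp add: vis_def)
    then have "exec B (While (Var x) c) s 2 s" using exec_While_false[of B s "Var x" c] by (simp add: eval_nat_numeral)
    then show ?case using 0 \<open>i = n\<close> by (intro exI[of _ 2] exI[of _ s]) simp
  next
    case (Suc k)
    then have i: "i < n" by simp
    obtain t1 s1 where s1: "exec B c s t1 s1" "t1 \<le> T i" "ok S s1" "I (Suc i) (vis s1) (arr s1)"
      using body[OF i] Suc.prems unfolding hoare_def by blast
    have k: "k = n - Suc i" using Suc.hyps(2) by simp
    obtain t2 s2 where s2: "exec B (While (Var x) c) s1 t2 s2" "t2 \<le> (\<Sum>i\<in>{Suc i..<n}. T i + 2) + 2" "ok S s2" "I n (vis s2) (arr s2)"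
      using Suc.hyps(1)[OF k Suc_leI[OF i] s1(3,4)] by blast
    have g: "scalar s x \<noteq> 0" using guard[of i "vis s" "arr s"] Suc.prems i x by (simp add: vis_def)
    have "x < 100" using x by simp
    then have "scalar s x \<le> B" using Suc.prems(2) S_le_B unfolding ok_def by (meson le_trans)
    then have "exec B (While (Var x) c) s (2 + t1 + t2) s2"
      using exec_While_true[of B s "Var x" c t1 s1 t2 s2] g s1(1) s2(1) by (simp add: eval_nat_numeral)
    moreover have "2 + t1 + t2 \<le> (\<Sum>i\<in>{i..<n}. T i + 2) + 2"
      using s1(2) s2(2) i by (simp add: sum.atLeast_Suc_lessThan)
    ultimately show ?case using s2(3,4) by blast
  qed
  then show ?thesis unfolding hoare_def by (metis atLeast0LessThan le0)
qed

end

text \<open>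
  Truth values are 0 and 1. Conjunction is multiplication and evaluates both sides; this is harmless because
  every evaluation is defined, reading some irrelevant cell at worst.
\<close>

definition xnot :: "xexp \<Rightarrow> xexp" where "xnot e = XB Equal e (XL 0)"
definition xless :: "xexp \<Rightarrow> xexp \<Rightarrow> xexp" (infix "[<]" 50) where "(a [<] b) = XB Less a b"
definition xeq :: "xexp \<Rightarrow> xexp \<Rightarrow> xexp" (infix "[=]" 50) where "(a [=] b) = XB Equal a b"
definition xle :: "xexp \<Rightarrow> xexp \<Rightarrow> xexp" (infix "[\<le>]" 50) where "(a [\<le>] b) = xnot (b [<] a)"
definition xand :: "xexp \<Rightarrow> xexp \<Rightarrow> xexp" (infixr "[&]" 35) where "(a [&] b) = XB Times a b"
definition ximp :: "xexp \<Rightarrow> xexp \<Rightarrow> xexp" (infixr "[\<longrightarrow>]" 25) where "(a [\<longrightarrow>] b) = xnot (XB Times a (xnot b))"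
definition xall :: "nat \<Rightarrow> nat \<Rightarrow> xexp \<Rightarrow> xexp" where "xall x y e = xnot (XAgg Total x y (xnot e))"
definition xex :: "nat \<Rightarrow> nat \<Rightarrow> xexp \<Rightarrow> xexp" where "xex x y e = xnot (xnot (XAgg Total x y e))"
abbreviation xplus (infixl "[+]" 65) where "a [+] b \<equiv> XB Plus a b"
abbreviation xminus (infixl "[-]" 65) where "a [-] b \<equiv> XB Minus a b"
abbreviation xtimes (infixl "[*]" 70) where "a [*] b \<equiv> XB Times a b"
abbreviation xdiv (infixl "[div]" 70) where "a [div] b \<equiv> XB Divide a b"
abbreviation xmod (infixl "[mod]" 70) where "a [mod] b \<equiv> XB Modulo a b"
abbreviation xsum where "xsum x y e \<equiv> XAgg Total x y e"
abbreviation xfirst where "xfirst x y e \<equiv> XAgg First x y e"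

lemma xev_not [simp]: "xev V A (xnot e) = of_bool (xev V A e = 0)"
  by (simp add: xnot_def)

lemma xev_less [simp]: "xev V A (a [<] b) = of_bool (xev V A a < xev V A b)"
  by (simp add: xless_def)

lemma xev_eq [simp]: "xev V A (a [=] b) = of_bool (xev V A a = xev V A b)"
  by (simp add: xeq_def)

lemma xev_le' [simp]: "xev V A (a [\<le>] b) = of_bool (xev V A a \<le> xev V A b)"
  by (simp add: xle_def not_less)

lemma xev_and [simp]: "xev V A (a [&] b) = xev V A a * xev V A b"
  by (simp add: xand_def)

lemma xev_imp [simp]: "xev V A (a [\<longrightarrow>] b) = of_bool (xev V A a \<noteq> 0 \<longrightarrow> xev V A b \<noteq> 0)"
  by (simp add: ximp_def)

lemma xev_all [simp]: "xev V A (xall x y e) = of_bool (\<forall>i<V y. xev (V(x := i)) A e \<noteq> 0)"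
  by (auto simp: xall_def)

lemma xev_ex [simp]: "xev V A (xex x y e) = of_bool (\<exists>i<V y. xev (V(x := i)) A e \<noteq> 0)"
  by (auto simp: xex_def)

lemmas xdefs = xnot_def xless_def xeq_def xle_def xand_def ximp_def xall_def xex_def

section \<open>Tables and the expressions that define them\<close>

definition tab :: "(nat \<Rightarrow> nat \<Rightarrow> nat) \<Rightarrow> nat \<Rightarrow> nat \<Rightarrow> (nat \<Rightarrow> nat) \<Rightarrow> bool" where
  "tab A a n f \<longleftrightarrow> (\<forall>k<n. A a k = f k)"

lemma tabD: "tab A a n f \<Longrightarrow> k < n \<Longrightarrow> A a k = f k"
  by (simp add: tab_def)

lemma pair_lt: "i < x \<Longrightarrow> j < y \<Longrightarrow> i * y + j < x * (y :: nat)"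
proof -
  assume "i < x" "j < y"
  then have "i * y + j < (i + 1) * y" by simp
  also have "\<dots> \<le> x * y" using \<open>i < x\<close> by (intro mult_le_mono1) simp
  finally show ?thesis .
qed

lemma tab2: "tab A a (x * y) (\<lambda>k. f (k div y) (k mod y)) \<Longrightarrow> i < x \<Longrightarrow> j < y \<Longrightarrow> A a (i * y + j) = f i j"
  using pair_lt[of i x j y] by (simp add: tab_def)

text \<open>
  The search of \<open>XAgg First\<close> also stops at its bound; if a solution exists below the bound,
  this makes no difference.
\<close>

lemma Least_guard:
  fixes n :: nat
  assumes "\<exists>i<n. P i" "\<And>i. i < n \<Longrightarrow> P' i \<longleftrightarrow> P i"
  shows "(LEAST i. n \<le> i \<or> P' i) = (LEAST i. i < n \<and> P i)"
proof (rule Least_equality)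
  obtain i0 where "i0 < n \<and> P i0" using assms(1) by auto
  then have *: "(LEAST i. i < n \<and> P i) < n \<and> P (LEAST i. i < n \<and> P i)" by (rule LeastI)
  then show "n \<le> (LEAST i. i < n \<and> P i) \<or> P' (LEAST i. i < n \<and> P i)" using assms(2) by blast
  fix i assume i: "n \<le> i \<or> P' i"
  show "(LEAST i. i < n \<and> P i) \<le> i"
  proof (cases "i < n")
    case True
    then show ?thesis using i assms(2) by (intro Least_le) auto
  next
    case False
    then show ?thesis using * by simp
  qed
qed

text \<open>
  The tables of a level, flattened. Entry \<open>k\<close> of the first two belongs to the block \<open>k div prod_list n\<close> and
  the translation \<open>k mod prod_list n\<close>.
\<close>

definition key_tab :: "nat \<Rightarrow> nat list \<Rightarrow> (nat \<Rightarrow> word) \<Rightarrow> nat \<Rightarrow> nat" where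
  "key_tab q n blk k = skey q n (trn n (k mod prod_list n) (blk (k div prod_list n)))"

definition below_tab :: "nat \<Rightarrow> nat list \<Rightarrow> (nat \<Rightarrow> word) \<Rightarrow> nat \<Rightarrow> nat" where
  "below_tab q n blk k = num_below q n (k mod prod_list n) (blk (k div prod_list n))"

definition gadd_tab :: "nat list \<Rightarrow> nat \<Rightarrow> nat" where
  "gadd_tab n k = gadd n (k div prod_list n) (k mod prod_list n)"

text \<open>A coefficient of \<open>r\<close> in Bezout's identity for \<open>r\<close> and \<open>m\<close>.\<close>

definition unit_of :: "nat \<Rightarrow> nat \<Rightarrow> nat" where
  "unit_of m r = (LEAST u. m \<le> u \<or> (u * r) mod m = gcd r m mod m)"

lemma gcd_mult_ex: "1 \<le> (m :: nat) \<Longrightarrow> \<exists>u<m. (u * r) mod m = gcd r m mod m"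
proof -
  assume m: "1 \<le> m"
  have "\<exists>u. (u * r) mod m = gcd r m mod m"
  proof (cases "r = 0")
    case True
    then show ?thesis by simp
  next
    case False
    obtain x y where "r * x = m * y + gcd r m" using bezout_nat[OF False, of m] by auto
    then have "(x * r) mod m = gcd r m mod m" by (simp add: mult.commute)
    then show ?thesis by blast
  qed
  then obtain u where "(u * r) mod m = gcd r m mod m" by auto
  then have "((u mod m) * r) mod m = gcd r m mod m" by (simp add: mod_mult_left_eq)
  then show ?thesis using m by (intro exI[of _ "u mod m"]) simp
qed

lemma unit_of: "1 \<le> m \<Longrightarrow> unit_of m r < m" "1 \<le> m \<Longrightarrow> (unit_of m r * r) mod m = gcd r m mod m"
proof -
  assume m: "1 \<le> m"
  let ?P = "\<lambda>u. (u * r) mod m = gcd r m mod m"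
  have "unit_of m r = (LEAST u. u < m \<and> ?P u)"
    unfolding unit_of_def by (rule Least_guard) (use gcd_mult_ex[OF m] in auto)
  moreover have "(LEAST u. u < m \<and> ?P u) < m \<and> ?P (LEAST u. u < m \<and> ?P u)"
    by (rule LeastI_ex) (rule gcd_mult_ex[OF m])
  ultimately show "unit_of m r < m" "?P (unit_of m r)" by simp_all
qed

text \<open>
  The gcd is found by search: it is the least positive number that is congruent to a multiple of \<open>r\<close>
  modulo \<open>m\<close>. For \<open>r = 0\<close> this is \<open>m\<close> itself, so the rotation by 0 needs no special treatment.
\<close>

lemma gcd_first:
  assumes "1 \<le> (m :: nat)"
  shows "Suc (LEAST i. m \<le> i \<or> (\<exists>u<m. (u * r) mod m = Suc i mod m)) = gcd r m"
proof -
  have pos: "0 < gcd r m" using assms by simp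
  have le: "gcd r m \<le> m" using assms by (intro gcd_le2_nat) simp
  have "(LEAST i. m \<le> i \<or> (\<exists>u<m. (u * r) mod m = Suc i mod m)) = gcd r m - 1"
  proof (rule Least_equality)
    show "m \<le> gcd r m - 1 \<or> (\<exists>u<m. (u * r) mod m = Suc (gcd r m - 1) mod m)"
      using gcd_mult_ex[OF assms, of r] pos by simp
    fix i assume i: "m \<le> i \<or> (\<exists>u<m. (u * r) mod m = Suc i mod m)"
    show "gcd r m - 1 \<le> i"
    proof (cases "m \<le> i")
      case True
      then show ?thesis using le by simp
    next
      case False
      then obtain u where "(u * r) mod m = Suc i mod m" using i by auto
      moreover have "gcd r m dvd (u * r) mod m" by (simp add: dvd_mod)
      ultimately have "gcd r m dvd Suc i" by (metis dvd_mod_iff gcd_dvd2)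
      then show ?thesis by (auto dest: dvd_imp_le)
    qed
  qed
  then show ?thesis using pos by simp
qed

text \<open>
  The variables of the program at a level with prefix \<open>n\<close> and next entry \<open>m\<close>, where \<open>p = prod_list n\<close>, \<open>R = p * m\<close>
  and \<open>base = key_bound q n * p\<close>:
  0 the dimension, 2 \<open>N\<close>, 3 the length of \<open>n\<close>, 4 \<open>m\<close>, 5 \<open>p\<close>, 6 \<open>R\<close>, 7 the number of blocks of size \<open>n @ [m]\<close>, 8 \<open>base\<close>,
  9 \<open>R * R\<close>, 10 the current block, 11 the current translation \<open>g\<close>, 12 the offset in the table being filled,
  13 \<open>m + 1\<close>, 14 \<open>(m + 1) * p\<close>, 15 \<open>R * (m + 1) * R\<close>, 16 the least translation of the current block, 17 to 19 the
  parameters \<open>s\<close>, \<open>t\<close> and \<open>l\<close> of \<open>twisted_count\<close> for \<open>g\<close>. Variable 1 holds \<open>q\<close> in the input and later the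
  condition of the main loop.

  The arrays: 0 and 1 the input; 2 the keys of all translates of all blocks of size \<open>n\<close>; 3 the values of \<open>num_below\<close> for
  them; 4 the values of \<open>num_fixed\<close>; 5 the addition table of the group; 6 powers of \<open>base\<close>; 7 multiples of
  group elements; 8 powers of numbers of fixed words; 9 gcds; 10 coefficients \<open>unit_of\<close>. For the current
  block: 12 the keys of its translates; 13 the letters \<open>letter z\<close> of its canonical representation; 14 \<open>num_below\<close> for its slices;
  15 rejection; 16 successor states; 17 and 18 the first names of letters and states; 19 transition counts; 20 walk
  counts. Arrays 22 to 25 collect the contents of arrays 2 to 5 for the next level.
\<close>

abbreviation "vm \<equiv> XV 4" abbreviation "vp \<equiv> XV 5" abbreviation "vR \<equiv> XV 6"
abbreviation "vz \<equiv> XV 12"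

definition "eADD = XC 5 ((vz [div] vR [mod] vp) [*] vp [+] (vz [mod] vR [mod] vp))
  [+] vp [*] ((vz [div] vR [div] vp [+] vz [mod] vR [div] vp) [mod] vm)"
definition "ePOW = (vz [=] XL 0) [+] (XL 0 [<] vz) [*] (XC 6 (vz [-] XL 1) [*] XV 8)"
definition "eMUL = (vp [\<le>] vz) [*] XC 5 ((vz [mod] vp) [*] vp [+] XC 7 (vz [-] vp))"
definition "eFXP = (vz [<] vp) [+] (vp [\<le>] vz) [*] (XC 8 (vz [-] vp) [*] XC 4 (vz [mod] vp))"
definition "eLL = xfirst 20 4 (xex 21 4 ((XV 21 [*] (vz [div] vp)) [mod] vm [=] (XV 20 [+] XL 1) [mod] vm)) [+] XL 1"
definition "eUU = xfirst 20 4 ((XV 20 [*] (vz [div] vp)) [mod] vm [=] XC 9 vz [mod] vm)"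
definition "eS g = XC 7 ((vm [div] XC 9 g) [*] vp [+] g [mod] vp)"
definition "eT g = XC 7 (XC 10 g [*] vp [+] g [mod] vp)"
definition "eFX = XC 8 (XC 9 vz [*] vp [+] eS vz)"
definition "eWK = xsum 20 4 (XC 2 ((XV 10 [*] vm [+] (XV 20 [+] vz [div] vp) [mod] vm) [*] vp [+] vz [mod] vp)
  [*] XC 6 (vm [-] XL 1 [-] XV 20))"
definition "eG0 = xfirst 20 6 (xall 21 6 (XC 12 (XV 20) [\<le>] XC 12 (XV 21)))"
definition "eSK = XC 12 (XV 16) [*] vR [+] xfirst 20 6 (XC 12 (XC 25 (XV 20 [*] vR [+] vz)) [=] XC 12 (XV 16))"
definition "eK = XC 2 ((XV 10 [*] vm [+] (vz [div] vp [+] XV 16 [div] vp) [mod] vm) [*] vp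
  [+] XC 5 ((vz [mod] vp) [*] vp [+] XV 16 [mod] vp))"
definition "eKF = XC 3 ((XV 10 [*] vm [+] (vz [div] vp [+] XV 16 [div] vp) [mod] vm) [*] vp [+] vz [mod] vp)"

text \<open>
  In tables over pairs of names, \<open>vz div vR\<close> names the state and \<open>vz mod vR\<close> the letter. A name splits further
  into a place and a group element by division by \<open>vp\<close>.
\<close>

definition "eRJ = (let ja = vz [div] vR [div] vp; ha = vz [div] vR [mod] vp; x = vz [mod] vR; jy = XV 20 [div] vp; hy = XV 20 [mod] vp in
  xex 20 6 (jy [\<le>] ja
    [&] xall 21 4 (XV 21 [<] jy [\<longrightarrow>] XC 13 ((ja [-] jy [+] XV 21) [*] vp [+] XC 5 (hy [*] vp [+] ha)) [=] XC 13 (XV 21 [*] vp))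
    [&] XC 13 ((x [div] vp) [*] vp [+] XC 5 (hy [*] vp [+] x [mod] vp)) [<] XC 13 (jy [*] vp)))"
text \<open>
  The successor is the longest suffix that is a state, and among its names the least one. A search for the first hit
  finds it if candidate \<open>z\<close> stands for the name with place \<open>m - 1 - z div p\<close>, so that long candidates come first.
\<close>

definition "eDT = (let ja = vz [div] vR [div] vp; ha = vz [div] vR [mod] vp; x = vz [mod] vR;
    jb = vm [-] XL 1 [-] XV 20 [div] vp; hb = XV 20 [mod] vp;
    z = xfirst 20 6 (XL 0 [<] jb [\<longrightarrow>] jb [\<le>] ja [+] XL 1
      [&] XC 13 x [=] XC 13 ((jb [-] XL 1) [*] vp [+] hb)
      [&] xall 21 4 (XV 21 [+] XL 1 [<] jb [\<longrightarrow>] XC 13 ((ja [+] XL 1 [-] jb [+] XV 21) [*] vp [+] ha) [=] XC 13 (XV 21 [*] vp [+] hb)))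
  in (vm [-] XL 1 [-] z [div] vp) [*] vp [+] z [mod] vp)"
definition "eFI = xall 20 6 (XV 20 [<] vz [\<longrightarrow>] xnot (XC 13 (XV 20) [=] XC 13 vz))"
definition "eCA = xall 20 6 (XV 20 [<] vz [\<longrightarrow>] xnot (XV 20 [div] vp [=] vz [div] vp [&]
  xall 21 4 (XV 21 [<] vz [div] vp [\<longrightarrow>] XC 13 (XV 21 [*] vp [+] XV 20 [mod] vp) [=] XC 13 (XV 21 [*] vp [+] vz [mod] vp))))"
text \<open>The right-hand side of \<open>step_count_table\<close>.\<close>

definition "eMT = (let a = vz [div] vR; a' = vz [mod] vR; s = XV 17; x = XV 20;
    fix = XC 13 ((x [div] vp) [*] vp [+] XC 5 (s [*] vp [+] x [mod] vp)) [=] XC 13 x in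
  (a' [=] XL 0) [*] (XC 4 s [-] XC 14 ((a [div] vp) [*] vp [+] s)
     [-] xsum 20 6 (XC 17 x [&] fix [&] XC 13 ((a [div] vp) [*] vp) [div] vp [\<le>] XC 13 x [div] vp))
  [+] xsum 20 6 (XC 17 x [&] fix [&] xnot (XC 15 (a [*] vR [+] x)) [&] XC 16 (a [*] vR [+] x) [=] a'))"
text \<open>
  Walk counts are stored at \<open>(a * (m + 1) + i) * R + a'\<close> for walks of length \<open>i\<close> from \<open>a\<close> to \<open>a'\<close>. Filling in this order,
  the row for length \<open>i - 1\<close> and the same \<open>a\<close> is already complete.
\<close>

definition "eW = (let a' = vz [mod] vR; ai = vz [div] vR; i = ai [mod] XV 13; a = ai [div] XV 13 in
  (i [=] XL 0 [&] a [=] a' [&] XC 18 a)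
  [+] (XL 0 [<] i) [*] xsum 20 6 (XC 20 ((ai [-] XL 1) [*] vR [+] XV 20) [*] XC 19 (XV 20 [*] vR [+] a')))"
text \<open>The right-hand side of \<open>card_below\<close>.\<close>

definition "eFC = XC 8 (XV 19 [*] vp [+] XV 17) [-] xsum 20 6 (XC 18 (XV 20) [*] xsum 21 6
  ((XV 21 [div] vp [=] XV 20 [div] vp [&]
    xall 22 4 (XV 22 [<] XV 20 [div] vp [\<longrightarrow>] XC 13 (XV 22 [*] vp [+] XC 5 (XV 18 [*] vp [+] XV 21 [mod] vp))
      [=] XC 13 (XV 22 [*] vp [+] XV 20 [mod] vp)))
   [*] XC 20 ((XV 20 [*] XV 13 [+] XV 19) [*] vR [+] XV 21)))"

definition gmul :: "nat list \<Rightarrow> nat \<Rightarrow> nat \<Rightarrow> nat" where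
  "gmul n c h = (gadd n h ^^ c) 0"

section \<open>Correctness of the expressions\<close>

definition sv :: "nat \<Rightarrow> nat list \<Rightarrow> nat \<Rightarrow> (nat \<Rightarrow> nat) \<Rightarrow> bool" where
  "sv q n m V \<longleftrightarrow> V 4 = m \<and> V 5 = prod_list n \<and> V 6 = prod_list n * m \<and>
    V 8 = key_bound q n * prod_list n \<and> V 13 = m + 1"

text \<open>
  The word is cut into \<open>NB\<close> consecutive blocks \<open>BLK b\<close> of size \<open>n @ [m]\<close>, and each of these into \<open>m\<close> blocks
  of size \<open>n\<close>.
\<close>

locale level =
  fixes q :: nat and n :: "nat list" and m NB :: nat and blk BLK :: "nat \<Rightarrow> word"
  assumes proper: "proper n" and m1: "1 \<le> m" and NB_pos: "0 < NB"
    and BLK: "\<And>b. b < NB \<Longrightarrow> BLK b \<in> words q (n @ [m])"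
    and slice_BLK: "\<And>b i. b < NB \<Longrightarrow> i < m \<Longrightarrow> slice n (BLK b) i = blk (b * m + i)"
begin

abbreviation "p \<equiv> prod_list n"
abbreviation "R \<equiv> p * m"
abbreviation "base \<equiv> key_bound q n * p"

lemma p_pos: "0 < p" and R_pos: "0 < R"
  using proper_pos[OF proper] m1 by simp_all

lemma proper': "proper (n @ [m])"
  using proper m1 by simp

lemma blk_in: "b < NB \<Longrightarrow> i < m \<Longrightarrow> blk (b * m + i) \<in> words q n"
  using slice_BLK slice_in[OF BLK] by metis

lemma gmul_less: "gmul n c h < p"
  unfolding gmul_def using p_pos gadd_less[OF proper] by (cases c) auto

lemma R_split: "g < R \<Longrightarrow> g mod p < p \<and> g div p < m \<and> g = g mod p + p * (g div p)"
  using p_pos by (simp add: less_mult_imp_div_less mult.commute)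

lemma RR_split: "z < R * R \<Longrightarrow> z div R < R \<and> z mod R < R"
  using R_pos by (simp add: less_mult_imp_div_less)

lemma eval_ADD:
  assumes "sv q n m V" "tab A 5 (p * p) (gadd_tab n)" "z < R * R" "V 12 = z"
  shows "xev V A eADD = gadd_tab (n @ [m]) z"
proof -
  note z = RR_split[OF assms(3)]
  note g1 = R_split[OF z[THEN conjunct1]] and g2 = R_split[OF z[THEN conjunct2]]
  have "A 5 (z div R mod p * p + z mod R mod p) = gadd n (z div R mod p) (z mod R mod p)"
    by (rule tab2[of A 5 p p "gadd n"]) (use assms(2) g1 g2 in \<open>simp_all add: gadd_tab_def[abs_def]\<close>)
  moreover have "gadd (n @ [m]) (z div R) (z mod R) =
      gadd n (z div R mod p) (z mod R mod p) + p * ((z div R div p + z mod R div p) mod m)"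
    using gadd_snoc[OF proper, of "z div R mod p" "z mod R mod p" "z div R div p" m "z mod R div p"] g1 g2 by metis
  ultimately show ?thesis using assms(1,4) by (simp add: eADD_def sv_def gadd_tab_def)
qed

lemma eval_POW:
  assumes "sv q n m V" "tab A 6 z (\<lambda>i. base ^ i)" "V 12 = z"
  shows "xev V A ePOW = base ^ z"
proof (cases z)
  case (Suc i)
  then have "A 6 i = base ^ i" using tabD[OF assms(2), of i] by simp
  then show ?thesis using Suc assms(1,3) by (simp add: ePOW_def sv_def)
qed (use assms in \<open>simp add: ePOW_def sv_def\<close>)

lemma eval_MUL:
  assumes "sv q n m V" "tab A 5 (p * p) (gadd_tab n)" "tab A 7 z (\<lambda>k. gmul n (k div p) (k mod p))" "V 12 = z"
  shows "xev V A eMUL = gmul n (z div p) (z mod p)"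
proof (cases "z < p")
  case True
  then show ?thesis using assms(1,4) by (simp add: eMUL_def sv_def gmul_def)
next
  case False
  then have zp: "z - p < z" "z div p = Suc ((z - p) div p)" "(z - p) mod p = z mod p"
    using p_pos by (simp_all add: le_div_geq le_mod_geq)
  have "A 7 (z - p) = gmul n ((z - p) div p) (z mod p)" using tabD[OF assms(3) zp(1)] zp(3) by simp
  moreover have "A 5 (z mod p * p + gmul n ((z - p) div p) (z mod p)) = gadd n (z mod p) (gmul n ((z - p) div p) (z mod p))"
    by (rule tab2[of A 5 p p "gadd n"]) (use assms(2) gmul_less p_pos in \<open>simp_all add: gadd_tab_def[abs_def]\<close>)
  ultimately show ?thesis using False assms(1,4) zp(2) by (simp add: eMUL_def sv_def gmul_def)
qed

lemma eval_FXP: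
  assumes "sv q n m V" "tab A 4 p (num_fixed q n)" "tab A 8 z (\<lambda>k. num_fixed q n (k mod p) ^ (k div p))" "V 12 = z"
  shows "xev V A eFXP = num_fixed q n (z mod p) ^ (z div p)"
proof (cases "z < p")
  case True
  then show ?thesis using assms(1,4) by (simp add: eFXP_def sv_def)
next
  case False
  then have zp: "z - p < z" "z div p = Suc ((z - p) div p)" "(z - p) mod p = z mod p"
    using p_pos by (simp_all add: le_div_geq le_mod_geq)
  have "A 8 (z - p) = num_fixed q n (z mod p) ^ ((z - p) div p)" using tabD[OF assms(3) zp(1)] zp(3) by simp
  moreover have "A 4 (z mod p) = num_fixed q n (z mod p)" using tabD[OF assms(2)] p_pos by simp
  ultimately show ?thesis using False assms(1,4) zp(2) by (simp add: eFXP_def sv_def mult.commute)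
qed

lemma eval_LL:
  assumes "sv q n m V" "V 12 = z"
  shows "xev V A eLL = gcd (z div p) m"
  using gcd_first[OF m1, of "z div p"] assms by (simp add: eLL_def sv_def)

lemma eval_UU:
  assumes "sv q n m V" "tab A 9 R (\<lambda>g. gcd (g div p) m)" "z < R" "V 12 = z"
  shows "xev V A eUU = unit_of m (z div p)"
  using tabD[OF assms(2,3)] assms by (simp add: eUU_def sv_def unit_of_def)

text \<open>The group elements \<open>s\<close> and \<open>t\<close> of \<open>twisted_count\<close> for the translation \<open>g\<close>.\<close>

abbreviation "sft g \<equiv> gmul n (m div gcd (g div p) m) (g mod p)"
abbreviation "tft g \<equiv> gmul n (unit_of m (g div p)) (g mod p)"

lemma MUL_at:
  assumes "tab A 7 ((m + 1) * p) (\<lambda>k. gmul n (k div p) (k mod p))" "c \<le> m" "h < p"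
  shows "A 7 (c * p + h) = gmul n c h"
  by (rule tab2[OF assms(1)]) (use assms in auto)

lemma eval_S:
  assumes "sv q n m V" "tab A 9 R (\<lambda>g. gcd (g div p) m)" "tab A 7 ((m + 1) * p) (\<lambda>k. gmul n (k div p) (k mod p))"
    "g < R" "xev V A eg = g"
  shows "xev V A (eS eg) = sft g"
  using MUL_at[OF assms(3), of "m div gcd (g div p) m" "g mod p"] tabD[OF assms(2,4)] assms(1,5) p_pos
  by (simp add: eS_def sv_def)

lemma eval_T:
  assumes "sv q n m V" "tab A 10 R (\<lambda>g. unit_of m (g div p))" "tab A 7 ((m + 1) * p) (\<lambda>k. gmul n (k div p) (k mod p))"
    "g < R" "xev V A eg = g"
  shows "xev V A (eT eg) = tft g"
  using MUL_at[OF assms(3), of "unit_of m (g div p)" "g mod p"] tabD[OF assms(2,4)] assms(1,5) p_pos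
    unit_of(1)[OF m1, of "g div p"]
  by (simp add: eT_def sv_def)

lemma FXP_at:
  assumes "tab A 8 ((m + 1) * p) (\<lambda>k. num_fixed q n (k mod p) ^ (k div p))" "i \<le> m" "s < p"
  shows "A 8 (i * p + s) = num_fixed q n s ^ i"
  by (rule tab2[OF assms(1)]) (use assms in auto)

lemma gcd_le_m: "gcd r m \<le> m"
  using m1 by (intro gcd_le2_nat) simp

lemma eval_WK:
  assumes "sv q n m V" "tab A 2 (NB * m * p) (key_tab q n blk)" "tab A 6 (m + 1) (\<lambda>i. base ^ i)" "z < R" "V 12 = z" "V 10 = b" "b < NB"
  shows "xev V A eWK = wkey q (n @ [m]) (trn (n @ [m]) z (BLK b))"
proof -
  note z = R_split[OF assms(4)]
  have "A 2 ((b * m + (i + z div p) mod m) * p + z mod p) * A 6 (m - 1 - i) =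
      skey q n (slice n (trn (n @ [m]) z (BLK b)) i) * base ^ (m - 1 - i)" if i: "i < m" for i
  proof -
    let ?j = "(i + z div p) mod m"
    have j: "?j < m" using m1 by simp
    have "A 2 ((b * m + ?j) * p + z mod p) = skey q n (trn n (z mod p) (blk (b * m + ?j)))"
      by (rule tab2[of A 2 "NB * m" p "\<lambda>k h. skey q n (trn n h (blk k))"])
        (use assms(2) pair_lt[OF assms(7) j] z in \<open>simp_all add: key_tab_def[abs_def]\<close>)
    moreover have "slice n (trn (n @ [m]) z (BLK b)) i = trn n (z mod p) (blk (b * m + ?j))"
      using slice_trn[OF proper, of "z mod p" "z div p" m i "BLK b"] z i slice_BLK[OF assms(7) j] by metis
    moreover have "A 6 (m - 1 - i) = base ^ (m - 1 - i)" by (rule tabD[OF assms(3)]) simp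
    ultimately show ?thesis by simp
  qed
  then have "(\<Sum>i<m. A 2 ((b * m + (i + z div p) mod m) * p + z mod p) * A 6 (m - 1 - i)) =
      wkey q (n @ [m]) (trn (n @ [m]) z (BLK b))"
    by simp
  then show ?thesis using assms(1,5,6) by (simp add: eWK_def sv_def)
qed

definition G0 :: "nat \<Rightarrow> nat" where
  "G0 b = least_shift (wkey q (n @ [m])) (n @ [m]) (BLK b)"

lemmas ctx = proper' wkey_inj[OF proper', of q] wkey_bound[OF proper', of _ q]

lemma G0: "G0 b < R" "wkey q (n @ [m]) (trn (n @ [m]) (G0 b) (BLK b)) = mkey q (n @ [m]) (BLK b)"
  using least_shift[OF ctx, where x = "BLK b"] by (simp_all add: G0_def)

lemma eval_G0:
  assumes "sv q n m V" "tab A 12 R (\<lambda>g. wkey q (n @ [m]) (trn (n @ [m]) g (BLK b)))"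
  shows "xev V A eG0 = G0 b"
proof -
  let ?f = "\<lambda>g. wkey q (n @ [m]) (trn (n @ [m]) g (BLK b))"
  let ?k = "mkey q (n @ [m]) (BLK b)"
  have le: "?k \<le> ?f g" if "g < R" for g
    using least_key_le[OF ctx, where h = g and x = "BLK b"] that by simp
  have "(\<forall>g<R. A 12 i \<le> A 12 g) \<longleftrightarrow> ?f i = ?k" if "i < R" for i
  proof -
    have "(\<forall>g<R. A 12 i \<le> A 12 g) \<longleftrightarrow> (\<forall>g<R. ?f i \<le> ?f g)" using tabD[OF assms(2)] that by auto
    also have "\<dots> \<longleftrightarrow> ?f i = ?k" using G0[of b] le that by (metis order_antisym)
    finally show ?thesis .
  qed
  then have "(LEAST i. R \<le> i \<or> (\<forall>g<R. A 12 i \<le> A 12 g)) = (LEAST i. i < R \<and> ?f i = ?k)"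
    by (intro Least_guard) (use G0[of b] in auto)
  also have "\<dots> = G0 b" by (simp add: G0_def least_shift_def)
  finally show ?thesis using assms(1) by (simp add: eG0_def sv_def)
qed

text \<open>
  The translates of a translate of the block are again translates of the block, so its canonical
  representation and least translation are read off the table of keys of translates.
\<close>

lemma eval_SK:
  assumes "sv q n m V" "tab A 12 R (\<lambda>g. wkey q (n @ [m]) (trn (n @ [m]) g (BLK b)))" "tab A 25 (R * R) (gadd_tab (n @ [m]))"
    "V 16 = G0 b" "V 12 = z" "z < R" "b < NB"
  shows "xev V A eSK = key_tab q (n @ [m]) BLK (b * R + z)"
proof -
  let ?f = "\<lambda>g. wkey q (n @ [m]) (trn (n @ [m]) g (BLK b))"
  let ?y = "trn (n @ [m]) z (BLK b)"
  have k: "mkey q (n @ [m]) ?y = A 12 (G0 b)"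
    using mkey_trn[OF proper' BLK[OF assms(7)], of z] assms(6) tabD[OF assms(2) G0(1)] G0(2) by simp
  have f: "A 12 (A 25 (i * R + z)) = wkey q (n @ [m]) (trn (n @ [m]) i ?y)" if "i < R" for i
  proof -
    have "A 25 (i * R + z) = gadd (n @ [m]) i z"
      by (rule tab2[of A 25 R R "gadd (n @ [m])"]) (use assms(3,6) that in \<open>simp_all add: gadd_tab_def[abs_def]\<close>)
    then show ?thesis using tabD[OF assms(2), of "gadd (n @ [m]) i z"] gadd_less[OF proper', of i z] trn_gadd[OF proper'] by simp
  qed
  have "(LEAST i. R \<le> i \<or> A 12 (A 25 (i * R + z)) = A 12 (G0 b)) =
      (LEAST i. i < R \<and> wkey q (n @ [m]) (trn (n @ [m]) i ?y) = mkey q (n @ [m]) ?y)"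
    by (rule Least_guard) (use least_key_attained[OF ctx, where x = ?y] f k in auto)
  also have "\<dots> = least_shift (wkey q (n @ [m])) (n @ [m]) ?y" by (simp add: least_shift_def)
  finally have L: "(LEAST i. R \<le> i \<or> A 12 (A 25 (i * R + z)) = A 12 (G0 b)) =
    least_shift (wkey q (n @ [m])) (n @ [m]) ?y" .
  have "(b * R + z) div R = b" "(b * R + z) mod R = z" using assms(6) R_pos by simp_all
  then have "key_tab q (n @ [m]) BLK (b * R + z) = A 12 (G0 b) * R + least_shift (wkey q (n @ [m])) (n @ [m]) ?y"
    unfolding key_tab_def slice_key_def k[symmetric] by (simp del: wkey.simps)
  then show ?thesis unfolding L[symmetric]
    using assms(1,4,5) by (simp add: eSK_def sv_def)
qed

text \<open>The canonical representation of the block, to which the automaton belongs.\<close>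

definition yb :: "nat \<Rightarrow> word" where
  "yb b = trn (n @ [m]) (G0 b) (BLK b)"

lemma block_step: "b < NB \<Longrightarrow> block_step q n m (yb b)"
  by unfold_locales
    (use proper m1 trn_in[OF proper' BLK] G0 mkey_trn[OF proper' BLK, of b "G0 b"] in \<open>auto simp: yb_def\<close>)

lemma slice_yb:
  assumes "b < NB" "i < m"
  shows "slice n (yb b) i = trn n (G0 b mod p) (blk (b * m + (i + G0 b div p) mod m))"
proof -
  have "(i + G0 b div p) mod m < m" using m1 by simp
  then show ?thesis
    using slice_trn[OF proper, of "G0 b mod p" "G0 b div p" m i "BLK b"] R_split[OF G0(1)[of b]] assms
      slice_BLK[OF assms(1)] unfolding yb_def by metis
qed

text \<open>
  The slices of the canonical representation are translated blocks of the previous level, whose keys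
  are tabulated.
\<close>

lemma eval_K:
  assumes "sv q n m V" "tab A 2 (NB * m * p) (key_tab q n blk)" "tab A 5 (p * p) (gadd_tab n)" "z < R" "V 12 = z" "V 10 = b" "b < NB"
    "V 16 = G0 b"
  shows "xev V A eK = skey q n (trn n (z mod p) (slice n (yb b) (z div p)))"
proof -
  note z = R_split[OF assms(4)]
  let ?j = "(z div p + G0 b div p) mod m"
  have j: "?j < m" using m1 by simp
  have g: "G0 b mod p < p" using p_pos by simp
  have "A 5 (z mod p * p + G0 b mod p) = gadd n (z mod p) (G0 b mod p)"
    by (rule tab2[of A 5 p p "gadd n"]) (use assms(3) z g in \<open>simp_all add: gadd_tab_def[abs_def]\<close>)
  moreover have "A 2 ((b * m + ?j) * p + gadd n (z mod p) (G0 b mod p)) =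
      skey q n (trn n (gadd n (z mod p) (G0 b mod p)) (blk (b * m + ?j)))"
    by (rule tab2[of A 2 "NB * m" p "\<lambda>k h. skey q n (trn n h (blk k))"])
      (use assms(2) pair_lt[OF assms(7) j] gadd_less[OF proper] in \<open>simp_all add: key_tab_def[abs_def]\<close>)
  moreover have "trn n (gadd n (z mod p) (G0 b mod p)) (blk (b * m + ?j)) =
      trn n (z mod p) (slice n (yb b) (z div p))"
    using slice_yb[OF assms(7), of "z div p"] z trn_gadd[OF proper] by simp
  ultimately show ?thesis using assms(1,5,6,8) by (simp add: eK_def sv_def)
qed

lemma num_below_trn: "x \<in> words q n \<Longrightarrow> h < p \<Longrightarrow> num_below q n s (trn n h x) = num_below q n s x"
  unfolding num_below_def using mkey_trn[OF proper] by simp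

lemma eval_KF:
  assumes "sv q n m V" "tab A 3 (NB * m * p) (below_tab q n blk)" "z < R" "V 12 = z" "V 10 = b" "b < NB" "V 16 = G0 b"
  shows "xev V A eKF = num_below q n (z mod p) (slice n (yb b) (z div p))"
proof -
  note z = R_split[OF assms(3)]
  let ?j = "(z div p + G0 b div p) mod m"
  have j: "?j < m" using m1 by simp
  have g: "G0 b mod p < p" using p_pos by simp
  have "A 3 ((b * m + ?j) * p + z mod p) = num_below q n (z mod p) (blk (b * m + ?j))"
    by (rule tab2[of A 3 "NB * m" p "\<lambda>k h. num_below q n h (blk k)"])
      (use assms(2) pair_lt[OF assms(6) j] z in \<open>simp_all add: below_tab_def[abs_def]\<close>)
  moreover have "num_below q n (z mod p) (slice n (yb b) (z div p)) = num_below q n (z mod p) (blk (b * m + ?j))"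
    using slice_yb[OF assms(6), of "z div p"] z num_below_trn[OF blk_in[OF assms(6) j] g] by simp
  ultimately show ?thesis using assms(1,4,5,7) by (simp add: eKF_def sv_def)
qed

end

lemma pair_div: "j < y \<Longrightarrow> (i * y + j) div y = (i :: nat)"
  by simp

lemma pair_mod: "j < y \<Longrightarrow> (i * y + j) mod y = (j :: nat)"
  by simp

text \<open>
  Controlled evaluation: unrestricted simplification would rearrange the nested index arithmetic of both
  sides differently.
\<close>

lemmas xeval = fun_upd_apply rel_simps if_True if_False xev.simps xev_not xev_less xev_eq xev_le' xev_and xev_imp xev_all
  xev_ex apply_op.simps agg_fold_Total agg_fold_First of_bool_conj[symmetric] of_bool_eq_0_iff not_not

lemma svD: "sv q n m V \<Longrightarrow> V 4 = m" "sv q n m V \<Longrightarrow> V 5 = prod_list n" "sv q n m V \<Longrightarrow> V 6 = prod_list n * m"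
    "sv q n m V \<Longrightarrow> V 8 = key_bound q n * prod_list n" "sv q n m V \<Longrightarrow> V 13 = m + 1"
  by (simp_all add: sv_def)

context block_step
begin

abbreviation "p \<equiv> prod_list n"
abbreviation "R \<equiv> p * m"
abbreviation "w \<equiv> code q n m y"

lemma letter_skey: "z < R \<Longrightarrow> letter z = skey q n (trn n (z mod p) (slice n y (z div p)))"
  unfolding letter_def using code_nth[OF div_less_m] lact_skey[OF proper slice_in[OF y div_less_m]] by simp

lemma K_at:
  assumes "tab A 13 R letter" "j < m" "h < p"
  shows "A 13 (j * p + h) = lact q n h (w ! j)"
  using tabD[OF assms(1) pair_less[OF assms(3,2)]] assms(3) by (simp add: letter_def)

lemma K_at0:
  assumes "tab A 13 R letter" "j < m"
  shows "A 13 (j * p) = w ! j"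
  using K_at[OF assms p_pos] act_0[OF w_nth_in[OF assms(2)]] by simp

lemma ADD_at:
  assumes "tab A 5 (p * p) (gadd_tab n)" "a < p" "b < p"
  shows "A 5 (a * p + b) = gadd n a b"
  by (rule tab2[of A 5 p p "gadd n"]) (use assms in \<open>simp_all add: gadd_tab_def[abs_def]\<close>)

lemma R_pos: "0 < R"
  using p_pos m_pos by simp

lemma RR_split: "z < R * R \<Longrightarrow> z div R < R \<and> z mod R < R"
  using R_pos by (simp add: less_mult_imp_div_less)

lemma eval_RJ:
  assumes "sv q n m V" "tab A 13 R letter" "tab A 5 (p * p) (gadd_tab n)" "z < R * R" "V 12 = z"
  shows "xev V A eRJ = of_bool (rej (state (z div R)) (letter (z mod R)))"
proof -
  define a where "a = z div R"
  define x where "x = z mod R"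
  have ax: "a < R" "x < R" unfolding a_def x_def using RR_split[OF assms(4)] by auto
  note d = div_less_m[OF ax(1)] div_less_m[OF ax(2)]
  have "(\<exists>i<R. i div p \<le> a div p \<and>
      (\<forall>k<m. k < i div p \<longrightarrow> A 13 ((a div p - i div p + k) * p + A 5 (i mod p * p + a mod p)) = A 13 (k * p)) \<and>
      A 13 (x div p * p + A 5 (i mod p * p + x mod p)) < A 13 (i div p * p)) \<longleftrightarrow> rej (state a) (letter x)"
    (is "?P \<longleftrightarrow> _")
    unfolding rej_state_iff[OF ax]
  proof (intro ex_cong1 conj_cong refl all_cong1 imp_cong)
    fix i k assume i: "i < R" "i div p \<le> a div p" and k: "k < m" "k < i div p"
    have "a div p - i div p + k < m" using k i(2) d(1) by simp
    then show "(A 13 ((a div p - i div p + k) * p + A 5 (i mod p * p + a mod p)) = A 13 (k * p)) =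
        (lact q n (gadd n (i mod p) (a mod p)) (w ! (a div p - i div p + k)) = w ! k)"
      unfolding ADD_at[OF assms(3) mod_less_p mod_less_p] K_at0[OF assms(2) k(1)]
      using K_at[OF assms(2) _ ad_less[OF mod_less_p mod_less_p]] by simp
  next
    fix i assume i: "i < R"
    show "(A 13 (x div p * p + A 5 (i mod p * p + x mod p)) < A 13 (i div p * p)) =
        (lact q n (gadd n (i mod p) (x mod p)) (w ! (x div p)) < w ! (i div p))"
      unfolding ADD_at[OF assms(3) mod_less_p mod_less_p] K_at0[OF assms(2) div_less_m[OF i]]
        K_at[OF assms(2) d(2) ad_less[OF mod_less_p mod_less_p]] ..
  qed
  moreover have "xev V A eRJ = of_bool ?P"
    unfolding eRJ_def Let_def by (simp only: xeval svD[OF assms(1)] assms(5) a_def x_def)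
  ultimately show ?thesis unfolding a_def[symmetric] x_def[symmetric] by (simp only:)
qed

text \<open>
  The candidates for the successor of state \<open>a\<close> under letter \<open>x\<close>: names of states that are suffixes of what has been read. The
  successor comes first among them in the order by decreasing length and then increasing name (\<open>suffix_state_le\<close>).
\<close>

definition suffix_state :: "nat \<Rightarrow> nat \<Rightarrow> nat \<Rightarrow> bool" where
  "suffix_state a x b \<longleftrightarrow> (\<exists>v. state a @ [letter x] = v @ state b)"

lemma suffix_state_iff:
  assumes "a < R" "x < R" "b < R"
  shows "suffix_state a x b \<longleftrightarrow> (0 < b div p \<longrightarrow> b div p \<le> a div p + 1 \<and> letter x = lact q n (b mod p) (w ! (b div p - 1)) \<and>
    (\<forall>i<m. i + 1 < b div p \<longrightarrow> lact q n (a mod p) (w ! (a div p + 1 - b div p + i)) = lact q n (b mod p) (w ! i)))"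
proof (cases "b div p")
  case 0
  then have "state b = []" using length_state[OF assms(3)] by simp
  then show ?thesis unfolding suffix_state_def using 0 by simp
next
  case (Suc j)
  have jm: "Suc j < m" using div_less_m[OF assms(3)] Suc by simp
  have am: "a div p < m" by (rule div_less_m[OF assms(1)])
  have sb: "state b = al (b mod p) (take j w) @ [lact q n (b mod p) (w ! j)]"
    using jm length_w by (simp add: state_def Suc take_Suc_conv_app_nth al_def)
  have la: "length (state a) = a div p" by (rule length_state[OF assms(1)])
  have "suffix_state a x b \<longleftrightarrow> (\<exists>v. state a = v @ al (b mod p) (take j w)) \<and> letter x = lact q n (b mod p) (w ! j)"
    unfolding suffix_state_def sb by (metis append1_eq_conv append_assoc)
  moreover have "(\<exists>v. state a = v @ al (b mod p) (take j w)) \<longleftrightarrow>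
      j \<le> a div p \<and> drop (a div p - j) (state a) = al (b mod p) (take j w)"
  proof
    assume "\<exists>v. state a = v @ al (b mod p) (take j w)"
    then obtain v where v: "state a = v @ al (b mod p) (take j w)" by auto
    then have "a div p = length v + j" using la jm length_w by simp
    then show "j \<le> a div p \<and> drop (a div p - j) (state a) = al (b mod p) (take j w)" using v by simp
  next
    assume "j \<le> a div p \<and> drop (a div p - j) (state a) = al (b mod p) (take j w)"
    then show "\<exists>v. state a = v @ al (b mod p) (take j w)" by (metis append_take_drop_id)
  qed
  moreover have "drop (a div p - j) (state a) = al (b mod p) (take j w) \<longleftrightarrow>
      (\<forall>i<j. lact q n (a mod p) (w ! (a div p - j + i)) = lact q n (b mod p) (w ! i))" if "j \<le> a div p"
    using that am jm length_w by (simp add: list_eq_iff_nth_eq state_def al_def)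
  moreover have "(\<forall>i<j. Q i) \<longleftrightarrow> (\<forall>i<m. i < j \<longrightarrow> Q i)" for Q using jm by auto
  ultimately show ?thesis using Suc by auto
qed

lemma suffix_state_succ:
  assumes "a < R" "x < R"
  shows "suffix_state a x (succ_name a x)"
  unfolding suffix_state_def succ_name(1)[OF assms] using st_suffix by metis

lemma suffix_state_le:
  assumes "a < R" "x < R" "b < R" "suffix_state a x b"
  shows "b div p < succ_name a x div p \<or> b div p = succ_name a x div p \<and> succ_name a x \<le> b"
proof -
  let ?u = "state a @ [letter x]"
  obtain v where v: "?u = v @ state b" using assms(4) unfolding suffix_state_def by auto
  obtain v' where v': "?u = v' @ st ?u" "\<And>i. i < length v' \<Longrightarrow> drop i ?u \<notin> States" using st_suffix[of ?u] by metis
  have "state b \<in> States" using assms(3) States_state by auto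
  moreover have "drop (length v) ?u = state b" using v by simp
  ultimately have len: "length v' \<le> length v" using v'(2)[of "length v"] by (metis not_le)
  have c: "length (st ?u) = succ_name a x div p"
    using succ_name[OF assms(1,2)] length_state by metis
  have "length v + b div p = length v' + succ_name a x div p"
    using arg_cong[OF v, of length] arg_cong[OF v'(1), of length] length_state[OF assms(3)] c by simp
  moreover have "succ_name a x \<le> b" if "length v = length v'"
  proof -
    have "state b = st ?u" using v v'(1) that by (metis append_eq_append_conv)
    then show ?thesis unfolding succ_name_def by (rule Least_le)
  qed
  ultimately show ?thesis using len by linarith
qed

lemma eval_DT:
  assumes "sv q n m V" "tab A 13 R letter" "z < R * R" "V 12 = z"
  shows "xev V A eDT = succ_name (z div R) (z mod R)"
proof -
  define a where "a = z div R"
  define x where "x = z mod R"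
  have ax: "a < R" "x < R" unfolding a_def x_def using RR_split[OF assms(3)] by auto
  note d = div_less_m[OF ax(1)] div_less_m[OF ax(2)]
  (* the involution that exchanges candidates and names *)
  define enc where "enc i = (m - 1 - i div p) * p + i mod p" for i
  have enc_div: "enc i div p = m - 1 - i div p" and enc_mod: "enc i mod p = i mod p" for i
    unfolding enc_def using p_pos by simp_all
  have enc_less: "enc i < R" for i
    unfolding enc_def by (rule pair_less[OF mod_less_p]) (use m_pos in simp)
  define Q where "Q i \<longleftrightarrow> (0 < m - 1 - i div p \<longrightarrow> m - 1 - i div p \<le> a div p + 1 \<and>
      A 13 x = A 13 ((m - 1 - i div p - 1) * p + i mod p) \<and>
      (\<forall>k<m. k + 1 < m - 1 - i div p \<longrightarrow>
        A 13 ((a div p + 1 - (m - 1 - i div p) + k) * p + a mod p) = A 13 (k * p + i mod p)))" for i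
  have Q: "Q i \<longleftrightarrow> suffix_state a x (enc i)" for i
  proof (cases "0 < m - 1 - i div p \<and> m - 1 - i div p \<le> a div p + 1")
    case True
    have "A 13 ((m - 1 - i div p - 1) * p + i mod p) = lact q n (i mod p) (w ! (m - 1 - i div p - 1))"
      by (rule K_at[OF assms(2) _ mod_less_p]) (use m_pos in simp)
    moreover have "A 13 ((a div p + 1 - (m - 1 - i div p) + k) * p + a mod p) =
        lact q n (a mod p) (w ! (a div p + 1 - (m - 1 - i div p) + k))" if "k + 1 < m - 1 - i div p" for k
      by (rule K_at[OF assms(2) _ mod_less_p]) (use that True d(1) in simp)
    moreover have "A 13 (k * p + i mod p) = lact q n (i mod p) (w ! k)" if "k < m" for k
      by (rule K_at[OF assms(2) that mod_less_p])
    ultimately show ?thesis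
      unfolding Q_def suffix_state_iff[OF ax enc_less] enc_div enc_mod tabD[OF assms(2) ax(2)] by simp
  next
    case False
    then show ?thesis unfolding Q_def suffix_state_iff[OF ax enc_less] enc_div enc_mod by auto
  qed
  let ?c = "succ_name a x"
  have c: "?c < R" by (rule succ_name(3)[OF ax])
  have cm: "?c div p \<le> m - 1" using div_less_m[OF c] by simp
  have encc: "enc (enc ?c) = ?c"
  proof -
    have "m - 1 - (m - 1 - ?c div p) = ?c div p" using cm by linarith
    then show ?thesis unfolding enc_def[of "enc ?c"] enc_div enc_mod by simp
  qed
  have "(LEAST i. R \<le> i \<or> Q i) = enc ?c"
  proof (rule Least_equality)
    show "R \<le> enc ?c \<or> Q (enc ?c)" unfolding Q encc using suffix_state_succ[OF ax] by simp
    fix i assume i: "R \<le> i \<or> Q i"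
    show "enc ?c \<le> i"
    proof (cases "R \<le> i")
      case True
      then show ?thesis using enc_less[of ?c] by simp
    next
      case False
      then have "suffix_state a x (enc i)" and iR: "i < R" using i Q by auto
      have im: "i div p \<le> m - 1" using div_less_m[OF iR] by simp
      from suffix_state_le[OF ax enc_less \<open>suffix_state a x (enc i)\<close>]
      consider "enc i div p < ?c div p" | "enc i div p = ?c div p" "?c \<le> enc i" by blast
      then show ?thesis
      proof cases
        case 1
        then have "m - 1 - ?c div p + 1 \<le> i div p" using cm im unfolding enc_div by linarith
        then have "(m - 1 - ?c div p + 1) * p \<le> i div p * p" by (rule mult_le_mono1)
        moreover have "i div p * p \<le> i" by simp
        moreover have "enc ?c \<le> (m - 1 - ?c div p + 1) * p" unfolding enc_def using mod_less_p[of ?c] by simp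
        ultimately show ?thesis by linarith
      next
        case 2
        have "?c div p * p + ?c mod p \<le> enc i div p * p + enc i mod p" using 2(2) by simp
        then have "?c mod p \<le> i mod p" unfolding 2(1) enc_mod by (rule add_le_imp_le_left)
        moreover have "m - 1 - ?c div p = i div p" using 2(1) im unfolding enc_div by simp
        ultimately have "enc ?c \<le> i div p * p + i mod p" unfolding enc_def by (simp only: add_le_cancel_left)
        then show ?thesis by (simp only: div_mult_mod_eq)
      qed
    qed
  qed
  then have "xev V A eDT = enc (enc ?c)"
    unfolding eDT_def Let_def enc_def[of "enc ?c"]
    by (simp only: xeval svD[OF assms(1)] assms(4) a_def[symmetric] x_def[symmetric] Q_def)
  then show ?thesis using encc by (simp add: a_def x_def)
qed

lemma eval_FI:
  assumes "sv q n m V" "tab A 13 R letter" "z < R" "V 12 = z"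
  shows "xev V A eFI = of_bool (newname z)"
proof -
  have "(\<forall>i<R. i < z \<longrightarrow> A 13 i \<noteq> A 13 z) \<longleftrightarrow> newname z"
  proof
    assume *: "\<forall>i<R. i < z \<longrightarrow> A 13 i \<noteq> A 13 z"
    show "newname z"
      unfolding newname_def
    proof (intro allI impI)
      fix i assume i: "i < z"
      then have iR: "i < R" using assms(3) by (rule less_trans)
      show "letter i \<noteq> letter z"
        using *[rule_format, OF iR i] unfolding tabD[OF assms(2) iR] tabD[OF assms(2,3)] .
    qed
  next
    assume *: "newname z"
    show "\<forall>i<R. i < z \<longrightarrow> A 13 i \<noteq> A 13 z"
    proof (intro allI impI)
      fix i assume "i < R" "i < z"
      then show "A 13 i \<noteq> A 13 z"
        using * unfolding newname_def tabD[OF assms(2) \<open>i < R\<close>] tabD[OF assms(2,3)] by iprover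
    qed
  qed
  then show ?thesis unfolding eFI_def by (simp only: xeval svD[OF assms(1)] assms(4))
qed

lemma eval_CA:
  assumes "sv q n m V" "tab A 13 R letter" "z < R" "V 12 = z"
  shows "xev V A eCA = of_bool (canon z)"
proof -
  have "(i div p = z div p \<and> (\<forall>k<m. k < z div p \<longrightarrow> A 13 (k * p + i mod p) = A 13 (k * p + z mod p))) \<longleftrightarrow> state i = state z"
    if "i < R" for i
    unfolding state_eq_iff[OF assms(3) that] by (simp only: K_at[OF assms(2) _ mod_less_p] cong: conj_cong imp_cong)
  then have "(\<forall>i<R. i < z \<longrightarrow> \<not> (i div p = z div p \<and> (\<forall>k<m. k < z div p \<longrightarrow> A 13 (k * p + i mod p) = A 13 (k * p + z mod p))))
     \<longleftrightarrow> canon z"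
  proof -
    assume **: "\<And>i. i < R \<Longrightarrow> (i div p = z div p \<and> (\<forall>k<m. k < z div p \<longrightarrow> A 13 (k * p + i mod p) = A 13 (k * p + z mod p))) \<longleftrightarrow> state i = state z"
    have "(\<forall>i<R. i < z \<longrightarrow> state i \<noteq> state z) \<longleftrightarrow> canon z"
      unfolding canon_def
    proof (intro iffI allI impI)
      fix i assume *: "\<forall>i<R. i < z \<longrightarrow> state i \<noteq> state z" and i: "i < z"
      show "state i \<noteq> state z" by (rule *[rule_format, OF less_trans[OF i assms(3)] i])
    qed iprover
    then show ?thesis by (simp only: ** cong: imp_cong)
  qed
  then show ?thesis unfolding eCA_def by (simp only: xeval svD[OF assms(1)] assms(4))
qed

lemma eval_MT:
  assumes "sv q n m V" "tab A 13 R letter" "tab A 5 (p * p) (gadd_tab n)" "tab A 4 p (num_fixed q n)"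
    "tab A 14 R (\<lambda>z. num_below q n (z mod p) (slice n y (z div p)))"
    "tab A 15 (R * R) (\<lambda>z. of_bool (rej (state (z div R)) (letter (z mod R))))"
    "tab A 16 (R * R) (\<lambda>z. succ_name (z div R) (z mod R))"
    "tab A 17 R (\<lambda>x. of_bool (newname x))" "z < R * R" "V 12 = z" "V 17 = s" "s < p"
  shows "xev V A eMT = of_bool (canon (z mod R)) * step_count (Fixed s) (state (z div R)) (state (z mod R))"
proof -
  define a where "a = z div R"
  define a' where "a' = z mod R"
  have ax: "a < R" "a' < R" unfolding a_def a'_def using RR_split[OF assms(9)] by auto
  note d = div_less_m[OF ax(1)]
  have nb: "A 14 (a div p * p + s) = card {x\<in>Fixed s. x div p < w ! (a div p) div p}"
    unfolding card_Fixed_class[OF d]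
    by (rule tab2[of A 14 m p "\<lambda>j s. num_below q n s (slice n y j)"]) (use assms(5,12) d in \<open>simp_all add: mult.commute\<close>)
  have fx: "A 4 s = card (Fixed s)" unfolding card_Fixed by (rule tabD[OF assms(4,12)])
  have fi: "A 17 x = of_bool (newname x)" if "x < R" for x by (rule tabD[OF assms(8) that])
  have fxd: "A 13 (x div p * p + A 5 (s * p + x mod p)) = A 13 x \<longleftrightarrow> lact q n s (letter x) = letter x" if "x < R" for x
    unfolding ADD_at[OF assms(3,12) mod_less_p] tabD[OF assms(2) that]
      K_at[OF assms(2) div_less_m[OF that] ad_less[OF assms(12) mod_less_p]] letter_def
    using act_ad[OF assms(12) mod_less_p w_nth_in[OF div_less_m[OF that]]] by simp
  have rj: "A 15 (a * R + x) = of_bool (rej (state a) (letter x))" if "x < R" for x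
    by (rule tab2[of A 15 R R "\<lambda>a x. of_bool (rej (state a) (letter x))"]) (use assms(6) ax that in simp_all)
  have dt: "A 16 (a * R + x) = succ_name a x" if "x < R" for x
    by (rule tab2[of A 16 R R succ_name]) (use assms(7) ax that in simp_all)
  have "(\<Sum>x<R. A 17 x * (of_bool (A 13 (x div p * p + A 5 (s * p + x mod p)) = A 13 x) *
      of_bool (A 13 (a div p * p) div p \<le> A 13 x div p))) =
    (\<Sum>x<R. of_bool (newname x \<and> lact q n s (letter x) = letter x \<and> w ! (a div p) div p \<le> letter x div p))"
  proof (rule sum.cong[OF refl])
    fix x assume "x \<in> {..<R}"
    then have x: "x < R" by simp
    show "A 17 x * (of_bool (A 13 (x div p * p + A 5 (s * p + x mod p)) = A 13 x) *
        of_bool (A 13 (a div p * p) div p \<le> A 13 x div p)) =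
      of_bool (newname x \<and> lact q n s (letter x) = letter x \<and> w ! (a div p) div p \<le> letter x div p)"
      unfolding fi[OF x] fxd[OF x] unfolding K_at0[OF assms(2) d] tabD[OF assms(2) x] of_bool_conj by (rule refl)
  qed
  moreover have "(\<Sum>x<R. A 17 x * (of_bool (A 13 (x div p * p + A 5 (s * p + x mod p)) = A 13 x) *
      (of_bool (A 15 (a * R + x) = 0) * of_bool (A 16 (a * R + x) = a')))) =
    (\<Sum>x<R. of_bool (newname x \<and> lact q n s (letter x) = letter x \<and> \<not> rej (state a) (letter x) \<and> succ_name a x = a'))"
  proof (rule sum.cong[OF refl])
    fix x assume "x \<in> {..<R}"
    then have x: "x < R" by simp
    show "A 17 x * (of_bool (A 13 (x div p * p + A 5 (s * p + x mod p)) = A 13 x) *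
        (of_bool (A 15 (a * R + x) = 0) * of_bool (A 16 (a * R + x) = a'))) =
      of_bool (newname x \<and> lact q n s (letter x) = letter x \<and> \<not> rej (state a) (letter x) \<and> succ_name a x = a')"
      unfolding fi[OF x] fxd[OF x] rj[OF x] dt[OF x] of_bool_eq_0_iff of_bool_conj by (rule refl)
  qed
  ultimately have "xev V A eMT = of_bool (canon a') * step_count (Fixed s) (state a) (state a')"
    unfolding step_count_table[OF ax] eMT_def Let_def
    by (simp only: xev.simps xev_and xev_eq xev_not xev_le' apply_op.simps agg_fold_Total fun_upd_apply rel_simps if_True if_False
        svD[OF assms(1)] assms(10,11) a_def[symmetric] a'_def[symmetric] nb fx)
  then show ?thesis by (simp add: a_def a'_def)
qed

text \<open>Masked walk counts, so that sums over names are sums over states.\<close>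

definition wtab :: "nat \<Rightarrow> nat \<Rightarrow> nat" where
  "wtab s z = of_bool (canon (z div R div (m + 1))) * of_bool (canon (z mod R)) *
     walk_count (Fixed s) (z div R mod (m + 1)) (state (z div R div (m + 1))) (state (z mod R))"

lemma eval_W:
  assumes "sv q n m V" "tab A 18 R (\<lambda>a. of_bool (canon a))"
    "tab A 19 (R * R) (\<lambda>z. of_bool (canon (z mod R)) * step_count (Fixed s) (state (z div R)) (state (z mod R)))"
    "tab A 20 z (wtab s)" "z < R * (m + 1) * R" "V 12 = z"
  shows "xev V A eW = wtab s z"
proof -
  define a' where "a' = z mod R"
  define ai where "ai = z div R"
  define a where "a = ai div (m + 1)"
  define i where "i = ai mod (m + 1)"
  have a': "a' < R" unfolding a'_def using R_pos by simp
  have "ai < R * (m + 1)" unfolding ai_def using assms(5) by (simp add: less_mult_imp_div_less)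
  then have a: "a < R" unfolding a_def by (rule less_mult_imp_div_less)
  have aS: "state a \<in> States" "state a' \<in> States" using a a' States_state by auto
  have z: "z = ai * R + a'" unfolding a'_def ai_def by (rule div_mult_mod_eq[symmetric])
  have wz: "wtab s z = of_bool (canon a) * of_bool (canon a') * walk_count (Fixed s) i (state a) (state a')"
    by (simp add: wtab_def a'_def a_def i_def ai_def)
  have ca: "A 18 a = of_bool (canon a)" by (rule tabD[OF assms(2) a])
  show ?thesis
  proof (cases "i = 0")
    case True
    have "of_bool (a = a') * A 18 a = wtab s z"
      unfolding wz True ca walk_count_0[OF aS(1)] using canon_eq[of a a'] by auto
    then show ?thesis using True assms(1,6)
      by (simp add: eW_def Let_def sv_def a'_def[symmetric] ai_def[symmetric] a_def[symmetric, simplified] i_def[symmetric, simplified])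
  next
    case False
    then have ai0: "0 < ai" unfolding i_def by (cases ai) auto
    have "ai = a * (m + 1) + i" unfolding a_def i_def by (rule div_mult_mod_eq[symmetric])
    then have ai1: "ai - 1 = a * (m + 1) + (i - 1)" using False by simp
    have im: "i - 1 < m + 1" unfolding i_def by (metis diff_le_self le_less_trans mod_less_divisor zero_less_Suc Suc_eq_plus1)
    have d1: "(ai - 1) div (m + 1) = a" "(ai - 1) mod (m + 1) = i - 1"
      unfolding ai1 by (rule pair_div[OF im], rule pair_mod[OF im])
    have v: "A 20 ((ai - 1) * R + c) = of_bool (canon a) * of_bool (canon c) * walk_count (Fixed s) (i - 1) (state a) (state c)"
      if c: "c < R" for c
    proof -
      have "(ai - 1) * R + c < ((ai - 1) + 1) * R" using c by simp
      then have "(ai - 1) * R + c < z" unfolding z using ai0 by simp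
      then have "A 20 ((ai - 1) * R + c) = wtab s ((ai - 1) * R + c)" by (rule tabD[OF assms(4)])
      moreover have "((ai - 1) * R + c) div R = ai - 1" "((ai - 1) * R + c) mod R = c" by (rule pair_div[OF c], rule pair_mod[OF c])
      ultimately show ?thesis unfolding wtab_def using d1 by simp
    qed
    have mt: "A 19 (c * R + a') = of_bool (canon a') * step_count (Fixed s) (state c) (state a')" if "c < R" for c
      by (rule tab2[of A 19 R R "\<lambda>a a'. of_bool (canon a') * step_count (Fixed s) (state a) (state a')"]) (use assms(3) a' that in simp_all)
    have "(\<Sum>c<R. A 20 ((ai - 1) * R + c) * A 19 (c * R + a')) =
        (\<Sum>c<R. of_bool (canon a) * of_bool (canon a') * (of_bool (canon c) * (walk_count (Fixed s) (i - 1) (state a) (state c) * step_count (Fixed s) (state c) (state a'))))"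
    proof (rule sum.cong[OF refl])
      fix c assume "c \<in> {..<R}"
      then have c: "c < R" by simp
      show "A 20 ((ai - 1) * R + c) * A 19 (c * R + a') = of_bool (canon a) * of_bool (canon a') *
          (of_bool (canon c) * (walk_count (Fixed s) (i - 1) (state a) (state c) * step_count (Fixed s) (state c) (state a')))"
        unfolding v[OF c] mt[OF c] by (simp only: mult_ac)
    qed
    also have "\<dots> = of_bool (canon a) * of_bool (canon a') * walk_count (Fixed s) (Suc (i - 1)) (state a) (state a')"
      unfolding sum_distrib_left[symmetric] walk_count_Suc[OF Fixed_in aS(1)] sum_States ..
    also have "\<dots> = wtab s z" unfolding wz using False by simp
    finally show ?thesis using False assms(1,6)
      by (simp add: eW_def Let_def sv_def a'_def[symmetric] ai_def[symmetric] a_def[symmetric, simplified] i_def[symmetric, simplified])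
  qed
qed

lemma lact_gmul: "h < p \<Longrightarrow> x \<in> letters q n \<Longrightarrow> lact q n (gmul n c h) x = (lact q n h ^^ c) x"
proof (induction c)
  case (Suc c)
  have "gmul n c h < p" unfolding gmul_def using p_pos gadd_less[OF proper] by (cases c) auto
  then show ?case using Suc act_ad[OF Suc.prems(1) _ Suc.prems(2), of "gmul n c h"] by (simp add: gmul_def)
qed (simp add: gmul_def act_0)

text \<open>The parameters computed by the program instantiate \<open>twisted_count\<close>.\<close>

lemma twisted:
  assumes "g < R"
  shows "twisted_count (letters q n) p (gadd n) (lact q n) w m (g mod p) (g div p) (gcd (g div p) m)
    (unit_of m (g div p)) (gmul n (m div gcd (g div p) m) (g mod p)) (gmul n (unit_of m (g div p)) (g mod p))"
proof
  have gl: "gmul n c h < p" for c h unfolding gmul_def using p_pos gadd_less[OF proper] by (cases c) auto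
  show "g mod p < p" by (rule mod_less_p)
  show "0 < gcd (g div p) m" using m_pos by simp
  show "gcd (g div p) m dvd m" "gcd (g div p) m dvd g div p" by simp_all
  show "unit_of m (g div p) * (g div p) mod m = gcd (g div p) m mod m" by (rule unit_of(2)[OF m1])
  show "gmul n (m div gcd (g div p) m) (g mod p) < p" "gmul n (unit_of m (g div p)) (g mod p) < p" by (rule gl)+
qed (rule lact_gmul[OF mod_less_p]; assumption)+

lemma eval_FC:
  assumes "sv q n m V" "tab A 13 R letter" "tab A 5 (p * p) (gadd_tab n)"
    "tab A 8 ((m + 1) * p) (\<lambda>k. num_fixed q n (k mod p) ^ (k div p))"
    "tab A 18 R (\<lambda>a. of_bool (canon a))" "tab A 20 (R * (m + 1) * R) (wtab s)" "g < R"
    "V 17 = s" "V 18 = t" "V 19 = gcd (g div p) m"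
    "s = gmul n (m div gcd (g div p) m) (g mod p)" "t = gmul n (unit_of m (g div p)) (g mod p)"
  shows "xev V A eFC = num_below q (n @ [m]) g y"
proof -
  interpret twisted_count "letters q n" p "gadd n" "lact q n" w m "g mod p" "g div p" "gcd (g div p) m"
      "unit_of m (g div p)" s t
    unfolding assms(11,12) by (rule twisted[OF assms(7)])
  let ?l = "gcd (g div p) m"
  have lm: "?l \<le> m" by (rule l_le)
  have g: "g = g mod p + p * (g div p)" by simp
  have "num_below q (n @ [m]) g y = card {v\<in>fixed_words (g mod p) (g div p). below v}"
    using num_below_code[OF mod_less_p div_less_m[OF assms(7)], of g] g by simp
  also have "\<dots> = card (Fixed s) ^ ?l - (\<Sum>a<R. of_bool (canon a) * (\<Sum>b<R. of_bool (al t (state b) = state a) *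
       (of_bool (canon b) * walk_count (Fixed s) ?l (state a) (state b))))"
    by (rule card_below)
  also have "card (Fixed s) ^ ?l = A 8 (?l * p + s)"
    unfolding card_Fixed by (rule tab2[symmetric, OF assms(4)]) (use lm s(1) in simp_all)
  also have "(\<Sum>a<R. of_bool (canon a) * (\<Sum>b<R. of_bool (al t (state b) = state a) *
       (of_bool (canon b) * walk_count (Fixed s) ?l (state a) (state b)))) =
    (\<Sum>a<R. A 18 a * (\<Sum>b<R. of_bool (b div p = a div p) * of_bool (\<forall>i<m. i < a div p \<longrightarrow>
         A 13 (i * p + A 5 (t * p + b mod p)) = A 13 (i * p + a mod p)) * A 20 ((a * (m + 1) + ?l) * R + b)))"
  proof (intro sum.cong refl)
    fix a assume "a \<in> {..<R}"
    then have a: "a < R" by simp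
    have ca: "A 18 a = of_bool (canon a)" by (rule tabD[OF assms(5) a])
    have "of_bool (canon a) * (of_bool (al t (state b) = state a) * (of_bool (canon b) * walk_count (Fixed s) ?l (state a) (state b))) =
      of_bool (canon a) * (of_bool (b div p = a div p) * of_bool (\<forall>i<m. i < a div p \<longrightarrow>
         A 13 (i * p + A 5 (t * p + b mod p)) = A 13 (i * p + a mod p)) * A 20 ((a * (m + 1) + ?l) * R + b))"
      if b: "b < R" for b
    proof -
      have e: "al t (state b) = state a \<longleftrightarrow> b div p = a div p \<and> (\<forall>i<m. i < a div p \<longrightarrow>
         A 13 (i * p + A 5 (t * p + b mod p)) = A 13 (i * p + a mod p))"
        unfolding al_state_eq_iff[OF a b t(1)] ADD_at[OF assms(3) t(1) mod_less_p]
        using K_at[OF assms(2) _ ad_less[OF t(1) mod_less_p]] K_at[OF assms(2) _ mod_less_p] by auto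
      have lt: "?l < m + 1" using lm by simp
      have "a * (m + 1) + ?l < R * (m + 1)" by (rule pair_lt[OF a lt])
      then have "(a * (m + 1) + ?l) * R + b < R * (m + 1) * R" by (rule pair_lt[OF _ b])
      then have "A 20 ((a * (m + 1) + ?l) * R + b) = wtab s ((a * (m + 1) + ?l) * R + b)" by (rule tabD[OF assms(6)])
      also have "\<dots> = of_bool (canon a) * of_bool (canon b) * walk_count (Fixed s) ?l (state a) (state b)"
      proof -
        have 1: "((a * (m + 1) + ?l) * R + b) div R = a * (m + 1) + ?l" "((a * (m + 1) + ?l) * R + b) mod R = b"
          by (rule pair_div[OF b], rule pair_mod[OF b])
        have 2: "(a * (m + 1) + ?l) div (m + 1) = a" "(a * (m + 1) + ?l) mod (m + 1) = ?l"
          by (rule pair_div[OF lt], rule pair_mod[OF lt])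
        show ?thesis unfolding wtab_def 1 2 ..
      qed
      finally show ?thesis unfolding e by auto
    qed
    then show "of_bool (canon a) * (\<Sum>b<R. of_bool (al t (state b) = state a) * (of_bool (canon b) * walk_count (Fixed s) ?l (state a) (state b))) =
      A 18 a * (\<Sum>b<R. of_bool (b div p = a div p) * of_bool (\<forall>i<m. i < a div p \<longrightarrow>
         A 13 (i * p + A 5 (t * p + b mod p)) = A 13 (i * p + a mod p)) * A 20 ((a * (m + 1) + ?l) * R + b))"
      unfolding ca sum_distrib_left by (intro sum.cong refl) simp
  qed
  finally show ?thesis using assms(1,8,9,10) by (simp add: eFC_def sv_def)
qed

text \<open>The fixed words themselves are counted without the automaton, as powers of counts for the previous level.\<close>

lemma num_fixed_twisted:
  assumes "g < R"
  shows "num_fixed q (n @ [m]) g = num_fixed q n (gmul n (m div gcd (g div p) m) (g mod p)) ^ gcd (g div p) m"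
proof -
  interpret twisted_count "letters q n" p "gadd n" "lact q n" w m "g mod p" "g div p" "gcd (g div p) m"
      "unit_of m (g div p)" "gmul n (m div gcd (g div p) m) (g mod p)" "gmul n (unit_of m (g div p)) (g mod p)"
    by (rule twisted[OF assms])
  have g: "g = g mod p + p * (g div p)" by simp
  show ?thesis
    using num_fixed_code[OF mod_less_p div_less_m[OF assms], of g] g card_fixed_words card_Fixed by simp
qed

end

section \<open>Assertions about variables and tables\<close>

text \<open>
  All assertions used are of this form: values of some variables, and contents \<open>f\<close> of the first \<open>n\<close> cells of some
  arrays. Every command extends these lists, and \<open>Inv_weaken\<close> forgets what is overwritten later.
\<close>

definition Inv :: "(nat \<times> nat) list \<Rightarrow> (nat \<times> nat \<times> (nat \<Rightarrow> nat)) list \<Rightarrow> assertion" where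
  "Inv L F V A \<longleftrightarrow> (\<forall>(x, v)\<in>set L. V x = v) \<and> (\<forall>(a, n, f)\<in>set F. tab A a n f)"

lemma Inv_var: "Inv L F V A \<Longrightarrow> (x, v) \<in> set L \<Longrightarrow> V x = v"
  by (auto simp: Inv_def)

lemma Inv_tab: "Inv L F V A \<Longrightarrow> (a, n, f) \<in> set F \<Longrightarrow> tab A a n f"
  by (auto simp: Inv_def)

lemma Inv_mono: "Inv L F V A \<Longrightarrow> set L' \<subseteq> set L \<Longrightarrow> set F' \<subseteq> set F \<Longrightarrow> Inv L' F' V A"
  unfolding Inv_def by (auto dest: subsetD)

lemma Inv_upd_var: "Inv L F V A \<Longrightarrow> x \<notin> fst ` set L \<Longrightarrow> Inv L F (V(x := v)) A"
  unfolding Inv_def by force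

lemma Inv_upd_arr: "Inv L F V A \<Longrightarrow> a \<notin> fst ` set F \<Longrightarrow> Inv L F V (A(a := g))"
  unfolding Inv_def tab_def by force

lemma Inv_Cons_var: "Inv ((x, v) # L) F V A \<longleftrightarrow> V x = v \<and> Inv L F V A"
  by (auto simp: Inv_def)

lemma Inv_Cons_tab: "Inv L ((a, n, f) # F) V A \<longleftrightarrow> tab A a n f \<and> Inv L F V A"
  by (auto simp: Inv_def)

context machine
begin

lemma Inv_weaken:
  assumes "hoare (Inv L F) c T (Inv L' F')" "set L \<subseteq> set L0" "set F \<subseteq> set F0" "T \<le> T0" "set L1 \<subseteq> set L'" "set F1 \<subseteq> set F'"
  shows "hoare (Inv L0 F0) c T0 (Inv L1 F1)"
  by (rule hoare_conseq[OF assms(1) Inv_mono[OF _ assms(2,3)] assms(4) Inv_mono[OF _ assms(5,6)]])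

lemma Inv_Set:
  assumes "\<And>V A. Inv L F V A \<Longrightarrow> xev V A e = v" "v \<le> S"
    and "wfx 20 e" "vdeg e \<le> D" "x < 20" "x \<notin> fst ` set L" "1 \<le> P"
    and "\<And>V A. Inv L F V A \<Longrightarrow> \<forall>y\<in>bnds e. V y \<le> P" "(tcoef e + 2) * P ^ tdeg e \<le> T"
  shows "hoare (Inv L F) (HSet x e) T (Inv ((x, v) # L) F)"
proof -
  have "hoare (Inv L F) (HSet x e) ((tcoef e + 2) * P ^ tdeg e) (Inv ((x, v) # L) F)"
    by (rule hoare_Set[OF assms(3,4,5,7)]) (simp add: assms(1,2,8) Inv_Cons_var Inv_upd_var assms(6))
  then show ?thesis by (rule hoare_conseq) (use assms(9) in auto)
qed

text \<open>The loop changes the tables only, as described by \<open>F\<close>; the loop variable is forgotten afterwards.\<close>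

lemma Inv_For:
  assumes "\<And>i. i < n \<Longrightarrow> hoare (Inv ((x, i) # L) (F i)) c T (Inv ((x, i) # L) (F (Suc i)))"
    and "(y, n) \<in> set L" "x < 20" "y < 20" "x \<notin> fst ` set L" "n * (T + 8) + 6 \<le> T'"
  shows "hoare (Inv L (F 0)) (HFor x y c) T' (Inv L (F n))"
proof -
  have xy: "x \<noteq> y" using assms(2,5) by force
  have "hoare (Inv L (F 0)) (HFor x y c) (n * (T + 8) + 6) (Inv L (F n))"
  proof (rule hoare_For[OF assms(3,4) xy, where I = "\<lambda>i. Inv L (F i)"])
    show "V y = n \<and> Inv L (F 0) (V(x := 0)) A" if "Inv L (F 0) V A" for V A
      using that assms(2,5) Inv_var Inv_upd_var by blast
    fix i assume "i < n"
    show "hoare (\<lambda>V A. Inv L (F i) V A \<and> V x = i \<and> V y = n) c T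
        (\<lambda>V A. V x = i \<and> V y = n \<and> Inv L (F (Suc i)) (V(x := Suc i)) A)"
      using assms(1)[OF \<open>i < n\<close>]
      by (rule hoare_conseq) (auto simp: Inv_Cons_var intro: Inv_upd_var[OF _ assms(5)] Inv_var[OF _ assms(2)])
  qed
  then show ?thesis by (rule hoare_conseq) (use assms(6) in auto)
qed

text \<open>
  The first \<open>w\<close> entries of the table may be present beforehand: the tables for the next level are extended block by
  block.
\<close>

lemma Inv_Fill:
  assumes ev: "\<And>V A z. Inv L F V A \<Longrightarrow> tab A a (w + z) f \<Longrightarrow> z < n \<Longrightarrow> V 12 = z \<Longrightarrow> xev V A e = f (w + z)"
    and base: "\<And>V A. Inv L F V A \<Longrightarrow> xev V A b = w"
    and fS: "\<And>z. z < n \<Longrightarrow> f (w + z) \<le> S"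
    and wf: "wfx 20 e" "vdeg e \<le> D" "wfx 20 b" "vdeg b + 1 \<le> D" "y < 20" "1 \<le> P" "12 \<notin> bnds e" "12 \<notin> bnds b"
    and y: "(y, n) \<in> set L" "12 \<notin> fst ` set L" "a \<notin> fst ` set F"
    and bd: "\<And>V A. Inv L F V A \<Longrightarrow> \<forall>y\<in>bnds e \<union> bnds b. V y \<le> P"
    and n: "n \<le> c * P ^ r" "1 \<le> c" "c * (tcoef e + tcoef b + 24) * P ^ (max (tdeg e) (tdeg b) + r) \<le> T"
  shows "hoare (Inv L ((a, w, f) # F)) (HFill a y b e) T (Inv L ((a, w + n, f) # F))"
proof -
  have y12: "y \<noteq> 12" using y by force
  have "hoare (Inv L ((a, w, f) # F)) (HFill a y b e) (c * (tcoef e + tcoef b + 24) * P ^ (max (tdeg e) (tdeg b) + r))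
      (Inv L ((a, w + n, f) # F))"
  proof (rule hoare_Fill[OF wf(1-5) y12 wf(6-8) n(1,2), where w = w and f = "\<lambda>z. f (w + z)"])
    fix V A z assume I: "Inv L ((a, w, f) # F) V A" and z: "z < n"
    let ?V = "V(12 := z)" and ?A = "A(a := fill w z (\<lambda>z. f (w + z)) (A a))"
    have I': "Inv L F ?V ?A"
      using I unfolding Inv_Cons_tab by (auto intro!: Inv_upd_var Inv_upd_arr y)
    have t: "tab ?A a (w + z) f" using I unfolding Inv_Cons_tab by (auto simp: tab_def fill_def)
    show "xev ?V ?A b = w \<and> xev ?V ?A e = f (w + z) \<and> f (w + z) \<le> S \<and> (\<forall>y\<in>bnds e \<union> bnds b. V y \<le> P)"
      using ev[OF I' t z] base[OF I'] fS[OF z] bd I unfolding Inv_Cons_tab by auto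
  next
    fix V A assume I: "Inv L ((a, w, f) # F) V A"
    then show "V y = n" unfolding Inv_Cons_tab using Inv_var y(1) by blast
    have "Inv L F (V(12 := n)) (A(a := fill w n (\<lambda>z. f (w + z)) (A a)))"
      using I unfolding Inv_Cons_tab by (auto intro!: Inv_upd_var Inv_upd_arr y)
    moreover have "tab (A(a := fill w n (\<lambda>z. f (w + z)) (A a))) a (w + n) f"
      using I unfolding Inv_Cons_tab by (auto simp: tab_def fill_def)
    ultimately show "Inv L ((a, w + n, f) # F) (V(12 := n)) (A(a := fill w n (\<lambda>z. f (w + z)) (A a)))"
      unfolding Inv_Cons_tab by simp
  qed
  then show ?thesis by (rule hoare_conseq) (use n(3) in auto)
qed

lemma Inv_Table:
  assumes ev: "\<And>V A z. Inv L F V A \<Longrightarrow> tab A a z f \<Longrightarrow> z < n \<Longrightarrow> V 12 = z \<Longrightarrow> xev V A e = f z"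
    and fS: "\<And>z. z < n \<Longrightarrow> f z \<le> S"
    and wf: "wfx 20 e" "vdeg e \<le> D" "y < 20" "1 \<le> P" "12 \<notin> bnds e"
    and y: "(y, n) \<in> set L" "12 \<notin> fst ` set L" "a \<notin> fst ` set F"
    and bd: "\<And>V A. Inv L F V A \<Longrightarrow> \<forall>y\<in>bnds e. V y \<le> P"
    and n: "n \<le> c * P ^ r" "1 \<le> c" "c * (tcoef e + 26) * P ^ (tdeg e + r) \<le> T" and D: "2 \<le> D"
  shows "hoare (Inv L F) (HFill a y (XL 0) e) T (Inv L ((a, n, f) # F))"
proof -
  have "hoare (Inv L ((a, 0, f) # F)) (HFill a y (XL 0) e) T (Inv L ((a, 0 + n, f) # F))"
    by (rule Inv_Fill[where P = P and c = c and r = r]) (use assms in \<open>auto simp: add.commute\<close>)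
  then show ?thesis by (rule hoare_conseq) (auto simp: Inv_Cons_tab tab_def)
qed

lemma Inv_Upd:
  assumes ev: "\<And>V A. Inv L F V A \<Longrightarrow> xev V A e = f w" "\<And>V A. Inv L F V A \<Longrightarrow> xev V A i = w" and "f w \<le> S"
    and wf: "wfx 20 e" "vdeg e \<le> D" "wfx 20 i" "vdeg i \<le> D" "1 \<le> P"
    and "a \<notin> fst ` set F"
    and bd: "\<And>V A. Inv L F V A \<Longrightarrow> \<forall>y\<in>bnds e \<union> bnds i. V y \<le> P"
    and T: "(tcoef e + tcoef i + 3) * P ^ max (tdeg e) (tdeg i) \<le> T"
  shows "hoare (Inv L ((a, w, f) # F)) (HUpd a i e) T (Inv L ((a, Suc w, f) # F))"
proof -
  have "hoare (Inv L ((a, w, f) # F)) (HUpd a i e) ((tcoef e + tcoef i + 3) * P ^ max (tdeg e) (tdeg i))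
      (Inv L ((a, Suc w, f) # F))"
  proof (rule hoare_Upd[OF wf])
    fix V A assume "Inv L ((a, w, f) # F) V A"
    then have I: "tab A a w f" "Inv L F V A" unfolding Inv_Cons_tab by auto
    have "Inv L F V (A(a := (A a)(w := f w)))" by (rule Inv_upd_arr[OF I(2) assms(9)])
    moreover have "tab (A(a := (A a)(w := f w))) a (Suc w) f" using I(1) by (auto simp: tab_def less_Suc_eq)
    ultimately show "(\<forall>y\<in>bnds e \<union> bnds i. V y \<le> P) \<and> xev V A e \<le> S \<and>
        Inv L ((a, Suc w, f) # F) V (A(a := (A a)(xev V A i := xev V A e)))"
      using ev[OF I(2)] assms(3) bd[OF I(2)] unfolding Inv_Cons_tab by simp
  qed
  then show ?thesis by (rule hoare_conseq) (use T in auto)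
qed

lemma Seq_scaled:
  assumes "hoare Pr c1 (C1 * X) Q" "hoare Q c2 (C2 * X) R"
  shows "hoare Pr (Seq c1 c2) ((C1 + C2) * X) R"
  using hoare_Seq[OF assms] by (simp add: distrib_right)

end

section \<open>One level of the program\<close>

text \<open>
  The commands of a level, from the inside out: the work for one translation of a block, the work for one block, the
  variables and tables that depend only on the sizes, and the passage to the next level.
\<close>

definition "cShift = Seq (HSet 17 (eS (XV 11))) (Seq (HSet 18 (eT (XV 11))) (Seq (HSet 19 (XC 9 (XV 11)))
  (Seq (HFill 19 9 (XL 0) eMT) (Seq (HFill 20 15 (XL 0) eW) (HUpd 23 (XV 10 [*] vR [+] XV 11) eFC)))))"

definition "cBlock = Seq (HFill 12 6 (XL 0) eWK) (Seq (HSet 16 eG0) (Seq (HFill 22 6 (XV 10 [*] vR) eSK)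
  (Seq (HFill 13 6 (XL 0) eK) (Seq (HFill 14 6 (XL 0) eKF) (Seq (HFill 15 9 (XL 0) eRJ) (Seq (HFill 16 9 (XL 0) eDT)
  (Seq (HFill 17 6 (XL 0) eFI) (Seq (HFill 18 6 (XL 0) eCA) (HFor 11 6 cShift)))))))))"

definition "cPre = Seq (HSet 4 (XC 0 (XV 3))) (Seq (HSet 6 (vp [*] vm)) (Seq (HSet 7 (XV 2 [div] vR)) (Seq (HSet 9 (vR [*] vR))
  (Seq (HSet 13 (vm [+] XL 1)) (Seq (HSet 14 (XV 13 [*] vp)) (HSet 15 (vR [*] XV 13 [*] vR)))))))"

definition "cTab = Seq (HFill 25 9 (XL 0) eADD) (Seq (HFill 6 13 (XL 0) ePOW) (Seq (HFill 7 14 (XL 0) eMUL) (Seq (HFill 8 14 (XL 0) eFXP)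
  (Seq (HFill 9 6 (XL 0) eLL) (Seq (HFill 10 6 (XL 0) eUU) (HFill 24 6 (XL 0) eFX))))))"

definition "cCopy = Seq (HFill 2 2 (XL 0) (XC 22 vz)) (Seq (HFill 3 2 (XL 0) (XC 23 vz))
  (Seq (HFill 4 6 (XL 0) (XC 24 vz)) (HFill 5 9 (XL 0) (XC 25 vz))))"

definition "cEnd = Seq (HSet 8 (XC 6 vm [*] vR)) (Seq (HSet 5 vR) (Seq (HSet 3 (XV 3 [+] XL 1)) (HSet 1 (XV 3 [<] XV 0))))"

definition "cLevel = Seq cPre (Seq cTab (Seq (HFor 10 7 cBlock) (Seq cCopy cEnd)))"

lemmas edefs = eADD_def ePOW_def eMUL_def eFXP_def eLL_def eUU_def eS_def eT_def eFX_def eWK_def eG0_def eSK_def eK_def eKF_def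
  eRJ_def eDT_def eFI_def eCA_def eMT_def eW_def eFC_def Let_def xdefs

text \<open>
  The degree 200 bounds \<open>vdeg\<close> of every expression of the program. The assumptions \<open>NS\<close>, \<open>dS\<close>, \<open>keyS\<close>, \<open>qS\<close> and \<open>RS\<close>
  keep all variables and table entries within \<open>S\<close>.
\<close>

locale level_run = level q n m NB blk BLK + machine B S 200
  for q n m NB blk BLK B S +
  fixes N d e :: nat and sz :: "nat \<Rightarrow> nat"
  assumes N: "N = NB * (prod_list n * m)" and NS: "N \<le> S" and ed: "e < d" and dS: "d \<le> S" and sz: "sz e = m" and q1: "1 \<le> q"
    and keyS: "key_bound q (n @ [m]) * prod_list (n @ [m]) \<le> S"
    and qS: "q ^ prod_list (n @ [m]) \<le> S"
    and RS: "prod_list (n @ [m]) * (m + 1) * prod_list (n @ [m]) \<le> S"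
begin

abbreviation "base' \<equiv> key_bound q (n @ [m]) * prod_list (n @ [m])"

text \<open>The variables and the tables during a level; \<open>F0\<close> is what the previous level provides.\<close>

definition "Lv = [(0 :: nat, d), (2, N), (3, e), (4, m), (5, p), (6, R), (7, NB), (8, base), (9, R * R), (13, m + 1), (14, (m + 1) * p),
  (15, R * (m + 1) * R)]"
definition "F0 = [(0 :: nat, d, sz), (2, N, key_tab q n blk), (3, N, below_tab q n blk), (4, p, num_fixed q n), (5, p * p, gadd_tab n)]"
definition "F1 = [(24 :: nat, R, num_fixed q (n @ [m])), (10, R, \<lambda>g. unit_of m (g div p)), (9, R, \<lambda>g. gcd (g div p) m),
  (8, (m + 1) * p, \<lambda>k. num_fixed q n (k mod p) ^ (k div p)), (7, (m + 1) * p, \<lambda>k. gmul n (k div p) (k mod p)),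
  (6, m + 1, \<lambda>i. base ^ i), (25, R * R, gadd_tab (n @ [m]))] @ F0"

lemma NB_le_N: "NB \<le> N" and R_le_N: "R \<le> N" and N_pos: "1 \<le> N"
  using N NB_pos R_pos by auto

lemma sizes: "m \<le> R" "p \<le> R" "R * R \<le> S" "R \<le> S" "m + 1 \<le> S" "(m + 1) * p \<le> S" "R * (m + 1) * R \<le> S"
    "m + 1 \<le> 2 * R" "(m + 1) * p \<le> 2 * R" "R * (m + 1) * R \<le> 2 * R ^ 3" "1 \<le> R"
proof -
  show 1: "m \<le> R" "p \<le> R" "1 \<le> R" using p_pos m1 R_pos by auto
  show 7: "R * (m + 1) * R \<le> S" using RS by simp
  have "1 * (R * R) \<le> (m + 1) * (R * R)" by (intro mult_le_mono1) simp
  also have "\<dots> = R * (m + 1) * R" by (simp only: mult_ac)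
  finally show 3: "R * R \<le> S" using 7 by linarith
  show "R \<le> S" using le_square[of R] 3 by (rule le_trans)
  show 8: "m + 1 \<le> 2 * R" using 1 by linarith
  have ab: "1 * (m + 1) \<le> R * (m + 1) * R" "(m + 1) * p \<le> (m + 1) * (R * R)"
  proof -
    have "1 * 1 \<le> R * R" using 1 by (intro mult_le_mono)
    then have "(m + 1) * 1 \<le> (m + 1) * (R * R)" by (intro mult_le_mono2) simp
    then show "1 * (m + 1) \<le> R * (m + 1) * R" by (simp only: mult_ac)
    have "p * 1 \<le> R * R" using 1 by (intro mult_le_mono)
    then show "(m + 1) * p \<le> (m + 1) * (R * R)" by (intro mult_le_mono2) simp
  qed
  show "m + 1 \<le> S" using le_trans[OF ab(1) 7] by (simp only: mult_1)
  have "(m + 1) * (R * R) = R * (m + 1) * R" by (simp only: mult_ac)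
  then show "(m + 1) * p \<le> S" using le_trans[OF ab(2)] 7 by metis
  show 9: "(m + 1) * p \<le> 2 * R" using 1 by (simp add: distrib_right mult.commute)
  have "R * (m + 1) * R \<le> R * (2 * R) * R" using 8 by (intro mult_le_mono) auto
  then show "R * (m + 1) * R \<le> 2 * R ^ 3" by (simp add: power3_eq_cube mult_ac)
qed

lemma base_pos: "1 \<le> base"
proof -
  have "0 < key_bound q n" using wkey_bound[OF proper, of "blk (0 * m + 0)" q] blk_in[OF NB_pos, of 0] m1 by force
  then show ?thesis using p_pos by simp
qed

text \<open>Powers of the base occur up to exponent \<open>m\<close>, and \<open>key_bound\<close> of the next level is the last of them.\<close>

lemma base_S: "i \<le> m \<Longrightarrow> base ^ i \<le> S" "base \<le> S" "key_bound q (n @ [m]) \<le> S"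
proof -
  have m: "base ^ m * 1 \<le> base'"
    unfolding key_bound.simps by (intro mult_le_mono2) (use R_pos in simp)
  have mS: "base ^ m \<le> S" using le_trans[OF m keyS] by (simp only: mult_1_right)
  show *: "base ^ i \<le> S" if "i \<le> m" for i
    using power_increasing[OF that base_pos] mS by (rule le_trans)
  show "base \<le> S" using *[of 1] m1 by simp
  show "key_bound q (n @ [m]) \<le> S" unfolding key_bound.simps by (rule mS)
qed

lemma q_S: "i \<le> m \<Longrightarrow> (q ^ p) ^ i \<le> S" "q ^ p \<le> S"
proof -
  show *: "(q ^ p) ^ i \<le> S" if "i \<le> m" for i
    using power_increasing[OF that, of "q ^ p"] q1 qS by (simp add: power_mult)
  show "q ^ p \<le> S" using *[of 1] m1 by simp
qed

lemma num_fixed_S: "i \<le> m \<Longrightarrow> num_fixed q n s ^ i \<le> S"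
  using power_mono[OF num_fixed_le[of q n s], of i] q_S(1)[of i] by simp

lemma LvD:
  assumes "Inv L F V A" "set Lv \<subseteq> set L"
  shows "V 2 = N" "V 3 = e" "V 4 = m" "V 5 = p" "V 6 = R" "V 7 = NB" "V 9 = R * R" "V 13 = m + 1" "V 14 = (m + 1) * p"
    "V 15 = R * (m + 1) * R" "sv q n m V" "V 0 = d" "V 8 = base"
proof -
  have *: "V x = v" if "(x, v) \<in> set Lv" for x v using Inv_var[OF assms(1)] that assms(2) by auto
  show "V 2 = N" "V 3 = e" "V 4 = m" "V 5 = p" "V 6 = R" "V 7 = NB" "V 9 = R * R" "V 13 = m + 1" "V 14 = (m + 1) * p"
    "V 15 = R * (m + 1) * R" "V 0 = d" "V 8 = base" by (rule *, simp add: Lv_def)+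
  then show "sv q n m V" by (simp add: sv_def)
qed

lemma bound_ok: "Inv L F V A \<Longrightarrow> set Lv \<subseteq> set L \<Longrightarrow> bnds e' \<subseteq> {4, 6} \<Longrightarrow> \<forall>y\<in>bnds e'. V y \<le> R"
  using LvD(3,5)[of L F V A] sizes(1) by auto

lemma time_ok: "C' \<le> C \<Longrightarrow> k \<le> j \<Longrightarrow> C' * R ^ k \<le> C * R ^ j"
  by (rule scale_mono[OF sizes(11)])

text \<open>
  Loop bounds of expressions are \<open>m\<close> and \<open>R\<close>, stored in variables 4 and 6, and tables have at most \<open>2 * R ^ r\<close> entries; the 2
  is due to the entries for \<open>m + 1\<close>. As \<open>2 * (900 + 26) \<le> 2000\<close>, a coefficient of 900 leads to time
  \<open>2000 * R ^ j\<close>.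
\<close>

lemma table_rule:
  assumes "\<And>V A z. Inv L F V A \<Longrightarrow> tab A a z f \<Longrightarrow> z < k \<Longrightarrow> V 12 = z \<Longrightarrow> xev V A e' = f z"
    and "\<And>z. z < k \<Longrightarrow> f z \<le> S"
    and "wfx 20 e' \<and> vdeg e' \<le> 200 \<and> bnds e' \<subseteq> {4, 6} \<and> tcoef e' \<le> 900 \<and> tdeg e' + r \<le> j"
    and "(y, k) \<in> set L" "set Lv \<subseteq> set L" "12 \<notin> fst ` set L" "a \<notin> fst ` set F" "y < 20" "k \<le> 2 * R ^ r"
  shows "hoare (Inv L F) (HFill a y (XL 0) e') (2000 * R ^ j) (Inv L ((a, k, f) # F))"
proof (rule Inv_Table[where P = R and c = 2 and r = r])
  show "\<forall>y\<in>bnds e'. V y \<le> R" if "Inv L F V A" for V A by (rule bound_ok[OF that assms(5)]) (use assms(3) in simp)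
  show "2 * (tcoef e' + 26) * R ^ (tdeg e' + r) \<le> 2000 * R ^ j" by (rule time_ok) (use assms(3) in auto)
  show "12 \<notin> bnds e'" using assms(3) by auto
qed (use assms sizes in auto)

lemma set_rule:
  assumes "\<And>V A. Inv L F V A \<Longrightarrow> xev V A e' = v" "v \<le> S"
    and "wfx 20 e' \<and> vdeg e' \<le> 200 \<and> bnds e' \<subseteq> {4, 6} \<and> tcoef e' \<le> 900 \<and> tdeg e' \<le> j"
    and "set Lv \<subseteq> set L \<or> bnds e' = {}" "x \<notin> fst ` set L" "x < 20"
  shows "hoare (Inv L F) (HSet x e') (2000 * R ^ j) (Inv ((x, v) # L) F)"
proof (rule Inv_Set[where P = R])
  show "\<forall>y\<in>bnds e'. V y \<le> R" if "Inv L F V A" for V A using bound_ok[OF that] assms(3,4) by blast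
  show "(tcoef e' + 2) * R ^ tdeg e' \<le> 2000 * R ^ j" by (rule time_ok) (use assms(3) in auto)
qed (use assms sizes in auto)

text \<open>
  Evaluation of the syntactic measures of the expressions. Whatever is computed once per level or once per
  translation has degree at most 4, whatever is computed once per block at most 5.
\<close>

lemma static_tab:
  "wfx 20 eADD \<and> vdeg eADD \<le> 200 \<and> bnds eADD \<subseteq> {4, 6} \<and> tcoef eADD \<le> 900 \<and> tdeg eADD + 2 \<le> 4"
  "wfx 20 ePOW \<and> vdeg ePOW \<le> 200 \<and> bnds ePOW \<subseteq> {4, 6} \<and> tcoef ePOW \<le> 900 \<and> tdeg ePOW + 1 \<le> 4"
  "wfx 20 eMUL \<and> vdeg eMUL \<le> 200 \<and> bnds eMUL \<subseteq> {4, 6} \<and> tcoef eMUL \<le> 900 \<and> tdeg eMUL + 1 \<le> 4"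
  "wfx 20 eFXP \<and> vdeg eFXP \<le> 200 \<and> bnds eFXP \<subseteq> {4, 6} \<and> tcoef eFXP \<le> 900 \<and> tdeg eFXP + 1 \<le> 4"
  "wfx 20 eLL \<and> vdeg eLL \<le> 200 \<and> bnds eLL \<subseteq> {4, 6} \<and> tcoef eLL \<le> 900 \<and> tdeg eLL + 1 \<le> 4"
  "wfx 20 eUU \<and> vdeg eUU \<le> 200 \<and> bnds eUU \<subseteq> {4, 6} \<and> tcoef eUU \<le> 900 \<and> tdeg eUU + 1 \<le> 4"
  "wfx 20 eFX \<and> vdeg eFX \<le> 200 \<and> bnds eFX \<subseteq> {4, 6} \<and> tcoef eFX \<le> 900 \<and> tdeg eFX + 1 \<le> 4"
  by (simp_all add: edefs)

lemma static_block:
  "wfx 20 eWK \<and> vdeg eWK \<le> 200 \<and> bnds eWK \<subseteq> {4, 6} \<and> tcoef eWK \<le> 900 \<and> tdeg eWK + 1 \<le> 5"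
  "wfx 20 eSK \<and> vdeg eSK \<le> 200 \<and> bnds eSK \<subseteq> {4, 6} \<and> tcoef eSK \<le> 900 \<and> tdeg eSK + 1 \<le> 5"
  "wfx 20 eK \<and> vdeg eK \<le> 200 \<and> bnds eK \<subseteq> {4, 6} \<and> tcoef eK \<le> 900 \<and> tdeg eK + 1 \<le> 5"
  "wfx 20 eKF \<and> vdeg eKF \<le> 200 \<and> bnds eKF \<subseteq> {4, 6} \<and> tcoef eKF \<le> 900 \<and> tdeg eKF + 1 \<le> 5"
  "wfx 20 eRJ \<and> vdeg eRJ \<le> 200 \<and> bnds eRJ \<subseteq> {4, 6} \<and> tcoef eRJ \<le> 900 \<and> tdeg eRJ + 2 \<le> 5"
  "wfx 20 eDT \<and> vdeg eDT \<le> 200 \<and> bnds eDT \<subseteq> {4, 6} \<and> tcoef eDT \<le> 900 \<and> tdeg eDT + 2 \<le> 5"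
  "wfx 20 eFI \<and> vdeg eFI \<le> 200 \<and> bnds eFI \<subseteq> {4, 6} \<and> tcoef eFI \<le> 900 \<and> tdeg eFI + 1 \<le> 5"
  "wfx 20 eCA \<and> vdeg eCA \<le> 200 \<and> bnds eCA \<subseteq> {4, 6} \<and> tcoef eCA \<le> 900 \<and> tdeg eCA + 1 \<le> 5"
  "wfx 20 eMT \<and> vdeg eMT \<le> 200 \<and> bnds eMT \<subseteq> {4, 6} \<and> tcoef eMT \<le> 900 \<and> tdeg eMT + 2 \<le> 4"
  "wfx 20 eW \<and> vdeg eW \<le> 200 \<and> bnds eW \<subseteq> {4, 6} \<and> tcoef eW \<le> 900 \<and> tdeg eW + 3 \<le> 4"
  "wfx 20 eFC \<and> vdeg eFC \<le> 200 \<and> bnds eFC \<subseteq> {4, 6} \<and> tcoef eFC \<le> 900 \<and> tdeg eFC \<le> 4"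
  "wfx 20 eG0 \<and> vdeg eG0 \<le> 200 \<and> bnds eG0 \<subseteq> {4, 6} \<and> tcoef eG0 \<le> 900 \<and> tdeg eG0 \<le> 5"
  "wfx 20 (eS (XV 11)) \<and> vdeg (eS (XV 11)) \<le> 200 \<and> bnds (eS (XV 11)) \<subseteq> {4, 6} \<and> tcoef (eS (XV 11)) \<le> 900 \<and> tdeg (eS (XV 11)) \<le> 4"
  "wfx 20 (eT (XV 11)) \<and> vdeg (eT (XV 11)) \<le> 200 \<and> bnds (eT (XV 11)) \<subseteq> {4, 6} \<and> tcoef (eT (XV 11)) \<le> 900 \<and> tdeg (eT (XV 11)) \<le> 4"
  by (simp_all add: edefs)

lemma tabs_hoare: "hoare (Inv Lv F0) cTab (14000 * R ^ 4) (Inv Lv F1)"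
proof -
  have f0: "tab A 5 (p * p) (gadd_tab n)" "tab A 4 p (num_fixed q n)" if "Inv L F V A" "set F0 \<subseteq> set F" for L F V A
    using Inv_tab[OF that(1)] that(2) by (auto simp: F0_def)
  let ?t1 = "(25::nat, R * R, gadd_tab (n @ [m]))" let ?t2 = "(6::nat, m + 1, \<lambda>i. base ^ i)"
  let ?t3 = "(7::nat, (m + 1) * p, \<lambda>k. gmul n (k div p) (k mod p))"
  let ?t4 = "(8::nat, (m + 1) * p, \<lambda>k. num_fixed q n (k mod p) ^ (k div p))"
  let ?t5 = "(9::nat, R, \<lambda>g. gcd (g div p) m)" let ?t6 = "(10::nat, R, \<lambda>g. unit_of m (g div p))"
  have 1: "hoare (Inv Lv F0) (HFill 25 9 (XL 0) eADD) (2000 * R ^ 4) (Inv Lv (?t1 # F0))"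
  proof (rule table_rule[OF _ _ static_tab(1)])
    fix V A z assume I: "Inv Lv F0 V A" and z: "z < R * R" "V 12 = z"
    show "xev V A eADD = gadd_tab (n @ [m]) z"
      by (rule eval_ADD[OF LvD(11)[OF I] _ z]) (use f0[OF I] in auto)
  next
    fix z show "gadd_tab (n @ [m]) z \<le> S" unfolding gadd_tab_def
      using gadd_less[OF proper', of "z div R" "z mod R"] sizes(4) by (simp add: less_imp_le order.trans)
  qed (use sizes in \<open>auto simp: Lv_def F0_def power2_eq_square\<close>)
  have 2: "hoare (Inv Lv (?t1 # F0)) (HFill 6 13 (XL 0) ePOW) (2000 * R ^ 4) (Inv Lv (?t2 # ?t1 # F0))"
  proof (rule table_rule[OF _ _ static_tab(2)])
    fix V A z assume I: "Inv Lv (?t1 # F0) V A" and z: "tab A 6 z ((^) base)" "z < m + 1" "V 12 = z"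
    show "xev V A ePOW = base ^ z" by (rule eval_POW[OF LvD(11)[OF I] z(1,3)]) auto
  qed (use sizes base_S(1) in \<open>auto simp: Lv_def F0_def\<close>)
  have 3: "hoare (Inv Lv (?t2 # ?t1 # F0)) (HFill 7 14 (XL 0) eMUL) (2000 * R ^ 4) (Inv Lv (?t3 # ?t2 # ?t1 # F0))"
  proof (rule table_rule[OF _ _ static_tab(3)])
    fix V A z assume I: "Inv Lv (?t2 # ?t1 # F0) V A" and z: "tab A 7 z (\<lambda>k. gmul n (k div p) (k mod p))" "V 12 = z"
    show "xev V A eMUL = gmul n (z div p) (z mod p)"
      by (rule eval_MUL[OF LvD(11)[OF I] _ z]) (use f0[OF I] in auto)
  next
    fix z show "gmul n (z div p) (z mod p) \<le> S"
      using gmul_less[of "z div p" "z mod p"] sizes(2,4) by linarith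
  qed (use sizes in \<open>auto simp: Lv_def F0_def\<close>)
  have 4: "hoare (Inv Lv (?t3 # ?t2 # ?t1 # F0)) (HFill 8 14 (XL 0) eFXP) (2000 * R ^ 4) (Inv Lv (?t4 # ?t3 # ?t2 # ?t1 # F0))"
  proof (rule table_rule[OF _ _ static_tab(4)])
    fix V A z assume I: "Inv Lv (?t3 # ?t2 # ?t1 # F0) V A"
      and z: "tab A 8 z (\<lambda>k. num_fixed q n (k mod p) ^ (k div p))" "V 12 = z"
    show "xev V A eFXP = num_fixed q n (z mod p) ^ (z div p)"
      by (rule eval_FXP[OF LvD(11)[OF I] _ z]) (use f0[OF I] in auto)
  next
    fix z assume "z < (m + 1) * p"
    then have "z div p < m + 1" by (rule less_mult_imp_div_less)
    then show "num_fixed q n (z mod p) ^ (z div p) \<le> S" by (intro num_fixed_S) simp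
  qed (use sizes in \<open>auto simp: Lv_def F0_def\<close>)
  have 5: "hoare (Inv Lv (?t4 # ?t3 # ?t2 # ?t1 # F0)) (HFill 9 6 (XL 0) eLL) (2000 * R ^ 4)
     (Inv Lv (?t5 # ?t4 # ?t3 # ?t2 # ?t1 # F0))"
  proof (rule table_rule[OF _ _ static_tab(5)])
    fix V A z assume I: "Inv Lv (?t4 # ?t3 # ?t2 # ?t1 # F0) V A" and z: "V 12 = z"
    show "xev V A eLL = gcd (z div p) m" by (rule eval_LL[OF LvD(11)[OF I] z]) simp
  next
    fix z show "gcd (z div p) m \<le> S" using gcd_le_m[of "z div p"] sizes(1,4) by linarith
  qed (use sizes in \<open>auto simp: Lv_def F0_def\<close>)
  have 6: "hoare (Inv Lv (?t5 # ?t4 # ?t3 # ?t2 # ?t1 # F0)) (HFill 10 6 (XL 0) eUU) (2000 * R ^ 4)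
     (Inv Lv (?t6 # ?t5 # ?t4 # ?t3 # ?t2 # ?t1 # F0))"
  proof (rule table_rule[OF _ _ static_tab(6)])
    fix V A z assume I: "Inv Lv (?t5 # ?t4 # ?t3 # ?t2 # ?t1 # F0) V A" and z: "z < R" "V 12 = z"
    show "xev V A eUU = unit_of m (z div p)"
      by (rule eval_UU[OF LvD(11)[OF I] _ z]) (use Inv_tab[OF I] in auto)
  next
    fix z show "unit_of m (z div p) \<le> S" using unit_of(1)[OF m1, of "z div p"] sizes(1,4) by linarith
  qed (use sizes in \<open>auto simp: Lv_def F0_def\<close>)
  have 7: "hoare (Inv Lv (?t6 # ?t5 # ?t4 # ?t3 # ?t2 # ?t1 # F0)) (HFill 24 6 (XL 0) eFX) (2000 * R ^ 4) (Inv Lv F1)"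
  proof -
    have "hoare (Inv Lv (?t6 # ?t5 # ?t4 # ?t3 # ?t2 # ?t1 # F0)) (HFill 24 6 (XL 0) eFX) (2000 * R ^ 4)
      (Inv Lv ((24, R, num_fixed q (n @ [m])) # ?t6 # ?t5 # ?t4 # ?t3 # ?t2 # ?t1 # F0))"
    proof (rule table_rule[OF _ _ static_tab(7)])
      fix V A z assume I: "Inv Lv (?t6 # ?t5 # ?t4 # ?t3 # ?t2 # ?t1 # F0) V A" and z: "z < R" "V 12 = z"
      have t: "tab A 9 R (\<lambda>g. gcd (g div p) m)" "tab A 7 ((m + 1) * p) (\<lambda>k. gmul n (k div p) (k mod p))"
        "tab A 8 ((m + 1) * p) (\<lambda>k. num_fixed q n (k mod p) ^ (k div p))"
        by (rule Inv_tab[OF I], simp)+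
      have sv: "sv q n m V" by (rule LvD(11)[OF I]) simp
      (* the counts of fixed words depend on no block; any block provides the context *)
      interpret y0: block_step q n m "yb 0" by (rule block_step[OF NB_pos])
      have "xev V A (eS vz) = sft z" by (rule eval_S[OF sv t(1,2) z(1)]) (simp add: z(2))
      then show "xev V A eFX = num_fixed q (n @ [m]) z"
        using FXP_at[OF t(3) gcd_le_m gmul_less] tabD[OF t(1) z(1)] svD(2)[OF sv] z(2)
          y0.num_fixed_twisted[OF z(1)] by (simp add: eFX_def)
    next
      fix z show "num_fixed q (n @ [m]) z \<le> S" using num_fixed_le[of q "n @ [m]" z] qS by linarith
    qed (use sizes in \<open>auto simp: Lv_def F0_def\<close>)
    then show ?thesis by (simp add: F1_def)
  qed
  show ?thesis unfolding cTab_def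
    using Seq_scaled[OF 1 Seq_scaled[OF 2 Seq_scaled[OF 3 Seq_scaled[OF 4 Seq_scaled[OF 5 Seq_scaled[OF 6 7]]]]]] by simp
qed

abbreviation "X22 k \<equiv> (22 :: nat, k :: nat, key_tab q (n @ [m]) BLK)"
abbreviation "X23 k \<equiv> (23 :: nat, k :: nat, below_tab q (n @ [m]) BLK)"

lemma below_tab_yb: "b < NB \<Longrightarrow> g < R \<Longrightarrow> num_below q (n @ [m]) g (yb b) = below_tab q (n @ [m]) BLK (b * R + g)"
proof -
  assume bg: "b < NB" "g < R"
  have "mkey q (n @ [m]) (yb b) = mkey q (n @ [m]) (BLK b)"
    unfolding yb_def by (rule mkey_trn[OF proper' BLK[OF bg(1)]]) (use G0(1) in simp)
  moreover have "(b * R + g) div R = b" "(b * R + g) mod R = g" by (rule pair_div[OF bg(2)], rule pair_mod[OF bg(2)])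
  ultimately show ?thesis unfolding below_tab_def num_below_def by simp
qed

lemma num_below_S: "num_below q (n @ [m]) g y \<le> S"
  using num_below_le[of q "n @ [m]" g y] qS by linarith

definition "Lb b = (16 :: nat, G0 b) # (10, b) # Lv"

text \<open>The tables of the automaton of block \<open>b\<close>.\<close>

definition "Fb b = [(18 :: nat, R, \<lambda>a. of_bool (least_translate.canon p (lact q n) (code q n m (yb b)) a)),
  (17, R, \<lambda>x. of_bool (least_translate.newname p (lact q n) (code q n m (yb b)) x)),
  (16, R * R, \<lambda>z. least_translate.succ_name p (lact q n) (code q n m (yb b)) m (z div R) (z mod R)),
  (15, R * R, \<lambda>z. of_bool (least_translate.rej p (lact q n) (code q n m (yb b)) m
     (least_translate.state p (lact q n) (code q n m (yb b)) (z div R))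
     (least_translate.letter p (lact q n) (code q n m (yb b)) (z mod R)))),
  (14, R, \<lambda>z. num_below q n (z mod p) (slice n (yb b) (z div p))),
  (13, R, least_translate.letter p (lact q n) (code q n m (yb b)))]"

text \<open>Six commands of time \<open>2000 * R ^ 4\<close> each; the table of walk counts, with \<open>R\<close> terms for each of about \<open>m * R * R\<close> entries, dominates.\<close>

lemma shift_step:
  assumes b: "b < NB" and g: "g < R"
    and F: "set (Fb b) \<subseteq> set F" "set F1 \<subseteq> set F" "19 \<notin> fst ` set F" "20 \<notin> fst ` set F" "23 \<notin> fst ` set F"
  shows "hoare (Inv ((11, g) # Lb b) (X23 (b * R + g) # F)) cShift (12000 * R ^ 4)
    (Inv ((11, g) # Lb b) (X23 (b * R + Suc g) # F))"
proof -
  interpret bs: block_step q n m "yb b" by (rule block_step[OF b])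
  let ?l = "gcd (g div p) m"
  let ?L0 = "(11::nat, g) # Lb b"
  let ?L1 = "(17, sft g) # ?L0" let ?L2 = "(18, tft g) # ?L1" let ?L3 = "(19, ?l) # ?L2"
  let ?F0 = "X23 (b * R + g) # F"
  let ?t19 = "(19::nat, R * R, \<lambda>z. of_bool (bs.canon (z mod R)) * bs.step_count (bs.Fixed (sft g)) (bs.state (z div R)) (bs.state (z mod R)))"
  let ?t20 = "(20::nat, R * (m + 1) * R, bs.wtab (sft g))"
  have Lv: "set Lv \<subseteq> set ?L0" by (auto simp: Lb_def)
  have fresh: "x \<notin> fst ` set (Lb b)" if "x \<in> {11, 12, 17, 18, 19}" for x using that by (auto simp: Lb_def Lv_def)
  have pS: "p \<le> S" "m \<le> S" using le_trans[OF sizes(2,4)] le_trans[OF sizes(1,4)] by simp_all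
  have vS: "sft g \<le> S" "tft g \<le> S" "?l \<le> S"
    using le_trans[OF less_imp_le[OF gmul_less] pS(1)] le_trans[OF gcd_le_m pS(2)] by simp_all
  have T: "tab A 9 R (\<lambda>g. gcd (g div p) m)" "tab A 7 ((m + 1) * p) (\<lambda>k. gmul n (k div p) (k mod p))"
      "tab A 10 R (\<lambda>g. unit_of m (g div p))" "tab A 8 ((m + 1) * p) (\<lambda>k. num_fixed q n (k mod p) ^ (k div p))"
      "tab A 5 (p * p) (gadd_tab n)" "tab A 4 p (num_fixed q n)"
      "tab A 13 R bs.letter" "tab A 14 R (\<lambda>z. num_below q n (z mod p) (slice n (yb b) (z div p)))"
      "tab A 15 (R * R) (\<lambda>z. of_bool (bs.rej (bs.state (z div R)) (bs.letter (z mod R))))"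
      "tab A 16 (R * R) (\<lambda>z. bs.succ_name (z div R) (z mod R))" "tab A 17 R (\<lambda>x. of_bool (bs.newname x))"
      "tab A 18 R (\<lambda>a. of_bool (bs.canon a))"
    if I: "Inv L F' V A" "set F \<subseteq> set F'" for L F' V A
    by (rule Inv_tab[OF I(1)], rule subsetD[OF I(2)], use F(1,2) in \<open>auto simp: Fb_def F1_def F0_def\<close>)+
  have 1: "hoare (Inv ?L0 ?F0) (HSet 17 (eS (XV 11))) (2000 * R ^ 4) (Inv ?L1 ?F0)"
  proof (rule set_rule[OF _ _ static_block(13)])
    fix V A assume I: "Inv ?L0 ?F0 V A"
    show "xev V A (eS (XV 11)) = sft g"
      by (rule eval_S[OF LvD(11)[OF I Lv] T(1)[OF I] T(2)[OF I] g]) (use Inv_var[OF I] in auto)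
  qed (use vS Lv fresh in auto)
  have 2: "hoare (Inv ?L1 ?F0) (HSet 18 (eT (XV 11))) (2000 * R ^ 4) (Inv ?L2 ?F0)"
  proof (rule set_rule[OF _ _ static_block(14)])
    fix V A assume I: "Inv ?L1 ?F0 V A"
    show "xev V A (eT (XV 11)) = tft g"
      by (rule eval_T[OF LvD(11)[OF I] T(3)[OF I] T(2)[OF I] g]) (use Inv_var[OF I] Lv in auto)
  qed (use vS Lv fresh in auto)
  have 3: "hoare (Inv ?L2 ?F0) (HSet 19 (XC 9 (XV 11))) (2000 * R ^ 4) (Inv ?L3 ?F0)"
  proof (rule set_rule)
    fix V A assume I: "Inv ?L2 ?F0 V A"
    show "xev V A (XC 9 (XV 11)) = ?l" using tabD[OF T(1)[OF I] g] Inv_var[OF I, of 11 g] by auto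
  qed (use vS Lv fresh in auto)
  have vars: "V 17 = sft g" "V 18 = tft g" "V 19 = ?l" "V 11 = g" "V 10 = b" "sv q n m V"
    if "Inv ?L3 F' V A" for F' V A
    using Inv_var[OF that] LvD(11)[OF that] Lv by (auto simp: Lb_def)
  have 4: "hoare (Inv ?L3 ?F0) (HFill 19 9 (XL 0) eMT) (2000 * R ^ 4) (Inv ?L3 (?t19 # ?F0))"
  proof (rule table_rule[OF _ _ static_block(9)])
    fix V A z assume I: "Inv ?L3 ?F0 V A" and z: "z < R * R" "V 12 = z"
    have s: "set F \<subseteq> set ?F0" by auto
    show "xev V A eMT = of_bool (bs.canon (z mod R)) * bs.step_count (bs.Fixed (sft g)) (bs.state (z div R)) (bs.state (z mod R))"
      by (rule bs.eval_MT[OF vars(6)[OF I] T(7)[OF I s] T(5)[OF I s] T(6)[OF I s] T(8)[OF I s] T(9)[OF I s] T(10)[OF I s] T(11)[OF I s]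
          z vars(1)[OF I] gmul_less])
  next
    fix z
    have "bs.step_count (bs.Fixed (sft g)) (bs.state (z div R)) (bs.state (z mod R)) \<le> card (bs.Fixed (sft g))"
      unfolding bs.step_count_def by (rule card_mono[OF bs.finite_Fixed]) (rule Collect_restrict)
    then show "of_bool (bs.canon (z mod R)) * bs.step_count (bs.Fixed (sft g)) (bs.state (z div R)) (bs.state (z mod R)) \<le> S"
      unfolding bs.card_Fixed using num_fixed_le[of q n "sft g"] q_S(2) by (cases "bs.canon (z mod R)") auto
  next
    show "(9, R * R) \<in> set ?L3" by (simp add: Lb_def Lv_def)
    show "set Lv \<subseteq> set ?L3" using Lv by auto
    show "12 \<notin> fst ` set ?L3" using fresh by auto
    show "19 \<notin> fst ` set ?F0" using F by auto
  qed (simp_all add: power2_eq_square)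
  have 5: "hoare (Inv ?L3 (?t19 # ?F0)) (HFill 20 15 (XL 0) eW) (2000 * R ^ 4) (Inv ?L3 (?t20 # ?t19 # ?F0))"
  proof (rule table_rule[OF _ _ static_block(10)])
    fix V A z assume I: "Inv ?L3 (?t19 # ?F0) V A" and t: "tab A 20 z (bs.wtab (sft g))" and z: "z < R * (m + 1) * R" "V 12 = z"
    have s: "set F \<subseteq> set (?t19 # ?F0)" by auto
    show "xev V A eW = bs.wtab (sft g) z"
      by (rule bs.eval_W[OF vars(6)[OF I] T(12)[OF I s] _ t z]) (rule Inv_tab[OF I], simp)
  next
    fix z assume "z < R * (m + 1) * R"
    let ?i = "z div R mod (m + 1)"
    have i: "?i \<le> m" using mod_less_divisor[of "m + 1" "z div R"] by linarith
    have "bs.walk_count (bs.Fixed (sft g)) ?i x y \<le> card (bs.Fixed (sft g)) ^ ?i" for x y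
      by (rule bs.walk_count_le[OF bs.finite_Fixed])
    also have "\<dots> \<le> S" unfolding bs.card_Fixed by (rule num_fixed_S[OF i])
    finally have "bs.walk_count (bs.Fixed (sft g)) ?i x y \<le> S" for x y .
    then show "bs.wtab (sft g) z \<le> S" unfolding bs.wtab_def by (auto simp: of_bool_def)
  next
    show "(15, R * (m + 1) * R) \<in> set ?L3" by (simp add: Lb_def Lv_def)
    show "set Lv \<subseteq> set ?L3" using Lv by auto
    show "12 \<notin> fst ` set ?L3" using fresh by auto
    show "20 \<notin> fst ` set (?t19 # ?F0)" using F by auto
    show "R * (m + 1) * R \<le> 2 * R ^ 3" by (rule sizes(10))
  qed simp
  have 6: "hoare (Inv ?L3 (X23 (b * R + g) # ?t20 # ?t19 # F)) (HUpd 23 (XV 10 [*] vR [+] XV 11) eFC) (2000 * R ^ 4)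
      (Inv ?L3 (X23 (Suc (b * R + g)) # ?t20 # ?t19 # F))"
  proof (rule Inv_Upd[where P = R])
    fix V A assume I: "Inv ?L3 (?t20 # ?t19 # F) V A"
    have s: "set F \<subseteq> set (?t20 # ?t19 # F)" by auto
    show "xev V A eFC = below_tab q (n @ [m]) BLK (b * R + g)"
      unfolding below_tab_yb[OF b g, symmetric]
      by (rule bs.eval_FC[OF vars(6)[OF I] T(7)[OF I s] T(5)[OF I s] T(4)[OF I s] T(12)[OF I s] _ g vars(1)[OF I] vars(2)[OF I] vars(3)[OF I] refl refl])
        (rule Inv_tab[OF I], simp)
    show "xev V A (XV 10 [*] vR [+] XV 11) = b * R + g" using vars[OF I] svD(3)[OF vars(6)[OF I]] by simp
    have "set Lv \<subseteq> set ?L3" using Lv by auto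
    then show "\<forall>y\<in>bnds eFC \<union> bnds (XV 10 [*] vR [+] XV 11). V y \<le> R"
      using bound_ok[OF I, of eFC] static_block(11) by simp
  next
    show "below_tab q (n @ [m]) BLK (b * R + g) \<le> S" unfolding below_tab_def by (rule num_below_S)
    show "23 \<notin> fst ` set (?t20 # ?t19 # F)" using F(5) by simp
    show "(tcoef eFC + tcoef (XV 10 [*] vR [+] XV 11) + 3) * R ^ max (tdeg eFC) (tdeg (XV 10 [*] vR [+] XV 11)) \<le> 2000 * R ^ 4"
      by (rule time_ok) (use static_block(11) in auto)
  qed (use static_block(11) sizes(11) in auto)
  have s6: "hoare (Inv ?L3 (?t20 # ?t19 # ?F0)) (HUpd 23 (XV 10 [*] vR [+] XV 11) eFC) (2000 * R ^ 4)
      (Inv ?L0 (X23 (b * R + Suc g) # F))"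
    by (rule Inv_weaken[OF 6]) auto
  show ?thesis unfolding cShift_def
    using Seq_scaled[OF 1 Seq_scaled[OF 2 Seq_scaled[OF 3 Seq_scaled[OF 4 Seq_scaled[OF 5 s6]]]]] by simp
qed

lemma block_hoare:
  assumes b: "b < NB"
  shows "hoare (Inv ((10, b) # Lv) (X22 (b * R) # X23 (b * R) # F1)) cBlock (40000 * R ^ 5)
    (Inv ((10, b) # Lv) (X22 (Suc b * R) # X23 (Suc b * R) # F1))"
proof -
  interpret bs: block_step q n m "yb b" by (rule block_step[OF b])
  let ?L0 = "(10::nat, b) # Lv"
  let ?t12 = "(12::nat, R, \<lambda>g. wkey q (n @ [m]) (trn (n @ [m]) g (BLK b)))"
  let ?t13 = "(13::nat, R, bs.letter)"
  let ?t14 = "(14::nat, R, \<lambda>z. num_below q n (z mod p) (slice n (yb b) (z div p)))"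
  let ?t15 = "(15::nat, R * R, \<lambda>z. of_bool (bs.rej (bs.state (z div R)) (bs.letter (z mod R))))"
  let ?t16 = "(16::nat, R * R, \<lambda>z. bs.succ_name (z div R) (z mod R))"
  let ?t17 = "(17::nat, R, \<lambda>x. of_bool (bs.newname x))"
  let ?t18 = "(18::nat, R, \<lambda>a. of_bool (bs.canon a))"
  let ?F0 = "X22 (b * R) # X23 (b * R) # F1"
  let ?F2 = "X22 (b * R + R) # ?t12 # X23 (b * R) # F1"
  have T: "tab A 2 N (key_tab q n blk)" "tab A 3 N (below_tab q n blk)" "tab A 5 (p * p) (gadd_tab n)" "tab A 6 (m + 1) (\<lambda>i. base ^ i)"
      "tab A 25 (R * R) (gadd_tab (n @ [m]))"
    if I: "Inv L F' V A" "set F1 \<subseteq> set F'" for L F' V A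
    by (rule Inv_tab[OF I(1)], rule subsetD[OF I(2)], simp add: F1_def F0_def)+
  have NN: "N = NB * m * p" using N by (simp only: mult_ac)
  have fresh: "x \<notin> fst ` set Lv" if "x \<in> {10, 11, 12, 16}" for x using that by (auto simp: Lv_def)
  have freshF: "x \<notin> fst ` set F1" if "x \<in> {12, 13, 14, 15, 16, 17, 18, 19, 20, 22, 23}" for x
    using that by (auto simp: F1_def F0_def)
  have vars: "V 16 = G0 b" "V 10 = b" "sv q n m V" if "Inv (Lb b) F' V A" for F' V A
    using Inv_var[OF that] LvD(11)[OF that] by (auto simp: Lb_def)
  have LbLv: "set Lv \<subseteq> set (Lb b)" "12 \<notin> fst ` set (Lb b)" "(6, R) \<in> set (Lb b)" "(9, R * R) \<in> set (Lb b)"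
    using fresh by (auto simp: Lb_def Lv_def)
  have 1: "hoare (Inv ?L0 ?F0) (HFill 12 6 (XL 0) eWK) (2000 * R ^ 5) (Inv ?L0 (?t12 # ?F0))"
  proof (rule table_rule[OF _ _ static_block(1)])
    fix V A z assume I: "Inv ?L0 ?F0 V A" and z: "z < R" "V 12 = z"
    have s: "set F1 \<subseteq> set ?F0" "set Lv \<subseteq> set ?L0" by auto
    show "xev V A eWK = wkey q (n @ [m]) (trn (n @ [m]) z (BLK b))"
      by (rule eval_WK[OF LvD(11)[OF I s(2)] T(1)[OF I s(1), unfolded NN] T(4)[OF I s(1)] z _ b]) (use Inv_var[OF I] in simp)
  next
    fix z show "wkey q (n @ [m]) (trn (n @ [m]) z (BLK b)) \<le> S"
      using wkey_bound[OF proper' trn_in[OF proper' BLK[OF b], of z]] base_S(3) by linarith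
  next
    show "(6, R) \<in> set ?L0" by (simp add: Lv_def)
    show "12 \<notin> fst ` set ?L0" using fresh by auto
    show "12 \<notin> fst ` set ?F0" using freshF by auto
  qed auto
  have 2: "hoare (Inv ?L0 (?t12 # ?F0)) (HSet 16 eG0) (2000 * R ^ 5) (Inv (Lb b) (?t12 # ?F0))"
    unfolding Lb_def
  proof (rule set_rule[OF _ _ static_block(12)])
    fix V A assume I: "Inv ?L0 (?t12 # ?F0) V A"
    show "xev V A eG0 = G0 b"
      by (rule eval_G0[OF LvD(11)[OF I]]) (auto intro: Inv_tab[OF I])
  qed (use G0(1)[of b] sizes(4) fresh in auto)
  have 3: "hoare (Inv (Lb b) (X22 (b * R) # ?t12 # X23 (b * R) # F1)) (HFill 22 6 (XV 10 [*] vR) eSK) (2000 * R ^ 5) (Inv (Lb b) ?F2)"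
  proof (rule Inv_Fill[where P = R and c = 1 and r = 1])
    fix V A z assume I: "Inv (Lb b) (?t12 # X23 (b * R) # F1) V A" and z: "z < R" "V 12 = z"
    have s: "set F1 \<subseteq> set (?t12 # X23 (b * R) # F1)" by auto
    show "xev V A eSK = key_tab q (n @ [m]) BLK (b * R + z)"
      by (rule eval_SK[OF vars(3)[OF I] _ T(5)[OF I s] vars(1)[OF I] z(2,1) b]) (rule Inv_tab[OF I], simp)
  next
    fix V A assume I: "Inv (Lb b) (?t12 # X23 (b * R) # F1) V A"
    show "xev V A (XV 10 [*] vR) = b * R" using vars[OF I] svD(3)[OF vars(3)[OF I]] by simp
    show "\<forall>y\<in>bnds eSK \<union> bnds (XV 10 [*] vR). V y \<le> R"
      using bound_ok[OF I LbLv(1), of eSK] static_block(2) by simp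
  next
    fix z assume z: "z < R"
    have "(b * R + z) div R = b" by (rule pair_div[OF z])
    moreover have P: "prod_list (n @ [m]) = R" by simp
    ultimately have "key_tab q (n @ [m]) BLK (b * R + z) = skey q (n @ [m]) (trn (n @ [m]) ((b * R + z) mod R) (BLK b))"
      unfolding key_tab_def by (simp only: P)
    then show "key_tab q (n @ [m]) BLK (b * R + z) \<le> S"
      using le_trans[OF less_imp_le[OF skey_bound[OF proper' trn_in[OF proper' BLK[OF b]]]] keyS] by (simp only:)
  next
    show "22 \<notin> fst ` set (?t12 # X23 (b * R) # F1)" using freshF by auto
    show "1 * (tcoef eSK + tcoef (XV 10 [*] vR) + 24) * R ^ (max (tdeg eSK) (tdeg (XV 10 [*] vR)) + 1) \<le> 2000 * R ^ 5"
      by (rule time_ok) (use static_block(2) in auto)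
    show "12 \<notin> bnds eSK" using static_block(2) by auto
  qed (use static_block(2) LbLv sizes in auto)
  have s3: "hoare (Inv (Lb b) (?t12 # ?F0)) (HFill 22 6 (XV 10 [*] vR) eSK) (2000 * R ^ 5) (Inv (Lb b) ?F2)"
    by (rule Inv_weaken[OF 3]) auto
  have 4: "hoare (Inv (Lb b) ?F2) (HFill 13 6 (XL 0) eK) (2000 * R ^ 5) (Inv (Lb b) (?t13 # ?F2))"
  proof (rule table_rule[OF _ _ static_block(3)])
    fix V A z assume I: "Inv (Lb b) ?F2 V A" and z: "z < R" "V 12 = z"
    have s: "set F1 \<subseteq> set ?F2" by auto
    show "xev V A eK = bs.letter z"
      unfolding bs.letter_skey[OF z(1)]
      by (rule eval_K[OF vars(3)[OF I] T(1)[OF I s, unfolded NN] T(3)[OF I s] z vars(2)[OF I] b vars(1)[OF I]])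
  next
    fix z assume z: "z < R"
    show "bs.letter z \<le> S" unfolding bs.letter_skey[OF z]
      by (rule le_trans[OF less_imp_le[OF skey_bound[OF proper trn_in[OF proper slice_in[OF bs.y bs.div_less_m[OF z]]]]] base_S(2)])
  next
    show "13 \<notin> fst ` set ?F2" using freshF by auto
  qed (use LbLv in auto)
  have 5: "hoare (Inv (Lb b) (?t13 # ?F2)) (HFill 14 6 (XL 0) eKF) (2000 * R ^ 5) (Inv (Lb b) (?t14 # ?t13 # ?F2))"
  proof (rule table_rule[OF _ _ static_block(4)])
    fix V A z assume I: "Inv (Lb b) (?t13 # ?F2) V A" and z: "z < R" "V 12 = z"
    have s: "set F1 \<subseteq> set (?t13 # ?F2)" by auto
    show "xev V A eKF = num_below q n (z mod p) (slice n (yb b) (z div p))"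
      by (rule eval_KF[OF vars(3)[OF I] T(2)[OF I s, unfolded NN] z vars(2)[OF I] b vars(1)[OF I]])
  next
    fix z show "num_below q n (z mod p) (slice n (yb b) (z div p)) \<le> S"
      using num_below_le[of q n "z mod p" "slice n (yb b) (z div p)"] q_S(2) by linarith
  next
    show "14 \<notin> fst ` set (?t13 # ?F2)" using freshF by auto
  qed (use LbLv in auto)
  let ?F5 = "?t14 # ?t13 # ?F2"
  have 6: "hoare (Inv (Lb b) ?F5) (HFill 15 9 (XL 0) eRJ) (2000 * R ^ 5) (Inv (Lb b) (?t15 # ?F5))"
  proof (rule table_rule[OF _ _ static_block(5)])
    fix V A z assume I: "Inv (Lb b) ?F5 V A" and z: "z < R * R" "V 12 = z"
    have s: "set F1 \<subseteq> set ?F5" by auto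
    show "xev V A eRJ = of_bool (bs.rej (bs.state (z div R)) (bs.letter (z mod R)))"
      by (rule bs.eval_RJ[OF vars(3)[OF I] _ T(3)[OF I s] z]) (rule Inv_tab[OF I], simp)
  next
    show "15 \<notin> fst ` set ?F5" using freshF by auto
    show "R * R \<le> 2 * R\<^sup>2" by (simp add: power2_eq_square)
  qed (use LbLv S2 in auto)
  have 7: "hoare (Inv (Lb b) (?t15 # ?F5)) (HFill 16 9 (XL 0) eDT) (2000 * R ^ 5) (Inv (Lb b) (?t16 # ?t15 # ?F5))"
  proof (rule table_rule[OF _ _ static_block(6)])
    fix V A z assume I: "Inv (Lb b) (?t15 # ?F5) V A" and z: "z < R * R" "V 12 = z"
    show "xev V A eDT = bs.succ_name (z div R) (z mod R)"
      by (rule bs.eval_DT[OF vars(3)[OF I] _ z]) (rule Inv_tab[OF I], simp)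
  next
    fix z assume "z < R * R"
    then have "bs.succ_name (z div R) (z mod R) < R" using RR_split bs.succ_name(3) by blast
    then show "bs.succ_name (z div R) (z mod R) \<le> S" using sizes(4) by linarith
  next
    show "16 \<notin> fst ` set (?t15 # ?F5)" using freshF by auto
    show "R * R \<le> 2 * R\<^sup>2" by (simp add: power2_eq_square)
  qed (use LbLv in auto)
  have 8: "hoare (Inv (Lb b) (?t16 # ?t15 # ?F5)) (HFill 17 6 (XL 0) eFI) (2000 * R ^ 5) (Inv (Lb b) (?t17 # ?t16 # ?t15 # ?F5))"
  proof (rule table_rule[OF _ _ static_block(7)])
    fix V A z assume I: "Inv (Lb b) (?t16 # ?t15 # ?F5) V A" and z: "z < R" "V 12 = z"
    show "xev V A eFI = of_bool (bs.newname z)"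
      by (rule bs.eval_FI[OF vars(3)[OF I] _ z]) (rule Inv_tab[OF I], simp)
  next
    show "17 \<notin> fst ` set (?t16 # ?t15 # ?F5)" using freshF by auto
  qed (use LbLv S2 in auto)
  have 9: "hoare (Inv (Lb b) (?t17 # ?t16 # ?t15 # ?F5)) (HFill 18 6 (XL 0) eCA) (2000 * R ^ 5)
      (Inv (Lb b) (?t18 # ?t17 # ?t16 # ?t15 # ?F5))"
  proof (rule table_rule[OF _ _ static_block(8)])
    fix V A z assume I: "Inv (Lb b) (?t17 # ?t16 # ?t15 # ?F5) V A" and z: "z < R" "V 12 = z"
    show "xev V A eCA = of_bool (bs.canon z)"
      by (rule bs.eval_CA[OF vars(3)[OF I] _ z]) (rule Inv_tab[OF I], simp)
  next
    show "18 \<notin> fst ` set (?t17 # ?t16 # ?t15 # ?F5)" using freshF by auto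
  qed (use LbLv S2 in auto)
  let ?G = "Fb b @ X22 (b * R + R) # F1"
  have 10: "hoare (Inv (Lb b) (X23 (b * R + 0) # ?G)) (HFor 11 6 cShift) (20000 * R ^ 5) (Inv (Lb b) (X23 (b * R + R) # ?G))"
  proof (rule Inv_For[where F = "\<lambda>g. X23 (b * R + g) # ?G" and y = 6 and n = R])
    fix g assume g: "g < R"
    show "hoare (Inv ((11, g) # Lb b) (X23 (b * R + g) # ?G)) cShift (12000 * R ^ 4) (Inv ((11, g) # Lb b) (X23 (b * R + Suc g) # ?G))"
      by (rule shift_step[OF b g]) (use freshF in \<open>auto simp: Fb_def\<close>)
  next
    have "8 * R ^ 1 \<le> 8 * R ^ 5" "6 * R ^ 0 \<le> 6 * R ^ 5" by (rule time_ok; simp)+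
    moreover have "R * (12000 * R ^ 4 + 8) + 6 = 12000 * R ^ 5 + 8 * R ^ 1 + 6 * R ^ 0"
      unfolding distrib_left power_0 power_one_right mult_1_right by (simp only: power_Suc[of R 4, simplified] mult_ac numeral_eq_Suc power_Suc pred_numeral_simps)
    ultimately show "R * (12000 * R ^ 4 + 8) + 6 \<le> 20000 * R ^ 5" by linarith
  qed (use fresh in \<open>auto simp: Lb_def Lv_def\<close>)
  have s10: "hoare (Inv (Lb b) (?t18 # ?t17 # ?t16 # ?t15 # ?F5)) (HFor 11 6 cShift) (20000 * R ^ 5)
      (Inv ?L0 (X22 (Suc b * R) # X23 (Suc b * R) # F1))"
    by (rule Inv_weaken[OF 10]) (auto simp: Fb_def Lb_def add.commute)
  have "hoare (Inv ?L0 ?F0) cBlock (38000 * R ^ 5) (Inv ?L0 (X22 (Suc b * R) # X23 (Suc b * R) # F1))"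
    unfolding cBlock_def
    using Seq_scaled[OF 1 Seq_scaled[OF 2 Seq_scaled[OF s3 Seq_scaled[OF 4 Seq_scaled[OF 5 Seq_scaled[OF 6 Seq_scaled[OF 7
      Seq_scaled[OF 8 Seq_scaled[OF 9 s10]]]]]]]]] by simp
  then show ?thesis by (rule Inv_weaken) auto
qed

end

text \<open>Unlike \<open>Inv_Set\<close>, this allows the new value to depend on the old value of the variable assigned.\<close>

lemma (in machine) Inv_Assign:
  assumes "\<And>V A. Inv L0 F V A \<Longrightarrow> xev V A e = v" "v \<le> S" "set L \<subseteq> set L0"
    and "wfx 20 e" "vdeg e \<le> D" "x < 20" "x \<notin> fst ` set L" "1 \<le> P"
    and "\<And>V A. Inv L0 F V A \<Longrightarrow> \<forall>y\<in>bnds e. V y \<le> P" "(tcoef e + 2) * P ^ tdeg e \<le> T"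
  shows "hoare (Inv L0 F) (HSet x e) T (Inv ((x, v) # L) F)"
proof -
  have "hoare (Inv L0 F) (HSet x e) ((tcoef e + 2) * P ^ tdeg e) (Inv ((x, v) # L) F)"
  proof (rule hoare_Set[OF assms(4,5,6,8)])
    fix V A assume I: "Inv L0 F V A"
    have "Inv L F (V(x := v)) A" by (rule Inv_upd_var[OF Inv_mono[OF I assms(3) order_refl] assms(7)])
    then show "(\<forall>y\<in>bnds e. V y \<le> P) \<and> xev V A e \<le> S \<and> Inv ((x, v) # L) F (V(x := xev V A e)) A"
      using assms(1)[OF I] assms(2) assms(9)[OF I] by (simp add: Inv_Cons_var)
  qed
  then show ?thesis by (rule hoare_conseq) (use assms(10) in auto)
qed

lemma (in machine) Inv_Assign0:
  assumes "\<And>V A. Inv L0 F V A \<Longrightarrow> xev V A e = v" "v \<le> S" "set L \<subseteq> set L0"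
    and "wfx 20 e \<and> vdeg e \<le> D \<and> bnds e = {} \<and> tdeg e = 0 \<and> tcoef e \<le> 1900" "x < 20" "x \<notin> fst ` set L"
  shows "hoare (Inv L0 F) (HSet x e) 2000 (Inv ((x, v) # L) F)"
  by (rule Inv_Assign[where P = 1]) (use assms in auto)

lemma (in machine) Inv_Copy:
  assumes "\<And>V A z. Inv L F V A \<Longrightarrow> z < k \<Longrightarrow> V 12 = z \<Longrightarrow> xev V A e = f z" "\<And>z. z < k \<Longrightarrow> f z \<le> S" "1 \<le> k"
    and "wfx 20 e \<and> vdeg e \<le> D \<and> bnds e = {} \<and> tdeg e = 0 \<and> tcoef e \<le> 1900" "2 \<le> D"
    and "(y, k) \<in> set L" "12 \<notin> fst ` set L" "a \<notin> fst ` set F" "y < 20"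
  shows "hoare (Inv L F) (HFill a y (XL 0) e) (2000 * k) (Inv L ((a, k, f) # F))"
proof (rule Inv_Table[where P = 1 and c = k and r = 0])
  show "k * (tcoef e + 26) * 1 ^ (tdeg e + 0) \<le> 2000 * k" using assms(4) by (simp add: mult.commute)
qed (use assms in auto)

context level_run
begin

definition "Lin = [(0 :: nat, d), (2, N), (3, e), (5, p), (8, base)]"
definition "Lout = [(0 :: nat, d), (2, N), (3, e + 1), (5, R), (8, base'), (1, of_bool (e + 1 < d))]"
definition "Fout = [(0 :: nat, d, sz), (2, N, key_tab q (n @ [m]) BLK), (3, N, below_tab q (n @ [m]) BLK),
  (4, R, num_fixed q (n @ [m])), (5, R * R, gadd_tab (n @ [m]))]"

lemma pre_hoare: "hoare (Inv Lin F0) cPre 14000 (Inv Lv F0)"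
proof -
  let ?L1 = "(4 :: nat, m) # Lin" let ?L2 = "(6, R) # ?L1" let ?L3 = "(7, NB) # ?L2" let ?L4 = "(9, R * R) # ?L3"
  let ?L5 = "(13, m + 1) # ?L4" let ?L6 = "(14, (m + 1) * p) # ?L5" let ?L7 = "(15, R * (m + 1) * R) # ?L6"
  have v: "V x = u" if "Inv L F V A" "(x, u) \<in> set L" for L F V A x u by (rule Inv_var[OF that])
  have mS: "m \<le> S" using le_trans[OF sizes(1,4)] .
  have NBS: "NB \<le> S" using le_trans[OF NB_le_N NS] .
  have 1: "hoare (Inv Lin F0) (HSet 4 (XC 0 (XV 3))) 2000 (Inv ?L1 F0)"
  proof (rule Inv_Assign0[OF _ mS order_refl])
    fix V A assume I: "Inv Lin F0 V A"
    have "tab A 0 d sz" by (rule Inv_tab[OF I]) (simp add: F0_def)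
    then show "xev V A (XC 0 (XV 3)) = m" using v[OF I, of 3 e] ed sz by (simp add: Lin_def tab_def)
  qed (auto simp: Lin_def)
  have 2: "hoare (Inv ?L1 F0) (HSet 6 (vp [*] vm)) 2000 (Inv ?L2 F0)"
  proof (rule Inv_Assign0[OF _ sizes(4) order_refl])
    fix V A assume I: "Inv ?L1 F0 V A"
    show "xev V A (vp [*] vm) = R" using v[OF I, of 5 p] v[OF I, of 4 m] by (simp add: Lin_def)
  qed (auto simp: Lin_def)
  have 3: "hoare (Inv ?L2 F0) (HSet 7 (XV 2 [div] vR)) 2000 (Inv ?L3 F0)"
  proof (rule Inv_Assign0[OF _ NBS order_refl])
    fix V A assume I: "Inv ?L2 F0 V A"
    have "N div R = NB" unfolding N using R_pos by (intro nonzero_mult_div_cancel_right) simp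
    then show "xev V A (XV 2 [div] vR) = NB" using v[OF I, of 2 N] v[OF I, of 6 R] by (simp add: Lin_def)
  qed (auto simp: Lin_def)
  have 4: "hoare (Inv ?L3 F0) (HSet 9 (vR [*] vR)) 2000 (Inv ?L4 F0)"
  proof (rule Inv_Assign0[OF _ sizes(3) order_refl])
    fix V A assume I: "Inv ?L3 F0 V A"
    show "xev V A (vR [*] vR) = R * R" using v[OF I, of 6 R] by simp
  qed (auto simp: Lin_def)
  have 5: "hoare (Inv ?L4 F0) (HSet 13 (vm [+] XL 1)) 2000 (Inv ?L5 F0)"
  proof (rule Inv_Assign0[OF _ sizes(5) order_refl])
    fix V A assume I: "Inv ?L4 F0 V A"
    show "xev V A (vm [+] XL 1) = m + 1" using v[OF I, of 4 m] by simp
  qed (auto simp: Lin_def)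
  have 6: "hoare (Inv ?L5 F0) (HSet 14 (XV 13 [*] vp)) 2000 (Inv ?L6 F0)"
  proof (rule Inv_Assign0[OF _ sizes(6) order_refl])
    fix V A assume I: "Inv ?L5 F0 V A"
    show "xev V A (XV 13 [*] vp) = (m + 1) * p" using v[OF I, of 13 "m + 1"] v[OF I, of 5 p] by (simp add: Lin_def)
  qed (auto simp: Lin_def)
  have 7: "hoare (Inv ?L6 F0) (HSet 15 (vR [*] XV 13 [*] vR)) 2000 (Inv ?L7 F0)"
  proof (rule Inv_Assign0[OF _ sizes(7) order_refl])
    fix V A assume I: "Inv ?L6 F0 V A"
    show "xev V A (vR [*] XV 13 [*] vR) = R * (m + 1) * R" using v[OF I, of 13 "m + 1"] v[OF I, of 6 R] by simp
  qed (auto simp: Lin_def)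
  have "hoare (Inv Lin F0) cPre 14000 (Inv ?L7 F0)"
    unfolding cPre_def using hoare_Seq[OF 1 hoare_Seq[OF 2 hoare_Seq[OF 3 hoare_Seq[OF 4 hoare_Seq[OF 5 hoare_Seq[OF 6 7]]]]]] by simp
  then show ?thesis by (rule Inv_weaken) (auto simp: Lin_def Lv_def)
qed

text \<open>There are \<open>N div R\<close> blocks of cost \<open>R ^ 5\<close>.\<close>

lemma blocks_hoare: "hoare (Inv Lv F1) (HFor 10 7 cBlock) (50000 * (N * R ^ 4)) (Inv Lv (X22 N # X23 N # F1))"
proof -
  have "hoare (Inv Lv (X22 (0 * R) # X23 (0 * R) # F1)) (HFor 10 7 cBlock) (50000 * (N * R ^ 4))
      (Inv Lv (X22 (NB * R) # X23 (NB * R) # F1))"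
  proof (rule Inv_For[where F = "\<lambda>b. X22 (b * R) # X23 (b * R) # F1" and y = 7 and n = NB])
    fix b assume "b < NB"
    then show "hoare (Inv ((10, b) # Lv) (X22 (b * R) # X23 (b * R) # F1)) cBlock (40000 * R ^ 5)
       (Inv ((10, b) # Lv) (X22 (Suc b * R) # X23 (Suc b * R) # F1))" by (rule block_hoare)
  next
    have "R ^ 5 = R * R ^ 4" by (simp add: eval_nat_numeral)
    then have "NB * R ^ 5 = N * R ^ 4" unfolding N by (simp only: mult_ac)
    moreover have "1 \<le> R ^ 4" using sizes(11) by simp
    then have "NB * 1 \<le> N * R ^ 4" "1 * 1 \<le> N * R ^ 4" using NB_le_N N_pos by (intro mult_le_mono; simp)+
    moreover have "NB * (40000 * R ^ 5 + 8) + 6 = 40000 * (NB * R ^ 5) + 8 * (NB * 1) + 6 * (1 * 1)" by (simp add: algebra_simps)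
    ultimately show "NB * (40000 * R ^ 5 + 8) + 6 \<le> 50000 * (N * R ^ 4)" by linarith
  qed (auto simp: Lv_def)
  then show ?thesis
    unfolding N by (rule hoare_conseq) (simp_all add: Inv_Cons_tab tab_def)
qed

definition "G1 = [X22 N, X23 N, (24, R, num_fixed q (n @ [m])), (6, m + 1, \<lambda>i. base ^ i), (25, R * R, gadd_tab (n @ [m])), (0, d, sz)]"

lemma key_tab_S: "z < N \<Longrightarrow> key_tab q (n @ [m]) BLK z \<le> S"
proof -
  assume "z < N"
  then have b: "z div R < NB" unfolding N by (simp add: less_mult_imp_div_less)
  have P: "prod_list (n @ [m]) = R" by simp
  show ?thesis
    unfolding key_tab_def P using less_imp_le[OF skey_bound[OF proper' trn_in[OF proper' BLK[OF b]]]] keyS by (rule le_trans)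
qed

text \<open>
  The tables of the next level replace those of the current one only now, since the work on later blocks still
  needs the latter.
\<close>

lemma copy_hoare: "hoare (Inv Lv G1) cCopy (8000 * (N * R ^ 4)) (Inv Lv (Fout @ [(6, m + 1, \<lambda>i. base ^ i)]))"
proof -
  let ?t2 = "(2 :: nat, N, key_tab q (n @ [m]) BLK)" let ?t3 = "(3 :: nat, N, below_tab q (n @ [m]) BLK)"
  let ?t4 = "(4 :: nat, R, num_fixed q (n @ [m]))" let ?t5 = "(5 :: nat, R * R, gadd_tab (n @ [m]))"
  have R4: "1 \<le> R ^ 4" using sizes(11) by simp
  have RR: "R * R \<le> R ^ 4"
  proof -
    have "R ^ 2 \<le> R ^ 4" using sizes(11) by (intro power_increasing) auto
    then show ?thesis by (simp add: power2_eq_square)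
  qed
  have b1: "N * 1 \<le> N * R ^ 4" using R4 by (rule mult_le_mono2)
  have b2: "1 * (R * R) \<le> N * R ^ 4" using N_pos RR by (rule mult_le_mono)
  have b3: "R * 1 \<le> N * R ^ 4" using R_le_N R4 by (rule mult_le_mono)
  have 2: "hoare (Inv Lv G1) (HFill 2 2 (XL 0) (XC 22 vz)) (2000 * N) (Inv Lv (?t2 # G1))"
  proof (rule Inv_Copy)
    fix V A z assume I: "Inv Lv G1 V A" and z: "z < N" "V 12 = z"
    have "tab A 22 N (key_tab q (n @ [m]) BLK)" by (rule Inv_tab[OF I]) (simp add: G1_def)
    then show "xev V A (XC 22 vz) = key_tab q (n @ [m]) BLK z" using z by (simp add: tab_def)
  qed (use key_tab_S N_pos in \<open>auto simp: Lv_def G1_def\<close>)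
  have 3: "hoare (Inv Lv (?t2 # G1)) (HFill 3 2 (XL 0) (XC 23 vz)) (2000 * N) (Inv Lv (?t3 # ?t2 # G1))"
  proof (rule Inv_Copy)
    fix V A z assume I: "Inv Lv (?t2 # G1) V A" and z: "z < N" "V 12 = z"
    have "tab A 23 N (below_tab q (n @ [m]) BLK)" by (rule Inv_tab[OF I]) (simp add: G1_def)
    then show "xev V A (XC 23 vz) = below_tab q (n @ [m]) BLK z" using z by (simp add: tab_def)
  next
    fix z show "below_tab q (n @ [m]) BLK z \<le> S" unfolding below_tab_def by (rule num_below_S)
  qed (use N_pos in \<open>auto simp: Lv_def G1_def\<close>)
  have 4: "hoare (Inv Lv (?t3 # ?t2 # G1)) (HFill 4 6 (XL 0) (XC 24 vz)) (2000 * R) (Inv Lv (?t4 # ?t3 # ?t2 # G1))"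
  proof (rule Inv_Copy)
    fix V A z assume I: "Inv Lv (?t3 # ?t2 # G1) V A" and z: "z < R" "V 12 = z"
    have "tab A 24 R (num_fixed q (n @ [m]))" by (rule Inv_tab[OF I]) (simp add: G1_def)
    then show "xev V A (XC 24 vz) = num_fixed q (n @ [m]) z" using z by (simp add: tab_def)
  next
    fix z show "num_fixed q (n @ [m]) z \<le> S" using num_fixed_le[of q "n @ [m]" z] qS by linarith
  qed (use sizes in \<open>auto simp: Lv_def G1_def\<close>)
  have 5: "hoare (Inv Lv (?t4 # ?t3 # ?t2 # G1)) (HFill 5 9 (XL 0) (XC 25 vz)) (2000 * (R * R)) (Inv Lv (?t5 # ?t4 # ?t3 # ?t2 # G1))"
  proof (rule Inv_Copy)
    fix V A z assume I: "Inv Lv (?t4 # ?t3 # ?t2 # G1) V A" and z: "z < R * R" "V 12 = z"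
    have "tab A 25 (R * R) (gadd_tab (n @ [m]))" by (rule Inv_tab[OF I]) (simp add: G1_def)
    then show "xev V A (XC 25 vz) = gadd_tab (n @ [m]) z" using z by (simp add: tab_def)
  next
    fix z show "gadd_tab (n @ [m]) z \<le> S" unfolding gadd_tab_def
      using le_trans[OF less_imp_le[OF gadd_less[OF proper']]] sizes(4) by simp
  next
    show "1 \<le> R * R" using sizes(11) by (metis mult_le_mono mult_1)
  qed (auto simp: Lv_def G1_def)
  have h: "hoare (Inv Lv G1) cCopy (2000 * N + (2000 * N + (2000 * R + 2000 * (R * R)))) (Inv Lv (?t5 # ?t4 # ?t3 # ?t2 # G1))"
    unfolding cCopy_def by (rule hoare_Seq[OF 2 hoare_Seq[OF 3 hoare_Seq[OF 4 5]]])
  have le: "2000 * N + (2000 * N + (2000 * R + 2000 * (R * R))) \<le> 8000 * (N * R ^ 4)"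
    using b1 b2 b3 unfolding mult_1 mult_1_right by linarith
  show ?thesis by (rule Inv_weaken[OF h _ _ le]) (auto simp: Fout_def G1_def)
qed

lemma end_hoare: "hoare (Inv Lv (Fout @ [(6, m + 1, \<lambda>i. base ^ i)])) cEnd 8000 (Inv Lout Fout)"
proof -
  let ?F = "Fout @ [(6, m + 1, \<lambda>i. base ^ i)]"
  let ?La = "[(0 :: nat, d), (2, N), (3, e), (6, R)]"
  let ?L1 = "(8, base') # ?La" let ?L2 = "(5, R) # ?L1"
  let ?L3 = "[(3, e + 1), (5, R), (8, base'), (0 :: nat, d), (2, N)]"
  let ?L4 = "(1, of_bool (e + 1 < d)) # ?L3"
  have 1: "hoare (Inv Lv ?F) (HSet 8 (XC 6 vm [*] vR)) 2000 (Inv ?L1 ?F)"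
  proof (rule Inv_Assign0[OF _ keyS])
    fix V A assume I: "Inv Lv ?F V A"
    have "tab A 6 (m + 1) (\<lambda>i. base ^ i)" by (rule Inv_tab[OF I]) simp
    then show "xev V A (XC 6 vm [*] vR) = base'" using LvD(3,5)[OF I order_refl] by (simp add: tab_def)
  qed (auto simp: Lv_def)
  have 2: "hoare (Inv ?L1 ?F) (HSet 5 vR) 2000 (Inv ?L2 ?F)"
  proof (rule Inv_Assign0[OF _ sizes(4) order_refl])
    show "xev V A vR = R" if "Inv ?L1 ?F V A" for V A using Inv_var[OF that, of 6 R] by simp
  qed auto
  have 3: "hoare (Inv ?L2 ?F) (HSet 3 (XV 3 [+] XL 1)) 2000 (Inv ?L3 ?F)"
  proof (rule Inv_Assign0)
    show "xev V A (XV 3 [+] XL 1) = e + 1" if "Inv ?L2 ?F V A" for V A using Inv_var[OF that, of 3 e] by simp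
    show "e + 1 \<le> S" using ed dS by simp
  qed auto
  have 4: "hoare (Inv ?L3 ?F) (HSet 1 (XV 3 [<] XV 0)) 2000 (Inv ?L4 ?F)"
  proof (rule Inv_Assign0[OF _ _ order_refl])
    show "xev V A (XV 3 [<] XV 0) = of_bool (e + 1 < d)" if "Inv ?L3 ?F V A" for V A
      using Inv_var[OF that, of 3 "e + 1"] Inv_var[OF that, of 0 d] by simp
    show "of_bool (e + 1 < d) \<le> S" using S2 by simp
  qed (auto simp: xdefs)
  have "hoare (Inv Lv ?F) cEnd 8000 (Inv ?L4 ?F)"
    unfolding cEnd_def using hoare_Seq[OF 1 hoare_Seq[OF 2 hoare_Seq[OF 3 4]]] by simp
  then show ?thesis by (rule Inv_weaken) (auto simp: Lout_def)
qed

theorem level_hoare: "hoare (Inv Lin F0) cLevel (100000 * (N * R ^ 4)) (Inv Lout Fout)"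
proof -
  have "hoare (Inv Lv (X22 N # X23 N # F1)) cCopy (8000 * (N * R ^ 4)) (Inv Lv (Fout @ [(6, m + 1, \<lambda>i. base ^ i)]))"
    by (rule Inv_weaken[OF copy_hoare]) (auto simp: G1_def F1_def F0_def)
  then have h: "hoare (Inv Lin F0) cLevel (14000 + (14000 * R ^ 4 + (50000 * (N * R ^ 4) + (8000 * (N * R ^ 4) + 8000)))) (Inv Lout Fout)"
    unfolding cLevel_def by (intro hoare_Seq[OF pre_hoare hoare_Seq[OF tabs_hoare hoare_Seq[OF blocks_hoare hoare_Seq[OF _ end_hoare]]]])
  have "1 * R ^ 4 \<le> N * R ^ 4" using N_pos by (rule mult_le_mono1)
  moreover have "1 \<le> R ^ 4" using sizes(11) by simp
  ultimately have le: "14000 + (14000 * R ^ 4 + (50000 * (N * R ^ 4) + (8000 * (N * R ^ 4) + 8000))) \<le> 100000 * (N * R ^ 4)"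
    unfolding mult_1 by linarith
  show ?thesis by (rule Inv_weaken[OF h _ _ le]) auto
qed

end

section \<open>Sizes all of whose entries are 1\<close>

text \<open>For such a size a word is a single symbol, and the tables with which the main loop starts are explicit.\<close>

lemma prod_ones [simp]: "prod_list (replicate k (1 :: nat)) = 1"
  by simp

lemma proper_ones: "proper (replicate k 1)"
  by (simp add: proper_def)

lemma skey_singleton:
  assumes "proper n" "prod_list n = 1" "x \<in> words q n"
  shows "mkey q n x = wkey q n x" "skey q n x = wkey q n x"
proof -
  have "{..<prod_list n} = {0}" using assms(2) by auto
  then show m: "mkey q n x = wkey q n x"
    unfolding least_key_def by (simp add: trn_0[OF assms(1,3)])
  have "least_shift (wkey q n) n x < 1"
    using least_shift(1)[OF assms(1) wkey_inj[OF assms(1), of q] wkey_bound[OF assms(1), of _ q], where x = x] assms(2) by simp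
  then show "skey q n x = wkey q n x" unfolding slice_key_def m assms(2) by simp
qed

lemma wkey_ones: "x \<in> words q (replicate k 1) \<Longrightarrow> wkey q (replicate k 1) x = x (replicate k 0)"
proof (induction k arbitrary: x)
  case (Suc k)
  have r: "replicate (Suc k) (1 :: nat) = replicate k 1 @ [1]" "replicate (Suc k) (0 :: nat) = replicate k 0 @ [0]"
    by (simp_all add: replicate_append_same)
  have x: "x \<in> words q (replicate k 1 @ [1])" using Suc.prems unfolding r(1) .
  have s: "slice (replicate k 1) x 0 \<in> words q (replicate k 1)" by (rule slice_in[OF x]) simp
  have "replicate k 0 \<in> positions (replicate k 1)" by (simp add: positions_def)
  then have "slice (replicate k 1) x 0 (replicate k 0) = x (replicate k 0 @ [0])" by (simp add: slice_def)
  then show ?case unfolding r wkey.simps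
    using skey_singleton(2)[OF proper_ones prod_ones s] Suc.IH[OF s] by simp
qed simp

lemma key_bound_ones: "key_bound q (replicate k 1) = q + 1"
proof (induction k)
  case (Suc k)
  have r: "replicate (Suc k) (1 :: nat) = replicate k 1 @ [1]" by (simp add: replicate_append_same)
  show ?case unfolding r key_bound.simps using Suc by simp
qed simp

lemma trn_ones: "x \<in> words q (replicate k 1) \<Longrightarrow> trn (replicate k 1) 0 x = x"
  by (rule trn_0[OF proper_ones])

lemma num_fixed_ones: "num_fixed q (replicate k 1) 0 = q"
proof -
  have "{x\<in>words q (replicate k 1). trn (replicate k 1) 0 x = x} = words q (replicate k 1)"
    using trn_ones by blast
  then show ?thesis unfolding num_fixed_def by (simp add: card_words)
qed

lemma num_below_ones:
  assumes "y \<in> words q (replicate k 1)"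
  shows "num_below q (replicate k 1) 0 y = y (replicate k 0) - 1"
proof -
  let ?n = "replicate k (1 :: nat)" let ?o = "replicate k (0 :: nat)"
  let ?c = "\<lambda>v. \<lambda>p\<in>positions ?n. v :: nat"
  have o: "positions ?n = {?o}"
  proof (intro equalityI subsetI)
    fix p assume "p \<in> positions ?n"
    then show "p \<in> {?o}" by (auto simp: positions_def intro!: nth_equalityI)
  qed (simp add: positions_def)
  have om: "?o \<in> positions ?n" unfolding o by simp
  have mk: "mkey q ?n x = x ?o" if "x \<in> words q ?n" for x
    using skey_singleton(1)[OF proper_ones prod_ones that] wkey_ones[OF that] by simp
  have yq: "y ?o \<in> {1..q}" using assms unfolding words_def o by (auto simp: PiE_def Pi_def)
  have "{x\<in>words q ?n. trn ?n 0 x = x \<and> mkey q ?n x < mkey q ?n y} = ?c ` {1..<y ?o}" (is "?A = ?B")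
  proof (intro equalityI subsetI)
    fix x assume x: "x \<in> ?A"
    then have xw: "x \<in> words q ?n" and "x ?o < y ?o" using mk mk[OF assms] by auto
    moreover have "x ?o \<in> {1..q}" using xw unfolding words_def o by (auto simp: PiE_def Pi_def)
    moreover have "x = ?c (x ?o)"
    proof (rule extensionalityI[OF words_extensional[OF xw]])
      fix p assume p: "p \<in> positions ?n"
      then have "p = ?o" unfolding o by simp
      then show "x p = ?c (x ?o) p" using p by simp
    qed simp
    ultimately show "x \<in> ?B" by (intro image_eqI[of _ _ "x ?o"]) auto
  next
    fix x assume "x \<in> ?B"
    then obtain v where v: "x = ?c v" "v \<in> {1..<y ?o}" by (rule imageE)
    have "v \<in> {1..q}" using v(2) yq by simp
    then have xw: "x \<in> words q ?n" unfolding words_def v(1) by (intro restrict_PiE_iff[THEN iffD2] ballI)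
    have "x ?o = v" unfolding v(1) by (rule restrict_apply'[OF om])
    then show "x \<in> ?A" using xw trn_ones[OF xw] mk[OF xw] mk[OF assms] v(2) by simp
  qed
  moreover have "inj_on ?c {1..<y ?o}"
  proof (rule inj_onI)
    fix u v assume "?c u = ?c v"
    then have "?c u ?o = ?c v ?o" by (rule fun_cong)
    then show "u = v" unfolding restrict_apply'[OF om] .
  qed
  ultimately show ?thesis unfolding num_below_def by (simp add: card_image)
qed

section \<open>The whole program\<close>

text \<open>
  Moves down from the last entry of the size vector as long as entries exceed 1. If variable 3 is 0,
  the cell that is read is cell 0 because of truncated subtraction, and the first factor decides.
\<close>

definition "xguard = (XL 0 [<] XV 3 [&] XL 1 [<] XC 0 (XV 3 [-] XL 1))"

text \<open>Finds the number of leading entries 1 and multiplies the other entries to obtain \<open>N\<close>.\<close>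

definition "cSearch = Seq (HSet 2 (XL 1)) (Seq (HSet 3 (XV 0)) (Seq (HSet 4 xguard)
  (While (Var 4) (Seq (HSet 3 (XV 3 [-] XL 1)) (Seq (HSet 2 (XV 2 [*] XC 0 (XV 3))) (HSet 4 xguard))))))"

text \<open>
  The tables of the size consisting of the leading entries 1: keys are symbols, there are
  \<open>x - 1\<close> symbols below \<open>x\<close>, and the group is trivial.
\<close>

definition "cInit = Seq (HFill 2 2 (XL 0) (XC 1 vz)) (Seq (HFill 3 2 (XL 0) (XC 1 vz [-] XL 1))
  (Seq (HUpd 4 (XL 0) (XV 1)) (Seq (HUpd 5 (XL 0) (XL 0)) (Seq (HSet 5 (XL 1)) (Seq (HSet 8 (XV 1 [+] XL 1))
  (HSet 1 (XV 3 [<] XV 0)))))))"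

definition "cFinal = HSet 0 (xsum 20 2 (XC 3 (XV 20)) [div] XV 2)"

definition "rank_prog = Seq cSearch (Seq cInit (Seq (While (Var 1) cLevel) cFinal))"

text \<open>The bound \<open>S\<close> on stored values is a power of \<open>d + q + N\<close>, whose exponent is large enough for \<open>key_le\<close>, \<open>base_le\<close> and \<open>cube_le\<close>.\<close>

locale rank_run = machine B S 200 for B S +
  fixes q :: nat and n :: "nat list" and C :: "word set"
  assumes size: "size_vector n" and C: "C \<in> necklaces q n"
    and S: "S = (length n + q + prod_list n) ^ (4 * prod_list n)"
begin

abbreviation "d \<equiv> length n"
abbreviation "N \<equiv> prod_list n"
abbreviation "X \<equiv> d + q + N"

definition "w0 = representative n C"
definition "fw k = w0 (vec n k)"

lemma proper: "proper n"
  using size unfolding size_vector_def proper_def by auto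

lemma proper_take: "proper (take e n)"
  using proper set_take_subset unfolding proper_def by fastforce

lemma N_pos: "1 \<le> N"
  using proper_pos[OF proper] by simp

lemma w0: "w0 \<in> words q n"
  unfolding w0_def by (rule representative(2)[OF proper C])

lemma fw: "k < N \<Longrightarrow> fw k \<in> {1..q}"
  using w0 vec_in unfolding fw_def words_def by (auto simp: PiE_def Pi_def)

lemma q1: "1 \<le> q"
  using fw[of 0] N_pos by force

lemma d1: "1 \<le> d"
  using size unfolding size_vector_def by (cases n) auto

lemma X3: "3 \<le> X"
  using d1 q1 N_pos by simp

text \<open>The main loop runs through the lengths of prefixes from \<open>e0\<close> to \<open>d\<close>.\<close>

definition "e0 = length (takeWhile (\<lambda>m. m = 1) n)"

lemma e0_le: "e0 \<le> d"
  unfolding e0_def by (rule length_takeWhile_le)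

lemma ones: "take e0 n = replicate e0 1"
proof -
  have "take e0 n = takeWhile (\<lambda>m. m = 1) n" unfolding e0_def by (rule takeWhile_eq_take[symmetric])
  moreover have "takeWhile (\<lambda>m. m = 1) n = replicate e0 1"
    unfolding e0_def by (rule replicate_length_same[symmetric]) (blast dest: set_takeWhileD)
  ultimately show ?thesis by simp
qed

lemma big: "e0 \<le> i \<Longrightarrow> i < d \<Longrightarrow> 2 \<le> n ! i"
proof -
  assume i: "e0 \<le> i" "i < d"
  then have "e0 < d" by simp
  then have "n ! e0 \<noteq> 1" unfolding e0_def by (rule nth_length_takeWhile)
  moreover have "1 \<le> n ! e0" using proper \<open>e0 < d\<close> unfolding proper_def by simp
  moreover have "n ! e0 \<le> n ! i"
    using size i unfolding size_vector_def by (intro sorted_nth_mono) auto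
  ultimately show "2 \<le> n ! i" by linarith
qed

abbreviation "pre e \<equiv> prod_list (take e n)"

lemma take_Suc: "e < d \<Longrightarrow> take (Suc e) n = take e n @ [n ! e]"
  by (rule take_Suc_conv_app_nth)

lemma pre_Suc: "e < d \<Longrightarrow> pre (Suc e) = pre e * n ! e"
  by (simp add: take_Suc)

lemma pre_pos: "1 \<le> pre e"
  using proper_pos[OF proper_take] by (simp add: Suc_leI)

lemma pre_drop: "N = pre e * prod_list (drop e n)"
  by (metis append_take_drop_id prod_list.append)

lemma pre_le: "pre e \<le> N"
  using pre_drop[of e] N_pos by (cases "prod_list (drop e n)") auto

lemma pre_e0: "pre e0 = 1"
  using ones by simp

text \<open>
  Since the last coordinate is the most significant one in \<open>index\<close>, blocks of every prefix size are
  contiguous in the input array.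
\<close>

definition "blk e b = (\<lambda>p\<in>positions (take e n). fw (b * pre e + index (take e n) p))"

lemma blk_in: "b < prod_list (drop e n) \<Longrightarrow> blk e b \<in> words q (take e n)"
proof -
  assume b: "b < prod_list (drop e n)"
  have "fw (b * pre e + index (take e n) p) \<in> {1..q}" if "p \<in> positions (take e n)" for p
  proof (rule fw)
    show "b * pre e + index (take e n) p < N"
      using pair_lt[OF b index_less[OF that]] pre_drop[of e] by (simp add: mult.commute)
  qed
  then show ?thesis unfolding words_def blk_def by auto
qed

lemma slice_blk: "e < d \<Longrightarrow> i < n ! e \<Longrightarrow> slice (take e n) (blk (Suc e) b) i = blk e (b * n ! e + i)"
  unfolding slice_def blk_def
  by (auto simp: fun_eq_iff take_Suc index_snoc length_positions algebra_simps)

lemma blk_d: "blk d 0 = w0"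
proof (rule extensionalityI)
  show "blk d 0 \<in> extensional (positions n)" unfolding blk_def by simp
  show "w0 \<in> extensional (positions n)" by (rule words_extensional[OF w0])
  show "blk d 0 p = w0 p" if "p \<in> positions n" for p
    using that by (simp add: blk_def fw_def vec_index)
qed

lemma X_pow: "a \<le> X ^ b \<Longrightarrow> b \<le> 4 * N \<Longrightarrow> a \<le> S"
proof -
  assume a: "a \<le> X ^ b" and b: "b \<le> 4 * N"
  have "X ^ b \<le> X ^ (4 * N)" using b X3 by (intro power_increasing) simp_all
  then show "a \<le> S" unfolding S using a by (rule le_trans[rotated])
qed

lemma four_sq_le: "2 \<le> m \<Longrightarrow> m ^ 2 * 4 \<le> (4 :: nat) ^ m"
proof (induction m rule: dec_induct)
  case (step k)
  have "Suc k ^ 2 \<le> (2 * k) ^ 2" using step.hyps by (intro power_mono) auto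
  then have "Suc k ^ 2 * 4 \<le> 4 * (k ^ 2 * 4)" by (simp add: power_mult_distrib)
  also have "\<dots> \<le> 4 * 4 ^ k" using step.IH by (rule mult_le_mono2)
  finally show ?case by simp
qed simp

text \<open>
  The factor \<open>4 * pre e ^ 2\<close> makes the induction work: passing from \<open>n\<close> to \<open>n @ [m]\<close> multiplies the exponent
  by \<open>m\<close>, and the new factors are absorbed by the \<open>m\<close>-th power of this one since \<open>4 * m ^ 2 \<le> 4 ^ m\<close> for \<open>2 \<le> m\<close>.
  For \<open>m = 1\<close> nothing is gained, but then \<open>n\<close> consists of entries 1 as well.
\<close>

lemma key_le: "e \<le> d \<Longrightarrow> 4 * key_bound q (take e n) * pre e ^ 2 \<le> X ^ (3 * pre e)"
proof (induction e)
  case 0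
  have "4 * (q + 1) \<le> 3 ^ 2 * X" using d1 N_pos by simp
  also have "\<dots> \<le> X ^ 2 * X" using X3 by (intro mult_le_mono1 power_mono) auto
  finally show ?case by (simp add: power3_eq_cube power2_eq_square)
next
  case (Suc e)
  let ?m = "n ! e" let ?p = "pre e" let ?Q = "key_bound q (take e n)"
  have e: "e < d" using Suc.prems by simp
  have m1: "1 \<le> ?m" using proper e unfolding proper_def by simp
  have "4 * (?Q * ?p) ^ ?m * (?p * ?m) ^ 2 \<le> (4 * ?Q * ?p ^ 2) ^ ?m"
  proof (cases "?m = 1")
    case True
    (* an entry 1 is preceded by entries 1 only *)
    have "e0 > e" using big[of e] e True by (cases "e0 \<le> e") auto
    then have "take e n = take e (take e0 n)" by simp
    then have "?p = 1" unfolding ones by simp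
    then show ?thesis using True by simp
  next
    case False
    then have m2: "2 \<le> ?m" using m1 by simp
    have "?m ^ 2 * 4 \<le> 4 ^ ?m" using m2 by (rule four_sq_le)
    moreover have "?p ^ 2 \<le> ?p ^ ?m" using m2 pre_pos by (intro power_increasing) auto
    ultimately have "(?Q * ?p) ^ ?m * ((?m ^ 2 * 4) * ?p ^ 2) \<le> (?Q * ?p) ^ ?m * (4 ^ ?m * ?p ^ ?m)"
      by (intro mult_le_mono2 mult_le_mono)
    moreover have "(?Q * ?p) ^ ?m * ((?m ^ 2 * 4) * ?p ^ 2) = 4 * (?Q * ?p) ^ ?m * (?p * ?m) ^ 2"
      unfolding power_mult_distrib[of ?p ?m] by (simp only: mult_ac)
    moreover have "(?Q * ?p) ^ ?m * (4 ^ ?m * ?p ^ ?m) = (4 * ?Q * ?p ^ 2) ^ ?m"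
      unfolding power_mult_distrib[symmetric] power2_eq_square by (simp only: mult_ac)
    ultimately show ?thesis by (simp only:)
  qed
  also have "\<dots> \<le> (X ^ (3 * ?p)) ^ ?m"
    by (rule power_mono[OF Suc.IH]) (use e in simp_all)
  also have "\<dots> = X ^ (3 * (?p * ?m))" by (simp only: power_mult[symmetric] mult.assoc)
  also have "4 * (?Q * ?p) ^ ?m * (?p * ?m) ^ 2 = 4 * key_bound q (take (Suc e) n) * pre (Suc e) ^ 2"
    unfolding pre_Suc[OF e] unfolding take_Suc[OF e] key_bound.simps ..
  finally show ?case unfolding pre_Suc[OF e] .
qed

lemma base_le: "e \<le> d \<Longrightarrow> key_bound q (take e n) * pre e \<le> S"
proof -
  assume e: "e \<le> d"
  have "pre e * 1 \<le> pre e * pre e" using pre_pos by (rule mult_le_mono2)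
  then have "key_bound q (take e n) * (pre e * 1) \<le> key_bound q (take e n) * (pre e * pre e)" by (rule mult_le_mono2)
  then have "key_bound q (take e n) * pre e \<le> 4 * (key_bound q (take e n) * (pre e * pre e))"
    unfolding mult_1_right by linarith
  then have "key_bound q (take e n) * pre e \<le> 4 * key_bound q (take e n) * pre e ^ 2"
    by (simp only: power2_eq_square mult.assoc)
  then have "key_bound q (take e n) * pre e \<le> X ^ (3 * pre e)" using key_le[OF e] by (rule le_trans)
  then show "key_bound q (take e n) * pre e \<le> S" by (rule X_pow) (use pre_le[of e] in linarith)
qed

lemma qN_le: "q ^ N \<le> S"
proof (rule X_pow[of _ N])
  show "q ^ N \<le> X ^ N" by (rule power_mono) simp_all
qed simp

lemma qpre_le: "q ^ pre e \<le> S"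
  using power_increasing[OF pre_le q1, of e] qN_le by (rule le_trans)

lemma X_le: "X \<le> S"
  by (rule X_pow[of _ 1]) (use N_pos in simp_all)

lemma cube_le: "e < d \<Longrightarrow> pre (Suc e) * (n ! e + 1) * pre (Suc e) \<le> S"
proof -
  assume e: "e < d"
  have "n ! e * 1 \<le> pre (Suc e)"
    unfolding pre_Suc[OF e] mult.commute[of "pre e"] using pre_pos by (rule mult_le_mono2)
  then have "n ! e + 1 \<le> N + N" using pre_le[of "Suc e"] N_pos by linarith
  moreover have "N + N \<le> X * X" using mult_le_mono[of 2 X N X] X3 by linarith
  ultimately have "n ! e + 1 \<le> X * X" by (rule le_trans)
  moreover have "pre (Suc e) \<le> X" using pre_le[of "Suc e"] by linarith
  ultimately have "pre (Suc e) * (n ! e + 1) * pre (Suc e) \<le> X * (X * X) * X" by (intro mult_le_mono)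
  then have "pre (Suc e) * (n ! e + 1) * pre (Suc e) \<le> X ^ 4" by (simp only: power4_eq_xxxx mult.assoc)
  then show "pre (Suc e) * (n ! e + 1) * pre (Suc e) \<le> S" by (rule X_pow) (use N_pos in linarith)
qed

lemma level: "e0 \<le> e \<Longrightarrow> e < d \<Longrightarrow>
  level_run q (take e n) (n ! e) (prod_list (drop (Suc e) n)) (blk e) (blk (Suc e)) B S N d e ((!) n)"
proof
  assume e: "e0 \<le> e" "e < d"
  show "proper (take e n)" by (rule proper_take)
  show "1 \<le> n ! e" using big[OF e] by simp
  show "0 < prod_list (drop (Suc e) n)" using pre_drop[of "Suc e"] N_pos by (cases "prod_list (drop (Suc e) n)") auto
  show "blk (Suc e) b \<in> words q (take e n @ [n ! e])" if "b < prod_list (drop (Suc e) n)" for b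
    using blk_in[OF that] take_Suc[OF e(2)] by simp
  show "slice (take e n) (blk (Suc e) b) i = blk e (b * n ! e + i)" if "i < n ! e" for b i
    by (rule slice_blk[OF e(2) that])
  show "N = prod_list (drop (Suc e) n) * (pre e * n ! e)"
    using pre_drop[of "Suc e"] pre_Suc[OF e(2)] by (simp only: mult.commute)
  show "N \<le> S" "d \<le> S" using X_le by simp_all
  show "e < d" "n ! e = n ! e" "1 \<le> q" using e q1 by simp_all
  show "key_bound q (take e n @ [n ! e]) * prod_list (take e n @ [n ! e]) \<le> S"
    unfolding take_Suc[OF e(2), symmetric] by (rule base_le) (use e in simp)
  show "q ^ prod_list (take e n @ [n ! e]) \<le> S" unfolding take_Suc[OF e(2), symmetric] by (rule qpre_le)
  show "prod_list (take e n @ [n ! e]) * (n ! e + 1) * prod_list (take e n @ [n ! e]) \<le> S"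
    unfolding take_Suc[OF e(2), symmetric] by (rule cube_le[OF e(2)])
qed

definition "Lev e = [(0 :: nat, d), (2, N), (3, e), (5, pre e), (8, key_bound q (take e n) * pre e), (1, of_bool (e < d))]"
definition "Fev e = [(0 :: nat, d, (!) n), (2, N, key_tab q (take e n) (blk e)), (3, N, below_tab q (take e n) (blk e)),
  (4, pre e, num_fixed q (take e n)), (5, pre e * pre e, gadd_tab (take e n))]"

lemma level_step:
  assumes "e0 \<le> e" "e < d"
  shows "hoare (Inv (Lev e) (Fev e)) cLevel (100000 * (N * pre (Suc e) ^ 4)) (Inv (Lev (Suc e)) (Fev (Suc e)))"
proof -
  interpret level_run q "take e n" "n ! e" "prod_list (drop (Suc e) n)" "blk e" "blk (Suc e)" B S N d e "(!) n"
    by (rule level[OF assms])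
  show ?thesis
  proof (rule Inv_weaken)
    show "set Lin \<subseteq> set (Lev e)" unfolding Lin_def Lev_def by simp
    show "set F0 \<subseteq> set (Fev e)" unfolding F0_def Fev_def by simp
    show "set (Lev (Suc e)) \<subseteq> set Lout" unfolding Lout_def Lev_def take_Suc[OF assms(2)] by simp
    show "set (Fev (Suc e)) \<subseteq> set Fout" unfolding Fout_def Fev_def take_Suc[OF assms(2)] by simp
    show "hoare (Inv Lin F0) cLevel (100000 * (N * pre (Suc e) ^ 4)) (Inv Lout Fout)"
      unfolding pre_Suc[OF assms(2)] by (rule level_hoare)
  qed simp
qed

text \<open>A geometric sum, as \<open>pre\<close> at least doubles at each level after the entries 1.\<close>

lemma sum_levels: "e0 + i \<le> d \<Longrightarrow> (\<Sum>j<i. pre (Suc (e0 + j)) ^ 4) \<le> 2 * pre (e0 + i) ^ 4"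
proof (induction i)
  case (Suc i)
  have e: "e0 + i < d" using Suc.prems by simp
  have "2 * pre (e0 + i) \<le> pre (Suc (e0 + i))"
    unfolding pre_Suc[OF e] using big[OF _ e] by (simp add: mult.commute)
  then have "(2 * pre (e0 + i)) ^ 4 \<le> pre (Suc (e0 + i)) ^ 4" by (rule power_mono) simp
  then have "2 * pre (e0 + i) ^ 4 \<le> pre (Suc (e0 + i)) ^ 4" by (simp add: power_mult_distrib)
  then show ?case using Suc by simp
qed simp

lemma levels_le: "d - e0 \<le> N"
proof -
  have "2 ^ i \<le> pre (e0 + i)" if "e0 + i \<le> d" for i
    using that
  proof (induction i)
    case (Suc i)
    then have e: "e0 + i < d" by simp
    have "2 ^ i * 2 \<le> pre (e0 + i) * n ! (e0 + i)" using Suc big[OF _ e] by (intro mult_le_mono) auto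
    then show ?case using pre_Suc[OF e] by simp
  qed (simp add: pre_e0)
  from this[of "d - e0"] have "2 ^ (d - e0) \<le> N" using e0_le by simp
  then show ?thesis using less_exp[of "d - e0"] by linarith
qed

lemma main_loop:
  "hoare (Inv (Lev e0) (Fev e0)) (While (Var 1) cLevel) (300000 * N ^ 5) (Inv (Lev d) (Fev d))"
proof -
  let ?T = "\<lambda>i. 100000 * (N * pre (Suc (e0 + i)) ^ 4)"
  have h: "hoare (Inv (Lev (e0 + 0)) (Fev (e0 + 0))) (While (Var 1) cLevel) ((\<Sum>i<d - e0. ?T i + 2) + 2)
      (Inv (Lev (e0 + (d - e0))) (Fev (e0 + (d - e0))))"
  proof (rule hoare_While[where I = "\<lambda>i. Inv (Lev (e0 + i)) (Fev (e0 + i))"])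
    fix i assume "i < d - e0"
    then show "hoare (Inv (Lev (e0 + i)) (Fev (e0 + i))) cLevel (?T i) (Inv (Lev (e0 + Suc i)) (Fev (e0 + Suc i)))"
      using level_step[of "e0 + i"] by simp
  next
    fix i V A assume "i \<le> d - e0" "Inv (Lev (e0 + i)) (Fev (e0 + i)) V A"
    then show "V 1 \<noteq> 0 \<longleftrightarrow> i < d - e0"
      using Inv_var[of "Lev (e0 + i)" "Fev (e0 + i)" V A 1 "of_bool (e0 + i < d)"] by (auto simp: Lev_def)
  qed simp
  have le: "(\<Sum>i<d - e0. ?T i + 2) + 2 \<le> 300000 * N ^ 5"
  proof -
    have "(\<Sum>i<d - e0. ?T i + 2) = 100000 * (N * (\<Sum>i<d - e0. pre (Suc (e0 + i)) ^ 4)) + 2 * (d - e0)"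
      by (simp only: sum.distrib sum_distrib_left[symmetric] sum_constant card_lessThan) simp
    moreover have "(\<Sum>i<d - e0. pre (Suc (e0 + i)) ^ 4) \<le> 2 * N ^ 4"
      using sum_levels[of "d - e0"] e0_le by simp
    then have "N * (\<Sum>i<d - e0. pre (Suc (e0 + i)) ^ 4) \<le> N * (2 * N ^ 4)" by (rule mult_le_mono2)
    moreover have "N * (2 * N ^ 4) = 2 * N ^ 5" using power_Suc[of N 4] by simp
    moreover have "N ^ 1 \<le> N ^ 5" using N_pos by (intro power_increasing) simp_all
    moreover have "1 \<le> N ^ 5" using N_pos by (rule one_le_power)
    ultimately show ?thesis using levels_le N_pos unfolding power_one_right by linarith
  qed
  have e: "e0 + 0 = e0" "e0 + (d - e0) = d" using e0_le by simp_all
  show ?thesis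
    by (rule Inv_weaken[OF h[unfolded e] subset_refl subset_refl le subset_refl subset_refl])
qed

definition "Fin = [(0 :: nat, d, (!) n), (1, N, fw)]"
text \<open>The variables after \<open>j\<close> rounds of the search.\<close>

definition "Lse j = [(0 :: nat, d), (1, q), (2, prod_list (drop (d - j) n)), (3, d - j), (4, of_bool (j < d - e0))]"

lemma cells_le: "i < d \<Longrightarrow> n ! i \<le> S"
proof -
  assume i: "i < d"
  have "n ! i * 1 \<le> pre (Suc i)"
    unfolding pre_Suc[OF i] mult.commute[of "pre i"] using pre_pos by (rule mult_le_mono2)
  then show ?thesis using pre_le[of "Suc i"] X_le by linarith
qed

lemma drop_le: "prod_list (drop e n) \<le> S"
proof -
  have "prod_list (drop e n) \<le> N" using pre_drop[of e] pre_pos[of e] by (cases "pre e") auto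
  then show ?thesis using X_le by linarith
qed

lemma guard_value:
  assumes "Inv L Fin V A" "V 3 = d - j" "j \<le> d - e0"
  shows "xev V A xguard = of_bool (j < d - e0)"
proof -
  have t: "tab A 0 d ((!) n)" by (rule Inv_tab[OF assms(1)]) (simp add: Fin_def)
  show ?thesis
  proof (cases "j < d")
    case True
    then have i: "d - j - 1 < d" by simp
    have A: "A 0 (d - j - 1) = n ! (d - j - 1)" by (rule tabD[OF t i])
    have "1 < n ! (d - j - 1) \<longleftrightarrow> j < d - e0"
    proof
      assume g: "1 < n ! (d - j - 1)"
      show "j < d - e0"
      proof (rule ccontr)
        assume "\<not> j < d - e0"
        then have k: "d - j - 1 < e0" using True by simp
        then have "n ! (d - j - 1) = take e0 n ! (d - j - 1)" by simp
        then show False using g k unfolding ones by simp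
      qed
    next
      assume "j < d - e0"
      then show "1 < n ! (d - j - 1)" using big[of "d - j - 1"] by fastforce
    qed
    then show ?thesis using True A assms(2) by (simp add: xguard_def)
  next
    case False
    then show ?thesis using assms(2) by (simp add: xguard_def)
  qed
qed

lemma search_hoare:
  "hoare (Inv [(0, d), (1, q)] Fin) cSearch (20000 * N) (Inv (Lse (d - e0)) Fin)"
proof -
  let ?L0 = "[(0 :: nat, d), (1, q)]"
  have g: "wfx 20 xguard \<and> vdeg xguard \<le> 200 \<and> bnds xguard = {} \<and> tdeg xguard = 0 \<and> tcoef xguard \<le> 1900"
    by (simp add: xguard_def xdefs)
  have 1: "hoare (Inv ?L0 Fin) (HSet 2 (XL 1)) 2000 (Inv ((2, 1) # ?L0) Fin)"
    by (rule Inv_Assign0[OF _ _ order_refl]) (use S2 in auto)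
  have 2: "hoare (Inv ((2, 1) # ?L0) Fin) (HSet 3 (XV 0)) 2000 (Inv ((3, d) # (2, 1) # ?L0) Fin)"
  proof (rule Inv_Assign0[OF _ _ order_refl])
    show "xev V A (XV 0) = d" if "Inv ((2, 1) # ?L0) Fin V A" for V A using Inv_var[OF that, of 0 d] by simp
  qed (use X_le in auto)
  have 3: "hoare (Inv ((3, d) # (2, 1) # ?L0) Fin) (HSet 4 xguard) 2000 (Inv ((4, of_bool (0 < d - e0)) # (3, d) # (2, 1) # ?L0) Fin)"
  proof (rule Inv_Assign0[OF _ _ order_refl g])
    show "xev V A xguard = of_bool (0 < d - e0)" if "Inv ((3, d) # (2, 1) # ?L0) Fin V A" for V A
      using guard_value[OF that, of 0] Inv_var[OF that, of 3 d] by simp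
  qed (use S2 in auto)
  have 3: "hoare (Inv ((3, d) # (2, 1) # ?L0) Fin) (HSet 4 xguard) 2000 (Inv (Lse 0) Fin)"
    by (rule Inv_weaken[OF 3]) (auto simp: Lse_def)
  let ?body = "Seq (HSet 3 (XV 3 [-] XL 1)) (Seq (HSet 2 (XV 2 [*] XC 0 (XV 3))) (HSet 4 xguard))"
  have 4: "hoare (Inv (Lse 0) Fin) (While (Var 4) ?body) ((\<Sum>i<d - e0. 6000 + 2) + 2) (Inv (Lse (d - e0)) Fin)"
  proof (rule hoare_While[where I = "\<lambda>i. Inv (Lse i) Fin"])
    fix j assume j: "j < d - e0"
    let ?P = "prod_list (drop (d - j) n)" let ?P' = "prod_list (drop (d - Suc j) n)"
    have e: "d - Suc j < d" "d - j = Suc (d - Suc j)" using j by simp_all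
    have P: "?P' = ?P * n ! (d - Suc j)"
      unfolding e(2) Cons_nth_drop_Suc[OF e(1), symmetric] by (simp add: mult.commute)
    have a: "hoare (Inv (Lse j) Fin) (HSet 3 (XV 3 [-] XL 1)) 2000 (Inv [(3, d - Suc j), (2, ?P), (0, d), (1, q)] Fin)"
    proof (rule Inv_Assign0)
      show "xev V A (XV 3 [-] XL 1) = d - Suc j" if "Inv (Lse j) Fin V A" for V A
        using Inv_var[OF that, of 3 "d - j"] by (simp add: Lse_def)
    qed (use X_le in \<open>auto simp: Lse_def\<close>)
    have b: "hoare (Inv [(3, d - Suc j), (2, ?P), (0, d), (1, q)] Fin) (HSet 2 (XV 2 [*] XC 0 (XV 3))) 2000
        (Inv [(2, ?P'), (3, d - Suc j), (0, d), (1, q)] Fin)"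
    proof (rule Inv_Assign0)
      fix V A assume I: "Inv [(3, d - Suc j), (2, ?P), (0, d), (1, q)] Fin V A"
      have "tab A 0 d ((!) n)" by (rule Inv_tab[OF I]) (simp add: Fin_def)
      then show "xev V A (XV 2 [*] XC 0 (XV 3)) = ?P'"
        unfolding P using Inv_var[OF I, of 3 "d - Suc j"] Inv_var[OF I, of 2 ?P] tabD[OF _ e(1)] by simp
    qed (use drop_le in auto)
    have c: "hoare (Inv [(2, ?P'), (3, d - Suc j), (0, d), (1, q)] Fin) (HSet 4 xguard) 2000
        (Inv ((4, of_bool (Suc j < d - e0)) # [(2, ?P'), (3, d - Suc j), (0, d), (1, q)]) Fin)"
    proof (rule Inv_Assign0[OF _ _ order_refl g])
      show "xev V A xguard = of_bool (Suc j < d - e0)" if "Inv [(2, ?P'), (3, d - Suc j), (0, d), (1, q)] Fin V A" for V A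
        using guard_value[OF that, of "Suc j"] Inv_var[OF that, of 3 "d - Suc j"] j by simp
    qed (use S2 in auto)
    have "hoare (Inv (Lse j) Fin) ?body (2000 + (2000 + 2000))
        (Inv ((4, of_bool (Suc j < d - e0)) # [(2, ?P'), (3, d - Suc j), (0, d), (1, q)]) Fin)"
      by (rule hoare_Seq[OF a hoare_Seq[OF b c]])
    then show "hoare (Inv (Lse j) Fin) ?body 6000 (Inv (Lse (Suc j)) Fin)"
      by (rule Inv_weaken) (auto simp: Lse_def)
  next
    fix i V A assume "Inv (Lse i) Fin V A"
    then show "V 4 \<noteq> 0 \<longleftrightarrow> i < d - e0"
      using Inv_var[of "Lse i" Fin V A 4 "of_bool (i < d - e0)"] by (auto simp: Lse_def)
  qed simp
  have "hoare (Inv ?L0 Fin) cSearch (2000 + (2000 + (2000 + ((\<Sum>i<d - e0. 6000 + 2) + 2)))) (Inv (Lse (d - e0)) Fin)"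
    unfolding cSearch_def by (rule hoare_Seq[OF 1 hoare_Seq[OF 2 hoare_Seq[OF 3 4]]])
  then show ?thesis by (rule Inv_weaken) (use levels_le N_pos in auto)
qed

lemma init_hoare: "hoare (Inv (Lse (d - e0)) Fin) cInit (20000 * N) (Inv (Lev e0) (Fev e0))"
proof -
  let ?L = "[(0 :: nat, d), (1, q), (2, N), (3, e0)]"
  let ?t2 = "(2 :: nat, N, fw)" let ?t3 = "(3 :: nat, N, \<lambda>k. fw k - 1)"
  let ?t4 = "\<lambda>k. (4 :: nat, k, \<lambda>_. q)" let ?t5 = "\<lambda>k. (5 :: nat, k, \<lambda>_. 0 :: nat)"
  have N: "prod_list (drop e0 n) = N" using pre_drop[of e0] pre_e0 by simp
  have fS: "fw k \<le> S" if "k < N" for k using fw[OF that] X_le by simp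
  have f1: "tab A 1 N fw" if "Inv L F V A" "set Fin \<subseteq> set F" for L F V A
    using Inv_tab[OF that(1), of 1 N fw] that(2) by (simp add: Fin_def)
  have 2: "hoare (Inv ?L Fin) (HFill 2 2 (XL 0) (XC 1 vz)) (2000 * N) (Inv ?L (?t2 # Fin))"
  proof (rule Inv_Copy)
    show "xev V A (XC 1 vz) = fw z" if "Inv ?L Fin V A" "z < N" "V 12 = z" for V A z
      using f1[OF that(1)] that by (simp add: tab_def)
  qed (use fS N_pos in \<open>auto simp: Fin_def\<close>)
  have 3: "hoare (Inv ?L (?t2 # Fin)) (HFill 3 2 (XL 0) (XC 1 vz [-] XL 1)) (2000 * N) (Inv ?L (?t3 # ?t2 # Fin))"
  proof (rule Inv_Copy)
    show "xev V A (XC 1 vz [-] XL 1) = fw z - 1" if "Inv ?L (?t2 # Fin) V A" "z < N" "V 12 = z" for V A z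
      using f1[OF that(1) set_subset_Cons] that by (simp add: tab_def)
    show "fw z - 1 \<le> S" if "z < N" for z using fS[OF that] by simp
  qed (use N_pos in \<open>auto simp: Fin_def\<close>)
  let ?F3 = "?t3 # ?t2 # Fin"
  have 4: "hoare (Inv ?L (?t4 0 # ?F3)) (HUpd 4 (XL 0) (XV 1)) 2000 (Inv ?L (?t4 (Suc 0) # ?F3))"
  proof (rule Inv_Upd[where P = 1])
    show "xev V A (XV 1) = q" if "Inv ?L ?F3 V A" for V A using Inv_var[OF that, of 1 q] by simp
  qed (use X_le in \<open>auto simp: Fin_def\<close>)
  have 5: "hoare (Inv ?L (?t5 0 # ?t4 (Suc 0) # ?F3)) (HUpd 5 (XL 0) (XL 0)) 2000 (Inv ?L (?t5 (Suc 0) # ?t4 (Suc 0) # ?F3))"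
    by (rule Inv_Upd[where P = 1]) (auto simp: Fin_def)
  let ?F5 = "?t5 (Suc 0) # ?t4 (Suc 0) # ?F3"
  have 4: "hoare (Inv ?L ?F3) (HUpd 4 (XL 0) (XV 1)) 2000 (Inv ?L (?t4 (Suc 0) # ?F3))"
    using 4 by (rule hoare_conseq) (auto simp: Inv_Cons_tab tab_def)
  have 5: "hoare (Inv ?L (?t4 (Suc 0) # ?F3)) (HUpd 5 (XL 0) (XL 0)) 2000 (Inv ?L ?F5)"
    using 5 by (rule hoare_conseq) (auto simp: Inv_Cons_tab tab_def)
  have 6: "hoare (Inv ?L ?F5) (HSet 5 (XL 1)) 2000 (Inv ((5, 1) # ?L) ?F5)"
    by (rule Inv_Assign0[OF _ _ order_refl]) (use S2 in auto)
  have 7: "hoare (Inv ((5, 1) # ?L) ?F5) (HSet 8 (XV 1 [+] XL 1)) 2000 (Inv ((8, q + 1) # (5, 1) # ?L) ?F5)"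
  proof (rule Inv_Assign0[OF _ _ order_refl])
    show "xev V A (XV 1 [+] XL 1) = q + 1" if "Inv ((5, 1) # ?L) ?F5 V A" for V A using Inv_var[OF that, of 1 q] by simp
  qed (use X_le d1 in auto)
  have 8: "hoare (Inv ((8, q + 1) # (5, 1) # ?L) ?F5) (HSet 1 (XV 3 [<] XV 0)) 2000
      (Inv ((1, of_bool (e0 < d)) # [(8, q + 1), (5, 1), (0, d), (2, N), (3, e0)]) ?F5)"
  proof (rule Inv_Assign0)
    show "xev V A (XV 3 [<] XV 0) = of_bool (e0 < d)" if "Inv ((8, q + 1) # (5, 1) # ?L) ?F5 V A" for V A
      using Inv_var[OF that, of 3 e0] Inv_var[OF that, of 0 d] by simp
  qed (use S2 in \<open>auto simp: xdefs\<close>)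
  have h: "hoare (Inv ?L Fin) cInit (2000 * N + (2000 * N + (2000 + (2000 + (2000 + (2000 + 2000))))))
      (Inv ((1, of_bool (e0 < d)) # [(8, q + 1), (5, 1), (0, d), (2, N), (3, e0)]) ?F5)"
    unfolding cInit_def by (rule hoare_Seq[OF 2 hoare_Seq[OF 3 hoare_Seq[OF 4 hoare_Seq[OF 5 hoare_Seq[OF 6 hoare_Seq[OF 7 8]]]]]])
  have b: "blk e0 k \<in> words q (replicate e0 1)" "blk e0 k (replicate e0 0) = fw k" if "k < N" for k
  proof -
    show "blk e0 k \<in> words q (replicate e0 1)" using blk_in[of k e0] that N ones by simp
    have "replicate e0 0 \<in> positions (replicate e0 1)" by (simp add: positions_def)
    then show "blk e0 k (replicate e0 0) = fw k"
      unfolding blk_def ones using index_replicate_0[of "replicate e0 1"] by simp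
  qed
  have sk: "key_tab q (take e0 n) (blk e0) k = fw k" if "k < N" for k
    unfolding key_tab_def ones using b[OF that] trn_ones[OF b(1)[OF that]] skey_singleton(2)[OF proper_ones prod_ones b(1)[OF that]]
      wkey_ones[OF b(1)[OF that]] by simp
  have fc: "below_tab q (take e0 n) (blk e0) k = fw k - 1" if "k < N" for k
    unfolding below_tab_def ones using b[OF that] num_below_ones[OF b(1)[OF that]] by simp
  have ad: "gadd_tab (take e0 n) 0 = 0"
    unfolding gadd_tab_def ones using gadd_less[OF proper_ones, of e0 0 0] by simp
  have kb: "key_bound q (take e0 n) = q + 1" unfolding ones by (rule key_bound_ones)
  show ?thesis
  proof (rule hoare_conseq[OF h])
    show "Inv ?L Fin V A" if "Inv (Lse (d - e0)) Fin V A" for V A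
      using that by (rule Inv_mono) (use N e0_le in \<open>auto simp: Lse_def\<close>)
    show "2000 * N + (2000 * N + (2000 + (2000 + (2000 + (2000 + 2000))))) \<le> 20000 * N" using N_pos by linarith
    fix V A assume I: "Inv ((1, of_bool (e0 < d)) # [(8, q + 1), (5, 1), (0, d), (2, N), (3, e0)]) ?F5 V A"
    have v: "\<forall>(x, u)\<in>set (Lev e0). V x = u"
      using I kb pre_e0 unfolding Inv_def Lev_def by auto
    have "tab A 0 d ((!) n)" "tab A 2 N fw" "tab A 3 N (\<lambda>k. fw k - 1)" "tab A 4 1 (\<lambda>_. q)" "tab A 5 1 (\<lambda>_. 0)"
      using Inv_tab[OF I] by (auto simp: Fin_def)
    then show "Inv (Lev e0) (Fev e0) V A"
      unfolding Inv_def Fev_def using v sk fc ad num_fixed_ones[of q e0] ones pre_e0 by (auto simp: tab_def)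
  qed
qed

lemma rank_sum: "(\<Sum>g<N. num_below q n g w0) = necklace_rank q n C * N"
  unfolding w0_def by (rule rank_burnside[OF proper C, symmetric])

text \<open>The only block of the full size is the given word; by \<open>rank_sum\<close> the average of its counts is the rank.\<close>

lemma final_hoare: "hoare (Inv (Lev d) (Fev d)) cFinal (2000 * N) (\<lambda>V A. V 0 = necklace_rank q n C)"
proof -
  have "hoare (Inv (Lev d) (Fev d)) cFinal (2000 * N) (Inv [(0, necklace_rank q n C)] (Fev d))"
    unfolding cFinal_def
  proof (rule Inv_Assign[where P = N])
    fix V A assume I: "Inv (Lev d) (Fev d) V A"
    have t: "tab A 3 N (below_tab q n (blk d))" by (rule Inv_tab[OF I]) (simp add: Fev_def)
    have N2: "V 2 = N" by (rule Inv_var[OF I]) (simp add: Lev_def)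
    have "A 3 g = num_below q n g w0" if "g < N" for g
      using tabD[OF t that] that by (simp add: below_tab_def blk_d)
    then have "(\<Sum>g<N. A 3 g) = necklace_rank q n C * N" using rank_sum by simp
    then show "xev V A (xsum 20 2 (XC 3 (XV 20)) [div] XV 2) = necklace_rank q n C"
      using N2 N_pos by simp
    show "\<forall>y\<in>bnds (xsum 20 2 (XC 3 (XV 20)) [div] XV 2). V y \<le> N" using N2 by simp
  next
    have "necklace_rank q n C * N \<le> q ^ N * N"
      unfolding rank_sum[symmetric] using sum_bounded_above[of "{..<N}" "\<lambda>g. num_below q n g w0" "q ^ N"] num_below_le
      by (simp add: mult.commute)
    then have "necklace_rank q n C \<le> q ^ N" using N_pos by simp
    then show "necklace_rank q n C \<le> S" using qN_le by (rule le_trans)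
  qed (use N_pos in auto)
  then show ?thesis by (rule hoare_conseq) (auto simp: Inv_Cons_var)
qed

lemma prog_hoare: "hoare (Inv [(0, d), (1, q)] Fin) rank_prog (400000 * N ^ 5) (\<lambda>V A. V 0 = necklace_rank q n C)"
proof -
  have h: "hoare (Inv [(0, d), (1, q)] Fin) rank_prog (20000 * N + (20000 * N + (300000 * N ^ 5 + 2000 * N)))
      (\<lambda>V A. V 0 = necklace_rank q n C)"
    unfolding rank_prog_def by (rule hoare_Seq[OF search_hoare hoare_Seq[OF init_hoare hoare_Seq[OF main_loop final_hoare]]])
  have "N ^ 1 \<le> N ^ 5" using N_pos by (intro power_increasing) auto
  then have le: "20000 * N + (20000 * N + (300000 * N ^ 5 + 2000 * N)) \<le> 400000 * N ^ 5" by simp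
  show ?thesis by (rule hoare_conseq[OF h _ le])
qed

lemma rank_prog_correct:
  "\<exists>t s. exec B rank_prog (input_store q n w0) t s \<and> t \<le> 400000 * N ^ 5 \<and> scalar s 0 = necklace_rank q n C"
proof -
  let ?s = "input_store q n w0"
  have f: "w0 (inv_into (positions n) (index n) k) = fw k" for k unfolding fw_def vec_def ..
  have le: "d \<le> S" "q \<le> S" using X_le by simp_all
  have cell: "fw k \<le> S" if "k < N" for k using fw[OF that] le(2) by simp
  have "ok S ?s"
    unfolding ok_def input_store_def f by (simp add: le cells_le cell)
  moreover have "Inv [(0, d), (1, q)] Fin (vis ?s) (arr ?s)"
    unfolding Inv_def Fin_def by (simp add: vis_def input_store_def tab_def f)
  ultimately obtain t s where ts: "exec B rank_prog ?s t s" "t \<le> 400000 * N ^ 5" "vis s 0 = necklace_rank q n C"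
    using prog_hoare unfolding hoare_def by blast
  then show ?thesis by (auto simp: vis_def)
qed

end

theorem theorem5:
  "\<exists>(prog :: com) (c :: nat) (k :: nat). \<forall>(q :: nat) (n :: nat list) (C :: word set).
     size_vector n \<longrightarrow> C \<in> necklaces q n \<longrightarrow>
     (\<exists>t s. exec (word_bound k q n) prog (input_store q n (representative n C)) t s \<and>
            t \<le> c * prod_list n ^ 5 \<and>
            scalar s 0 = necklace_rank q n C)"
proof (rule exI[of _ rank_prog], rule exI[of _ 400000], rule exI[of _ 800], intro allI impI)
  fix q n C assume nC: "size_vector n" "C \<in> necklaces q n"
  let ?N = "prod_list n" let ?X = "length n + q + ?N"
  have N: "1 \<le> ?N"
    using proper_pos[of n] nC(1) unfolding size_vector_def proper_def by (simp add: Suc_leI)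
  have d: "1 \<le> length n" using nC(1) unfolding size_vector_def by (cases n) auto
  have X: "2 \<le> ?X" using N d by simp
  interpret rank_run "word_bound 800 q n" "?X ^ (4 * ?N)" q n C
  proof
    have "?X ^ 1 \<le> ?X ^ (4 * ?N)" using N X by (intro power_increasing) auto
    then show "2 \<le> ?X ^ (4 * ?N)" using X by simp
    (* 800 = 4 * 200, the exponent of the bound on stored values times the degree of expressions *)
    show "(?X ^ (4 * ?N)) ^ 200 \<le> word_bound 800 q n"
      unfolding word_bound_def power_mult[symmetric] by simp
  qed (use nC in auto)
  show "\<exists>t s. exec (word_bound 800 q n) rank_prog (input_store q n (representative n C)) t s \<and>
            t \<le> 400000 * ?N ^ 5 \<and> scalar s 0 = necklace_rank q n C"
    using rank_prog_correct unfolding w0_def .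
qed

end
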